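(* Let $E=(d_0,d_1)$ with $-\infty\le d_0<d_1\le\infty$, equipped with Lebesgue measure, and $L^1=L^1(E)$. Let $g\colon E\to\mathbb{R}$ be continuous and strictly positive, let $\varphi\ge0$ be Borel measurable and integrable on compact subsets of $E$, define $G,Q$ as in the context, and assume $G(d_1)=+\infty$ and $Q(d_1)=+\infty$. Let $P\colon L^1\to L^1$ be a stochastic operator, let $A$, $\mathcal{D}(A)$, $\{P(t)\}_{t\ge0}$, $R_0$ and $K=P(\varphi R_0)$ be as in the context. Then: (i) If $K$ has an invariant density $v_*$ with $v_*>0$ a.e., then $\{P(t)\}_{t\ge0}$ is a stochastic semigroup. If moreover $\{P(t)\}_{t\ge0}$ is partially integral and $R_0v_*\in L^1$, then $\{P(t)\}_{t\ge0}$ is asymptotically stable with invariant density $u_*=R_0v_*/\|R_0v_*\|$. (ii) Conversely, if $\{P(t)\}_{t\ge0}$ has an invariant density $u_*\in\mathcal{D}(A)$, then the density $P(\varphi u_* )/\|\varphi u_*\|$ is invariant for $K$.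
   Context: $G(x)=\int_{x_0}^x\frac{dz}{g(z)}$, $Q(x)=\int_{x_1}^x\frac{\varphi(z)}{g(z)}dz$, where $x_0=d_0$ (resp. $x_1=d_0$) if the corresponding integral is finite for all $x\in E$, otherwise a fixed point of $E$; $G(d_1),Q(d_1)$ are the limits as $x\uparrow d_1$. $AC$ is the space of absolutely continuous functions on $E$. $Au=-\frac{d}{dx}(gu)-\varphi u$ with $\mathcal{D}(A)=\{u\in L^1: gu\in AC,\ \frac{d}{dx}(gu)\in L^1,\ \lim_{x\downarrow d_0}g(x)u(x)=0,\ \varphi u\in L^1\}$; under $G(d_1)=+\infty$ it generates a positive strongly continuous contraction semigroup on $L^1$ with resolvent $R(\lambda,A)$. $\{P(t)\}_{t\ge0}$ is the minimal positive strongly continuous contraction semigroup on $L^1$ whose generator $C$ extends the operator $u\mapsto Au+P(\varphi u)$, $u\in\mathcal{D}(A)$; its generator is characterized by $R(\lambda,C)u=\lim_{N\to\infty}R(\lambda,A)\sum_{n=0}^N(P(\varphi R(\lambda,A)))^nu$ for $u\in L^1$, $\lambda>0$. $R_0v(x)=\int_{d_0}^{d_1}\mathbf{1}_{(d_0,x)}(y)\frac{e^{Q(y)-Q(x)}}{g(x)}v(y)\,dy$ (defined for $v$ with $R_0v\in L^1$); $\varphi R_0$ extends uniquely by the same formula to a positive contraction on $L^1$, and $K u=P(\varphi R_0u)$, $u\in L^1$. A density is a nonnegative element of $L^1$ of norm $1$; a stochastic operator maps densities to densities; a stochastic semigroup is a strongly continuous semigroup of stochastic operators. A density $u$ is invariant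 for an operator $T$ if $Tu=u$, and for a semigroup if $P(t)u=u$ for all $t\ge 0$. $\{P(t)\}$ is asymptotically stable if there is an invariant density $u_*$ with $\|P(t)u-u_*\|\to0$ for every density $u$. $\{P(t)\}$ is partially integral if for some $t_0>0$ there is a measurable $p\colon E\times E\to[0,\infty)$ with $\iint p(x,y)\,dy\,dx>0$ and $P(t_0)u(x)\ge\int_E p(x,y)u(y)\,dy$ for every density $u$. *)

theory Defs
  imports "HOL-Analysis.Analysis"
begin

definition Eint :: "ereal \<Rightarrow> ereal \<Rightarrow> real set" where
  "Eint d0 d1 = einterval d0 d1"

text \<open>Elements of L1(E) are represented by functions real => real that are
  Lebesgue integrable on E; two representatives are identified when they
  agree almost everywhere on E.\<close>

definition L1 :: "real set \<Rightarrow> (real \<Rightarrow> real) \<Rightarrow> bool" where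
  "L1 E u \<longleftrightarrow> integrable (lebesgue_on E) u"

definition L1norm :: "real set \<Rightarrow> (real \<Rightarrow> real) \<Rightarrow> real" where
  "L1norm E u = (LINT x|lebesgue_on E. \<bar>u x\<bar>)"

definition eqL :: "real set \<Rightarrow> (real \<Rightarrow> real) \<Rightarrow> (real \<Rightarrow> real) \<Rightarrow> bool" where
  "eqL E u v \<longleftrightarrow> (AE x in lebesgue_on E. u x = v x)"

definition nonnegL :: "real set \<Rightarrow> (real \<Rightarrow> real) \<Rightarrow> bool" where
  "nonnegL E u \<longleftrightarrow> (AE x in lebesgue_on E. 0 \<le> u x)"

definition is_density :: "real set \<Rightarrow> (real \<Rightarrow> real) \<Rightarrow> bool" where
  "is_density E u \<longleftrightarrow> L1 E u \<and> nonnegL E u \<and> L1norm E u = 1"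

definition L1_limseq :: "real set \<Rightarrow> (nat \<Rightarrow> real \<Rightarrow> real) \<Rightarrow> (real \<Rightarrow> real) \<Rightarrow> bool" where
  "L1_limseq E f w \<longleftrightarrow> (\<forall>n. L1 E (f n)) \<and> L1 E w \<and>
     ((\<lambda>n. L1norm E (\<lambda>x. f n x - w x)) \<longlonglongrightarrow> 0)"

type_synonym op = "(real \<Rightarrow> real) \<Rightarrow> (real \<Rightarrow> real)"

definition L1_operator :: "real set \<Rightarrow> op \<Rightarrow> bool" where
  "L1_operator E T \<longleftrightarrow>
     (\<forall>u. L1 E u \<longrightarrow> L1 E (T u)) \<and>
     (\<forall>u v. L1 E u \<longrightarrow> L1 E v \<longrightarrow> eqL E u v \<longrightarrow> eqL E (T u) (T v)) \<and>
     (\<forall>u v a b. L1 E u \<longrightarrow> L1 E v \<longrightarrow>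
        eqL E (T (\<lambda>x. a * u x + b * v x)) (\<lambda>x. a * T u x + b * T v x))"

definition stochastic_op :: "real set \<Rightarrow> op \<Rightarrow> bool" where
  "stochastic_op E T \<longleftrightarrow> L1_operator E T \<and> (\<forall>u. is_density E u \<longrightarrow> is_density E (T u))"

definition invariant_density_op :: "real set \<Rightarrow> op \<Rightarrow> (real \<Rightarrow> real) \<Rightarrow> bool" where
  "invariant_density_op E T u \<longleftrightarrow> is_density E u \<and> eqL E (T u) u"

definition C0_semigroup :: "real set \<Rightarrow> (real \<Rightarrow> op) \<Rightarrow> bool" where
  "C0_semigroup E S \<longleftrightarrow>
     (\<forall>t\<ge>0. L1_operator E (S t)) \<and>
     (\<forall>u. L1 E u \<longrightarrow> eqL E (S 0 u) u) \<and>
     (\<forall>t s u. 0 \<le> t \<longrightarrow> 0 \<le> s \<longrightarrow> L1 E u \<longrightarrow> eqL E (S (t + s) u) (S t (S s u))) \<and>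
     (\<forall>u t. L1 E u \<longrightarrow> 0 \<le> t \<longrightarrow>
        ((\<lambda>s. L1norm E (\<lambda>x. S s u x - S t u x)) \<longlongrightarrow> 0) (at t within {0..}))"

definition positive_contraction_C0_semigroup :: "real set \<Rightarrow> (real \<Rightarrow> op) \<Rightarrow> bool" where
  "positive_contraction_C0_semigroup E S \<longleftrightarrow> C0_semigroup E S \<and>
     (\<forall>t u. 0 \<le> t \<longrightarrow> L1 E u \<longrightarrow> nonnegL E u \<longrightarrow> nonnegL E (S t u)) \<and>
     (\<forall>t u. 0 \<le> t \<longrightarrow> L1 E u \<longrightarrow> L1norm E (S t u) \<le> L1norm E u)"

definition stochastic_semigroup :: "real set \<Rightarrow> (real \<Rightarrow> op) \<Rightarrow> bool" where
  "stochastic_semigroup E S \<longleftrightarrow> C0_semigroup E S \<and> (\<forall>t\<ge>0. stochastic_op E (S t))"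

definition generator_graph :: "real set \<Rightarrow> (real \<Rightarrow> op) \<Rightarrow> (real \<Rightarrow> real) \<Rightarrow> (real \<Rightarrow> real) \<Rightarrow> bool" where
  "generator_graph E S u f \<longleftrightarrow> L1 E u \<and> L1 E f \<and>
     ((\<lambda>h. L1norm E (\<lambda>x. (S h u x - u x) / h - f x)) \<longlongrightarrow> 0) (at_right 0)"

definition invariant_density_sg :: "real set \<Rightarrow> (real \<Rightarrow> op) \<Rightarrow> (real \<Rightarrow> real) \<Rightarrow> bool" where
  "invariant_density_sg E S u \<longleftrightarrow> is_density E u \<and> (\<forall>t\<ge>0. eqL E (S t u) u)"

definition asymptotically_stable_with :: "real set \<Rightarrow> (real \<Rightarrow> op) \<Rightarrow> (real \<Rightarrow> real) \<Rightarrow> bool" where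
  "asymptotically_stable_with E S ustar \<longleftrightarrow> invariant_density_sg E S ustar \<and>
     (\<forall>u. is_density E u \<longrightarrow> ((\<lambda>t. L1norm E (\<lambda>x. S t u x - ustar x)) \<longlongrightarrow> 0) at_top)"

definition asymptotically_stable :: "real set \<Rightarrow> (real \<Rightarrow> op) \<Rightarrow> bool" where
  "asymptotically_stable E S \<longleftrightarrow> (\<exists>ustar. asymptotically_stable_with E S ustar)"

definition partially_integral :: "real set \<Rightarrow> (real \<Rightarrow> op) \<Rightarrow> bool" where
  "partially_integral E S \<longleftrightarrow> (\<exists>t0>0. \<exists>p :: real \<times> real \<Rightarrow> real.
     p \<in> borel_measurable borel \<and> (\<forall>z. 0 \<le> p z) \<and>
     (\<integral>\<^sup>+ x. (\<integral>\<^sup>+ y. ennreal (p (x, y)) \<partial>lebesgue_on E) \<partial>lebesgue_on E) > 0 \<and>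
     (\<forall>u. is_density E u \<longrightarrow>
        (AE x in lebesgue_on E.
           (\<integral>\<^sup>+ y. ennreal (p (x, y) * u y) \<partial>lebesgue_on E) \<le> ennreal (S t0 u x))))"

definition abs_continuous_on :: "real set \<Rightarrow> (real \<Rightarrow> real) \<Rightarrow> bool" where
  "abs_continuous_on S f \<longleftrightarrow> (\<forall>\<epsilon>>0. \<exists>\<delta>>0. \<forall>(n::nat) a b.
     (\<forall>i<n. a i \<le> b i \<and> {a i..b i} \<subseteq> S) \<and>
     (\<forall>i<n. \<forall>j<n. i \<noteq> j \<longrightarrow> {a i<..<b i} \<inter> {a j<..<b j} = {}) \<and>
     (\<Sum>i<n. b i - a i) < \<delta> \<longrightarrow> (\<Sum>i<n. \<bar>f (b i) - f (a i)\<bar>) < \<epsilon>)"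

definition prim :: "ereal \<Rightarrow> ereal \<Rightarrow> (real \<Rightarrow> real) \<Rightarrow> real \<Rightarrow> real" where
  "prim d0 d1 h x =
     (if (\<forall>y\<in>Eint d0 d1. set_integrable lborel (einterval d0 (ereal y)) h)
      then interval_lebesgue_integral lborel d0 (ereal x) h
      else interval_lebesgue_integral lborel (ereal (SOME c. c \<in> Eint d0 d1)) (ereal x) h)"

definition Gfun :: "ereal \<Rightarrow> ereal \<Rightarrow> (real \<Rightarrow> real) \<Rightarrow> real \<Rightarrow> real" where
  "Gfun d0 d1 g = prim d0 d1 (\<lambda>z. 1 / g z)"

definition Qfun :: "ereal \<Rightarrow> ereal \<Rightarrow> (real \<Rightarrow> real) \<Rightarrow> (real \<Rightarrow> real) \<Rightarrow> real \<Rightarrow> real" where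
  "Qfun d0 d1 g \<phi> = prim d0 d1 (\<lambda>z. \<phi> z / g z)"

definition tends_to_infty_at_d1 :: "ereal \<Rightarrow> ereal \<Rightarrow> (real \<Rightarrow> real) \<Rightarrow> bool" where
  "tends_to_infty_at_d1 d0 d1 F \<longleftrightarrow>
     (\<forall>M. \<exists>c\<in>Eint d0 d1. \<forall>x\<in>Eint d0 d1. c < x \<longrightarrow> M < F x)"

definition A_graph :: "ereal \<Rightarrow> ereal \<Rightarrow> (real \<Rightarrow> real) \<Rightarrow> (real \<Rightarrow> real) \<Rightarrow>
    (real \<Rightarrow> real) \<Rightarrow> (real \<Rightarrow> real) \<Rightarrow> bool" where
  "A_graph d0 d1 g \<phi> u f \<longleftrightarrow> (let E = Eint d0 d1 in
     L1 E u \<and>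
     (\<exists>w. abs_continuous_on E w \<and> eqL E (\<lambda>x. g x * u x) w \<and>
          L1 E (deriv w) \<and>
          (\<forall>\<epsilon>>0. \<exists>c\<in>E. \<forall>x\<in>E. x < c \<longrightarrow> \<bar>w x\<bar> < \<epsilon>) \<and>
          L1 E (\<lambda>x. \<phi> x * u x) \<and>
          eqL E f (\<lambda>x. - deriv w x - \<phi> x * u x)))"

definition A_domain :: "ereal \<Rightarrow> ereal \<Rightarrow> (real \<Rightarrow> real) \<Rightarrow> (real \<Rightarrow> real) \<Rightarrow> (real \<Rightarrow> real) \<Rightarrow> bool" where
  "A_domain d0 d1 g \<phi> u \<longleftrightarrow> (\<exists>f. A_graph d0 d1 g \<phi> u f)"

definition RA :: "ereal \<Rightarrow> ereal \<Rightarrow> (real \<Rightarrow> real) \<Rightarrow> (real \<Rightarrow> real) \<Rightarrow> real \<Rightarrow> op" where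
  "RA d0 d1 g \<phi> lam v = (SOME u. \<exists>f. A_graph d0 d1 g \<phi> u f \<and>
       eqL (Eint d0 d1) (\<lambda>x. lam * u x - f x) v)"

text \<open>P(t) is the positive strongly continuous contraction semigroup whose
  generator C has resolvent
  R(lambda,C) u = lim_N R(lambda,A) sum_{n=0}^N (P(phi R(lambda,A)))^n u.\<close>
definition is_Pt_semigroup :: "ereal \<Rightarrow> ereal \<Rightarrow> (real \<Rightarrow> real) \<Rightarrow> (real \<Rightarrow> real) \<Rightarrow>
    op \<Rightarrow> (real \<Rightarrow> op) \<Rightarrow> bool" where
  "is_Pt_semigroup d0 d1 g \<phi> P S \<longleftrightarrow> (let E = Eint d0 d1 in
     positive_contraction_C0_semigroup E S \<and>
     (\<forall>lam>0. \<forall>u. L1 E u \<longrightarrow>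
        (\<exists>w. L1_limseq E
               (\<lambda>N. RA d0 d1 g \<phi> lam
                  (\<lambda>x. \<Sum>n\<le>N. (((\<lambda>v. P (\<lambda>y. \<phi> y * RA d0 d1 g \<phi> lam v y)) ^^ n) u) x)) w
             \<and> generator_graph E S w (\<lambda>x. lam * w x - u x))))"

definition R0 :: "ereal \<Rightarrow> ereal \<Rightarrow> (real \<Rightarrow> real) \<Rightarrow> (real \<Rightarrow> real) \<Rightarrow> op" where
  "R0 d0 d1 g \<phi> v x =
     (LINT y|lebesgue_on (einterval d0 (ereal x)).
        exp (Qfun d0 d1 g \<phi> y - Qfun d0 d1 g \<phi> x) / g x * v y)"

definition Kop :: "ereal \<Rightarrow> ereal \<Rightarrow> (real \<Rightarrow> real) \<Rightarrow> (real \<Rightarrow> real) \<Rightarrow> op \<Rightarrow> op" where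
  "Kop d0 d1 g \<phi> P u = P (\<lambda>x. \<phi> x * R0 d0 d1 g \<phi> u x)"

end

theory Submission
  imports Defs "HOL-Library.Lattice_Algebras"
begin

text \<open>Write \<open>B = P (\<phi> R(1, A))\<close>. Since \<open>R(1, A) \<le> R\<^sub>0\<close>, an invariant density \<open>v\<^sub>*\<close> of \<open>K\<close> satisfies \<open>B v\<^sub>* \<le> v\<^sub>*\<close>.
  The powers of \<open>B\<close> therefore tend to zero on multiples of the strictly positive \<open>v\<^sub>*\<close>, hence everywhere. As
  \<open>\<parallel>u\<parallel> = \<parallel>R(1, A) u\<parallel> + \<parallel>B u\<parallel>\<close> for \<open>u \<ge> 0\<close>, the resolvent series of the generator preserves the norm of nonnegative
  vectors, and so does the semigroup. The function \<open>R\<^sub>0 v\<^sub>*\<close> solves \<open>(A + P \<phi>) u = 0\<close>, hence is invariant.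

  An invariant \<open>e \<ge> 0\<close> dominates \<open>R(1, A) e\<close>, which is strictly positive near \<open>d\<^sub>1\<close>. So two nonzero nonnegative invariant
  vectors are never disjoint, and every nonnegative nonzero vector is eventually transported into any given set of positive measure.
  Using the kernel minorant twice one obtains \<open>S(m) u \<ge> \<beta>(u) \<alpha>\<close> with a nonzero vector \<open>\<alpha> \<ge> 0\<close> and a functional
  \<open>\<beta> \<ge> 0\<close>. A zero-two law for such semigroups, proved in abstract L spaces, gives convergence.

  Conversely, an invariant \<open>u\<^sub>*\<close> in the domain of \<open>A\<close> satisfies \<open>A u\<^sub>* = - P(\<phi> u\<^sub>*)\<close>, that is, \<open>u\<^sub>* = R\<^sub>0 P(\<phi> u\<^sub>*)\<close>.\<close>

section \<open>Positive semigroups on abstract L spaces\<close>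

text \<open>Two obstacles shape the proof. The definitions speak of representatives, while the
  lattice arguments need classes; hence the abstract L spaces, in which convergence of order bounded
  monotone sequences stands in for completeness, and a quotient type to which all operators are
  lifted. Moreover, the semigroup is known only through the resolvent of its generator.
  Vector-valued Laplace integrals are avoided: only the resolvent at 1 is used, and each consequence
  follows by comparing a real function of time whose growth to the right is controlled at every
  point.

  A kernel minorant alone gives no rank-one bound, because a plane set of positive measure need not
  contain a product of two sets of positive measure. Sending mass through the kernel, letting it
  move, and sending it through again repairs this: the first passage only has to be close in norm to
  a multiple of one fixed column, since a bounded kernel turns closeness in norm into closeness at
  every point. Periodicity is excluded by strong continuity: a short time shift of
  \<open>\<alpha>\<close> still overlaps \<open>\<alpha>\<close>.\<close>

class al_space = real_normed_vector + ordered_real_vector + lattice_ab_group_add +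
  assumes norm_add_nonneg: "0 \<le> x \<Longrightarrow> 0 \<le> y \<Longrightarrow> norm (x + y) = norm x + norm y"
    and norm_eq_pprt_nprt: "norm x = norm (sup x 0) + norm (sup (- x) 0)"
    and convergent_if_incseq_bounded: "(\<And>n. X n \<le> X (Suc n)) \<Longrightarrow> (\<And>n. X n \<le> c) \<Longrightarrow> convergent X"

lemma norm_mono_nonneg:
  fixes x y :: "'a::al_space"
  assumes "0 \<le> x" "x \<le> y" shows "norm x \<le> norm y"
proof -
  have "norm y = norm x + norm (y - x)"
    using norm_add_nonneg[of x "y - x"] assms by simp
  then show ?thesis by simp
qed

lemma norm_diff_nonneg:
  fixes x y :: "'a::al_space"
  assumes "0 \<le> x" "x \<le> y" shows "norm (y - x) = norm y - norm x"
  using norm_add_nonneg[of x "y - x"] assms by simp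

lemma norm_sup_0_le: "norm (sup x 0) \<le> norm (x::'a::al_space)"
  by (subst (2) norm_eq_pprt_nprt) simp

lemma sup_0_diff: "sup x 0 - sup (- x) 0 = (x::'a::al_space)"
  using prts[of x] pprt_neg[of x] by (simp add: pprt_def nprt_def)

text \<open>As \<open>x n\<close> is nonnegative, \<open>- l \<le> x n - l\<close>; so the negative
  part of the limit is bounded in norm by the distance to it, which tends to zero.\<close>

lemma nonneg_if_limit:
  fixes l :: "'a::al_space"
  assumes "x \<longlonglongrightarrow> l" "\<And>n. 0 \<le> x n" shows "0 \<le> l"
proof -
  have "norm (sup (- l) 0) \<le> norm (x n - l)" for n
  proof -
    have "sup (- l) 0 \<le> sup (x n - l) 0"
      using assms(2)[of n] by (intro sup_mono) auto
    then have "norm (sup (- l) 0) \<le> norm (sup (x n - l) 0)"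
      by (intro norm_mono_nonneg) auto
    then show ?thesis using norm_sup_0_le[of "x n - l"] by simp
  qed
  moreover have "(\<lambda>n. norm (x n - l)) \<longlonglongrightarrow> 0"
    using assms(1) by (simp add: LIM_zero tendsto_norm_zero)
  ultimately have "norm (sup (- l) 0) \<le> 0"
    by (intro LIMSEQ_le_const[where X="\<lambda>n. norm (x n - l)"]) auto
  then have "sup (- l) 0 = 0" by simp
  then show ?thesis
    by (metis neg_le_0_iff_le sup.cobounded1)
qed

lemma le_if_limit:
  fixes l k :: "'a::al_space"
  assumes "x \<longlonglongrightarrow> l" "y \<longlonglongrightarrow> k" "\<And>n. x n \<le> y n" shows "l \<le> k"
  using nonneg_if_limit[OF tendsto_diff[OF assms(2,1)]] assms(3) by simp

text \<open>Infima commute with translations, so each of the positive and negative parts of the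
  difference of the infima lies below the corresponding part of \<open>x - y\<close>.\<close>

lemma norm_inf_diff_le:
  fixes x y c :: "'a::al_space"
  shows "norm (inf x c - inf y c) \<le> norm (x - y)"
proof -
  have le: "inf x c - inf y c \<le> sup (x - y) 0" for x y
  proof -
    have "x \<le> y + sup (x - y) 0" by (metis add.commute diff_le_eq sup.cobounded1)
    moreover have "c \<le> c + sup (x - y) 0" by simp
    ultimately have "inf x c \<le> inf (y + sup (x - y) 0) (c + sup (x - y) 0)"
      by (rule inf_mono)
    also have "\<dots> = inf y c + sup (x - y) 0" by (simp add: add_inf_distrib_right)
    finally show ?thesis by (subst diff_le_eq) (simp add: add.commute)
  qed
  have "norm (sup (inf x c - inf y c) 0) \<le> norm (sup (x - y) 0)"
    using le[of x y] by (intro norm_mono_nonneg) auto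
  moreover have "norm (sup (- (inf x c - inf y c)) 0) \<le> norm (sup (- (x - y)) 0)"
    by (intro norm_mono_nonneg) (simp_all only: minus_diff_eq sup.cobounded2 sup_mono[OF order_refl] le[of y x] sup.bounded_iff)
  ultimately show ?thesis
    by (subst (1 2) norm_eq_pprt_nprt) linarith
qed

lemma tendsto_inf_const:
  fixes l c :: "'a::al_space"
  assumes "(f \<longlongrightarrow> l) F" shows "((\<lambda>x. inf (f x) c) \<longlongrightarrow> inf l c) F"
proof (rule Lim_transform_bound[where g = "\<lambda>x. f x - l" and f="\<lambda>x. inf (f x) c - inf l c" for f, THEN LIM_zero_cancel])
  show "\<forall>\<^sub>F n in F. norm (inf (f n) c - inf l c) \<le> norm (f n - l)"
    by (rule always_eventually) (blast intro: norm_inf_diff_le)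
  show "((\<lambda>x. f x - l) \<longlongrightarrow> 0) F" using assms by (rule LIM_zero)
qed

lemma incseq_le_limit:
  fixes l :: "'a::al_space"
  assumes "incseq x" "x \<longlonglongrightarrow> l" shows "x n \<le> l"
proof -
  have "(\<lambda>m. x (m + n)) \<longlonglongrightarrow> l" using assms(2) by (rule LIMSEQ_ignore_initial_segment)
  moreover have "x n \<le> x (m + n)" for m using assms(1) by (simp add: incseqD)
  ultimately show ?thesis by (intro le_if_limit[OF tendsto_const[of "x n"], of "\<lambda>m. x (m + n)" l])
qed

lemma incseq_bounded_convergent:
  fixes x :: "nat \<Rightarrow> 'a::al_space"
  assumes inc: "incseq x" and le: "\<And>n. x n \<le> c"
  obtains l where "x \<longlonglongrightarrow> l" "\<And>n. x n \<le> l" "l \<le> c"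
proof -
  have "convergent x" using inc le by (intro convergent_if_incseq_bounded) (auto simp: incseqD)
  then obtain l where l: "x \<longlonglongrightarrow> l" by (auto simp: convergent_def)
  have "l \<le> c" by (rule le_if_limit[OF l tendsto_const le])
  with l incseq_le_limit[OF inc l] show thesis by (rule that)
qed

lemma decseq_nonneg_convergent:
  fixes x :: "nat \<Rightarrow> 'a::al_space"
  assumes dec: "decseq x" and ge: "\<And>n. 0 \<le> x n"
  obtains l where "x \<longlonglongrightarrow> l" "\<And>n. l \<le> x n" "0 \<le> l"
proof -
  obtain l where l: "(\<lambda>n. - x n) \<longlonglongrightarrow> l" "\<And>n. - x n \<le> l" "l \<le> 0"
    using incseq_bounded_convergent[of "\<lambda>n. - x n" 0] dec ge by (auto simp: incseq_def decseq_def)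
  show thesis
  proof
    show "x \<longlonglongrightarrow> - l" using tendsto_minus[OF l(1)] by simp
    show "- l \<le> x n" for n using l(2)[of n] by (metis minus_le_iff)
    show "0 \<le> - l" using l(3) by simp
  qed
qed

text \<open>The witness \<open>v\<close> is the limit superior of the \<open>x j\<close>, as in the Borel--Cantelli lemma.\<close>

lemma order_limsup_of_summable:
  fixes x :: "nat \<Rightarrow> 'a::al_space" and f :: "'r \<Rightarrow> 'a \<Rightarrow> real"
  assumes x: "\<And>j. 0 \<le> x j" "\<And>j. x j \<le> c" "\<And>j. x j \<in> X"
    and X: "closed X" "\<And>u v. u \<in> X \<Longrightarrow> v \<in> X \<Longrightarrow> sup u v \<in> X"
    and f: "\<And>r. r \<in> A \<Longrightarrow> bounded_linear (f r)" "\<And>r u. r \<in> A \<Longrightarrow> 0 \<le> u \<Longrightarrow> 0 \<le> f r u"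
    and b: "summable b" "\<And>r j. r \<in> A \<Longrightarrow> f r (x j) \<le> b j"
  obtains v where "0 \<le> v" "v \<in> X" "\<And>r. r \<in> A \<Longrightarrow> f r v = 0" "v = 0 \<Longrightarrow> x \<longlonglongrightarrow> 0"
proof -
  \<comment> \<open>\<open>s k n\<close> is the supremum of \<open>x k\<close>, ...,
    \<open>x (k + n)\<close>. Its limit in \<open>n\<close> is \<open>w k\<close>, the supremum of a
    tail, and the decreasing limit of the \<open>w k\<close> is the witness.\<close>
  define s where "s k n = rec_nat (x k) (\<lambda>i y. sup y (x (k + Suc i))) n" for k n
  have s0: "s k 0 = x k" and sS: "s k (Suc n) = sup (s k n) (x (k + Suc n))" for k n
    by (auto simp: s_def)
  have inc: "incseq (s k)" for k
    by (rule incseq_SucI) (simp add: sS)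
  have sc: "s k n \<le> c" for k n
    by (induction n) (auto simp: s0 sS x)
  have sX: "s k n \<in> X" for k n
    by (induction n) (auto simp: s0 sS x X)
  have s_ge: "x (k + n) \<le> s k n" for k n
    by (cases n) (auto simp: s0 sS)
  have s_nonneg: "0 \<le> s k n" for k n
    using x(1) s_ge order_trans by blast
  have s_le: "s k n \<le> (\<Sum>i\<le>n. x (k + i))" for k n
  proof (induction n)
    case (Suc n)
    have "0 \<le> (\<Sum>i\<le>n. x (k + i))" using x(1) by (simp add: sum_nonneg)
    then show ?case using Suc x(1)[of "k + Suc n"]
      by (auto simp: sS add_increasing add_increasing2)
  qed (simp add: s0)
  have s_shift: "s (Suc k) n \<le> s k (Suc n)" for k n
  proof (induction n)
    case (Suc n) then show ?case by (auto simp: sS[of "Suc k"] sS[of k "Suc n"] le_supI1)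
  qed (simp add: s0 sS)
  have "\<exists>l. s k \<longlonglongrightarrow> l \<and> (\<forall>n. s k n \<le> l) \<and> l \<le> c" for k
    using incseq_bounded_convergent[OF inc sc] by metis
  then obtain w where w: "\<And>k. s k \<longlonglongrightarrow> w k" "\<And>k n. s k n \<le> w k" "\<And>k. w k \<le> c"
    by metis
  have wX: "w k \<in> X" for k
    using closed_sequentially[OF X(1) _ w(1)] sX by blast
  have w_ge: "x k \<le> w k" for k using w(2)[of k 0] by (simp add: s0)
  have w_nonneg: "0 \<le> w k" for k using x(1) w_ge order_trans by blast
  have wdec: "decseq w"
  proof (rule decseq_SucI)
    fix k
    have "s (Suc k) n \<le> w k" for n using s_shift w(2) order_trans by blast
    then show "w (Suc k) \<le> w k" using le_if_limit[OF w(1) tendsto_const] by blast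
  qed
  obtain v where v: "w \<longlonglongrightarrow> v" "\<And>k. v \<le> w k" "0 \<le> v"
    using decseq_nonneg_convergent[OF wdec w_nonneg] by blast
  show thesis
  proof (rule that[of v])
    show "v \<in> X" using closed_sequentially[OF X(1) _ v(1)] wX by blast
    show "f r v = 0" if r: "r \<in> A" for r
    proof -
      interpret fr: bounded_linear "f r" by (rule f(1)[OF r])
      have mono: "f r u \<le> f r u'" if "u \<le> u'" for u u'
        using f(2)[OF r, of "u' - u"] that by (simp add: fr.diff)
      have b0: "0 \<le> b j" for j using b(2)[OF r, of j] f(2)[OF r x(1)[of j]] by simp
      \<comment> \<open>A finite supremum of nonnegative vectors lies below their sum, so the tails
        of \<open>b\<close> bound \<open>f r\<close> on every tail supremum.\<close>
      have "f r (s k n) \<le> (\<Sum>i. b (i + k))" for k n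
      proof -
        have "f r (s k n) \<le> f r (\<Sum>i\<le>n. x (k + i))" by (rule mono[OF s_le])
        also have "\<dots> = (\<Sum>i\<le>n. f r (x (k + i)))" by (simp add: fr.sum)
        also have "\<dots> \<le> (\<Sum>i\<le>n. b (i + k))" by (intro sum_mono) (metis add.commute b(2) r)
        also have "\<dots> \<le> (\<Sum>i. b (i + k))"
          using b(1) b0 by (intro sum_le_suminf) (auto simp: summable_iff_shift)
        finally show ?thesis .
      qed
      then have "f r (w k) \<le> (\<Sum>i. b (i + k))" for k
        using LIMSEQ_le_const2[OF fr.tendsto[OF w(1)]] by blast
      then have "f r v \<le> (\<Sum>i. b (i + k))" for k
        using mono[OF v(2)] order_trans by blast
      then have "f r v \<le> 0"
        using LIMSEQ_le_const[OF suminf_exist_split2[OF b(1)]] by blast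
      then show ?thesis using f(2)[OF r v(3)] by simp
    qed
    show "x \<longlonglongrightarrow> 0" if "v = 0"
    proof (rule Lim_null_comparison[where g="\<lambda>k. norm (w k)"])
      show "\<forall>\<^sub>F n in sequentially. norm (x n) \<le> norm (w n)"
        by (rule always_eventually) (use norm_mono_nonneg[OF x(1) w_ge] in blast)
      show "(\<lambda>k. norm (w k)) \<longlonglongrightarrow> 0" using v(1) that by (simp add: tendsto_norm_zero)
    qed
  qed (fact v)
qed

section \<open>One-sided derivative estimates and the generator\<close>

text \<open>Right-hand estimates suffice, so \<open>f\<close> may be the norm along an orbit, which
  need not be differentiable. After tilting \<open>f\<close> by a slope below its average slope, the
  last point of a sublevel set could be passed by a small step to the right without leaving the
  set.\<close>

lemma dini_nonincreasing:
  fixes f :: "real \<Rightarrow> real"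
  assumes cont: "continuous_on {0..} f" and t: "0 \<le> t"
    and dini: "\<And>t e. 0 \<le> t \<Longrightarrow> 0 < e \<Longrightarrow> \<forall>\<^sub>F h in at_right 0. f (t + h) \<le> f t + e * h"
  shows "f t \<le> f 0"
proof (rule ccontr)
  assume n: "\<not> f t \<le> f 0"
  then have t0: "0 < t" using t by (cases "t = 0") auto
  \<comment> \<open>Half of the average slope of \<open>f\<close>, small enough that the tilted
    function still rises from 0 to \<open>t\<close>.\<close>
  define e where "e = (f t - f 0) / (2 * t)"
  have e: "0 < e" using n t0 by (simp add: e_def)
  define g where "g s = f s - e * s" for s
  have "g t = f 0 + (f t - f 0) / 2" using t0 by (simp add: g_def e_def field_simps)
  then have gt: "g 0 < g t" using n by (simp add: g_def)
  define c where "c = (g 0 + g t) / 2"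
  have c: "g 0 < c" "c < g t" using gt by (auto simp: c_def)
  have cg: "continuous_on {0..t} g" unfolding g_def
    by (intro continuous_intros continuous_on_subset[OF cont]) auto
  define A where "A = {0..t} \<inter> g -` {..c}"
  have "closed A" unfolding A_def by (rule continuous_closed_preimage[OF cg]) auto
  then have cA: "compact A" unfolding A_def
    by (metis compact_Icc compact_Int_closed inf_left_idem A_def)
  have "0 \<in> A" using t0 c by (auto simp: A_def)
  then obtain s where s: "s \<in> A" "\<And>x. x \<in> A \<Longrightarrow> x \<le> s"
    using compact_attains_sup[OF cA] by blast
  have s': "0 \<le> s" "s \<le> t" "g s \<le> c" using s by (auto simp: A_def)
  have st: "s < t" using s' c by (cases "s = t") auto
  have "\<forall>\<^sub>F h in at_right 0. f (s + h) \<le> f s + e * h" by (rule dini[OF s'(1) e])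
  moreover have "\<forall>\<^sub>F h in at_right (0::real). h < t - s \<and> 0 < h"
    using st by (auto simp: eventually_at_right_less eventually_conj_iff
        intro: eventually_at_rightI[of 0 "t - s"])
  ultimately have "\<forall>\<^sub>F h in at_right (0::real). f (s + h) \<le> f s + e * h \<and> h < t - s \<and> 0 < h"
    by eventually_elim auto
  then obtain h where h: "f (s + h) \<le> f s + e * h" "h < t - s" "0 < h"
    using eventually_happens[of _ "at_right (0::real)"] trivial_limit_at_right_real by blast
  have "g (s + h) \<le> g s" using h by (simp add: g_def algebra_simps)
  then have "s + h \<in> A" using h s' by (auto simp: A_def)
  then show False using s(2) h(3) by force
qed

lemma sup_0_eq: "sup x 0 = x - inf x (0::'a::lattice_ab_group_add)"
  unfolding eq_diff_eq using add_eq_inf_sup[of x 0, symmetric] by (simp only: add_0_right)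

lemma norm_sup_0_add_le:
  fixes a r :: "'a::al_space"
  assumes "b \<le> a + r" shows "norm (sup b 0) \<le> norm (sup a 0) + norm r"
proof -
  have "b \<le> sup a 0 + sup r 0" using assms by (meson add_mono order_trans sup.cobounded1)
  then have "sup b 0 \<le> sup a 0 + sup r 0" by (simp add: add_nonneg_nonneg)
  then have "norm (sup b 0) \<le> norm (sup a 0 + sup r 0)" by (intro norm_mono_nonneg) auto
  also have "\<dots> \<le> norm (sup a 0) + norm r"
    using norm_triangle_ineq[of "sup a 0" "sup r 0"] norm_sup_0_le[of r] by linarith
  finally show ?thesis .
qed

lemma exp_minus_quotient_tendsto: "((\<lambda>h::real. (exp (- h) - 1) / h) \<longlongrightarrow> - 1) (at_right 0)"
proof -
  have "((\<lambda>h::real. exp (- h)) has_real_derivative - 1) (at 0)"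
    by (auto intro!: derivative_eq_intros)
  then have "((\<lambda>h::real. (exp (- h) - 1) / h) \<longlongrightarrow> - 1) (at 0)"
    by (simp add: has_field_derivative_iff)
  then show ?thesis by (rule tendsto_within_subset) auto
qed

lemma exp_minus_tendsto_0: "((\<lambda>t::real. exp (- t)) \<longlongrightarrow> 0) at_top"
  by (rule filterlim_compose[OF exp_at_bot filterlim_uminus_at_bot_at_top])

text \<open>The operators will be lifts that read only the part of a vector living on the interval.
  They act on a larger space, so \<open>S 0\<close> is the identity only on the closed sublattice
  \<open>X\<close> of vectors concentrated there.\<close>

locale pos_semigroup =
  fixes S :: "real \<Rightarrow> 'a::al_space \<Rightarrow> 'a" and X :: "'a set"
  assumes lin: "0 \<le> t \<Longrightarrow> linear (S t)"
    and pos: "0 \<le> t \<Longrightarrow> 0 \<le> u \<Longrightarrow> 0 \<le> S t u"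
    and contr: "0 \<le> t \<Longrightarrow> norm (S t u) \<le> norm u"
    and semig: "0 \<le> t \<Longrightarrow> 0 \<le> s \<Longrightarrow> S (t + s) u = S t (S s u)"
    and cont: "continuous_on {0..} (\<lambda>t. S t u)"
    and S0: "u \<in> X \<Longrightarrow> S 0 u = u"
    and SX: "0 \<le> t \<Longrightarrow> S t u \<in> X"
    and subspace_X: "subspace X" and closed_X: "closed X"
    and sup_X: "u \<in> X \<Longrightarrow> v \<in> X \<Longrightarrow> sup u v \<in> X"
begin

lemma bounded_linear_S: "0 \<le> t \<Longrightarrow> bounded_linear (S t)"
  using lin[of t] contr[of t] by (intro bounded_linear_intro[of _ 1]) (auto simp: linear_add linear_scale)

lemma mono: "0 \<le> t \<Longrightarrow> u \<le> v \<Longrightarrow> S t u \<le> S t v"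
  using pos[of t "v - u"] linear_diff[OF lin[of t]] by simp

lemma S_add: "0 \<le> t \<Longrightarrow> S t (u + v) = S t u + S t v"
  and S_diff: "0 \<le> t \<Longrightarrow> S t (u - v) = S t u - S t v"
  and S_scale: "0 \<le> t \<Longrightarrow> S t (c *\<^sub>R u) = c *\<^sub>R S t u"
  and S_zero: "0 \<le> t \<Longrightarrow> S t 0 = 0"
  using linear_add linear_diff linear_scale linear_0 lin by blast+

lemma commute: "0 \<le> t \<Longrightarrow> 0 \<le> s \<Longrightarrow> S t (S s u) = S s (S t u)"
  using semig[of t s u] semig[of s t u] by (simp add: add.commute)

lemma tendsto_S_0: "u \<in> X \<Longrightarrow> ((\<lambda>t. S t u) \<longlongrightarrow> u) (at_right 0)"
proof -
  assume u: "u \<in> X"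
  have "((\<lambda>t. S t u) \<longlongrightarrow> S 0 u) (at 0 within {0..})"
    using cont[of u] by (simp add: continuous_on_def)
  then show ?thesis
    unfolding S0[OF u] by (rule tendsto_within_subset) auto
qed

definition gen :: "'a \<Rightarrow> 'a \<Rightarrow> bool" where
  "gen w f \<longleftrightarrow> w \<in> X \<and> ((\<lambda>h. (S h w - w) /\<^sub>R h) \<longlongrightarrow> f) (at_right 0)"

text \<open>\<open>gen w (w - v)\<close> says that \<open>w\<close> is the resolvent at 1 of
  \<open>v\<close>, so \<open>exp (- t) *\<^sub>R S t w\<close> has right derivative
  \<open>- exp (- t) *\<^sub>R S t v\<close>. The error made at time 0 is carried to time
  \<open>t\<close> by a contraction, hence the same bound \<open>e * h\<close>.\<close>

lemma gen_step:
  assumes gen: "gen w (w - v)" and t: "0 \<le> t" and e: "0 < e"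
  shows "\<forall>\<^sub>F h in at_right 0.
    norm (exp (- (t + h)) *\<^sub>R S (t + h) w - exp (- t) *\<^sub>R S t w + (h * exp (- t)) *\<^sub>R S t v) \<le> e * h"
proof -
  note exp_minus_quotient_tendsto
  moreover have "((\<lambda>h::real. exp (- h)) \<longlongrightarrow> 1) (at_right 0)"
    by (auto intro!: tendsto_eq_intros)
  ultimately have "((\<lambda>h. exp (- h) *\<^sub>R ((S h w - w) /\<^sub>R h) + ((exp (- h) - 1) / h) *\<^sub>R w + v) \<longlongrightarrow>
      1 *\<^sub>R (w - v) + (- 1) *\<^sub>R w + v) (at_right 0)"
    using gen unfolding gen_def by (intro tendsto_intros) auto
  then have "((\<lambda>h. exp (- h) *\<^sub>R ((S h w - w) /\<^sub>R h) + ((exp (- h) - 1) / h) *\<^sub>R w + v) \<longlongrightarrow> 0) (at_right 0)"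
    by simp
  then have "\<forall>\<^sub>F h in at_right 0. norm (exp (- h) *\<^sub>R ((S h w - w) /\<^sub>R h) + ((exp (- h) - 1) / h) *\<^sub>R w + v) < e"
    using e by (auto simp: tendsto_iff)
  moreover have "\<forall>\<^sub>F h in at_right (0::real). 0 < h" by (simp add: eventually_at_right_less)
  ultimately show ?thesis
  proof eventually_elim
    case (elim h)
    let ?d = "exp (- h) *\<^sub>R ((S h w - w) /\<^sub>R h) + ((exp (- h) - 1) / h) *\<^sub>R w + v"
    have d: "h *\<^sub>R ?d = exp (- h) *\<^sub>R S h w - w + h *\<^sub>R v"
    proof -
      have "h *\<^sub>R ?d = exp (- h) *\<^sub>R (S h w - w) + (exp (- h) - 1) *\<^sub>R w + h *\<^sub>R v"
        using elim by (simp add: scaleR_add_right)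
      then show ?thesis by (simp add: algebra_simps)
    qed
    have "exp (- (t + h)) *\<^sub>R S (t + h) w - exp (- t) *\<^sub>R S t w + (h * exp (- t)) *\<^sub>R S t v
       = exp (- t) *\<^sub>R S t (exp (- h) *\<^sub>R S h w - w + h *\<^sub>R v)"
      using t elim semig[of t h w]
      unfolding minus_add_distrib exp_add
      by (simp add: S_add S_diff S_scale scaleR_add_right scaleR_diff_right mult.commute)
    also have "\<dots> = exp (- t) *\<^sub>R S t (h *\<^sub>R ?d)" by (simp only: d)
    finally have "norm (exp (- (t + h)) *\<^sub>R S (t + h) w - exp (- t) *\<^sub>R S t w + (h * exp (- t)) *\<^sub>R S t v)
       = exp (- t) * norm (S t (h *\<^sub>R ?d))" by simp
    also have "\<dots> \<le> 1 * (h * norm ?d)"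
      using contr[OF t, of "h *\<^sub>R ?d"] elim t by (intro mult_mono) auto
    also have "\<dots> \<le> e * h" using elim by simp
    finally show ?case .
  qed
qed

lemma continuous_on_exp_S: "continuous_on {0..} (\<lambda>t. exp (- t) *\<^sub>R S t w)"
  by (intro continuous_intros cont)

lemma exp_S_tendsto_0: "((\<lambda>t. exp (- t) *\<^sub>R S t w) \<longlongrightarrow> 0) at_top"
proof (rule Lim_null_comparison[where g="\<lambda>t. exp (- t) * norm w"])
  show "\<forall>\<^sub>F t in at_top. norm (exp (- t) *\<^sub>R S t w) \<le> exp (- t) * norm w"
    using eventually_ge_at_top[of "0::real"] by eventually_elim (simp add: contr)
  have "((\<lambda>t::real. exp (- t) * norm w) \<longlongrightarrow> 0 * norm w) at_top"
    by (intro tendsto_mult tendsto_const exp_minus_tendsto_0)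
  then show "((\<lambda>t::real. exp (- t) * norm w) \<longlongrightarrow> 0) at_top" by simp
qed

text \<open>Formally \<open>w\<close> is the integral of \<open>exp (- s) *\<^sub>R S s v\<close>
  over all \<open>s \<ge> 0\<close>, and the left-hand side is the part over
  \<open>s \<ge> t\<close>. The comparison is made for the norm of the positive part of the
  difference.\<close>

lemma resolvent_supermedian:
  assumes gen: "gen w (w - v)" and v: "0 \<le> v" and t: "0 \<le> t"
  shows "exp (- t) *\<^sub>R S t w \<le> w"
proof -
  define f where "f t = norm (sup (exp (- t) *\<^sub>R S t w - w) 0)" for t
  have "f t \<le> f 0"
  proof (rule dini_nonincreasing[OF _ t])
    show "continuous_on {0..} f"
      unfolding f_def sup_0_eq continuous_on_def
      by (intro ballI tendsto_intros tendsto_inf_const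
          continuous_on_exp_S[unfolded continuous_on_def, rule_format]) auto
    fix t e :: real assume te: "0 \<le> t" "0 < e"
    show "\<forall>\<^sub>F h in at_right 0. f (t + h) \<le> f t + e * h"
      using gen_step[OF gen te] eventually_at_right_less[of "0::real"]
    proof eventually_elim
      case (elim h)
      let ?r = "exp (- (t + h)) *\<^sub>R S (t + h) w - exp (- t) *\<^sub>R S t w + (h * exp (- t)) *\<^sub>R S t v"
      have "0 \<le> (h * exp (- t)) *\<^sub>R S t v" using elim te pos v by (intro scaleR_nonneg_nonneg) auto
      then have "f (t + h) \<le> f t + norm ?r"
        unfolding f_def by (intro norm_sup_0_add_le) (simp add: algebra_simps)
      then show ?case using elim by linarith
    qed
  qed
  moreover have "f 0 = 0" using gen S0 by (simp add: f_def gen_def)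
  ultimately have "sup (exp (- t) *\<^sub>R S t w - w) 0 = 0" by (simp add: f_def)
  then show ?thesis by (metis diff_le_0_iff_le sup.cobounded1)
qed

text \<open>Formally \<open>norm w\<close> is the integral of
  \<open>exp (- s) * norm (S s v)\<close>, which reaches \<open>norm v\<close> only if
  \<open>norm (S s v)\<close> never falls below \<open>norm v\<close>.\<close>

lemma norm_S_eq_if_resolvent_norm_eq:
  assumes gen: "gen w (w - v)" and v: "0 \<le> v" and w: "0 \<le> w" and eq: "norm w = norm v" and s: "0 \<le> s"
  shows "norm (S s v) = norm v"
proof (rule ccontr)
  assume neq: "norm (S s v) \<noteq> norm v"
  then have lt: "norm (S s v) < norm v" using contr[OF s, of v] by simp
  \<comment> \<open>\<open>f t\<close> compares the mass collected by the resolvent up to time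
    \<open>t\<close> with the value \<open>(1 - exp (- t)) * norm v\<close> of a norm-preserving
    orbit. The norm hypothesis makes \<open>f\<close> nonnegative, while a loss at time
    \<open>s\<close> would make it fall strictly there.\<close>
  define f where "f t = norm (w - exp (- t) *\<^sub>R S t w) + exp (- t) * norm v - norm v" for t
  have f_nonneg: "0 \<le> f t" if "0 \<le> t" for t
  proof -
    have "norm (w - exp (- t) *\<^sub>R S t w) = norm w - exp (- t) * norm (S t w)"
      using norm_diff_nonneg[OF _ resolvent_supermedian[OF gen v that]] pos[OF that w]
      by (simp add: scaleR_nonneg_nonneg)
    then show ?thesis using contr[OF that, of w] by (simp add: f_def eq mult_left_mono)
  qed
  have step: "\<forall>\<^sub>F h in at_right 0. f (t + h) \<le> f t - h * exp (- t) * (norm v - norm (S t v)) + e * h"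
    if te: "0 \<le> t" "0 < e" for t e
  proof -
    have "((\<lambda>h::real. ((exp (- h) - 1) / h) * norm v) \<longlongrightarrow> - 1 * norm v) (at_right 0)"
      by (intro tendsto_intros exp_minus_quotient_tendsto)
    then have "\<forall>\<^sub>F h in at_right 0. ((exp (- h) - 1) / h) * norm v < - 1 * norm v + e / 2"
      using te by (intro order_tendstoD) auto
    with gen_step[OF gen te(1) half_gt_zero[OF te(2)]] eventually_at_right_less[of "0::real"]
    show ?thesis
    proof eventually_elim
      case (elim h)
      let ?r = "exp (- (t + h)) *\<^sub>R S (t + h) w - exp (- t) *\<^sub>R S t w + (h * exp (- t)) *\<^sub>R S t v"
      have "w - exp (- (t + h)) *\<^sub>R S (t + h) w
        = (w - exp (- t) *\<^sub>R S t w) + (h * exp (- t)) *\<^sub>R S t v - ?r" (is "?l = ?a") by simp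
      then have "norm ?l = norm ?a" by (rule arg_cong)
      then have "norm (w - exp (- (t + h)) *\<^sub>R S (t + h) w)
        \<le> norm (w - exp (- t) *\<^sub>R S t w) + norm ((h * exp (- t)) *\<^sub>R S t v) + norm ?r"
        using norm_triangle_ineq[of "w - exp (- t) *\<^sub>R S t w" "(h * exp (- t)) *\<^sub>R S t v"]
          norm_triangle_ineq4[of "(w - exp (- t) *\<^sub>R S t w) + (h * exp (- t)) *\<^sub>R S t v" ?r]
        by linarith
      then have 1: "norm (w - exp (- (t + h)) *\<^sub>R S (t + h) w)
        \<le> norm (w - exp (- t) *\<^sub>R S t w) + h * exp (- t) * norm (S t v) + e / 2 * h"
        using elim by (simp add: abs_mult)
      have "(exp (- h) - 1) * norm v \<le> h * (- norm v + e / 2)"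
        using elim by (simp add: field_simps)
      then have "exp (- t) * ((exp (- h) - 1) * norm v) \<le> exp (- t) * (h * (- norm v + e / 2))"
        by (intro mult_left_mono) auto
      also have "\<dots> \<le> - h * exp (- t) * norm v + 1 * (h * e / 2)"
      proof -
        have "exp (- t) * (h * e / 2) \<le> 1 * (h * e / 2)"
          using te elim by (intro mult_right_mono) auto
        then show ?thesis by (simp add: algebra_simps)
      qed
      finally have "exp (- (t + h)) * norm v - exp (- t) * norm v \<le> - h * exp (- t) * norm v + h * e / 2"
        by (simp only: minus_add_distrib exp_add) (simp add: algebra_simps)
      then show ?case using 1 unfolding f_def by (simp add: algebra_simps)
    qed
  qed
  have "continuous_on {0..} f"
    unfolding f_def by (intro continuous_intros continuous_on_exp_S)
  moreover have "\<forall>\<^sub>F h in at_right 0. f (t + h) \<le> f t + e * h" if te: "0 \<le> t" "0 < e" for t e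
    using step[OF te] eventually_at_right_less[of "0::real"]
  proof eventually_elim
    case (elim h)
    have "0 \<le> h * exp (- t) * (norm v - norm (S t v))" using elim contr[OF te(1), of v] by simp
    then show ?case using elim by linarith
  qed
  ultimately have "f s \<le> f 0" using dini_nonincreasing s by blast
  then have fs: "f s \<le> 0" using gen S0 by (simp add: f_def gen_def)
  \<comment> \<open>The rate at which \<open>f\<close> falls at time \<open>s\<close>. Half of it is
    spent on the error in \<open>step\<close>; the rest drives \<open>f\<close> below zero right
    after \<open>s\<close>.\<close>
  let ?k = "exp (- s) * (norm v - norm (S s v))"
  have k: "0 < ?k" using lt by simp
  obtain h where h: "0 < h" "f (s + h) \<le> f s - h * exp (- s) * (norm v - norm (S s v)) + ?k / 2 * h"
  proof -
    have "\<forall>\<^sub>F h in at_right 0. 0 < h \<and> f (s + h) \<le> f s - h * exp (- s) * (norm v - norm (S s v)) + ?k / 2 * h"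
      using step[OF s half_gt_zero[OF k]] eventually_at_right_less[of "0::real"]
      by eventually_elim auto
    then show thesis
      using eventually_happens[of _ "at_right (0::real)"] trivial_limit_at_right_real that by blast
  qed
  have "f (s + h) \<le> f s - h * ?k / 2" using h(2) by (simp add: field_simps)
  also have "\<dots> < 0" using fs mult_pos_pos[OF h(1) k] by linarith
  finally show False using f_nonneg[of "s + h"] s h(1) by simp
qed

text \<open>The orbit moves at time \<open>t\<close> no faster than at time 0, where its speed is
  zero.\<close>

lemma invariant_if_gen_0:
  assumes gen: "gen r 0" and t: "0 \<le> t"
  shows "S t r = r"
proof -
  define f where "f t = norm (S t r - r)" for t
  have "f t \<le> f 0"
  proof (rule dini_nonincreasing[OF _ t])
    show "continuous_on {0..} f" unfolding f_def by (intro continuous_intros cont)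
    fix t e :: real assume te: "0 \<le> t" "0 < e"
    have "\<forall>\<^sub>F h in at_right 0. norm ((S h r - r) /\<^sub>R h) < e"
      using gen te by (auto simp: gen_def tendsto_iff)
    then show "\<forall>\<^sub>F h in at_right 0. f (t + h) \<le> f t + e * h"
      using eventually_at_right_less[of "0::real"]
    proof eventually_elim
      case (elim h)
      have "S (t + h) r - r = (S t r - r) + S t (S h r - r)" (is "?l = ?a")
        using te elim by (simp add: semig S_diff)
      then have "norm ?l = norm ?a" by (rule arg_cong)
      then have "f (t + h) \<le> f t + norm (S h r - r)"
        using norm_triangle_ineq[of "S t r - r" "S t (S h r - r)"] contr[OF te(1), of "S h r - r"]
        unfolding f_def by linarith
      also have "norm (S h r - r) \<le> e * h"
      proof -
        have "norm ((S h r - r) /\<^sub>R h) = norm (S h r - r) / h" using elim(2) by (simp add: divide_inverse mult.commute)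
        then show ?thesis using elim by (simp add: pos_divide_less_eq)
      qed
      finally show ?case by simp
    qed
  qed
  then show ?thesis using gen S0 by (simp add: f_def gen_def)
qed

text \<open>The identity \<open>exp (- t) *\<^sub>R S t w - w = - (1 - exp (- t)) *\<^sub>R
  z\<close> holds at all times, and its limit leaves \<open>w = z\<close>. It makes an invariant
  vector comparable with the first term of its own resolvent series.\<close>

lemma resolvent_of_invariant:
  assumes gen: "gen w (w - z)" and inv: "\<And>t. 0 \<le> t \<Longrightarrow> S t z = z"
  shows "w = z"
proof -
  define f where "f t = norm (exp (- t) *\<^sub>R S t w - w + (1 - exp (- t)) *\<^sub>R z)" for t
  have f0: "f t = 0" if t: "0 \<le> t" for t
  proof -
    have "f t \<le> f 0"
    proof (rule dini_nonincreasing[OF _ t])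
      show "continuous_on {0..} f"
        unfolding f_def by (intro continuous_intros continuous_on_exp_S)
      fix t e :: real assume te: "0 \<le> t" "0 < e"
      have "((\<lambda>h::real. norm (((exp (- h) - 1) / h + 1) *\<^sub>R z)) \<longlongrightarrow> norm ((- 1 + 1) *\<^sub>R z)) (at_right 0)"
        by (intro tendsto_intros exp_minus_quotient_tendsto)
      then have "\<forall>\<^sub>F h::real in at_right 0. norm (((exp (- h) - 1) / h + 1) *\<^sub>R z) < e / 2"
        using te by (intro order_tendstoD) auto
      with gen_step[OF gen te(1) half_gt_zero[OF te(2)]] eventually_at_right_less[of "0::real"]
      show "\<forall>\<^sub>F h in at_right 0. f (t + h) \<le> f t + e * h"
      proof eventually_elim
        case (elim h)
        let ?r = "exp (- (t + h)) *\<^sub>R S (t + h) w - exp (- t) *\<^sub>R S t w + (h * exp (- t)) *\<^sub>R S t z"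
        let ?q = "(exp (- t) * (1 - h - exp (- h))) *\<^sub>R z"
        have "f (t + h) = norm ((exp (- t) *\<^sub>R S t w - w + (1 - exp (- t)) *\<^sub>R z) + ?r + ?q)"
          unfolding f_def minus_add_distrib exp_add
          by (rule arg_cong[of _ _ norm]) (simp add: inv te algebra_simps)
        also have "\<dots> \<le> f t + norm ?r + norm ?q"
          unfolding f_def
          using norm_triangle_ineq[of "exp (- t) *\<^sub>R S t w - w + (1 - exp (- t)) *\<^sub>R z" ?r]
            norm_triangle_ineq[of "(exp (- t) *\<^sub>R S t w - w + (1 - exp (- t)) *\<^sub>R z) + ?r" ?q]
          by linarith
        also have "norm ?q \<le> norm ((1 - h - exp (- h)) *\<^sub>R z)"
          using te mult_right_mono[of "exp (- t)" 1 "\<bar>1 - h - exp (- h)\<bar> * norm z"]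
          by (simp add: abs_mult mult.assoc)
        also have "\<dots> = norm (h *\<^sub>R ((exp (- h) - 1) / h + 1) *\<^sub>R z)"
        proof -
          have "h * ((exp (- h) - 1) / h + 1) = - (1 - h - exp (- h))"
            using elim by (simp add: distrib_left)
          then have "h *\<^sub>R ((exp (- h) - 1) / h + 1) *\<^sub>R z = - ((1 - h - exp (- h)) *\<^sub>R z)"
            by (simp only: scaleR_scaleR scaleR_minus_left)
          then show ?thesis by (simp only: norm_minus_cancel)
        qed
        also have "\<dots> = h * norm (((exp (- h) - 1) / h + 1) *\<^sub>R z)"
          using elim(2) by (subst norm_scaleR) (simp only: abs_of_pos)
        also have "\<dots> \<le> h * (e / 2)" using elim(2,3) by (intro mult_left_mono) auto
        finally have "f (t + h) \<le> f t + norm ?r + h * (e / 2)" by simp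
        moreover have "h * (e / 2) + e / 2 * h = e * h" by simp
        ultimately show ?case using elim(1) by linarith
      qed
    qed
    then show ?thesis using gen S0 by (simp add: f_def gen_def)
  qed
  have "((\<lambda>t. exp (- t) *\<^sub>R S t w - w + (1 - exp (- t)) *\<^sub>R z) \<longlongrightarrow> 0 - w + (1 - 0) *\<^sub>R z) at_top"
    by (intro tendsto_intros exp_S_tendsto_0 exp_minus_tendsto_0)
  moreover have "\<forall>\<^sub>F t in at_top. exp (- t) *\<^sub>R S t w - w + (1 - exp (- t)) *\<^sub>R z = 0"
    using eventually_ge_at_top[of "0::real"] by eventually_elim (use f0 in \<open>simp add: f_def\<close>)
  ultimately have "((\<lambda>t::real. 0) \<longlongrightarrow> 0 - w + (1 - 0) *\<^sub>R z) at_top"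
    by (rule tendsto_cong[THEN iffD1, rotated])
  then show ?thesis by (simp add: tendsto_const_iff)
qed

text \<open>The resolvent is a weighted average of the orbit of \<open>v\<close>, so it inherits the
  vanishing of \<open>\<beta>\<close>. In place of the average the proof follows
  \<open>\<beta> (exp (- t) *\<^sub>R S t w - w)\<close>, which stays zero.\<close>

lemma functional_resolvent_eq_0:
  fixes \<beta> :: "'a \<Rightarrow> real"
  assumes gen: "gen w (w - v)" and b: "bounded_linear \<beta>" and z: "\<And>t. 0 \<le> t \<Longrightarrow> \<beta> (S t v) = 0"
  shows "\<beta> w = 0"
proof -
  interpret b: bounded_linear \<beta> by fact
  obtain K where K: "0 < K" "\<And>x. norm (\<beta> x) \<le> norm x * K" using b.pos_bounded by blast
  define f where "f t = \<bar>\<beta> (exp (- t) *\<^sub>R S t w - w)\<bar>" for t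
  have f0: "f t = 0" if t: "0 \<le> t" for t
  proof -
    have "f t \<le> f 0"
    proof (rule dini_nonincreasing[OF _ t])
      show "continuous_on {0..} f"
        unfolding f_def by (intro continuous_intros continuous_on_exp_S b.continuous_on)
      fix t e :: real assume te: "0 \<le> t" "0 < e"
      have "0 < e / K" using te K by simp
      from gen_step[OF gen te(1) this] eventually_at_right_less[of "0::real"]
      show "\<forall>\<^sub>F h in at_right 0. f (t + h) \<le> f t + e * h"
      proof eventually_elim
        case (elim h)
        let ?r = "exp (- (t + h)) *\<^sub>R S (t + h) w - exp (- t) *\<^sub>R S t w + (h * exp (- t)) *\<^sub>R S t v"
        have "f (t + h) = \<bar>\<beta> ((exp (- t) *\<^sub>R S t w - w) + ?r)\<bar>"
          unfolding f_def using z te by (simp add: b.add b.diff b.scaleR)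
        also have "\<dots> \<le> f t + \<bar>\<beta> ?r\<bar>" unfolding f_def b.add by (rule abs_triangle_ineq)
        also have "\<bar>\<beta> ?r\<bar> \<le> norm ?r * K" using K(2)[of ?r] by simp
        also have "\<dots> \<le> e / K * h * K" using elim K by (intro mult_right_mono) auto
        finally show ?case using K by simp
      qed
    qed
    then show ?thesis using gen S0 by (simp add: f_def gen_def)
  qed
  have "((\<lambda>t. \<beta> (exp (- t) *\<^sub>R S t w - w)) \<longlongrightarrow> \<beta> (0 - w)) at_top"
    by (intro b.tendsto tendsto_intros exp_S_tendsto_0)
  moreover have "\<forall>\<^sub>F t in at_top. \<beta> (exp (- t) *\<^sub>R S t w - w) = 0"
    using eventually_ge_at_top[of "0::real"] by eventually_elim (use f0 in \<open>simp add: f_def\<close>)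
  ultimately have "((\<lambda>t::real. 0) \<longlongrightarrow> \<beta> (0 - w)) at_top"
    by (rule tendsto_cong[THEN iffD1, rotated])
  then show ?thesis by (simp add: tendsto_const_iff b.neg)
qed

end

section \<open>Powers of averaged operators\<close>

lemma binomial_sum_Suc:
  fixes a :: "nat \<Rightarrow> 'a::real_vector"
  shows "(\<Sum>j\<le>k. real (k choose j) *\<^sub>R a j) = a 0 + (\<Sum>j\<le>k. real (k choose Suc j) *\<^sub>R a (Suc j))"
proof -
  have "(\<Sum>j\<le>k. real (k choose j) *\<^sub>R a j) = (\<Sum>j\<le>Suc k. real (k choose j) *\<^sub>R a j)" by simp
  also have "\<dots> = a 0 + (\<Sum>j\<le>k. real (k choose Suc j) *\<^sub>R a (Suc j))"
    by (subst sum.atMost_Suc_shift) simp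
  finally show ?thesis .
qed

lemma averaged_power_eq:
  fixes V :: "'a::real_vector \<Rightarrow> 'a"
  assumes V: "linear V"
  shows "((\<lambda>x. (1/2) *\<^sub>R (x + V x)) ^^ k) f = (1 / 2 ^ k) *\<^sub>R (\<Sum>j\<le>k. real (k choose j) *\<^sub>R (V ^^ j) f)"
proof (induction k)
  case (Suc k)
  let ?a = "\<lambda>j. (V ^^ j) f"
  have "(\<Sum>j\<le>Suc k. real (Suc k choose j) *\<^sub>R ?a j)
      = ?a 0 + (\<Sum>j\<le>k. (real (k choose j) + real (k choose Suc j)) *\<^sub>R ?a (Suc j))"
    by (subst sum.atMost_Suc_shift) simp
  also have "\<dots> = (\<Sum>j\<le>k. real (k choose j) *\<^sub>R ?a j) + (\<Sum>j\<le>k. real (k choose j) *\<^sub>R ?a (Suc j))"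
    by (subst binomial_sum_Suc) (simp add: scaleR_add_left sum.distrib)
  also have "(\<Sum>j\<le>k. real (k choose j) *\<^sub>R ?a (Suc j)) = V (\<Sum>j\<le>k. real (k choose j) *\<^sub>R ?a j)"
    using V by (simp add: linear_sum linear_scale)
  finally have "(\<Sum>j\<le>Suc k. real (Suc k choose j) *\<^sub>R ?a j)
      = (\<Sum>j\<le>k. real (k choose j) *\<^sub>R ?a j) + V (\<Sum>j\<le>k. real (k choose j) *\<^sub>R ?a j)" .
  then show ?case using Suc V by (simp add: linear_scale scaleR_add_right)
qed simp

text \<open>The coefficients rise from 1 to the central one and then fall to 0, the entry after the
  last one being 0. Both halves telescope, so the sum is the rise plus the fall.\<close>

lemma sum_abs_diff_central_binomial:
  "(\<Sum>j\<le>2 * n. \<bar>real (2 * n choose Suc j) - real (2 * n choose j)\<bar>) = 2 * real (2 * n choose n) - 1"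
proof -
  let ?b = "\<lambda>j. real (2 * n choose j)"
  have "{..2 * n} = {..<n} \<union> {n..<Suc (2 * n)}" by auto
  then have "(\<Sum>j\<le>2 * n. \<bar>?b (Suc j) - ?b j\<bar>)
      = (\<Sum>j<n. \<bar>?b (Suc j) - ?b j\<bar>) + (\<Sum>j=n..<Suc (2 * n). \<bar>?b (Suc j) - ?b j\<bar>)"
    by (simp only: sum.union_disjoint[OF _ _ ivl_disj_int_one(2)] finite_lessThan finite_atLeastLessThan)
  also have "(\<Sum>j<n. \<bar>?b (Suc j) - ?b j\<bar>) = (\<Sum>j<n. ?b (Suc j) - ?b j)"
  proof (rule sum.cong)
    fix j assume "j \<in> {..<n}"
    then have "(2 * n choose j) \<le> (2 * n choose Suc j)" by (intro binomial_mono) auto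
    then show "\<bar>?b (Suc j) - ?b j\<bar> = ?b (Suc j) - ?b j" by simp
  qed simp
  also have "\<dots> = ?b n - 1" by (subst sum_lessThan_telescope) simp
  also have "(\<Sum>j=n..<Suc (2 * n). \<bar>?b (Suc j) - ?b j\<bar>) = (\<Sum>j=n..<Suc (2 * n). - ?b (Suc j) - (- ?b j))"
  proof (rule sum.cong)
    fix j assume j: "j \<in> {n..<Suc (2 * n)}"
    have "(2 * n choose Suc j) \<le> (2 * n choose j)"
    proof (cases "j = 2 * n")
      case False
      then show ?thesis using j by (intro binomial_antimono) auto
    qed (simp add: binomial_eq_0)
    then show "\<bar>?b (Suc j) - ?b j\<bar> = - ?b (Suc j) - (- ?b j)" by simp
  qed simp
  also have "\<dots> = ?b n" by (subst sum_Suc_diff') auto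
  finally show ?thesis by simp
qed

text \<open>Consecutive terms have the ratio \<open>(2 * n + 1) / (2 * n + 2)\<close>, and the
  invariant \<open>(c n)\<^sup>2 * (2 * n + 1) \<le> 1\<close> survives the step because
  \<open>(2 * n + 1) * (2 * n + 3) \<le> (2 * n + 2)\<^sup>2\<close>.\<close>

lemma central_binomial_tendsto_0: "(\<lambda>n. real (2 * n choose n) / 4 ^ n) \<longlonglongrightarrow> 0"
proof -
  define c where "c n = real (2 * n choose n) / 4 ^ n" for n
  have rec: "c (Suc n) = c n * (2 * real n + 1) / (2 * real n + 2)" for n
  proof -
    have 1: "Suc n * (2 * Suc n choose Suc n) = (2 * n + 2) * (Suc (2 * n) choose n)"
      using Suc_times_binomial[of n "Suc (2 * n)"] by simp
    have 2: "(Suc (2 * n) choose n) = (Suc (2 * n) choose Suc n)"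
      using binomial_symmetric[of n "Suc (2 * n)"] by simp
    have 3: "Suc n * (Suc (2 * n) choose Suc n) = Suc (2 * n) * (2 * n choose n)"
      using Suc_times_binomial[of n "2 * n"] by simp
    have "Suc n * (Suc n * (2 * Suc n choose Suc n)) = (2 * n + 2) * (Suc (2 * n) * (2 * n choose n))"
      by (simp only: 1 2 3[symmetric]) (simp add: algebra_simps)
    then have "real (Suc n) * (real (Suc n) * real (2 * Suc n choose Suc n))
      = real (2 * n + 2) * (real (Suc (2 * n)) * real (2 * n choose n))"
      by (simp only: of_nat_mult[symmetric])
    then have cancelled: "B * (real n + 1) = 2 * (2 * real n + 1) * C"
      if "B = real (2 * Suc n choose Suc n)" "C = real (2 * n choose n)" for B C
    proof -
      have "real (Suc n) * (real (Suc n) * B) = real (Suc n) * (2 * (2 * real n + 1) * C)"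
        using \<open>real (Suc n) * _ = _\<close> unfolding that[symmetric] by (simp add: algebra_simps)
      then have "real (Suc n) * B = 2 * (2 * real n + 1) * C" unfolding mult_left_cancel[OF of_nat_neq_0] .
      then show ?thesis by (simp add: algebra_simps)
    qed
    have "B / 4 ^ Suc n = C / 4 ^ n * (2 * real n + 1) / (2 * real n + 2)"
      if "B = real (2 * Suc n choose Suc n)" "C = real (2 * n choose n)" for B C
    proof -
      have "B = 2 * (2 * real n + 1) * C / (real n + 1)"
        using cancelled[OF that] by (simp add: eq_divide_eq)
      moreover have "2 * (2 * real n + 1) * C / (real n + 1) / (4 * q) = C / q * (2 * real n + 1) / (2 * real n + 2)" if "0 < q" for q
        using that by (simp add: divide_simps) (simp add: algebra_simps)
      ultimately show ?thesis by simp
    qed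
    then show ?thesis unfolding c_def by blast
  qed
  have bound: "(c n)\<^sup>2 * (2 * real n + 1) \<le> 1" for n
  proof (induction n)
    case (Suc n)
    have "(c (Suc n))\<^sup>2 * (2 * real (Suc n) + 1)
      = ((c n)\<^sup>2 * (2 * real n + 1)) * ((2 * real n + 1) * (2 * real n + 3) / (2 * real n + 2)\<^sup>2)"
    proof -
      have 3: "2 * real (Suc n) + 1 = 2 * real n + 3" by simp
      have "(x * a / b)\<^sup>2 * d = (x\<^sup>2 * a) * (a * d / b\<^sup>2)" for x a b d :: real
        by (simp add: power2_eq_square)
      then show ?thesis unfolding 3 rec .
    qed
    also have "\<dots> \<le> 1"
    proof (rule mult_le_one[OF Suc])
      show "0 \<le> (2 * real n + 1) * (2 * real n + 3) / (2 * real n + 2)\<^sup>2"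
        by (intro divide_nonneg_nonneg mult_nonneg_nonneg) auto
      show "(2 * real n + 1) * (2 * real n + 3) / (2 * real n + 2)\<^sup>2 \<le> 1"
      proof (subst divide_le_eq_1_pos)
        show "0 < (2 * real n + 2)\<^sup>2" by (intro zero_less_power) simp
        show "(2 * real n + 1) * (2 * real n + 3) \<le> (2 * real n + 2)\<^sup>2"
          by (simp add: power2_eq_square algebra_simps)
      qed
    qed
    finally show ?case .
  qed (simp add: c_def)
  have "(\<lambda>n. (c n)\<^sup>2) \<longlonglongrightarrow> 0"
  proof (rule Lim_null_comparison)
    show "\<forall>\<^sub>F n in sequentially. norm ((c n)\<^sup>2) \<le> 1 / real (Suc n)"
    proof (rule always_eventually, rule allI)
      fix n
      have "(c n)\<^sup>2 * real (Suc n) \<le> (c n)\<^sup>2 * (2 * real n + 1)" by (intro mult_left_mono) auto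
      then have "(c n)\<^sup>2 * real (Suc n) \<le> 1" using bound[of n] by linarith
      then show "norm ((c n)\<^sup>2) \<le> 1 / real (Suc n)" by (simp add: field_simps)
    qed
    show "(\<lambda>n. 1 / real (Suc n)) \<longlonglongrightarrow> 0" by (rule LIMSEQ_Suc[OF lim_1_over_n])
  qed
  then have "(\<lambda>n. sqrt ((c n)\<^sup>2)) \<longlonglongrightarrow> sqrt 0" by (intro tendsto_intros)
  moreover have "0 \<le> c n" for n by (simp add: c_def)
  ultimately show ?thesis unfolding c_def by simp
qed

text \<open>In the binomial expansion of \<open>H ^^ (2 * n)\<close> the difference has the
  increments of the binomial coefficients as coefficients. Their total variation is twice the
  central coefficient, against the denominator \<open>4 ^ n\<close>.\<close>

lemma norm_diff_averaged_power_le: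
  fixes V :: "'a::real_normed_vector \<Rightarrow> 'a"
  assumes V: "linear V" and contr: "\<And>x. norm (V x) \<le> norm x"
  defines "H \<equiv> (\<lambda>x. (1/2) *\<^sub>R (x + V x))"
  shows "norm ((H ^^ (2 * n)) f - V ((H ^^ (2 * n)) f)) \<le> 2 * (real (2 * n choose n) / 4 ^ n) * norm f"
proof -
  let ?a = "\<lambda>j. (V ^^ j) f" and ?b = "\<lambda>j. real (2 * n choose j)"
  have na: "norm (?a j) \<le> norm f" for j
    by (induction j) (auto intro: order_trans[OF contr])
  have h: "(H ^^ (2 * n)) f = (1 / 4 ^ n) *\<^sub>R (\<Sum>j\<le>2 * n. ?b j *\<^sub>R ?a j)"
    unfolding H_def by (subst averaged_power_eq[OF V]) (simp add: power_mult)
  have "(H ^^ (2 * n)) f - V ((H ^^ (2 * n)) f)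
    = (1 / 4 ^ n) *\<^sub>R ((\<Sum>j\<le>2 * n. ?b j *\<^sub>R ?a j) - (\<Sum>j\<le>2 * n. ?b j *\<^sub>R ?a (Suc j)))"
    unfolding h using V by (simp add: linear_sum linear_scale scaleR_diff_right)
  also have "\<dots> = (1 / 4 ^ n) *\<^sub>R (f + (\<Sum>j\<le>2 * n. (?b (Suc j) - ?b j) *\<^sub>R ?a (Suc j)))"
    by (subst binomial_sum_Suc) (simp add: scaleR_diff_left sum_subtractf)
  finally have "norm ((H ^^ (2 * n)) f - V ((H ^^ (2 * n)) f))
    = (1 / 4 ^ n) * norm (f + (\<Sum>j\<le>2 * n. (?b (Suc j) - ?b j) *\<^sub>R ?a (Suc j)))" by simp
  also have "norm (f + (\<Sum>j\<le>2 * n. (?b (Suc j) - ?b j) *\<^sub>R ?a (Suc j)))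
     \<le> norm f + (\<Sum>j\<le>2 * n. \<bar>?b (Suc j) - ?b j\<bar> * norm f)"
    by (intro order_trans[OF norm_triangle_ineq] add_left_mono sum_norm_le)
      (use na[of "Suc _"] in \<open>auto intro!: mult_left_mono\<close>)
  also have "\<dots> = norm f + (2 * ?b n - 1) * norm f"
    by (simp only: sum_abs_diff_central_binomial flip: sum_distrib_right)
  finally show ?thesis by (simp add: field_simps)
qed

section \<open>Long-time behaviour under a rank-one minorization\<close>

context pos_semigroup begin

lemma X_intros: "0 \<in> X" "u \<in> X \<Longrightarrow> v \<in> X \<Longrightarrow> u + v \<in> X" "u \<in> X \<Longrightarrow> v \<in> X \<Longrightarrow> u - v \<in> X"
    "u \<in> X \<Longrightarrow> c *\<^sub>R u \<in> X" "u \<in> X \<Longrightarrow> v \<in> X \<Longrightarrow> inf u v \<in> X"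
proof -
  show "0 \<in> X" "u \<in> X \<Longrightarrow> v \<in> X \<Longrightarrow> u + v \<in> X" "u \<in> X \<Longrightarrow> v \<in> X \<Longrightarrow> u - v \<in> X"
    "u \<in> X \<Longrightarrow> c *\<^sub>R u \<in> X" for u v c
    using subspace_X by (auto intro: subspace_0 subspace_add subspace_diff subspace_scale)
  show "inf u v \<in> X" if "u \<in> X" "v \<in> X"
    using subspace_neg[OF subspace_X] sup_X[of "- u" "- v"] that by (metis inf_eq_neg_sup)
qed

text \<open>The norm along an orbit is nonincreasing, so this infimum is also its limit: a seminorm
  that forgets whatever is lost in time and is unchanged by the semigroup. Merging of two orbits is
  the vanishing of \<open>ell\<close> on their difference.\<close>

definition ell :: "'a \<Rightarrow> real" where "ell f = (INF t\<in>{0..}. norm (S t f))"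

lemma bdd_below_norm_S: "bdd_below ((\<lambda>t. norm (S t f)) ` {0..})"
  by (rule bdd_belowI[of _ 0]) auto

lemma ell_le: "0 \<le> t \<Longrightarrow> ell f \<le> norm (S t f)"
  unfolding ell_def by (rule cINF_lower[OF bdd_below_norm_S]) auto

lemma ell_nonneg: "0 \<le> ell f"
  unfolding ell_def by (rule cINF_greatest) auto

lemma norm_S_antimono: "0 \<le> s \<Longrightarrow> s \<le> t \<Longrightarrow> norm (S t f) \<le> norm (S s f)"
  using semig[of "t - s" s f] contr[of "t - s" "S s f"] by simp

lemma ell_less: "ell f < c \<Longrightarrow> \<exists>t\<ge>0. \<forall>s\<ge>t. norm (S s f) < c"
proof -
  assume "ell f < c"
  then obtain t where "0 \<le> t" "norm (S t f) < c"
    unfolding ell_def by (subst (asm) cINF_less_iff[OF _ bdd_below_norm_S]) auto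
  then show ?thesis using norm_S_antimono[of t] by (auto intro: order.strict_trans1)
qed

lemma ell_add: "ell (f + g) \<le> ell f + ell g"
proof (rule field_le_epsilon)
  fix e :: real assume e: "0 < e"
  obtain t where t: "0 \<le> t" "\<And>s. t \<le> s \<Longrightarrow> norm (S s f) < ell f + e / 2"
    using ell_less[of f "ell f + e / 2"] e by auto
  obtain r where r: "0 \<le> r" "\<And>s. r \<le> s \<Longrightarrow> norm (S s g) < ell g + e / 2"
    using ell_less[of g "ell g + e / 2"] e by auto
  let ?s = "max t r"
  have "ell (f + g) \<le> norm (S ?s (f + g))" using t r by (intro ell_le) auto
  also have "\<dots> \<le> norm (S ?s f) + norm (S ?s g)"
    using t by (simp add: S_add norm_triangle_ineq)
  also have "\<dots> \<le> ell f + ell g + e" using t(2)[of ?s] r(2)[of ?s] by auto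
  finally show "ell (f + g) \<le> ell f + ell g + e" .
qed

lemma ell_scale: "ell (c *\<^sub>R f) \<le> \<bar>c\<bar> * ell f"
proof (cases "c = 0")
  case True
  then show ?thesis using ell_le[of 0 0] by (simp add: S_zero)
next
  case False
  have "ell (c *\<^sub>R f) / \<bar>c\<bar> \<le> ell f"
    unfolding ell_def[of f]
  proof (rule cINF_greatest)
    fix t :: real assume "t \<in> {0..}"
    then show "ell (c *\<^sub>R f) / \<bar>c\<bar> \<le> norm (S t f)"
      using ell_le[of t "c *\<^sub>R f"] False by (simp add: S_scale field_simps)
  qed simp
  then show ?thesis using False by (simp add: field_simps)
qed

lemma ell_le_norm: "ell f \<le> norm f"
  using ell_le[of 0 f] contr[of 0 f] by simp

lemma ell_S: "0 \<le> r \<Longrightarrow> ell (S r f) = ell f"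
proof (rule antisym)
  assume r: "0 \<le> r"
  show "ell (S r f) \<le> ell f"
    unfolding ell_def[of f]
  proof (rule cINF_greatest)
    fix t :: real assume t: "t \<in> {0..}"
    have "ell (S r f) \<le> norm (S t (S r f))" using t by (intro ell_le) auto
    also have "\<dots> \<le> norm (S t f)" using norm_S_antimono[of t "t + r" f] t r by (simp add: semig)
    finally show "ell (S r f) \<le> norm (S t f)" .
  qed simp
  show "ell f \<le> ell (S r f)"
    unfolding ell_def[of "S r f"]
  proof (rule cINF_greatest)
    fix t :: real assume t: "t \<in> {0..}"
    then show "ell f \<le> norm (S t (S r f))" using ell_le[of "t + r" f] r by (simp add: semig)
  qed simp
qed

lemma ell_0_tendsto: "ell f = 0 \<Longrightarrow> ((\<lambda>t. S t f) \<longlongrightarrow> 0) at_top"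
  using ell_less[of f] by (auto simp: tendsto_iff eventually_at_top_linorder)

end

text \<open>\<open>us_dense\<close> expresses that the invariant vector is strictly positive,
  \<open>irred\<close> that every nonzero nonnegative start is seen by \<open>\<beta>\<close> at
  some time, and \<open>minor\<close> that what is seen reappears as a multiple of the single vector
  \<open>\<alpha>\<close>.\<close>

locale minorized_semigroup = pos_semigroup +
  fixes us \<alpha> :: 'a and \<beta> :: "'a \<Rightarrow> real" and m :: real
  assumes stoch: "0 \<le> t \<Longrightarrow> 0 \<le> u \<Longrightarrow> u \<in> X \<Longrightarrow> norm (S t u) = norm u"
    and us: "us \<in> X" "0 \<le> us" "us \<noteq> 0" "\<And>t. 0 \<le> t \<Longrightarrow> S t us = us"
    and us_dense: "0 \<le> u \<Longrightarrow> u \<in> X \<Longrightarrow> (\<lambda>n. inf u (real n *\<^sub>R us)) \<longlonglongrightarrow> u"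
    and \<beta>: "bounded_linear \<beta>" "\<And>u. 0 \<le> u \<Longrightarrow> 0 \<le> \<beta> u"
    and irred: "0 \<le> v \<Longrightarrow> v \<in> X \<Longrightarrow> (\<And>r. 0 \<le> r \<Longrightarrow> \<beta> (S r v) = 0) \<Longrightarrow> v = 0"
    and \<alpha>: "\<alpha> \<in> X" "0 \<le> \<alpha>" "\<alpha> \<noteq> 0" and m: "0 \<le> m"
    and minor: "0 \<le> u \<Longrightarrow> u \<in> X \<Longrightarrow> \<beta> u *\<^sub>R \<alpha> \<le> S m u"
begin

interpretation \<beta>: bounded_linear \<beta> by (rule \<beta>)

text \<open>The supremum over all times need not be attained, but some time reaches at least half of
  it, and the factor 2 does no harm to summability.\<close>

lemma greedy_time:
  assumes "0 \<le> v"
  shows "\<exists>r\<ge>0. \<forall>s\<ge>0. \<beta> (S s v) \<le> 2 * \<beta> (S r v)"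
proof -
  obtain K where K: "\<And>x. norm (\<beta> x) \<le> norm x * K" "0 < K" using \<beta>.pos_bounded by blast
  have "\<beta> (S s v) \<le> norm v * K" if "0 \<le> s" for s
  proof -
    have "norm (S s v) * K \<le> norm v * K" using K(2) by (intro mult_right_mono contr that) auto
    then show ?thesis using K(1)[of "S s v"] by simp
  qed
  then have bdd: "bdd_above ((\<lambda>s. \<beta> (S s v)) ` {0..})" by (intro bdd_aboveI) auto
  let ?s = "SUP s\<in>{0..}. \<beta> (S s v)"
  have le: "\<beta> (S s v) \<le> ?s" if "0 \<le> s" for s using cSUP_upper[OF _ bdd] that by simp
  show ?thesis
  proof (cases "?s \<le> 0")
    case True
    have "\<beta> (S s v) \<le> 2 * \<beta> (S 0 v)" if "0 \<le> s" for s
      using le[OF that] True \<beta>(2)[OF pos[of 0 v]] assms by simp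
    then show ?thesis by auto
  next
    case False
    then have "?s / 2 < ?s" by simp
    then obtain r where r: "0 \<le> r" "?s / 2 < \<beta> (S r v)"
      by (subst (asm) less_cSUP_iff[OF _ bdd]) auto
    have "\<beta> (S s v) \<le> 2 * \<beta> (S r v)" if "0 \<le> s" for s using le[OF that] r(2) by linarith
    then show ?thesis using r(1) by auto
  qed
qed

text \<open>Greedy exhaustion: repeatedly split off the part of \<open>u\<close> that is moved onto \<open>\<gamma>\<close>, at a time where
  this part is almost as large as possible. The remainders vanish in the limit by irreducibility.\<close>

lemma exhaustion_dominated:
  assumes \<gamma>: "\<gamma> \<in> X" "0 \<le> \<gamma>" "\<gamma> \<noteq> 0" and k: "0 \<le> k"
    and minor_\<gamma>: "\<And>u. 0 \<le> u \<Longrightarrow> u \<in> X \<Longrightarrow> \<beta> u *\<^sub>R \<gamma> \<le> S k u"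
    and N_add: "\<And>u v. 0 \<le> u \<Longrightarrow> 0 \<le> v \<Longrightarrow> u \<in> X \<Longrightarrow> v \<in> X \<Longrightarrow> N (u + v) \<le> N u + N v"
    and N_scale: "\<And>c. 0 \<le> c \<Longrightarrow> N (c *\<^sub>R \<gamma>) \<le> c * N \<gamma>"
    and N_le: "\<And>u. 0 \<le> u \<Longrightarrow> u \<in> X \<Longrightarrow> N u \<le> L * norm u"
    and N_S: "\<And>u r. 0 \<le> r \<Longrightarrow> 0 \<le> u \<Longrightarrow> u \<in> X \<Longrightarrow> N u \<le> N (S r u)"
    and u: "0 \<le> u" "u \<in> X" "u \<le> c *\<^sub>R us"
  shows "N u * norm \<gamma> \<le> norm u * N \<gamma>"
proof -
  define \<rho> where "\<rho> v = (SOME r. 0 \<le> r \<and> (\<forall>s\<ge>0. \<beta> (S s v) \<le> 2 * \<beta> (S r v)))" for v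
  have \<rho>: "0 \<le> \<rho> v" "\<And>s. 0 \<le> s \<Longrightarrow> \<beta> (S s v) \<le> 2 * \<beta> (S (\<rho> v) v)" if "0 \<le> v" for v
  proof -
    have "0 \<le> \<rho> v \<and> (\<forall>s\<ge>0. \<beta> (S s v) \<le> 2 * \<beta> (S (\<rho> v) v))"
      unfolding \<rho>_def by (rule someI_ex) (use greedy_time[OF that] in auto)
    then show "0 \<le> \<rho> v" "\<And>s. 0 \<le> s \<Longrightarrow> \<beta> (S s v) \<le> 2 * \<beta> (S (\<rho> v) v)" by auto
  qed
  \<comment> \<open>Wait until the nearly best time, apply the minorization, and keep only what
    exceeds the multiple of \<open>\<gamma>\<close> so produced.\<close>
  define stp where "stp v = S (k + \<rho> v) v - \<beta> (S (\<rho> v) v) *\<^sub>R \<gamma>" for v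
  define U where "U j = (stp ^^ j) u" for j
  define b where "b j = \<beta> (S (\<rho> (U j)) (U j))" for j
  have U0: "U 0 = u" and US: "U (Suc j) = S (k + \<rho> (U j)) (U j) - b j *\<^sub>R \<gamma>" for j
    by (auto simp: U_def b_def stp_def)
  have U: "0 \<le> U j \<and> U j \<in> X \<and> U j \<le> c *\<^sub>R us" for j
  proof (induction j)
    case 0 then show ?case using u by (simp add: U0)
  next
    case (Suc j)
    let ?r = "\<rho> (U j)"
    have r: "0 \<le> ?r" using \<rho>(1) Suc by blast
    have "b j *\<^sub>R \<gamma> \<le> S k (S ?r (U j))"
      unfolding b_def using minor_\<gamma>[of "S ?r (U j)"] pos[OF r] SX[OF r] Suc by simp
    then have 1: "0 \<le> U (Suc j)" using r k by (simp add: US semig)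
    have bj: "0 \<le> b j" unfolding b_def by (intro \<beta>(2) pos r) (use Suc in auto)
    \<comment> \<open>The bound by \<open>c *\<^sub>R us\<close> persists because \<open>us\<close>
      is invariant; it is the order bound that the limit superior below requires.\<close>
    have "U (Suc j) \<le> S (k + ?r) (U j)" using bj \<gamma> by (simp add: US scaleR_nonneg_nonneg)
    also have "\<dots> \<le> S (k + ?r) (c *\<^sub>R us)" using r k Suc by (intro mono) auto
    also have "\<dots> = c *\<^sub>R us" using r k by (simp add: S_scale us)
    finally have 2: "U (Suc j) \<le> c *\<^sub>R us" .
    show ?case using 1 2 r k \<gamma> SX by (auto simp: US intro!: X_intros)
  qed
  have bj: "0 \<le> b j" for j unfolding b_def using \<rho>(1) U by (intro \<beta>(2) pos) auto
  have split: "U (Suc j) + b j *\<^sub>R \<gamma> = S (k + \<rho> (U j)) (U j)" for j by (simp add: US)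
  \<comment> \<open>Norms add on the positive cone and are preserved there by \<open>S\<close>, so
    each step removes exactly the mass of the multiple of \<open>\<gamma>\<close> that is split
    off.\<close>
  have norms: "norm (U j) = norm (U (Suc j)) + b j * norm \<gamma>" for j
  proof -
    have "norm (U j) = norm (S (k + \<rho> (U j)) (U j))" using U \<rho>(1) k by (intro stoch[symmetric]) auto
    also have "\<dots> = norm (U (Suc j)) + norm (b j *\<^sub>R \<gamma>)"
      using norm_add_nonneg[of "U (Suc j)" "b j *\<^sub>R \<gamma>"] U[of "Suc j"] bj[of j] \<gamma>
      by (simp only: split scaleR_nonneg_nonneg)
    finally show ?thesis using bj[of j] by simp
  qed
  have Ns: "N (U j) \<le> N (U (Suc j)) + b j * N \<gamma>" for j
  proof -
    have "N (U j) \<le> N (S (k + \<rho> (U j)) (U j))" using U \<rho>(1) k by (intro N_S) auto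
    also have "\<dots> \<le> N (U (Suc j)) + N (b j *\<^sub>R \<gamma>)"
      unfolding split[symmetric] using U[of "Suc j"] bj[of j] \<gamma>
      by (intro N_add) (auto intro: X_intros scaleR_nonneg_nonneg)
    also have "N (b j *\<^sub>R \<gamma>) \<le> b j * N \<gamma>" by (rule N_scale[OF bj])
    finally show ?thesis by simp
  qed
  have sum_norm: "norm u = norm (U n) + (\<Sum>j<n. b j) * norm \<gamma>" for n
  proof (induction n)
    case (Suc n) then show ?case using norms[of n] by (simp add: algebra_simps)
  qed (simp add: U0)
  have sum_N: "N u \<le> N (U n) + (\<Sum>j<n. b j) * N \<gamma>" for n
  proof (induction n)
    case (Suc n) then show ?case using Ns[of n] by (simp add: algebra_simps)
  qed (simp add: U0)
  have n\<gamma>: "0 < norm \<gamma>" using \<gamma> by simp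
  have "summable b"
  proof (rule bounded_imp_summable[OF bj])
    fix n
    have "(\<Sum>j<Suc n. b j) * norm \<gamma> \<le> norm u" using sum_norm[of "Suc n"] by (simp only: le_add_same_cancel2 norm_ge_zero)
    then show "(\<Sum>j\<le>n. b j) \<le> norm u / norm \<gamma>"
      using n\<gamma> by (simp add: pos_le_divide_eq lessThan_Suc_atMost)
  qed
  then have sb: "summable (\<lambda>j. 2 * b j)" by (rule summable_mult)
  \<comment> \<open>By the greedy choice, \<open>2 * b j\<close> bounds \<open>\<beta>\<close> along
    the whole orbit of \<open>U j\<close>. The limit superior is thus never seen by
    \<open>\<beta>\<close>, and \<open>irred\<close> makes it vanish.\<close>
  obtain v where v: "0 \<le> v" "v \<in> X" "\<And>r. r \<in> {0..} \<Longrightarrow> \<beta> (S r v) = 0" "v = 0 \<Longrightarrow> U \<longlonglongrightarrow> 0"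
  proof (rule order_limsup_of_summable[where x=U and c="c *\<^sub>R us" and X=X and A="{0..}" and f="\<lambda>r v. \<beta> (S r v)" and b="\<lambda>j. 2 * b j"])
    show "bounded_linear (\<lambda>v. \<beta> (S r v))" if "r \<in> {0..}" for r
      using bounded_linear_compose[OF \<beta>(1) bounded_linear_S] that by simp
    show "\<beta> (S r (U j)) \<le> 2 * b j" if "r \<in> {0..}" for r j
      unfolding b_def using \<rho>(2) U that by auto
  qed (use U closed_X sup_X sb \<beta>(2) pos in auto)
  have U_lim: "U \<longlonglongrightarrow> 0" by (rule v(4)) (use irred[OF v(1,2)] v(3) in auto)
  have "N u * norm \<gamma> \<le> L * norm (U n) * norm \<gamma> + (norm u - norm (U n)) * N \<gamma>" for n
  proof -
    have "N u * norm \<gamma> \<le> (L * norm (U n) + (\<Sum>j<n. b j) * N \<gamma>) * norm \<gamma>"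
      using sum_N[of n] N_le[of "U n"] U[of n] by (intro mult_right_mono) auto
    also have "\<dots> = L * norm (U n) * norm \<gamma> + (norm u - norm (U n)) * N \<gamma>"
      using sum_norm[of n] by (simp add: algebra_simps)
    finally show ?thesis .
  qed
  moreover have "(\<lambda>n. L * norm (U n) * norm \<gamma> + (norm u - norm (U n)) * N \<gamma>)
      \<longlonglongrightarrow> L * norm (0::'a) * norm \<gamma> + (norm u - norm (0::'a)) * N \<gamma>"
    by (intro tendsto_intros U_lim)
  ultimately show ?thesis using LIMSEQ_le_const by fastforce
qed

text \<open>Cutting \<open>u\<close> at multiples of \<open>us\<close> gives dominated vectors
  converging to \<open>u\<close>; subadditivity of \<open>N\<close> and its bound by the norm absorb
  the remainder.\<close>

lemma exhaustion:
  assumes \<gamma>: "\<gamma> \<in> X" "0 \<le> \<gamma>" "\<gamma> \<noteq> 0" and k: "0 \<le> k"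
    and minor_\<gamma>: "\<And>u. 0 \<le> u \<Longrightarrow> u \<in> X \<Longrightarrow> \<beta> u *\<^sub>R \<gamma> \<le> S k u"
    and N_add: "\<And>u v. 0 \<le> u \<Longrightarrow> 0 \<le> v \<Longrightarrow> u \<in> X \<Longrightarrow> v \<in> X \<Longrightarrow> N (u + v) \<le> N u + N v"
    and N_scale: "\<And>c. 0 \<le> c \<Longrightarrow> N (c *\<^sub>R \<gamma>) \<le> c * N \<gamma>"
    and N_le: "\<And>u. 0 \<le> u \<Longrightarrow> u \<in> X \<Longrightarrow> N u \<le> L * norm u"
    and N_S: "\<And>u r. 0 \<le> r \<Longrightarrow> 0 \<le> u \<Longrightarrow> u \<in> X \<Longrightarrow> N u \<le> N (S r u)"
    and u: "0 \<le> u" "u \<in> X"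
  shows "N u * norm \<gamma> \<le> norm u * N \<gamma>"
proof -
  let ?v = "\<lambda>n. inf u (real n *\<^sub>R us)"
  have v: "0 \<le> ?v n" "?v n \<in> X" for n using u us by (auto intro!: X_intros scaleR_nonneg_nonneg)
  have "N u * norm \<gamma> \<le> norm (?v n) * N \<gamma> + L * norm (u - ?v n) * norm \<gamma>" for n
  proof -
    have le: "?v n \<le> u" by simp
    then have d: "0 \<le> u - ?v n" by (simp only: diff_ge_0_iff_ge)
    have "N u \<le> N (?v n) + N (u - ?v n)"
      using N_add[OF v(1)[of n] d v(2) X_intros(3)[OF u(2) v(2)]]
      by (simp only: add_diff_eq add_diff_cancel_left')
    also have "\<dots> \<le> N (?v n) + L * norm (u - ?v n)"
      using N_le[OF d X_intros(3)[OF u(2) v(2)]] by simp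
    finally have "N u * norm \<gamma> \<le> N (?v n) * norm \<gamma> + L * norm (u - ?v n) * norm \<gamma>"
      by (metis distrib_right mult_right_mono norm_ge_zero)
    also have "N (?v n) * norm \<gamma> \<le> norm (?v n) * N \<gamma>"
      by (rule exhaustion_dominated[OF assms(1-9) v inf.cobounded2])
    finally show ?thesis by simp
  qed
  moreover have "(\<lambda>n. norm (?v n) * N \<gamma> + L * norm (u - ?v n) * norm \<gamma>)
    \<longlonglongrightarrow> norm u * N \<gamma> + L * norm (u - u) * norm \<gamma>"
    by (intro tendsto_intros us_dense u)
  ultimately show ?thesis using LIMSEQ_le_const by fastforce
qed

text \<open>A zero-two law. Replacing \<open>\<alpha>'\<close> by its average \<open>H \<alpha>'\<close> in the minorization lets one insert arbitrarily many
  averaging operators \<open>H\<close>, and \<open>(I - S \<delta>) H\<^sup>k\<close> tends to zero in norm.\<close>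

lemma ell_diff_small:
  assumes \<delta>: "0 \<le> \<delta>" and near: "norm (\<alpha> - S \<delta> \<alpha>) < norm \<alpha>" and u: "0 \<le> u" "u \<in> X"
  shows "ell (u - S \<delta> u) = 0"
proof -
  \<comment> \<open>The common part of \<open>\<alpha>\<close> and its time shift. It is nonzero
    since the shift moves \<open>\<alpha>\<close> by less than \<open>norm \<alpha>\<close>.\<close>
  define a where "a = inf \<alpha> (S \<delta> \<alpha>)"
  define H where "H = (\<lambda>x. (1/2) *\<^sub>R (x + S \<delta> x))"
  have aX: "a \<in> X" and a0: "0 \<le> a" and a1: "a \<le> \<alpha>" "a \<le> S \<delta> \<alpha>"
    unfolding a_def using \<alpha> \<delta> SX pos by (auto intro: X_intros)
  have "norm (\<alpha> - a) \<le> norm (\<alpha> - S \<delta> \<alpha>)"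
    using norm_inf_diff_le[of \<alpha> \<alpha> "S \<delta> \<alpha>"] by (simp add: a_def inf.commute)
  then have "a \<noteq> 0" using near by auto
  have HX: "H x \<in> X" if "x \<in> X" for x unfolding H_def using that \<delta> by (intro X_intros SX)
  have Hpos: "0 \<le> H x" if "0 \<le> x" for x
    unfolding H_def using that \<delta> pos by (intro scaleR_nonneg_nonneg add_nonneg_nonneg) auto
  have HS: "H (S r x) = S r (H x)" if "0 \<le> r" for r x
    unfolding H_def using that \<delta> by (simp add: S_scale S_add commute)
  have norm_H: "norm (H x) = norm x" if "0 \<le> x" "x \<in> X" for x
  proof -
    have "norm (H x) = (norm x + norm (S \<delta> x)) / 2"
      unfolding H_def using norm_add_nonneg[OF that(1) pos[OF \<delta> that(1)]] by simp
    then show ?thesis using stoch[OF \<delta> that] by simp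
  qed
  have Hk: "(H ^^ k) (x + y) = (H ^^ k) x + (H ^^ k) y" "(H ^^ k) (c *\<^sub>R x) = c *\<^sub>R (H ^^ k) x"
      "norm ((H ^^ k) x) \<le> norm x" for k x y c
  proof -
    show "(H ^^ k) (x + y) = (H ^^ k) x + (H ^^ k) y"
      by (induction k) (auto simp: H_def S_add[OF \<delta>] algebra_simps)
    show "(H ^^ k) (c *\<^sub>R x) = c *\<^sub>R (H ^^ k) x"
      by (induction k) (auto simp: H_def S_scale[OF \<delta>] algebra_simps)
    have "norm (H x) \<le> norm x" for x
      unfolding H_def using norm_triangle_ineq[of x "S \<delta> x"] contr[OF \<delta>, of x] by simp
    then show "norm ((H ^^ k) x) \<le> norm x"
      by (induction k) (auto intro: order_trans)
  qed
  have HkS: "(H ^^ k) (S r x) = S r ((H ^^ k) x)" if "0 \<le> r" for k r x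
    by (induction k) (auto simp: HS that)
  \<comment> \<open>What survives in the long run of the difference between
    \<open>(H ^^ k) u\<close> and its time shift by \<open>\<delta>\<close>.\<close>
  define N where "N k u = ell ((H ^^ k) u - S \<delta> ((H ^^ k) u))" for k u
  have N_H: "N k (H x) = N (Suc k) x" for k x
    unfolding N_def by (simp add: funpow_swap1)
  have mass: "norm (H a) = norm a" using norm_H a0 aX by blast
  \<comment> \<open>Minorizing by \<open>H a\<close> instead of \<open>a\<close> is what raises the
    index from \<open>k\<close> to \<open>Suc k\<close>; with \<open>x = a\<close> it makes
    \<open>N k a\<close> nondecreasing in \<open>k\<close>.\<close>
  have main: "N k x * norm a \<le> norm x * N (Suc k) a" if x: "0 \<le> x" "x \<in> X" for k x
    unfolding N_H[symmetric] mass[symmetric]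
  proof (rule exhaustion[where N="N k" and k="m + \<delta>" and L=2 and \<gamma>="H a", OF HX[OF aX] Hpos[OF a0] _ _ _ _ _ _ _ x])
    show "H a \<noteq> 0" using mass \<open>a \<noteq> 0\<close> by auto
    show "0 \<le> m + \<delta>" using m \<delta> by simp
    fix u v assume u: "0 \<le> u" "u \<in> X"
    \<comment> \<open>\<open>H a\<close> is the mean of two vectors below
      \<open>S \<delta> \<alpha>\<close>, so it minorizes once \<open>\<delta>\<close> is added to
      the time \<open>m\<close>.\<close>
    have "\<beta> u *\<^sub>R S \<delta> \<alpha> \<le> S (m + \<delta>) u"
      using mono[OF \<delta> minor[OF u]] \<delta> m by (simp add: S_scale semig[of \<delta> m] add.commute)
    moreover have "\<beta> u *\<^sub>R H a \<le> \<beta> u *\<^sub>R S \<delta> \<alpha>"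
    proof (intro scaleR_left_mono \<beta>(2) u)
      have "a + S \<delta> a \<le> S \<delta> \<alpha> + S \<delta> \<alpha>" using a1 mono[OF \<delta> a1(1)] by (intro add_mono)
      then have "H a \<le> (1/2) *\<^sub>R (S \<delta> \<alpha> + S \<delta> \<alpha>)" unfolding H_def by (intro scaleR_left_mono) auto
      then show "H a \<le> S \<delta> \<alpha>" by (simp flip: scaleR_2)
    qed
    ultimately show "\<beta> u *\<^sub>R H a \<le> S (m + \<delta>) u" by simp
    show "N k u \<le> 2 * norm u"
    proof -
      have "N k u \<le> norm ((H ^^ k) u - S \<delta> ((H ^^ k) u))" unfolding N_def by (rule ell_le_norm)
      also have "\<dots> \<le> 2 * norm u"
        using norm_triangle_ineq4[of "(H ^^ k) u" "S \<delta> ((H ^^ k) u)"] contr[OF \<delta>, of "(H ^^ k) u"] Hk(3)[of k u]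
        by simp
      finally show ?thesis .
    qed
    show "N k u \<le> N k (S r u)" if "0 \<le> r" for r
    proof -
      have "(H ^^ k) (S r u) - S \<delta> ((H ^^ k) (S r u)) = S r ((H ^^ k) u - S \<delta> ((H ^^ k) u))"
        using that \<delta> by (simp add: HkS S_diff commute[of \<delta> r])
      then show ?thesis unfolding N_def using ell_S[OF that] by simp
    qed
    show "N k (u + v) \<le> N k u + N k v"
      unfolding N_def using ell_add[of "(H ^^ k) u - S \<delta> ((H ^^ k) u)" "(H ^^ k) v - S \<delta> ((H ^^ k) v)"]
      by (simp add: Hk S_add[OF \<delta>] algebra_simps)
  next
    fix c :: real assume "0 \<le> c"
    then show "N k (c *\<^sub>R H a) \<le> c * N k (H a)"
      unfolding N_def using ell_scale[of c "(H ^^ k) (H a) - S \<delta> ((H ^^ k) (H a))"]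
      by (simp add: Hk S_scale[OF \<delta>] scaleR_diff_right)
  qed
  have na: "0 < norm a" using \<open>a \<noteq> 0\<close> by simp
  have inc: "N k a \<le> N (Suc k) a" for k
    using main[OF a0 aX, of k] na by simp
  have "incseq (\<lambda>k. N k a)" by (rule incseq_SucI) (rule inc)
  \<comment> \<open>The central binomial estimate concerns even powers. A nondecreasing quantity
    that is bounded along even indices by a null sequence is at most zero.\<close>
  then have Nle: "N 1 a \<le> N (2 * Suc n) a" for n by (rule incseqD) simp
  have "N (2 * n) a \<le> 2 * (real (2 * n choose n) / 4 ^ n) * norm a" for n
    unfolding N_def H_def
    by (rule order_trans[OF ell_le_norm norm_diff_averaged_power_le[OF lin[OF \<delta>] contr[OF \<delta>]]])
  then have "N 1 a \<le> 2 * (real (2 * Suc n choose Suc n) / 4 ^ Suc n) * norm a" for n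
    using Nle order_trans by blast
  moreover have "(\<lambda>n. 2 * (real (2 * Suc n choose Suc n) / 4 ^ Suc n) * norm a) \<longlonglongrightarrow> 2 * 0 * norm a"
    by (intro tendsto_intros LIMSEQ_Suc[OF central_binomial_tendsto_0])
  ultimately have "N 1 a \<le> 0" using LIMSEQ_le_const by fastforce
  then have "N 0 u * norm a \<le> 0"
    using main[OF u, of 0] mult_left_mono[of "N 1 a" 0 "norm u"] by simp
  then have "N 0 u \<le> 0" using na by (simp add: mult_le_0_iff)
  then show ?thesis unfolding N_def using ell_nonneg[of "u - S \<delta> u"] by simp
qed

text \<open>For small shifts, strong continuity at \<open>\<alpha>\<close> supplies the overlap. A
  longer shift is cut into equal small ones, and \<open>ell\<close> of the total difference is at
  most the sum over the pieces.\<close>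

lemma ell_diff:
  assumes s: "0 \<le> s" and u: "0 \<le> u" "u \<in> X"
  shows "ell (u - S s u) = 0"
proof -
  have "((\<lambda>t. norm (\<alpha> - S t \<alpha>)) \<longlongrightarrow> norm (\<alpha> - \<alpha>)) (at_right 0)"
    by (intro tendsto_intros tendsto_S_0 \<alpha>)
  then have "\<forall>\<^sub>F t in at_right 0. norm (\<alpha> - S t \<alpha>) < norm \<alpha>"
    using \<alpha> by (intro order_tendstoD(2)) auto
  then obtain d where d: "0 < d" "\<And>t. 0 < t \<Longrightarrow> t < d \<Longrightarrow> norm (\<alpha> - S t \<alpha>) < norm \<alpha>"
    by (auto simp: eventually_at_right_field)
  show ?thesis
  proof (cases "s = 0")
    case True
    then show ?thesis using u S0 ell_le_norm[of 0] ell_nonneg[of 0] by simp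
  next
    case False
    obtain n where n: "s / d < real n" using reals_Archimedean2 by blast
    have n0: "0 < real n" using n d s by (smt (verit) divide_nonneg_pos)
    define t where "t = s / n"
    have t: "0 < t" "t < d" using n n0 False s d by (auto simp: t_def field_simps)
    have "ell (u - S (real k * t) u) = 0" for k
    proof (induction k)
      case 0
      then show ?case using u S0 ell_le_norm[of 0] ell_nonneg[of 0] by simp
    next
      case (Suc k)
      let ?v = "S (real k * t) u"
      have "u - S (real (Suc k) * t) u = (u - ?v) + (?v - S t ?v)"
        using t semig[of t "real k * t" u] by (simp add: algebra_simps)
      then have "ell (u - S (real (Suc k) * t) u) \<le> ell (u - ?v) + ell (?v - S t ?v)"
        by (metis ell_add)
      also have "\<dots> = 0"
        using Suc ell_diff_small[of t ?v] t d pos[of "real k * t" u] SX[of "real k * t" u] u by simp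
      finally show ?case using ell_nonneg[of "u - S (real (Suc k) * t) u"] by simp
    qed
    from this[of n] show ?thesis using n0 by (simp add: t_def)
  qed
qed

text \<open>The exhaustion is used a second time, with a functional that measures in
  \<open>ell\<close> the distance to the multiple of the normalized \<open>\<alpha>\<close> of equal
  norm. It does not decrease along the semigroup, because \<open>ell\<close> does not notice time
  shifts, and it vanishes at \<open>\<alpha>\<close>, hence everywhere. So \<open>u\<close> and the
  multiple of \<open>us\<close> of equal norm have merging orbits.\<close>

theorem asymptotic_stability:
  assumes u: "0 \<le> u" "u \<in> X"
  shows "((\<lambda>t. S t u) \<longlongrightarrow> (norm u / norm us) *\<^sub>R us) at_top"
proof -
  define a where "a = (1 / norm \<alpha>) *\<^sub>R \<alpha>"
  define N where "N v = ell (v - norm v *\<^sub>R a)" for v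
  have na: "norm a = 1" using \<alpha> by (simp add: a_def)
  have N0: "N v = 0" if v: "0 \<le> v" "v \<in> X" for v
  proof -
    have "N v * norm \<alpha> \<le> norm v * N \<alpha>"
    proof (rule exhaustion[where k=m and L=2, OF \<alpha> m minor _ _ _ _ v])
      fix u v assume u: "0 \<le> u" "u \<in> X" and v: "0 \<le> v" "v \<in> X"
      show "N (u + v) \<le> N u + N v"
        unfolding N_def using ell_add[of "u - norm u *\<^sub>R a" "v - norm v *\<^sub>R a"]
        by (simp add: norm_add_nonneg u v algebra_simps)
    next
      fix c :: real assume "0 \<le> c"
      then show "N (c *\<^sub>R \<alpha>) \<le> c * N \<alpha>"
        unfolding N_def using ell_scale[of c "\<alpha> - norm \<alpha> *\<^sub>R a"] by (simp add: scaleR_diff_right)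
    next
      fix u assume u: "0 \<le> u" "u \<in> X"
      show "N u \<le> 2 * norm u"
        unfolding N_def using ell_le_norm[of "u - norm u *\<^sub>R a"] norm_triangle_ineq4[of u "norm u *\<^sub>R a"] na
        by simp
      show "N u \<le> N (S r u)" if "0 \<le> r" for r
      proof -
        have "N u \<le> ell (u - S r u) + ell (S r u - norm u *\<^sub>R a)"
          unfolding N_def using ell_add[of "u - S r u" "S r u - norm u *\<^sub>R a"] by simp
        then show ?thesis unfolding N_def using ell_diff[OF that u] stoch[OF that u] by simp
      qed
    qed
    moreover have "N \<alpha> = 0"
      unfolding N_def a_def using \<alpha> ell_le_norm[of 0] ell_nonneg[of 0] by simp
    ultimately have "N v \<le> 0" using \<alpha> by (simp add: mult_le_0_iff)
    then show ?thesis unfolding N_def using ell_nonneg[of "v - norm v *\<^sub>R a"] by simp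
  qed
  let ?c = "norm u / norm us"
  have "u - ?c *\<^sub>R us = (u - norm u *\<^sub>R a) + (- ?c) *\<^sub>R (us - norm us *\<^sub>R a)"
    using us by (simp add: algebra_simps)
  then have "ell (u - ?c *\<^sub>R us) \<le> N u + \<bar>- ?c\<bar> * N us"
    unfolding N_def by (metis add_left_mono ell_add ell_scale order_trans)
  then have "ell (u - ?c *\<^sub>R us) = 0"
    using N0[OF u] N0[OF us(2,1)] ell_nonneg[of "u - ?c *\<^sub>R us"] by simp
  then have "((\<lambda>t. S t (u - ?c *\<^sub>R us)) \<longlongrightarrow> 0) at_top" by (rule ell_0_tendsto)
  moreover have "\<forall>\<^sub>F t in at_top. S t (u - ?c *\<^sub>R us) = S t u - ?c *\<^sub>R us"
    using eventually_ge_at_top[of "0::real"] by eventually_elim (simp add: S_diff S_scale us)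
  ultimately have "((\<lambda>t. S t u - ?c *\<^sub>R us) \<longlongrightarrow> 0) at_top"
    by (rule tendsto_cong[THEN iffD1, rotated])
  then show ?thesis by (rule LIM_zero_cancel)
qed

end

section \<open>Bands and irreducibility\<close>

lemma inf_add_le:
  fixes a b c :: "'a::lattice_ab_group_add"
  assumes "0 \<le> a" "0 \<le> b" "0 \<le> c"
  shows "inf a (b + c) \<le> inf a b + inf a c"
proof -
  have "inf a b + inf a c = inf (inf (a + a) (a + c)) (inf (b + a) (b + c))"
    by (simp add: add_inf_distrib_left add_inf_distrib_right inf.assoc inf.left_commute)
  moreover have "inf a (b + c) \<le> a + a" "inf a (b + c) \<le> a + c" "inf a (b + c) \<le> b + a"
    using assms by (auto intro: le_infI1 add_increasing add_increasing2)
  ultimately show ?thesis by simp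
qed

lemma inf_scale_eq_0:
  fixes a b :: "'a::al_space"
  assumes ab: "0 \<le> a" "0 \<le> b" "inf a b = 0"
  shows "inf a (real n *\<^sub>R b) = 0"
proof (induction n)
  case 0 then show ?case using ab by (simp add: inf_absorb2)
next
  case (Suc n)
  have nb: "0 \<le> real n *\<^sub>R b" using ab by (simp add: scaleR_nonneg_nonneg)
  have "inf a (real (Suc n) *\<^sub>R b) \<le> inf a (real n *\<^sub>R b) + inf a b"
    using inf_add_le[OF ab(1) nb ab(2)] by (simp add: algebra_simps)
  moreover have "0 \<le> real (Suc n) *\<^sub>R b" using ab by (intro scaleR_nonneg_nonneg) auto
  ultimately show ?case using Suc ab by (intro antisym) simp_all
qed

context pos_semigroup begin

text \<open>The component \<open>e\<close> of \<open>us\<close> in the band generated by the resolvent \<open>w\<close> of \<open>v\<close> is invariant, and so is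
  the complementary component.\<close>

lemma resolvent_eq_0_if_functional_vanishes:
  assumes stoch: "\<And>t u. 0 \<le> t \<Longrightarrow> 0 \<le> u \<Longrightarrow> u \<in> X \<Longrightarrow> norm (S t u) = norm u"
    and us: "us \<in> X" "0 \<le> us" "\<And>t. 0 \<le> t \<Longrightarrow> S t us = us"
    and us_dense: "\<And>u. 0 \<le> u \<Longrightarrow> u \<in> X \<Longrightarrow> (\<lambda>n. inf u (real n *\<^sub>R us)) \<longlonglongrightarrow> u"
    and disj: "\<And>e e'. e \<in> X \<Longrightarrow> e' \<in> X \<Longrightarrow> 0 \<le> e \<Longrightarrow> 0 \<le> e' \<Longrightarrow> (\<And>t. 0 \<le> t \<Longrightarrow> S t e = e) \<Longrightarrow>
        (\<And>t. 0 \<le> t \<Longrightarrow> S t e' = e') \<Longrightarrow> inf e e' = 0 \<Longrightarrow> e = 0 \<or> e' = 0"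
    and gen: "gen w (w - v)" and v: "0 \<le> v" and w: "0 \<le> w"
    and \<beta>: "bounded_linear \<beta>" "\<And>u. 0 \<le> u \<Longrightarrow> 0 \<le> \<beta> u" "\<beta> us \<noteq> (0::real)"
    and vanish: "\<And>r. 0 \<le> r \<Longrightarrow> \<beta> (S r v) = 0"
  shows "w = 0"
proof -
  interpret \<beta>: bounded_linear \<beta> by (rule \<beta>)
  have wX: "w \<in> X" using gen by (simp add: gen_def)
  \<comment> \<open>These truncations increase to the component of \<open>us\<close> in the band of
    \<open>w\<close>.\<close>
  let ?x = "\<lambda>n. inf us (real n *\<^sub>R w)"
  have nw: "0 \<le> c *\<^sub>R w" if "0 \<le> c" for c using w that by (simp add: scaleR_nonneg_nonneg)
  have sc: "c *\<^sub>R w \<le> d *\<^sub>R w" if "c \<le> d" for c d using w that by (simp add: scaleR_right_mono)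
  have x: "0 \<le> ?x n" "?x n \<in> X" for n
    using us wX nw by (auto intro: X_intros)
  have "incseq ?x"
    by (intro monoI inf_mono order_refl sc) simp
  then obtain e where e: "?x \<longlonglongrightarrow> e" "\<And>n. ?x n \<le> e" "e \<le> us"
    using incseq_bounded_convergent[of ?x us] by auto
  have eX: "e \<in> X" using closed_sequentially[OF closed_X _ e(1)] x by blast
  have e0: "0 \<le> e" using x(1)[of 0] e(2)[of 0] by (rule order_trans)
  have inv_e: "S t e = e" if t: "0 \<le> t" for t
  proof -
    interpret St: bounded_linear "S t" by (rule bounded_linear_S[OF t])
    \<comment> \<open>The resolvent grows at most by the factor \<open>exp t\<close> in time
      \<open>t\<close>, so \<open>S t\<close> sends each truncation below a later one.\<close>
    have Sw: "S t w \<le> exp t *\<^sub>R w"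
    proof -
      have "exp t *\<^sub>R (exp (- t) *\<^sub>R S t w) \<le> exp t *\<^sub>R w"
        using resolvent_supermedian[OF gen v t] by (intro scaleR_left_mono) auto
      then show ?thesis by (simp add: exp_minus)
    qed
    have "S t (?x n) \<le> e" for n
    proof -
      obtain k :: nat where k: "real n * exp t \<le> real k" using real_arch_simple by blast
      have "S t (?x n) \<le> S t us" using t by (intro mono) auto
      moreover have "S t (?x n) \<le> S t (real n *\<^sub>R w)" using t by (intro mono) auto
      moreover have "S t (real n *\<^sub>R w) \<le> real k *\<^sub>R w"
        using scaleR_left_mono[OF Sw, of "real n"] sc[OF k] by (simp add: S_scale[OF t])
      ultimately have "S t (?x n) \<le> ?x k" using us(3)[OF t] by (simp add: order_trans)
      then show ?thesis using e(2) order_trans by blast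
    qed
    then have le: "S t e \<le> e" by (rule le_if_limit[OF St.tendsto[OF e(1)] tendsto_const])
    \<comment> \<open>A strict decrease of \<open>e\<close> would cost norm, but norms of
      nonnegative vectors in \<open>X\<close> are preserved.\<close>
    have "norm (e - S t e) = 0"
      using norm_diff_nonneg[OF pos[OF t e0] le] stoch[OF t e0 eX] by simp
    then show ?thesis by simp
  qed
  define e' where "e' = us - e"
  have e': "e' \<in> X" "0 \<le> e'" unfolding e'_def using us eX e(3) by (auto intro: X_intros)
  have inv_e': "S t e' = e'" if "0 \<le> t" for t
    unfolding e'_def using that inv_e us by (simp add: S_diff)
  have "inf e' w = 0"
  proof -
    \<comment> \<open>Adding the common part \<open>?h\<close> to a truncation stays below
      \<open>us\<close> and below the next multiple of \<open>w\<close>, hence below the next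
      truncation; in the limit \<open>e + ?h \<le> e\<close>.\<close>
    let ?h = "inf e' w"
    have "?x n + ?h \<le> e" for n
    proof -
      have "?x n + ?h \<le> e + e'" using e(2) by (intro add_mono) auto
      then have "?x n + ?h \<le> us" by (simp add: e'_def)
      moreover have "?x n + ?h \<le> real n *\<^sub>R w + w" by (intro add_mono) auto
      then have "?x n + ?h \<le> real (Suc n) *\<^sub>R w" by (simp add: algebra_simps)
      ultimately have "?x n + ?h \<le> ?x (Suc n)" by (rule le_infI)
      then show ?thesis using e(2) order_trans by blast
    qed
    then have "e + ?h \<le> e" by (rule le_if_limit[OF tendsto_add[OF e(1) tendsto_const] tendsto_const])
    then have "?h \<le> 0" by simp
    moreover have "0 \<le> ?h" using e' w by simp
    ultimately show ?thesis by (rule antisym)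
  qed
  then have d: "inf e' (real n *\<^sub>R w) = 0" for n by (rule inf_scale_eq_0[OF e'(2) w])
  have "inf (?x n) e' = 0" for n
  proof (rule antisym)
    have "inf (?x n) e' \<le> inf e' (real n *\<^sub>R w)" by (simp add: le_infI1)
    then show "inf (?x n) e' \<le> 0" by (simp only: d)
    show "0 \<le> inf (?x n) e'" using x(1) e' by simp
  qed
  then have "(\<lambda>n. 0) \<longlonglongrightarrow> inf e e'" using tendsto_inf_const[OF e(1), of e'] by simp
  then have "inf e e' = 0" by (simp add: tendsto_const_iff)
  \<comment> \<open>If \<open>e\<close> vanishes, \<open>w\<close> is disjoint from the strictly
    positive \<open>us\<close> and therefore zero. If \<open>e'\<close> vanishes, \<open>us\<close>
    lies in the band of \<open>w\<close>, on which \<open>\<beta>\<close> is zero, against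
    \<open>\<beta> us \<noteq> 0\<close>.\<close>
  then consider "e = 0" | "e' = 0" using disj[OF eX e'(1) e0 e'(2) inv_e inv_e'] by blast
  then show ?thesis
  proof cases
    case 1
    then have "inf us w \<le> 0" using e(2)[of 1] by simp
    then have "inf w us = 0" using us w by (intro antisym) (auto simp: inf.commute)
    then have "(\<lambda>n. 0) \<longlonglongrightarrow> w" using us_dense[OF w wX] inf_scale_eq_0[OF w us(2)] by simp
    then show ?thesis by (simp add: tendsto_const_iff)
  next
    case 2
    have "\<beta> w = 0" using functional_resolvent_eq_0[OF gen \<beta>(1) vanish] .
    have "\<beta> (?x n) = 0" for n
    proof (rule antisym)
      have "0 \<le> real n *\<^sub>R w - ?x n" by (simp only: diff_ge_0_iff_ge inf.cobounded2)
      then have "0 \<le> \<beta> (real n *\<^sub>R w - ?x n)" by (rule \<beta>(2))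
      then show "\<beta> (?x n) \<le> 0" by (simp only: \<beta>.diff \<beta>.scaleR \<open>\<beta> w = 0\<close>) simp
    qed (rule \<beta>(2)[OF x(1)])
    then have "(\<lambda>n. 0) \<longlonglongrightarrow> \<beta> e" using \<beta>.tendsto[OF e(1)] by simp
    then have "\<beta> e = 0" by (simp add: tendsto_const_iff)
    moreover have "e = us" using 2 by (simp add: e'_def)
    ultimately show ?thesis using \<beta>(3) by simp
  qed
qed

end

section \<open>The resolvent series of a substochastic pair\<close>

text \<open>\<open>R\<close> stands for R(1, A) and \<open>B\<close> for P \<phi> R(1, A). With a
  clock of rate one, \<open>R u\<close> is the mass stopped by the clock before any jump and
  \<open>B u\<close> the mass just after a jump that came before the clock; \<open>balance\<close>
  says that nothing is lost. \<open>R_B_0\<close> reflects that \<open>B\<close> factors through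
  \<open>R\<close>.\<close>

locale substochastic_pair =
  fixes R B :: "'a::al_space \<Rightarrow> 'a" and X :: "'a set"
  assumes R: "bounded_linear R" "\<And>u. 0 \<le> u \<Longrightarrow> 0 \<le> R u"
    and B: "linear B" "\<And>u. 0 \<le> u \<Longrightarrow> 0 \<le> B u" "\<And>u. norm (B u) \<le> norm u" "\<And>u. B u \<in> X"
    and closed_X: "closed X"
    and balance: "\<And>u. 0 \<le> u \<Longrightarrow> u \<in> X \<Longrightarrow> norm u = norm (R u) + norm (B u)"
    and R_B_0: "\<And>u. R u = 0 \<Longrightarrow> B u = 0"
begin

lemma B_power: "linear (B ^^ n)" "0 \<le> u \<Longrightarrow> 0 \<le> (B ^^ n) u" "norm ((B ^^ n) u) \<le> norm u"
    "u \<in> X \<Longrightarrow> (B ^^ n) u \<in> X"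
proof -
  show "linear (B ^^ n)"
  proof (induction n)
    case 0 then show ?case using linear_id by (simp add: id_def)
  next
    case (Suc n) then show ?case unfolding funpow.simps by (rule linear_compose[OF _ B(1)])
  qed
  show "0 \<le> u \<Longrightarrow> 0 \<le> (B ^^ n) u" by (induction n) (auto intro: B)
  show "norm ((B ^^ n) u) \<le> norm u" by (induction n) (auto intro: order_trans[OF B(3)])
  show "u \<in> X \<Longrightarrow> (B ^^ n) u \<in> X" by (cases n) (auto intro: B)
qed

lemma B_power_mono: "u \<le> v \<Longrightarrow> (B ^^ n) u \<le> (B ^^ n) v"
  using B_power(2)[of "v - u" n] linear_diff[OF B_power(1)] by simp

text \<open>The decreasing powers on \<open>v\<close> have a limit fixed by \<open>B\<close>.
  Balance leaves no mass of it for \<open>R\<close>, and what \<open>R\<close> kills is killed by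
  \<open>B\<close>, so the limit is zero. Truncation at multiples of \<open>v\<close> and
  contractivity carry this to every \<open>u\<close>.\<close>

lemma B_power_tendsto_0:
  assumes v: "v \<in> X" "0 \<le> v" "B v \<le> v"
    and v_dense: "\<And>u. 0 \<le> u \<Longrightarrow> u \<in> X \<Longrightarrow> (\<lambda>n. inf u (real n *\<^sub>R v)) \<longlonglongrightarrow> u"
    and u: "0 \<le> u" "u \<in> X"
  shows "(\<lambda>n. (B ^^ n) u) \<longlonglongrightarrow> 0"
proof -
  interpret B: bounded_linear B
    using B by (intro bounded_linear_intro[of _ 1]) (auto simp: linear_add linear_scale)
  have dec: "decseq (\<lambda>n. (B ^^ n) v)"
    by (rule decseq_SucI) (use B_power_mono[OF v(3)] in \<open>simp add: funpow_swap1\<close>)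
  obtain z where z: "(\<lambda>n. (B ^^ n) v) \<longlonglongrightarrow> z" "\<And>n. z \<le> (B ^^ n) v" "0 \<le> z"
    using decseq_nonneg_convergent[OF dec B_power(2)[OF v(2)]] by metis
  have zX: "z \<in> X" using closed_sequentially[OF closed_X _ z(1)] B_power(4)[OF v(1)] by blast
  have "(\<lambda>n. (B ^^ Suc n) v) \<longlonglongrightarrow> B z" using B.tendsto[OF z(1)] by simp
  moreover have "(\<lambda>n. (B ^^ Suc n) v) \<longlonglongrightarrow> z" using z(1) by (rule LIMSEQ_Suc)
  ultimately have Bz: "B z = z" by (rule LIMSEQ_unique)
  then have "R z = 0" using balance[OF z(3) zX] by simp
  then have "z = 0" using R_B_0 Bz by force
  with z(1) have lim: "(\<lambda>n. (B ^^ n) v) \<longlonglongrightarrow> 0" by simp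
  show ?thesis
  proof (rule LIMSEQ_I)
    fix e :: real assume e: "0 < e"
    have "(\<lambda>k. norm (u - inf u (real k *\<^sub>R v))) \<longlonglongrightarrow> norm (u - u)"
      by (intro tendsto_intros v_dense u)
    then have "\<forall>\<^sub>F k in sequentially. norm (u - inf u (real k *\<^sub>R v)) < e / 2"
      using e by (intro order_tendstoD) auto
    then obtain k where k: "norm (u - inf u (real k *\<^sub>R v)) < e / 2"
      by (auto simp: eventually_sequentially)
    let ?i = "inf u (real k *\<^sub>R v)"
    have "(\<lambda>n. real k * norm ((B ^^ n) v)) \<longlonglongrightarrow> real k * norm (0::'a)"
      by (intro tendsto_intros lim)
    then have "\<forall>\<^sub>F n in sequentially. real k * norm ((B ^^ n) v) < e / 2"
      using e by (intro order_tendstoD) auto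
    then obtain n0 where n0: "\<And>n. n \<ge> n0 \<Longrightarrow> real k * norm ((B ^^ n) v) < e / 2"
      by (auto simp: eventually_sequentially)
    have "norm ((B ^^ n) u) < e" if n: "n \<ge> n0" for n
    proof -
      have i: "0 \<le> ?i" using u v by (simp add: scaleR_nonneg_nonneg)
      have "norm ((B ^^ n) ?i) \<le> norm ((B ^^ n) (real k *\<^sub>R v))"
        by (intro norm_mono_nonneg B_power(2) B_power_mono i) auto
      then have "norm ((B ^^ n) ?i) \<le> real k * norm ((B ^^ n) v)"
        by (simp add: linear_scale[OF B_power(1)])
      moreover have "(B ^^ n) u = (B ^^ n) ?i + (B ^^ n) (u - ?i)"
        by (subst linear_diff[OF B_power(1)]) (simp only: add_diff_eq add_diff_cancel_left')
      then have "norm ((B ^^ n) u) \<le> norm ((B ^^ n) ?i) + norm ((B ^^ n) (u - ?i))"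
        using norm_triangle_ineq[of "(B ^^ n) ?i" "(B ^^ n) (u - ?i)"] by (simp only:)
      moreover have "norm ((B ^^ n) (u - ?i)) \<le> norm (u - ?i)" by (rule B_power(3))
      ultimately show ?thesis using k n0[OF n] by linarith
    qed
    then show "\<exists>n0. \<forall>n\<ge>n0. norm ((B ^^ n) u - 0) < e" by auto
  qed
qed

text \<open>Balance, applied to each power, gives the partial sums the norm
  \<open>norm u - norm ((B ^^ Suc N) u)\<close> exactly.\<close>

lemma norm_resolvent_eq:
  assumes B0: "(\<lambda>n. (B ^^ n) u) \<longlonglongrightarrow> 0" and u: "0 \<le> u" "u \<in> X"
    and w: "(\<lambda>N. R (\<Sum>n\<le>N. (B ^^ n) u)) \<longlonglongrightarrow> w"
  shows "norm w = norm u"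
proof -
  interpret R: bounded_linear R by (rule R)
  have part: "norm (R (\<Sum>n\<le>N. (B ^^ n) u)) = norm u - norm ((B ^^ Suc N) u)" for N
  proof (induction N)
    case 0
    then show ?case using balance[OF u] by simp
  next
    case (Suc N)
    have nn: "0 \<le> R (\<Sum>n\<le>N. (B ^^ n) u)" "0 \<le> R ((B ^^ Suc N) u)"
      by (intro R(2) sum_nonneg B_power(2) u)+
    have "R (\<Sum>n\<le>Suc N. (B ^^ n) u) = R (\<Sum>n\<le>N. (B ^^ n) u) + R ((B ^^ Suc N) u)"
      by (simp only: sum.atMost_Suc R.add)
    then have "norm (R (\<Sum>n\<le>Suc N. (B ^^ n) u)) = norm u - norm ((B ^^ Suc N) u) + norm (R ((B ^^ Suc N) u))"
      using norm_add_nonneg[OF nn] Suc by simp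
    also have "\<dots> = norm u - norm ((B ^^ Suc (Suc N)) u)"
      using balance[OF B_power(2)[OF u(1)] B_power(4)[OF u(2)], of "Suc N"] by simp
    finally show ?case .
  qed
  have "(\<lambda>N. norm u - norm ((B ^^ Suc N) u)) \<longlonglongrightarrow> norm u - norm (0::'a)"
    by (intro tendsto_intros LIMSEQ_Suc[OF B0])
  then have "(\<lambda>N. norm (R (\<Sum>n\<le>N. (B ^^ n) u))) \<longlonglongrightarrow> norm u" unfolding part by simp
  moreover have "(\<lambda>N. norm (R (\<Sum>n\<le>N. (B ^^ n) u))) \<longlonglongrightarrow> norm w" by (intro tendsto_intros w)
  ultimately show ?thesis by (rule LIMSEQ_unique[symmetric])
qed

text \<open>Telescoping: on \<open>u - B u\<close> the resolvent series collapses to \<open>R u\<close>.\<close>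

lemma resolvent_series_diff:
  assumes conv: "(\<lambda>N. R (\<Sum>n\<le>N. (B ^^ n) u)) \<longlonglongrightarrow> z"
  shows "(\<lambda>N. R (\<Sum>n\<le>N. (B ^^ n) (u - B u))) \<longlonglongrightarrow> R u"
proof -
  interpret R: bounded_linear R by (rule R)
  have tele: "(\<Sum>n\<le>N. (B ^^ n) (u - B u)) = u - (B ^^ Suc N) u" for N
  proof (induction N)
    case (Suc N)
    have "(B ^^ Suc N) (u - B u) = (B ^^ Suc N) u - (B ^^ Suc (Suc N)) u"
      by (subst linear_diff[OF B_power(1)]) (simp add: funpow_swap1)
    then show ?case using Suc by (simp only: sum.atMost_Suc) simp
  qed simp
  have "R ((B ^^ Suc N) u) = R (\<Sum>n\<le>Suc N. (B ^^ n) u) - R (\<Sum>n\<le>N. (B ^^ n) u)" for N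
    by (simp only: sum.atMost_Suc R.add add_diff_cancel_left')
  moreover have "(\<lambda>N. R (\<Sum>n\<le>Suc N. (B ^^ n) u) - R (\<Sum>n\<le>N. (B ^^ n) u)) \<longlonglongrightarrow> z - z"
    by (intro tendsto_diff conv LIMSEQ_Suc[OF conv])
  ultimately have "(\<lambda>N. R ((B ^^ Suc N) u)) \<longlonglongrightarrow> 0" by simp
  then have "(\<lambda>N. R u - R ((B ^^ Suc N) u)) \<longlonglongrightarrow> R u - 0" by (intro tendsto_diff tendsto_const)
  then show ?thesis unfolding tele R.diff by simp
qed

end

section \<open>Lebesgue integrable functions as an abstract L space\<close>

definition ae_eq :: "(real \<Rightarrow> real) \<Rightarrow> (real \<Rightarrow> real) \<Rightarrow> bool" where
  "ae_eq f g \<longleftrightarrow> integrable lebesgue f \<and> integrable lebesgue g \<and> (AE x in lebesgue. f x = g x)"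

\<comment> \<open>A type cannot depend on the interval, so classes are formed over the whole line
  and functions on the interval are embedded by zero. Integrability is part of the relation, which
  is therefore only a partial equivalence.\<close>
quotient_type l1 = "real \<Rightarrow> real" / partial: ae_eq
proof (rule part_equivpI)
  show "\<exists>f. ae_eq f f" by (rule exI[of _ "\<lambda>x. 0"]) (simp add: ae_eq_def)
  show "symp ae_eq" by (auto simp: symp_def ae_eq_def)
  show "transp ae_eq"
  proof (rule transpI)
    fix f g h assume "ae_eq f g" "ae_eq g h"
    then show "ae_eq f h" unfolding ae_eq_def by (auto elim: AE_mp)
  qed
qed

instantiation l1 :: ab_group_add
begin
lift_definition zero_l1 :: l1 is "\<lambda>x. 0" by (simp add: ae_eq_def)
lift_definition plus_l1 :: "l1 \<Rightarrow> l1 \<Rightarrow> l1" is "\<lambda>f g x. f x + g x"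
  by (auto simp: ae_eq_def elim!: AE_mp)
lift_definition minus_l1 :: "l1 \<Rightarrow> l1 \<Rightarrow> l1" is "\<lambda>f g x. f x - g x"
  by (auto simp: ae_eq_def elim!: AE_mp)
lift_definition uminus_l1 :: "l1 \<Rightarrow> l1" is "\<lambda>f x. - f x"
  by (auto simp: ae_eq_def elim!: AE_mp)
instance by standard (transfer, auto simp: ae_eq_def)+
end

instantiation l1 :: real_vector
begin
lift_definition scaleR_l1 :: "real \<Rightarrow> l1 \<Rightarrow> l1" is "\<lambda>c f x. c * f x"
  by (auto simp: ae_eq_def elim!: AE_mp)
instance by standard (transfer, auto simp: ae_eq_def algebra_simps)+
end

lemma integral_abs_add_le:
  assumes "integrable M f" "integrable M g"
  shows "(LINT x|M. \<bar>f x + g x\<bar>) \<le> (LINT x|M. \<bar>f x\<bar>) + (LINT x|M. \<bar>g x :: real\<bar>)"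
proof -
  have "(LINT x|M. \<bar>f x + g x\<bar>) \<le> (LINT x|M. \<bar>f x\<bar> + \<bar>g x\<bar>)"
    using assms by (intro integral_mono) auto
  then show ?thesis using assms by simp
qed

instantiation l1 :: real_normed_vector
begin
lift_definition norm_l1 :: "l1 \<Rightarrow> real" is "\<lambda>f. LINT x|lebesgue. \<bar>f x\<bar>"
  unfolding ae_eq_def by (intro integral_cong_AE) (auto elim!: AE_mp)
definition dist_l1 :: "l1 \<Rightarrow> l1 \<Rightarrow> real" where "dist_l1 x y = norm (x - y)"
definition sgn_l1 :: "l1 \<Rightarrow> l1" where "sgn_l1 x = x /\<^sub>R norm x"
definition uniformity_l1 :: "(l1 \<times> l1) filter" where
  "uniformity_l1 = (INF e\<in>{0<..}. principal {(x, y). dist x y < e})"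
definition open_l1 :: "l1 set \<Rightarrow> bool" where
  "open_l1 U = (\<forall>x\<in>U. eventually (\<lambda>(x', y). x' = x \<longrightarrow> y \<in> U) uniformity)"
instance
proof
  fix x y :: l1 and a :: real
  show "dist x y = norm (x - y)" by (fact dist_l1_def)
  show "sgn x = x /\<^sub>R norm x" by (fact sgn_l1_def)
  show "uniformity = (INF e\<in>{0<..}. principal {(x, y :: l1). dist x y < e})" by (fact uniformity_l1_def)
  show "open U = (\<forall>x\<in>U. \<forall>\<^sub>F (x', y) in uniformity. x' = x \<longrightarrow> y \<in> U)" for U :: "l1 set"
    by (fact open_l1_def)
  show "(norm x = 0) = (x = 0)"
    by transfer (auto simp: ae_eq_def integral_nonneg_eq_0_iff_AE)
  show "norm (x + y) \<le> norm x + norm y"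
    by transfer (auto simp: ae_eq_def integral_abs_add_le)
  show "norm (a *\<^sub>R x) = \<bar>a\<bar> * norm x"
    by transfer (auto simp: ae_eq_def abs_mult)
qed
end

instantiation l1 :: lattice
begin
lift_definition less_eq_l1 :: "l1 \<Rightarrow> l1 \<Rightarrow> bool" is "\<lambda>f g. AE x in lebesgue. f x \<le> g x"
proof -
  fix f f' g g' assume "ae_eq f f'" "ae_eq g g'"
  then have "AE x in lebesgue. f x = f' x" "AE x in lebesgue. g x = g' x" by (auto simp: ae_eq_def)
  then show "(AE x in lebesgue. f x \<le> g x) = (AE x in lebesgue. f' x \<le> g' x)"
    by (intro AE_cong_simp iffI; elim AE_mp) (auto elim!: AE_mp)
qed
definition less_l1 :: "l1 \<Rightarrow> l1 \<Rightarrow> bool" where "less_l1 x y \<longleftrightarrow> x \<le> y \<and> \<not> y \<le> x"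
lift_definition inf_l1 :: "l1 \<Rightarrow> l1 \<Rightarrow> l1" is "\<lambda>f g x. min (f x) (g x)"
  by (auto simp: ae_eq_def elim!: AE_mp)
lift_definition sup_l1 :: "l1 \<Rightarrow> l1 \<Rightarrow> l1" is "\<lambda>f g x. max (f x) (g x)"
  by (auto simp: ae_eq_def elim!: AE_mp)
instance
proof
  fix x y z :: l1
  show "(x < y) = (x \<le> y \<and> \<not> y \<le> x)" by (fact less_l1_def)
  show "x \<le> x" by transfer simp
  show "x \<le> y \<Longrightarrow> y \<le> z \<Longrightarrow> x \<le> z" by transfer (auto elim!: AE_mp)
  show "x \<le> y \<Longrightarrow> y \<le> x \<Longrightarrow> x = y" by transfer (auto simp: ae_eq_def elim!: AE_mp)
  show "inf x y \<le> x" "inf x y \<le> y" "x \<le> sup x y" "y \<le> sup x y" by (transfer, simp)+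
  show "x \<le> y \<Longrightarrow> x \<le> z \<Longrightarrow> x \<le> inf y z" by transfer (auto elim!: AE_mp)
  show "y \<le> x \<Longrightarrow> z \<le> x \<Longrightarrow> sup y z \<le> x" by transfer (auto elim!: AE_mp)
qed
end

instance l1 :: ordered_real_vector
proof
  fix x y z :: l1 and a b :: real
  show "x \<le> y \<Longrightarrow> z + x \<le> z + y" by transfer auto
  show "x \<le> y \<Longrightarrow> 0 \<le> a \<Longrightarrow> a *\<^sub>R x \<le> a *\<^sub>R y"
    by transfer (auto elim!: AE_mp intro!: mult_left_mono)
  show "a \<le> b \<Longrightarrow> 0 \<le> x \<Longrightarrow> a *\<^sub>R x \<le> b *\<^sub>R x"
    by transfer (auto elim!: AE_mp intro!: mult_right_mono)
qed

lemma norm_abs_l1: "integrable lebesgue f \<Longrightarrow> norm (abs_l1 f) = (LINT x|lebesgue. \<bar>f x\<bar>)"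
  by (rule norm_l1.abs_eq) (simp add: ae_eq_def)

lemma abs_l1_eq_iff:
  "integrable lebesgue f \<Longrightarrow> integrable lebesgue g \<Longrightarrow> abs_l1 f = abs_l1 g \<longleftrightarrow> (AE x in lebesgue. f x = g x)"
  using Quotient_rel[OF Quotient_l1, of f g] by (auto simp: ae_eq_def)

lemma integrable_rep_l1 [simp]: "integrable lebesgue (rep_l1 x)"
  using Quotient_rep_reflp[OF Quotient_l1, of x] by (simp add: ae_eq_def)

lemma abs_rep_l1 [simp]: "abs_l1 (rep_l1 x) = x"
  by (rule Quotient_abs_rep[OF Quotient_l1])

lemma rep_abs_l1: "integrable lebesgue f \<Longrightarrow> AE x in lebesgue. rep_l1 (abs_l1 f) x = f x"
  using abs_l1_eq_iff[of "rep_l1 (abs_l1 f)" f] by simp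

lemma diff_abs_l1:
  "integrable lebesgue f \<Longrightarrow> integrable lebesgue g \<Longrightarrow> abs_l1 f - abs_l1 g = abs_l1 (\<lambda>x. f x - g x)"
  by (rule minus_l1.abs_eq) (simp_all add: ae_eq_def)

lemma le_abs_l1_iff:
  "integrable lebesgue f \<Longrightarrow> integrable lebesgue g \<Longrightarrow> abs_l1 f \<le> abs_l1 g \<longleftrightarrow> (AE x in lebesgue. f x \<le> g x)"
  by (rule less_eq_l1.abs_eq) (simp_all add: ae_eq_def)

lemma abs_l1_tendsto_dominated:
  assumes f: "\<And>n. integrable lebesgue (f n)" and g: "g \<in> borel_measurable lebesgue" and w: "integrable lebesgue w"
    and lim: "AE x in lebesgue. (\<lambda>n. f n x) \<longlonglongrightarrow> g x"
    and bound: "\<And>n. AE x in lebesgue. \<bar>f n x\<bar> \<le> w x"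
  shows "integrable lebesgue g" "(\<lambda>n. abs_l1 (f n)) \<longlonglongrightarrow> abs_l1 g"
proof -
  show ig: "integrable lebesgue g"
    by (rule integrable_dominated_convergence[OF g _ w lim]) (use f bound in auto)
  have "(\<lambda>n. LINT x|lebesgue. \<bar>f n x - g x\<bar>) \<longlonglongrightarrow> (LINT x|(lebesgue :: real measure). (0::real))"
  proof (rule integral_dominated_convergence[where w="\<lambda>x. w x + \<bar>g x\<bar>"])
    show "AE x in lebesgue. (\<lambda>n. \<bar>f n x - g x\<bar>) \<longlonglongrightarrow> 0"
      using lim by eventually_elim (simp add: LIM_zero tendsto_rabs_zero)
    show "AE x in lebesgue. norm \<bar>f n x - g x\<bar> \<le> w x + \<bar>g x\<bar>" for n
      using bound[of n] by eventually_elim auto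
  qed (use f ig w in auto)
  then have "(\<lambda>n. norm (abs_l1 (f n) - abs_l1 g)) \<longlonglongrightarrow> 0"
    using f ig by (simp add: diff_abs_l1 norm_abs_l1)
  then show "(\<lambda>n. abs_l1 (f n)) \<longlonglongrightarrow> abs_l1 g"
    by (rule LIM_zero_cancel[OF tendsto_norm_zero_cancel])
qed

instance l1 :: lattice_ab_group_add ..

instance l1 :: al_space
proof
  fix x y c :: l1 and X :: "nat \<Rightarrow> l1"
  show "0 \<le> x \<Longrightarrow> 0 \<le> y \<Longrightarrow> norm (x + y) = norm x + norm y"
  proof transfer
    fix f g :: "real \<Rightarrow> real" assume fg: "ae_eq f f" "ae_eq g g" "AE x in lebesgue. 0 \<le> f x" "AE x in lebesgue. 0 \<le> g x"
    then have "(LINT x|lebesgue. \<bar>f x + g x\<bar>) = (LINT x|lebesgue. \<bar>f x\<bar> + \<bar>g x\<bar>)"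
      by (intro integral_cong_AE) (auto simp: ae_eq_def elim!: AE_mp)
    then show "(LINT x|lebesgue. \<bar>f x + g x\<bar>) = (LINT x|lebesgue. \<bar>f x\<bar>) + (LINT x|lebesgue. \<bar>g x\<bar>)"
      using fg by (simp add: ae_eq_def)
  qed
  show "norm x = norm (sup x 0) + norm (sup (- x) 0)"
  proof transfer
    fix f :: "real \<Rightarrow> real" assume f: "ae_eq f f"
    have "(LINT x|lebesgue. \<bar>f x\<bar>) = (LINT x|lebesgue. \<bar>max (f x) 0\<bar> + \<bar>max (- f x) 0\<bar>)"
      by (rule Bochner_Integration.integral_cong) auto
    then show "(LINT x|lebesgue. \<bar>f x\<bar>) = (LINT x|lebesgue. \<bar>max (f x) 0\<bar>) + (LINT x|lebesgue. \<bar>max (- f x) 0\<bar>)"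
      using f by (simp add: ae_eq_def)
  qed
  assume inc: "\<And>n. X n \<le> X (Suc n)" and le: "\<And>n. X n \<le> c"
  define f where "f n = rep_l1 (X n)" for n
  define h where "h = rep_l1 c"
  have f: "integrable lebesgue (f n)" "X n = abs_l1 (f n)" for n by (simp_all add: f_def)
  have h: "integrable lebesgue h" "c = abs_l1 h" by (simp_all add: h_def)
  have "AE x in lebesgue. f n x \<le> f (Suc n) x" for n using inc[of n] f by (simp add: le_abs_l1_iff)
  then have A: "AE x in lebesgue. \<forall>n. f n x \<le> f (Suc n) x" by (simp add: AE_all_countable)
  have B0: "AE x in lebesgue. f n x \<le> h x" for n using le[of n] f h by (simp add: le_abs_l1_iff)
  then have B: "AE x in lebesgue. \<forall>n. f n x \<le> h x" by (simp add: AE_all_countable)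
  \<comment> \<open>Everything lies between \<open>f 0\<close> and \<open>h\<close>, so there is one
    integrable majorant, and the pointwise limit is a limit in norm.\<close>
  have bnd: "AE x in lebesgue. \<bar>f n x\<bar> \<le> \<bar>f 0 x\<bar> + \<bar>h x\<bar>" for n
    using A B
  proof eventually_elim
    case (elim x)
    have "f 0 x \<le> f n x" by (rule lift_Suc_mono_le[of "\<lambda>n. f n x", OF elim(1)[rule_format]]) simp
    moreover have "f n x \<le> h x" using elim(2) by simp
    ultimately show ?case by linarith
  qed
  define l where "l x = lim (\<lambda>n. f n x)" for x
  have lim: "AE x in lebesgue. (\<lambda>n. f n x) \<longlonglongrightarrow> l x"
    using A B
  proof eventually_elim
    case (elim x)
    have "incseq (\<lambda>n. f n x)" by (rule incseq_SucI) (rule elim(1)[rule_format])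
    then obtain L where "(\<lambda>n. f n x) \<longlonglongrightarrow> L" by (rule incseq_convergent[OF _ elim(2)])
    then show ?case unfolding l_def by (simp add: limI)
  qed
  have "l \<in> borel_measurable lebesgue"
    unfolding l_def using f(1) by (intro borel_measurable_lim_metric) auto
  then have "(\<lambda>n. abs_l1 (f n)) \<longlonglongrightarrow> abs_l1 l"
    using f h bnd lim by (intro abs_l1_tendsto_dominated(2)[where w="\<lambda>x. \<bar>f 0 x\<bar> + \<bar>h x\<bar>"]) auto
  moreover have "X = (\<lambda>n. abs_l1 (f n))" using f(2) by (rule ext)
  ultimately show "convergent X" unfolding convergent_def by auto
qed

section \<open>Absolutely continuous functions\<close>

definition disjoint_ivls :: "nat \<Rightarrow> (nat \<Rightarrow> real) \<Rightarrow> (nat \<Rightarrow> real) \<Rightarrow> bool" where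
  "disjoint_ivls n a b \<longleftrightarrow> (\<forall>i<n. a i \<le> b i) \<and> (\<forall>i<n. \<forall>j<n. i \<noteq> j \<longrightarrow> {a i<..<b i} \<inter> {a j<..<b j} = {})"

lemma abs_continuous_on_iff:
  "abs_continuous_on S w \<longleftrightarrow> (\<forall>e>0. \<exists>d>0. \<forall>n a b. disjoint_ivls n a b \<and> (\<forall>i<n. {a i..b i} \<subseteq> S) \<and>
      (\<Sum>i<n. b i - a i) < d \<longrightarrow> (\<Sum>i<n. \<bar>w (b i) - w (a i)\<bar>) < e)"
proof -
  have "((\<forall>i<n. a i \<le> b i \<and> {a i..b i} \<subseteq> S) \<and> D \<and> L) \<longleftrightarrow>
      (((\<forall>i<n. a i \<le> b i) \<and> D) \<and> (\<forall>i<n. {a i..b i} \<subseteq> S) \<and> L)" for n :: nat and a b :: "nat \<Rightarrow> real" and D L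
    by blast
  then show ?thesis unfolding abs_continuous_on_def disjoint_ivls_def by (simp only:)
qed

lemma abs_continuous_onD:
  assumes "abs_continuous_on S w" "0 < e"
  shows "\<exists>d>0. \<forall>n a b. disjoint_ivls n a b \<longrightarrow> (\<forall>i<n. {a i..b i} \<subseteq> S) \<longrightarrow>
      (\<Sum>i<n. b i - a i) < d \<longrightarrow> (\<Sum>i<n. \<bar>w (b i) - w (a i)\<bar>) < e"
  by (rule assms(1)[unfolded abs_continuous_on_iff imp_conjL, THEN spec, THEN mp, OF assms(2)])

text \<open>Outer regularity encloses a null set in an open set shorter than
  \<open>\<delta>\<close>, and inner regularity reduces to compact subsets of the latter. Such a
  subset is covered by finitely many disjoint intervals inside the open set, and to these the
  definition of absolute continuity applies.\<close>

lemma mono_AC_absolutely_continuous_measure: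
  fixes F :: "real \<Rightarrow> real"
  assumes mono: "\<And>x y. x \<le> y \<Longrightarrow> F x \<le> F y" and cont: "\<And>x. continuous (at_right x) F"
    and fin: "emeasure (interval_measure F) UNIV \<noteq> \<infinity>"
    and AC: "abs_continuous_on UNIV F"
  shows "absolutely_continuous lborel (interval_measure F)"
  unfolding absolutely_continuous_def
proof
  let ?\<mu> = "interval_measure F"
  fix N assume N: "N \<in> null_sets (lborel :: real measure)"
  have small: "emeasure ?\<mu> N \<le> ennreal e" if e: "0 < e" for e
  proof -
    from abs_continuous_onD[OF AC e] obtain \<delta> where \<delta>: "0 < \<delta>"
      and ac: "\<forall>n a b. disjoint_ivls n a b \<longrightarrow> (\<forall>i<n. {a i..b i} \<subseteq> UNIV) \<longrightarrow>
        (\<Sum>i<n. b i - a i) < \<delta> \<longrightarrow> (\<Sum>i<n. \<bar>F (b i) - F (a i)\<bar>) < e" by (elim exE conjE) rule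
    note ac = ac[rule_format]
    have Nb: "N \<in> sets borel" using N by (auto simp: null_sets_def)
    obtain U where U: "open U" "N \<subseteq> U" "emeasure lborel (U - N) < ennreal \<delta>"
      using outer_regular_lborel[OF Nb \<delta>] by blast
    have "emeasure lborel U \<le> emeasure lborel (U - N) + emeasure lborel N"
    proof -
      have "U = (U - N) \<union> N" using U(2) by blast
      moreover have "emeasure lborel ((U - N) \<union> N) \<le> emeasure lborel (U - N) + emeasure lborel N"
        using U(1) Nb by (intro emeasure_subadditive) auto
      ultimately show ?thesis by simp
    qed
    then have Ulen: "emeasure lborel U < ennreal \<delta>" using U(3) N by (auto simp: null_sets_def)
    have K: "emeasure ?\<mu> K \<le> ennreal e" if K: "K \<subseteq> U" "compact K" for K
    proof -
      obtain d where d: "0 < d" "\<And>x y. x \<in> K \<Longrightarrow> y \<in> - U \<Longrightarrow> d \<le> dist x y"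
      proof -
        have "closed (- U)" "K \<inter> - U = {}" using U(1) K(1) by (auto simp: closed_Compl)
        from separate_compact_closed[OF K(2) this] show thesis using that by blast
      qed
      \<comment> \<open>Cells shorter than the gap between \<open>K\<close> and the complement of
        \<open>U\<close> cannot leave \<open>U\<close> once they meet \<open>K\<close>.\<close>
      define h where "h = d / 2"
      have h: "0 < h" "h < d" using d by (auto simp: h_def)
      \<comment> \<open>Half-open cells partition the line and have increments of \<open>F\<close>
        as their measure. The right end belongs to the cell, hence the ceiling minus one in
        \<open>idx\<close>.\<close>
      define cell where "cell i = {of_int i * h<..(of_int i + 1) * h}" for i :: int
      define idx where "idx x = \<lceil>x / h\<rceil> - 1" for x
      have in_cell: "x \<in> cell (idx x)" for x
      proof -
        have "of_int (idx x) < x / h" "x / h \<le> of_int (idx x) + 1" unfolding idx_def by linarith+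
        then show ?thesis using h by (auto simp: cell_def pos_less_divide_eq pos_divide_le_eq)
      qed
      have cell_eq: "i = idx x" if "x \<in> cell i" for i x
      proof -
        have "of_int i < x / h" "x / h \<le> of_int i + 1"
          using that h by (auto simp: cell_def pos_less_divide_eq pos_divide_le_eq)
        then show ?thesis unfolding idx_def by linarith
      qed
      have cell_U: "cell (idx x) \<subseteq> U" if x: "x \<in> K" for x
      proof
        fix y assume y: "y \<in> cell (idx x)"
        have "dist x y < d" using y in_cell[of x] h by (auto simp: cell_def dist_real_def algebra_simps)
        then show "y \<in> U" using d(2)[OF x, of y] by force
      qed
      define I where "I = idx ` K"
      obtain B where B: "\<And>x. x \<in> K \<Longrightarrow> \<bar>x\<bar> \<le> B"
        using compact_imp_bounded[OF K(2)] by (auto simp: bounded_iff)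
      have "I \<subseteq> {\<lceil>- B / h\<rceil> - 1..\<lceil>B / h\<rceil> - 1}"
      proof
        fix i assume "i \<in> I"
        then obtain x where x: "x \<in> K" "i = idx x" by (auto simp: I_def)
        have "- B \<le> x" "x \<le> B" using B[OF x(1)] by auto
        then have "- B / h \<le> x / h" "x / h \<le> B / h" using h by (simp_all only: divide_right_mono less_imp_le)
        then have "\<lceil>- B / h\<rceil> \<le> \<lceil>x / h\<rceil>" "\<lceil>x / h\<rceil> \<le> \<lceil>B / h\<rceil>" by (simp_all only: ceiling_mono)
        then show "i \<in> {\<lceil>- B / h\<rceil> - 1..\<lceil>B / h\<rceil> - 1}" unfolding x(2) idx_def by simp
      qed
      then have finI: "finite I" by (rule finite_subset) simp
      obtain f where f: "bij_betw f {..<card I} I"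
        using ex_bij_betw_nat_finite[OF finI] by (auto simp: atLeast0LessThan)
      have fI: "f i \<in> I" if "i < card I" for i using bij_betwE[OF f] that by auto
      have finj: "f i \<noteq> f j" if "i < card I" "j < card I" "i \<noteq> j" for i j
        using bij_betw_imp_inj_on[OF f] that by (auto simp: inj_on_def)
      have cell_disj: "cell i \<inter> cell j = {}" if "i \<noteq> j" for i j using cell_eq that by blast
      have le: "of_int i * h \<le> (of_int i + 1) * h" for i :: int using h by (simp add: algebra_simps)
      have "ennreal (\<Sum>i<card I. (of_int (f i) + 1) * h - of_int (f i) * h) = (\<Sum>i<card I. emeasure lborel (cell (f i)))"
        unfolding cell_def using le h by (subst sum_ennreal[symmetric]) auto
      also have "\<dots> = emeasure lborel (\<Union>i<card I. cell (f i))"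
        by (intro sum_emeasure) (use cell_disj finj in \<open>auto simp: disjoint_family_on_def cell_def\<close>)
      also have "\<dots> \<le> emeasure lborel U"
      proof (rule emeasure_mono)
        show "(\<Union>i<card I. cell (f i)) \<subseteq> U" using fI cell_U by (fastforce simp: I_def)
        show "U \<in> sets lborel" using U(1) by simp
      qed
      finally have len: "(\<Sum>i<card I. (of_int (f i) + 1) * h - of_int (f i) * h) < \<delta>"
      proof -
        assume "ennreal (\<Sum>i<card I. (of_int (f i) + 1) * h - of_int (f i) * h) \<le> emeasure lborel U"
        also note Ulen
        finally show ?thesis by (subst (asm) ennreal_less_iff) (use le in \<open>auto intro!: sum_nonneg\<close>)
      qed
      have "(\<Sum>i<card I. \<bar>F ((of_int (f i) + 1) * h) - F (of_int (f i) * h)\<bar>) < e"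
      proof (rule ac[OF _ subset_UNIV len])
        have "{of_int (f i) * h<..<(of_int (f i) + 1) * h} \<inter> {of_int (f j) * h<..<(of_int (f j) + 1) * h} = {}"
          if ij: "i < card I" "j < card I" "i \<noteq> j" for i j
        proof -
          have "cell (f i) \<inter> cell (f j) = {}" by (rule cell_disj[OF finj[OF ij]])
          then show ?thesis by (auto simp: cell_def disjoint_iff)
        qed
        then show "disjoint_ivls (card I) (\<lambda>i. of_int (f i) * h) (\<lambda>i. (of_int (f i) + 1) * h)"
          using le unfolding disjoint_ivls_def by blast
      qed
      moreover have "emeasure ?\<mu> K \<le> emeasure ?\<mu> (\<Union>i<card I. cell (f i))"
      proof (rule emeasure_mono)
        have "(\<Union>i<card I. cell (f i)) = (\<Union>i\<in>I. cell i)"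
        proof -
          have "(\<Union>i\<in>I. cell i) = (\<Union>i\<in>f ` {..<card I}. cell i)" by (simp only: bij_betw_imp_surj_on[OF f])
          then show ?thesis by (simp only: image_image)
        qed
        then show "K \<subseteq> (\<Union>i<card I. cell (f i))" using in_cell by (auto simp: I_def)
      qed (auto simp: cell_def)
      moreover have "emeasure ?\<mu> (\<Union>i<card I. cell (f i)) = (\<Sum>i<card I. emeasure ?\<mu> (cell (f i)))"
        by (intro sum_emeasure[symmetric]) (use cell_disj finj in \<open>auto simp: disjoint_family_on_def cell_def\<close>)
      moreover have "\<dots> = (\<Sum>i<card I. ennreal (F ((of_int (f i) + 1) * h) - F (of_int (f i) * h)))"
        unfolding cell_def by (intro sum.cong refl emeasure_interval_measure_Ioc le mono cont)
      moreover have "\<dots> = ennreal (\<Sum>i<card I. \<bar>F ((of_int (f i) + 1) * h) - F (of_int (f i) * h)\<bar>)"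
        using mono[OF le] by (subst sum_ennreal) auto
      ultimately show ?thesis by (simp add: ennreal_leI order_trans)
    qed
    have "emeasure ?\<mu> N \<le> emeasure ?\<mu> U" using U by (intro emeasure_mono) auto
    also have "\<dots> = (SUP K \<in> {K. K \<subseteq> U \<and> compact K}. emeasure ?\<mu> K)"
      using fin U(1) by (intro inner_regular) auto
    also have "\<dots> \<le> ennreal e" using K by (intro SUP_least) auto
    finally show ?thesis .
  qed
  have "emeasure ?\<mu> N \<le> 0"
  proof (rule ennreal_le_epsilon)
    fix e :: real assume "0 < e"
    from small[OF this] show "emeasure ?\<mu> N \<le> 0 + ennreal e" by simp
  qed
  then show "N \<in> null_sets ?\<mu>" using N by (auto simp: null_sets_def)
qed

text \<open>The density is the Radon-Nikodym derivative of the Stieltjes measure of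
  \<open>F\<close>, which is finite because \<open>F\<close> is bounded. That measure gives the
  increments on half-open intervals; for the density the left end point makes no difference.\<close>

lemma mono_AC_density:
  fixes F :: "real \<Rightarrow> real"
  assumes mono: "\<And>x y. x \<le> y \<Longrightarrow> F x \<le> F y" and cont: "continuous_on UNIV F"
    and bounded: "\<And>x. \<bar>F x\<bar> \<le> C" and AC: "abs_continuous_on UNIV F"
  obtains D where "integrable lborel D" "\<And>x y. x \<le> y \<Longrightarrow> (LINT z:{x..y}|lborel. D z) = F y - F x"
proof -
  let ?\<mu> = "interval_measure F"
  have rc: "continuous (at_right x) F" for x
    using cont by (simp add: continuous_on_eq_continuous_at continuous_at_imp_continuous_within)
  have Ioc: "emeasure ?\<mu> {x<..y} = ennreal (F y - F x)" if "x \<le> y" for x y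
    using emeasure_interval_measure_Ioc[OF that mono rc] .
  have "emeasure ?\<mu> UNIV \<le> ennreal (2 * C)"
  proof -
    have "(\<Union>n. {- real n<..real n}) = UNIV"
    proof (intro set_eqI iffI UNIV_I)
      fix x :: real
      obtain n where "\<bar>x\<bar> < real n" using reals_Archimedean2 by blast
      then show "x \<in> (\<Union>n. {- real n<..real n})" by (intro UN_I[of n]) auto
    qed
    moreover have "(SUP n. emeasure ?\<mu> {- real n<..real n}) = emeasure ?\<mu> (\<Union>n. {- real n<..real n})"
      by (intro SUP_emeasure_incseq) (auto simp: incseq_def)
    moreover have "emeasure ?\<mu> {- real n<..real n} \<le> ennreal (2 * C)" for n
      using bounded[of "real n"] bounded[of "- real n"] by (subst Ioc) (auto intro!: ennreal_leI)
    ultimately show ?thesis using SUP_least[of UNIV "\<lambda>n. emeasure ?\<mu> {- real n<..real n}" "ennreal (2 * C)"] by simp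
  qed
  then have fin: "emeasure ?\<mu> UNIV \<noteq> \<infinity>" by (auto simp: top_unique)
  then interpret \<mu>: finite_measure ?\<mu> by (intro finite_measureI) simp
  have ac: "absolutely_continuous lborel ?\<mu>"
    by (rule mono_AC_absolutely_continuous_measure[OF mono rc fin AC])
  obtain D where D: "D \<in> borel_measurable lborel" "AE x in lborel. RN_deriv lborel ?\<mu> x = ennreal (D x)" "\<And>x. 0 \<le> D x"
    using sigma_finite_measure.real_RN_deriv[OF sigma_finite_lborel \<mu>.finite_measure_axioms ac] by (metis sets_interval_measure sets_lborel)
  have em: "emeasure ?\<mu> A = (\<integral>\<^sup>+x. ennreal (D x) * indicator A x \<partial>lborel)" if "A \<in> sets borel" for A
  proof -
    have "emeasure ?\<mu> A = emeasure (density lborel (RN_deriv lborel ?\<mu>)) A"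
      using sigma_finite_measure.density_RN_deriv[OF sigma_finite_lborel ac] by simp
    also have "\<dots> = (\<integral>\<^sup>+x. RN_deriv lborel ?\<mu> x * indicator A x \<partial>lborel)"
      using that by (subst emeasure_density) auto
    also have "\<dots> = (\<integral>\<^sup>+x. ennreal (D x) * indicator A x \<partial>lborel)"
      using D(2) by (intro nn_integral_cong_AE) auto
    finally show ?thesis .
  qed
  have int: "integrable lborel D"
  proof (rule integrableI_nonneg)
    show "(\<integral>\<^sup>+x. ennreal (D x) \<partial>lborel) < \<infinity>"
      using em[of UNIV] fin by (simp add: less_top)
  qed (use D in auto)
  have "(LINT z:{x..y}|lborel. D z) = F y - F x" if xy: "x \<le> y" for x y
  proof -
    have "ennreal (LINT z:{x<..y}|lborel. D z) = (\<integral>\<^sup>+z. ennreal (D z * indicator {x<..y} z) \<partial>lborel)"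
      unfolding set_lebesgue_integral_def using D int
      by (subst nn_integral_eq_integral)
        (auto simp: mult.commute intro: integrable_mult_indicator[of _ _ D, simplified])
    also have "\<dots> = (\<integral>\<^sup>+z. ennreal (D z) * indicator {x<..y} z \<partial>lborel)"
      by (intro nn_integral_cong) (auto split: split_indicator)
    also have "\<dots> = ennreal (F y - F x)" using em[of "{x<..y}"] Ioc[OF xy] by simp
    finally have "(LINT z:{x<..y}|lborel. D z) = F y - F x"
      using D(3) mono[OF xy] by (subst (asm) ennreal_inj) (auto simp: set_lebesgue_integral_def intro!: integral_nonneg)
    moreover have "(LINT z:{x..y}|lborel. D z) = (LINT z:{x<..y}|lborel. D z)"
    proof -
      have "AE z in lborel. z \<noteq> x" by (rule AE_lborel_singleton)
      then have "AE z in lborel. indicator {x..y} z *\<^sub>R D z = indicator {x<..y} z *\<^sub>R D z"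
        by eventually_elim (auto split: split_indicator)
      then show ?thesis unfolding set_lebesgue_integral_def
        using D(1) by (intro integral_cong_AE) auto
    qed
    ultimately show ?thesis by simp
  qed
  with int show thesis by (rule that)
qed

text \<open>Averages over intervals to the right of a point converge off a null set. The same fact
  for the reflected function supplies the left derivative off the mirror image of another null
  set.\<close>

lemma indefinite_integral_has_derivative_AE:
  fixes f :: "real \<Rightarrow> real"
  assumes f: "\<And>a b. f integrable_on {a..b}"
    and W: "\<And>x y. x \<le> y \<Longrightarrow> W y - W x = integral {x..y} f"
  obtains N where "negligible N" "\<And>x. x \<notin> N \<Longrightarrow> (W has_real_derivative f x) (at x)"
proof -
  obtain N1 where N1: "negligible N1"
      "\<And>x e. x \<notin> N1 \<Longrightarrow> 0 < e \<Longrightarrow> \<exists>d>0. \<forall>h. 0 < h \<and> h < d \<longrightarrow> norm (integral {x..x + h} f / h - f x) < e"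
    using integrable_ccontinuous_explicit[of f] f by (auto simp: divide_inverse mult.commute)
  have f': "(\<lambda>x. f (- x)) integrable_on {a..b}" for a b
    using Henstock_Kurzweil_Integration.integrable_reflect_real[of f "- a" "- b"] f by simp
  obtain N2 where N2: "negligible N2"
      "\<And>x e. x \<notin> N2 \<Longrightarrow> 0 < e \<Longrightarrow>
        \<exists>d>0. \<forall>h. 0 < h \<and> h < d \<longrightarrow> norm (integral {x..x + h} (\<lambda>x. f (- x)) / h - f (- x)) < e"
    using integrable_ccontinuous_explicit[of "\<lambda>x. f (- x)"] f' by (auto simp: divide_inverse mult.commute)
  show thesis
  proof
    have "negligible (uminus ` N2)"
      by (rule negligible_differentiable_image_negligible[OF _ N2(1)])
        (auto simp: differentiable_on_def intro!: derivative_intros)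
    then show "negligible (N1 \<union> uminus ` N2)" using N1(1) by (simp add: negligible_Un)
    fix x assume x: "x \<notin> N1 \<union> uminus ` N2"
    then have x2: "- x \<notin> N2" by (metis UnI2 image_eqI minus_minus)
    show "(W has_real_derivative f x) (at x)"
      unfolding DERIV_def LIM_def
    proof (intro allI impI)
      fix e :: real assume e: "0 < e"
      obtain d1 where d1: "0 < d1" "\<And>h. 0 < h \<Longrightarrow> h < d1 \<Longrightarrow> norm (integral {x..x + h} f / h - f x) < e"
        using N1(2)[of x e] x e by auto
      obtain d2 where d2: "0 < d2" "\<And>h. 0 < h \<Longrightarrow> h < d2 \<Longrightarrow>
          norm (integral {- x..- x + h} (\<lambda>x. f (- x)) / h - f x) < e"
        using N2(2)[OF x2 e] by auto
      show "\<exists>s>0. \<forall>h. h \<noteq> 0 \<and> dist h 0 < s \<longrightarrow> dist ((W (x + h) - W x) / h) (f x) < e"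
      proof (intro exI[of _ "min d1 d2"] conjI allI impI)
        fix h :: real assume h: "h \<noteq> 0 \<and> dist h 0 < min d1 d2"
        show "dist ((W (x + h) - W x) / h) (f x) < e"
        proof (cases "0 < h")
          case True
          then show ?thesis using d1(2)[of h] W[of x "x + h"] h by (simp add: dist_real_def)
        next
          case False
          then have h0: "h < 0" using h by simp
          have "integral {- x..- x + - h} (\<lambda>x. f (- x)) = integral {x + h..x} f"
            using Henstock_Kurzweil_Integration.integral_reflect_real[of x "x + h" f] by simp
          also have "\<dots> = W x - W (x + h)" using W[of "x + h" x] h0 by simp
          finally have "integral {- x..- x + - h} (\<lambda>x. f (- x)) / (- h) = (W (x + h) - W x) / h"
            using h0 by (simp add: field_simps)
          then show ?thesis using d2(2)[of "- h"] h h0 by (simp add: dist_real_def)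
        qed
      qed (use d1 d2 in auto)
    qed
  qed
qed

section \<open>Total variation and the fundamental theorem\<close>

text \<open>The sums whose supremum is the total variation. Points of a subdivision may repeat, so
  that subdivisions of different lengths can be padded to a common length.\<close>

definition vsums :: "(real \<Rightarrow> real) \<Rightarrow> real \<Rightarrow> real \<Rightarrow> real set" where
  "vsums w x y = {s. \<exists>(n::nat) t. mono t \<and> t 0 = x \<and> t n = y \<and> s = (\<Sum>i<n. \<bar>w (t (Suc i)) - w (t i)\<bar>)}"

definition vart :: "(real \<Rightarrow> real) \<Rightarrow> real \<Rightarrow> real \<Rightarrow> real" where
  "vart w x y = Sup (vsums w x y)"

lemma vsums_simple:
  assumes "x \<le> y" shows "\<bar>w y - w x\<bar> \<in> vsums w x y"
  unfolding vsums_def using assms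
  by (auto intro!: exI[of _ 1] exI[of _ "\<lambda>i. if i = 0 then x else y"] simp: mono_def)

text \<open>Clip the subdivision at \<open>y\<close> from above and from below. One of the two
  clipped points is always \<open>y\<close>, so \<open>w (t i) = w (t1 i) + w (t2 i) - w y\<close>,
  and the triangle inequality applies termwise.\<close>

lemma vsums_split:
  assumes s: "s \<in> vsums w x z" and xy: "x \<le> y" "y \<le> z"
  obtains s1 s2 where "s1 \<in> vsums w x y" "s2 \<in> vsums w y z" "s \<le> s1 + s2"
proof -
  obtain n t where t: "mono t" "t 0 = x" "t n = z" "s = (\<Sum>i<n. \<bar>w (t (Suc i)) - w (t i)\<bar>)"
    using s by (auto simp: vsums_def)
  define t1 t2 where "t1 i = min (t i) y" and "t2 i = max (t i) y" for i
  have "mono t1" unfolding t1_def by (intro monoI min.mono order_refl monoD[OF t(1)])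
  have "mono t2" unfolding t2_def by (intro monoI max.mono order_refl monoD[OF t(1)])
  show thesis
  proof
    show "(\<Sum>i<n. \<bar>w (t1 (Suc i)) - w (t1 i)\<bar>) \<in> vsums w x y"
      unfolding vsums_def using t xy \<open>mono t1\<close>
      by (intro CollectI exI[of _ n] exI[of _ t1]) (auto simp: t1_def)
    show "(\<Sum>i<n. \<bar>w (t2 (Suc i)) - w (t2 i)\<bar>) \<in> vsums w y z"
      unfolding vsums_def using t xy \<open>mono t2\<close>
      by (intro CollectI exI[of _ n] exI[of _ t2]) (auto simp: t2_def)
    have w: "w (t i) = w (t1 i) + w (t2 i) - w y" for i by (auto simp: t1_def t2_def min_def max_def)
    show "s \<le> (\<Sum>i<n. \<bar>w (t1 (Suc i)) - w (t1 i)\<bar>) + (\<Sum>i<n. \<bar>w (t2 (Suc i)) - w (t2 i)\<bar>)"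
      unfolding t(4) sum.distrib[symmetric]
    proof (rule sum_mono)
      fix i
      show "\<bar>w (t (Suc i)) - w (t i)\<bar> \<le> \<bar>w (t1 (Suc i)) - w (t1 i)\<bar> + \<bar>w (t2 (Suc i)) - w (t2 i)\<bar>"
        unfolding w[of i] w[of "Suc i"] by linarith
    qed
  qed
qed

lemma vsums_concat:
  assumes s1: "s1 \<in> vsums w x y" and s2: "s2 \<in> vsums w y z"
  shows "s1 + s2 \<in> vsums w x z"
proof -
  obtain n t where t: "mono t" "t 0 = x" "t n = y" "s1 = (\<Sum>i<n. \<bar>w (t (Suc i)) - w (t i)\<bar>)"
    using s1 by (auto simp: vsums_def)
  obtain n' t' where t': "mono t'" "t' 0 = y" "t' n' = z" "s2 = (\<Sum>i<n'. \<bar>w (t' (Suc i)) - w (t' i)\<bar>)"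
    using s2 by (auto simp: vsums_def)
  define T where "T i = (if i \<le> n then t i else t' (i - n))" for i
  have "mono T"
  proof (rule monoI)
    fix i j :: nat assume ij: "i \<le> j"
    show "T i \<le> T j"
    proof (cases "j \<le> n \<or> n < i")
      case True
      then show ?thesis using ij t(1) t'(1) by (auto simp: T_def mono_def)
    next
      case False
      then have "t i \<le> t n" "t' 0 \<le> t' (j - n)" using t(1) t'(1) by (auto simp: mono_def)
      then show ?thesis using False t t' by (auto simp: T_def)
    qed
  qed
  moreover have "s1 + s2 = (\<Sum>i<n + n'. \<bar>w (T (Suc i)) - w (T i)\<bar>)"
  proof -
    have "(\<Sum>i<n + n'. \<bar>w (T (Suc i)) - w (T i)\<bar>)
      = (\<Sum>i<n. \<bar>w (T (Suc i)) - w (T i)\<bar>) + (\<Sum>i<n'. \<bar>w (T (Suc (n + i))) - w (T (n + i))\<bar>)"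
      by (induction n') auto
    moreover have "(\<Sum>i<n. \<bar>w (T (Suc i)) - w (T i)\<bar>) = s1"
      unfolding t(4) by (intro sum.cong) (auto simp: T_def)
    moreover have "(\<Sum>i<n'. \<bar>w (T (Suc (n + i))) - w (T (n + i))\<bar>) = s2"
      unfolding t'(4)
    proof (rule sum.cong)
      fix i
      have "T (n + i) = t' i" "T (Suc (n + i)) = t' (Suc i)"
        using t(3) t'(2) by (cases i; auto simp: T_def Suc_diff_le)+
      then show "\<bar>w (T (Suc (n + i))) - w (T (n + i))\<bar> = \<bar>w (t' (Suc i)) - w (t' i)\<bar>" by simp
    qed simp
    ultimately show ?thesis by simp
  qed
  moreover have "T 0 = x" "T (n + n') = z" using t t' by (cases n'; auto simp: T_def)+
  ultimately show ?thesis unfolding vsums_def by blast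
qed

lemma vsums_pad:
  assumes s: "s \<in> vsums w x y"
  obtains n where "\<And>m. n \<le> m \<Longrightarrow> \<exists>t. mono t \<and> t 0 = x \<and> t m = y \<and> s = (\<Sum>i<m. \<bar>w (t (Suc i)) - w (t i)\<bar>)"
proof -
  obtain n t where t: "mono t" "t 0 = x" "t n = y" "s = (\<Sum>i<n. \<bar>w (t (Suc i)) - w (t i)\<bar>)"
    using s by (auto simp: vsums_def)
  define T where "T i = t (min i n)" for i
  have "mono T" using t(1) by (auto simp: T_def mono_def)
  moreover have "T 0 = x" using t by (simp add: T_def)
  moreover have "T m = y" if "n \<le> m" for m using t that by (simp add: T_def)
  moreover have "(\<Sum>i<m. \<bar>w (T (Suc i)) - w (T i)\<bar>) = s" if "n \<le> m" for m
  proof -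
    have "(\<Sum>i<m. \<bar>w (T (Suc i)) - w (T i)\<bar>) = (\<Sum>i<n. \<bar>w (T (Suc i)) - w (T i)\<bar>)"
      using that by (intro sum.mono_neutral_right) (auto simp: T_def)
    also have "\<dots> = s" unfolding t(4) by (intro sum.cong) (auto simp: T_def)
    finally show ?thesis .
  qed
  ultimately have "\<exists>t. mono t \<and> t 0 = x \<and> t m = y \<and> s = (\<Sum>i<m. \<bar>w (t (Suc i)) - w (t i)\<bar>)" if "n \<le> m" for m
    using that by (intro exI[of _ T]) auto
  then show thesis by (rule that)
qed

lemma vsums_compose_mono:
  assumes "s \<in> vsums (\<lambda>x. w (c x)) x y" "mono c"
  shows "s \<in> vsums w (c x) (c y)"
  using assms unfolding vsums_def
proof clarify
  fix n :: nat and t :: "nat \<Rightarrow> real" assume t: "mono t" "mono c"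
  show "\<exists>n' t'. mono t' \<and> t' 0 = c (t 0) \<and> t' n' = c (t n) \<and>
      (\<Sum>i<n. \<bar>w (c (t (Suc i))) - w (c (t i))\<bar>) = (\<Sum>i<n'. \<bar>w (t' (Suc i)) - w (t' i)\<bar>)"
    using t by (intro exI[of _ n] exI[of _ "\<lambda>i. c (t i)"]) (auto simp: mono_def)
qed

lemma disjoint_ivls_mono: "mono t \<Longrightarrow> disjoint_ivls n t (\<lambda>i. t (Suc i))"
proof -
  assume t: "mono t"
  have "{t i<..<t (Suc i)} \<inter> {t j<..<t (Suc j)} = {}" if "i < j" for i j
    using monoD[OF t, of "Suc i" j] that by auto
  then have "{t i<..<t (Suc i)} \<inter> {t j<..<t (Suc j)} = {}" if "i \<noteq> j" for i j
    using that by (metis Int_commute linorder_neqE_nat)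
  then show ?thesis using t by (auto simp: disjoint_ivls_def mono_def)
qed

context
  fixes w :: "real \<Rightarrow> real"
  assumes AC: "abs_continuous_on UNIV w"
begin

text \<open>The modulus for the value 1 bounds the variation over every piece shorter than
  \<open>d\<close>, and an interval of length at most \<open>L\<close> is cut into a fixed number of
  pieces of length \<open>d / 2\<close>.\<close>

lemma vsums_bounded:
  obtains K where "\<And>x y s. x \<le> y \<Longrightarrow> y - x \<le> L \<Longrightarrow> s \<in> vsums w x y \<Longrightarrow> s \<le> K"
proof -
  from abs_continuous_onD[OF AC zero_less_one] obtain d where d: "0 < d"
    and ac: "\<forall>n a b. disjoint_ivls n a b \<longrightarrow> (\<forall>i<n. {a i..b i} \<subseteq> UNIV) \<longrightarrow>
      (\<Sum>i<n. b i - a i) < d \<longrightarrow> (\<Sum>i<n. \<bar>w (b i) - w (a i)\<bar>) < 1" by (elim exE conjE) rule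
  note ac = ac[rule_format, OF _ subset_UNIV]
  have small: "s < 1" if len: "y - x < d" and sv: "s \<in> vsums w x y" for x y s
  proof -
    obtain n t where t: "mono t" "t 0 = x" "t n = y" "s = (\<Sum>i<n. \<bar>w (t (Suc i)) - w (t i)\<bar>)"
      using sv by (auto simp: vsums_def)
    have "(\<Sum>i<n. t (Suc i) - t i) = y - x" using t by (simp add: sum_lessThan_telescope)
    then show ?thesis unfolding t(4) using len by (intro ac disjoint_ivls_mono t) auto
  qed
  have bnd: "s \<le> real k + 1" if "x \<le> y" "y - x \<le> real k * (d / 2)" "s \<in> vsums w x y" for k x y s
    using that
  proof (induction k arbitrary: y s)
    case 0
    then show ?case using small[of y x s] d by simp
  next
    case (Suc k)
    define c where "c = max x (y - d / 2)"
    have c: "x \<le> c" "c \<le> y" using Suc.prems d by (auto simp: c_def)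
    obtain s1 s2 where s: "s1 \<in> vsums w x c" "s2 \<in> vsums w c y" "s \<le> s1 + s2"
      using vsums_split[OF Suc.prems(3) c] .
    have "c - x \<le> real k * (d / 2)" using Suc.prems(2) d by (auto simp: c_def max_def algebra_simps)
    then have "s1 \<le> real k + 1" using Suc.IH[OF c(1) _ s(1)] by simp
    moreover have "s2 < 1" using small[OF _ s(2)] d by (auto simp: c_def)
    ultimately show ?case using s(3) by simp
  qed
  obtain k :: nat where k: "L / (d / 2) \<le> real k" using real_arch_simple by blast
  then have "L \<le> real k * (d / 2)" using d by (simp add: field_simps)
  then show thesis using bnd that[of "real k + 1"] by fastforce
qed

lemma bdd_above_vsums: "x \<le> y \<Longrightarrow> bdd_above (vsums w x y)"
  using vsums_bounded[of "y - x"] by (metis bdd_aboveI order_refl)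

lemma vsums_nonempty: "x \<le> y \<Longrightarrow> vsums w x y \<noteq> {}"
  using vsums_simple by blast

lemma vart_ge: "x \<le> y \<Longrightarrow> s \<in> vsums w x y \<Longrightarrow> s \<le> vart w x y"
  unfolding vart_def by (rule cSup_upper) (auto intro: bdd_above_vsums)

lemma abs_diff_le_vart: "x \<le> y \<Longrightarrow> \<bar>w y - w x\<bar> \<le> vart w x y"
  by (rule vart_ge[OF _ vsums_simple])

lemma vart_add:
  assumes "x \<le> y" "y \<le> z" shows "vart w x z = vart w x y + vart w y z"
proof (rule antisym)
  show "vart w x z \<le> vart w x y + vart w y z"
    unfolding vart_def[of w x z]
  proof (rule cSup_least)
    fix s assume "s \<in> vsums w x z"
    then obtain s1 s2 where s: "s1 \<in> vsums w x y" "s2 \<in> vsums w y z" "s \<le> s1 + s2"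
      using vsums_split assms by metis
    then show "s \<le> vart w x y + vart w y z"
      using vart_ge[OF assms(1) s(1)] vart_ge[OF assms(2) s(2)] by simp
  qed (rule vsums_nonempty[OF order_trans[OF assms]])
  have "s1 \<le> vart w x z - vart w y z" if s1: "s1 \<in> vsums w x y" for s1
  proof -
    have "s2 \<le> vart w x z - s1" if "s2 \<in> vsums w y z" for s2
      using vart_ge[OF _ vsums_concat[OF s1 that]] assms by simp
    then have "vart w y z \<le> vart w x z - s1"
      unfolding vart_def[of w y z] using vsums_nonempty[OF assms(2)] by (intro cSup_least)
    then show ?thesis by simp
  qed
  then have "vart w x y \<le> vart w x z - vart w y z"
    unfolding vart_def[of w x y] using vsums_nonempty[OF assms(1)] by (intro cSup_least)
  then show "vart w x y + vart w y z \<le> vart w x z" by simp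
qed

text \<open>Nearly optimal subdivisions of all the given intervals form one disjoint family of the
  same total length, so the modulus of \<open>w\<close> at \<open>e / 2\<close> serves for its
  variation at \<open>e\<close>.\<close>

lemma vart_AC:
  assumes e: "0 < e"
  obtains d where "0 < d" "\<And>n a b. disjoint_ivls n a b \<Longrightarrow> (\<Sum>i<n. b i - a i) < d \<Longrightarrow> (\<Sum>i<n. vart w (a i) (b i)) < e"
proof -
  from abs_continuous_onD[OF AC half_gt_zero[OF e]] obtain d where d: "0 < d"
    and ac: "\<forall>n a b. disjoint_ivls n a b \<longrightarrow> (\<forall>i<n. {a i..b i} \<subseteq> UNIV) \<longrightarrow>
      (\<Sum>i<n. b i - a i) < d \<longrightarrow> (\<Sum>i<n. \<bar>w (b i) - w (a i)\<bar>) < e / 2" by (elim exE conjE) rule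
  note ac = ac[rule_format, OF _ subset_UNIV]
  have "(\<Sum>i<n. vart w (a i) (b i)) < e" if ab: "disjoint_ivls n a b" "(\<Sum>i<n. b i - a i) < d" for n a b
  proof (cases "n = 0")
    case True then show ?thesis using e by simp
  next
    case False
    \<comment> \<open>The loss allowed per interval; the \<open>n\<close> losses add up to the other
      half of \<open>e\<close>.\<close>
    define \<eta> where "\<eta> = e / (2 * real n)"
    have \<eta>: "0 < \<eta>" using e False by (simp add: \<eta>_def)
    have le: "a i \<le> b i" if "i < n" for i using ab that by (simp add: disjoint_ivls_def)
    have "\<exists>s. s \<in> vsums w (a i) (b i) \<and> vart w (a i) (b i) - \<eta> < s" if "i < n" for i
      using less_cSupD[OF vsums_nonempty[OF le[OF that]], of "vart w (a i) (b i) - \<eta>"] \<eta>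
      by (auto simp: vart_def)
    then obtain s where s: "\<And>i. i < n \<Longrightarrow> s i \<in> vsums w (a i) (b i)" "\<And>i. i < n \<Longrightarrow> vart w (a i) (b i) - \<eta> < s i"
      by metis
    have "\<exists>N. \<forall>m\<ge>N. \<exists>t. mono t \<and> t 0 = a i \<and> t m = b i \<and> s i = (\<Sum>j<m. \<bar>w (t (Suc j)) - w (t j)\<bar>)" if "i < n" for i
      using vsums_pad[OF s(1)[OF that]] by metis
    then obtain N where N: "\<And>i m. i < n \<Longrightarrow> N i \<le> m \<Longrightarrow>
        \<exists>t. mono t \<and> t 0 = a i \<and> t m = b i \<and> s i = (\<Sum>j<m. \<bar>w (t (Suc j)) - w (t j)\<bar>)"
      by metis
    define m where "m = Suc (Max (N ` {..<n}))"
    have m: "N i \<le> m" if "i < n" for i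
      using that by (auto simp: m_def intro: le_SucI Max_ge)
    have "\<exists>t. mono t \<and> t 0 = a i \<and> t m = b i \<and> s i = (\<Sum>j<m. \<bar>w (t (Suc j)) - w (t j)\<bar>)" if "i < n" for i
      using N[OF that m[OF that]] .
    then obtain t where t: "\<And>i. i < n \<Longrightarrow> mono (t i)" "\<And>i. i < n \<Longrightarrow> t i 0 = a i" "\<And>i. i < n \<Longrightarrow> t i m = b i"
        "\<And>i. i < n \<Longrightarrow> s i = (\<Sum>j<m. \<bar>w (t i (Suc j)) - w (t i j)\<bar>)"
      by metis
    have m0: "0 < m" by (simp add: m_def)
    \<comment> \<open>Division with remainder lists the double family of subdivision intervals by
      one index; this is why all subdivisions were padded to the same length
      \<open>m\<close>.\<close>
    define A B where "A k = t (k div m) (k mod m)" and "B k = t (k div m) (Suc (k mod m))" for k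
    have group: "(\<Sum>k<n * m. f (k div m) (k mod m)) = (\<Sum>i<n. \<Sum>j<m. f i j)" for f :: "nat \<Rightarrow> nat \<Rightarrow> real"
    proof -
      have "(\<Sum>k<n * m. f (k div m) (k mod m)) = (\<Sum>i<n. \<Sum>k=i * m..<i * m + m. f (k div m) (k mod m))"
        by (rule sum.nat_group[symmetric])
      also have "\<dots> = (\<Sum>i<n. \<Sum>j<m. f i j)"
      proof (rule sum.cong)
        fix i
        have "(\<Sum>k=i * m..<i * m + m. f (k div m) (k mod m)) = (\<Sum>j=0..<m. f ((j + i * m) div m) ((j + i * m) mod m))"
          using sum.shift_bounds_nat_ivl[of "\<lambda>k. f (k div m) (k mod m)" 0 "i * m" m] by (simp add: add.commute)
        also have "\<dots> = (\<Sum>j<m. f i j)"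
          using m0 by (intro sum.cong) (auto simp: atLeast0LessThan)
        finally show "(\<Sum>k=i * m..<i * m + m. f (k div m) (k mod m)) = (\<Sum>j<m. f i j)" .
      qed simp
      finally show ?thesis .
    qed
    have "(\<Sum>k<n * m. \<bar>w (B k) - w (A k)\<bar>) < e / 2"
    proof (rule ac)
      have "(\<Sum>k<n * m. B k - A k) = (\<Sum>i<n. \<Sum>j<m. t i (Suc j) - t i j)"
        unfolding A_def B_def by (rule group)
      also have "\<dots> = (\<Sum>i<n. b i - a i)"
        by (intro sum.cong) (auto simp: sum_lessThan_telescope t)
      finally show "(\<Sum>k<n * m. B k - A k) < d" using ab(2) by simp
      show "disjoint_ivls (n * m) A B"
        unfolding disjoint_ivls_def
      proof (intro conjI allI impI)
        fix k assume k: "k < n * m"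
        then have "k div m < n" using m0 by (simp add: less_mult_imp_div_less)
        then show "A k \<le> B k" using t(1) by (simp add: A_def B_def mono_def)
        fix l assume l: "l < n * m" and kl: "k \<noteq> l"
        have kn: "k div m < n" and ln: "l div m < n" using k l by (simp_all add: less_mult_imp_div_less)
        show "{A k<..<B k} \<inter> {A l<..<B l} = {}"
        proof (cases "k div m = l div m")
          case True
          then have "k mod m \<noteq> l mod m" using kl by (metis div_mult_mod_eq)
          then show ?thesis
            using disjoint_ivls_mono[OF t(1)[OF kn], of m] True m0 unfolding A_def B_def disjoint_ivls_def by simp
        next
          case False
          have sub: "{A k<..<B k} \<subseteq> {a (k div m)<..<b (k div m)}" if "k div m < n" for k
          proof -
            have "k mod m < m" using m0 by simp
            then have "t (k div m) 0 \<le> A k" "B k \<le> t (k div m) m"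
              using t(1)[OF that] by (auto simp: A_def B_def mono_def Suc_le_eq)
            then show ?thesis using t(2,3)[OF that] by auto
          qed
          have "{a (k div m)<..<b (k div m)} \<inter> {a (l div m)<..<b (l div m)} = {}"
            using ab(1) kn ln False by (simp add: disjoint_ivls_def)
          then show ?thesis using sub[OF kn] sub[OF ln] by blast
        qed
      qed
    qed
    moreover have "(\<Sum>k<n * m. \<bar>w (B k) - w (A k)\<bar>) = (\<Sum>i<n. s i)"
      unfolding A_def B_def using t(4) by (subst group) simp
    moreover have "(\<Sum>i<n. vart w (a i) (b i)) \<le> (\<Sum>i<n. s i + \<eta>)"
      using s(2) by (intro sum_mono) (force simp: less_eq_real_def)
    moreover have "(\<Sum>i<n. s i + \<eta>) = (\<Sum>i<n. s i) + e / 2"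
      using False by (simp add: sum.distrib \<eta>_def)
    ultimately show ?thesis by simp
  qed
  with d show thesis by (rule that)
qed

end

lemma abs_continuous_on_imp_continuous_on:
  assumes "abs_continuous_on UNIV w" shows "continuous_on UNIV w"
  unfolding continuous_on_iff
proof (intro ballI allI impI)
  fix x e :: real assume e: "0 < e"
  from abs_continuous_onD[OF assms e] obtain d where d: "0 < d"
    and ac: "\<forall>n a b. disjoint_ivls n a b \<longrightarrow> (\<forall>i<n. {a i..b i} \<subseteq> UNIV) \<longrightarrow>
      (\<Sum>i<n. b i - a i) < d \<longrightarrow> (\<Sum>i<n. \<bar>w (b i) - w (a i)\<bar>) < e" by (elim exE conjE) rule
  note ac = ac[rule_format, OF _ subset_UNIV]
  have "dist (w y) (w x) < e" if "dist y x < d" for y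
    using ac[of 1 "\<lambda>_. min x y" "\<lambda>_. max x y"] that
    by (cases "x \<le> y") (auto simp: disjoint_ivls_def dist_real_def abs_minus_commute)
  then show "\<exists>d>0. \<forall>x'\<in>UNIV. dist x' x < d \<longrightarrow> dist (w x') (w x) < e" using d by auto
qed

text \<open>Clamping the argument extends \<open>w\<close> from the interval to an absolutely
  continuous function on the line. Jordan decomposition writes it as \<open>V\<close> minus
  \<open>V - v\<close>; both are nondecreasing, bounded and absolutely continuous, so each has a
  density.\<close>

lemma AC_on_Icc_density:
  assumes AC: "abs_continuous_on E w" and ab: "a \<le> b" "{a..b} \<subseteq> E"
  obtains D where "integrable lborel D"
    "\<And>x y. a \<le> x \<Longrightarrow> x \<le> y \<Longrightarrow> y \<le> b \<Longrightarrow> (LINT z:{x..y}|lborel. D z) = w y - w x"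
proof -
  define c where "c x = max a (min b x)" for x
  have c_mono: "mono c" by (auto simp: c_def mono_def)
  have c_range: "a \<le> c x" "c x \<le> b" for x using ab by (auto simp: c_def)
  define v where "v x = w (c x)" for x
  have ACv: "abs_continuous_on UNIV v"
    unfolding abs_continuous_on_iff
  proof (intro allI impI)
    fix e :: real assume "0 < e"
    from abs_continuous_onD[OF AC this] obtain d where d: "0 < d"
      and ac: "\<forall>n a b. disjoint_ivls n a b \<longrightarrow> (\<forall>i<n. {a i..b i} \<subseteq> E) \<longrightarrow>
        (\<Sum>i<n. b i - a i) < d \<longrightarrow> (\<Sum>i<n. \<bar>w (b i) - w (a i)\<bar>) < e" by (elim exE conjE) rule
    have "(\<Sum>i<n. \<bar>v (B i) - v (A i)\<bar>) < e" if AB: "disjoint_ivls n A B" "(\<Sum>i<n. B i - A i) < d" for n A B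
      unfolding v_def
    proof (rule ac[rule_format])
      show "disjoint_ivls n (\<lambda>i. c (A i)) (\<lambda>i. c (B i))"
        unfolding disjoint_ivls_def
      proof (intro conjI allI impI)
        fix i assume i: "i < n"
        then show "c (A i) \<le> c (B i)" using AB(1) by (intro monoD[OF c_mono]) (simp add: disjoint_ivls_def)
        fix j assume j: "j < n" "i \<noteq> j"
        have "{A i<..<B i} \<inter> {A j<..<B j} = {}" using AB(1) i j by (simp add: disjoint_ivls_def)
        moreover have "{c (A k)<..<c (B k)} \<subseteq> {A k<..<B k}" for k by (auto simp: c_def)
        ultimately show "{c (A i)<..<c (B i)} \<inter> {c (A j)<..<c (B j)} = {}" by blast
      qed
      show "{c (A i)..c (B i)} \<subseteq> E" for i using c_range[of "A i"] c_range[of "B i"] ab(2) by auto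
      have "(\<Sum>i<n. c (B i) - c (A i)) \<le> (\<Sum>i<n. B i - A i)"
        using AB(1) by (intro sum_mono) (auto simp: disjoint_ivls_def c_def)
      then show "(\<Sum>i<n. c (B i) - c (A i)) < d" using AB(2) by simp
    qed
    then show "\<exists>d>0. \<forall>n A B. disjoint_ivls n A B \<and> (\<forall>i<n. {A i..B i} \<subseteq> UNIV) \<and> (\<Sum>i<n. B i - A i) < d \<longrightarrow>
        (\<Sum>i<n. \<bar>v (B i) - v (A i)\<bar>) < e"
      using d by blast
  qed
  note add = vart_add[OF ACv] and ge = abs_diff_le_vart[OF ACv]
  have vart0: "vart v x x = 0" for x using add[of x x x] by simp
  obtain K where K: "\<And>x y s. x \<le> y \<Longrightarrow> y - x \<le> b - a \<Longrightarrow> s \<in> vsums v x y \<Longrightarrow> s \<le> K"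
    using vsums_bounded[OF ACv, of "b - a"] by blast
  have cc: "v (c x) = v x" for x using ab by (auto simp: v_def c_def)
  have varK: "vart v x y \<le> K" if "x \<le> y" for x y
    unfolding vart_def
  proof (rule cSup_least)
    show "vsums v x y \<noteq> {}" by (rule vsums_nonempty[OF ACv that])
    fix s assume s: "s \<in> vsums v x y"
    have "s \<in> vsums v (c x) (c y)"
      using vsums_compose_mono[of s v c x y] s c_mono by (simp add: cc)
    then show "s \<le> K"
      using K[of "c x" "c y" s] monoD[OF c_mono that] c_range[of x] c_range[of y] by simp
  qed
  \<comment> \<open>The variation measured from 0 with a sign, so that increments of
    \<open>V\<close> are variations over intervals anywhere on the line.\<close>
  define V where "V x = (if 0 \<le> x then vart v 0 x else - vart v x 0)" for x
  have Vd: "V y - V x = vart v x y" if "x \<le> y" for x y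
    using that add[of 0 x y] add[of x y 0] add[of x 0 y] by (auto simp: V_def)
  have V_le: "\<bar>V x\<bar> \<le> K" for x
    using varK[of 0 x] varK[of x 0] ge[of 0 x] ge[of x 0] by (auto simp: V_def)
  have V_AC: "\<exists>d>0. \<forall>n A B. disjoint_ivls n A B \<and> (\<Sum>i<n. B i - A i) < d \<longrightarrow> (\<Sum>i<n. V (B i) - V (A i)) < e"
    if "0 < e" for e
  proof -
    have eq: "(\<Sum>i<n. V (B i) - V (A i)) = (\<Sum>i<n. vart v (A i) (B i))" if "disjoint_ivls n A B" for n A B
      using that by (intro sum.cong) (auto simp: Vd disjoint_ivls_def)
    show ?thesis
    proof (rule vart_AC[OF ACv \<open>0 < e\<close>])
      fix d assume "0 < d" and d: "\<And>n a b. disjoint_ivls n a b \<Longrightarrow> (\<Sum>i<n. b i - a i) < d \<Longrightarrow> (\<Sum>i<n. vart v (a i) (b i)) < e"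
      then show ?thesis using d by (intro exI[of _ d]) (simp add: eq)
    qed
  qed
  have V_mono: "V x \<le> V y" if "x \<le> y" for x y using Vd[OF that] ge[OF that] by simp
  have d_mono: "V x - v x \<le> V y - v y" if "x \<le> y" for x y using Vd[OF that] ge[OF that] by simp
  \<comment> \<open>The factor 2 is for \<open>V - v\<close>, whose increments are at most those of
    \<open>V\<close> plus the absolute increments of \<open>v\<close>.\<close>
  have dom: "abs_continuous_on UNIV F" if F: "\<And>x y. x \<le> y \<Longrightarrow> \<bar>F y - F x\<bar> \<le> 2 * (V y - V x)" for F
    unfolding abs_continuous_on_iff
  proof (intro allI impI)
    fix e :: real assume "0 < e"
    from V_AC[OF half_gt_zero[OF this]] obtain d where d: "0 < d"
      and ac: "\<forall>n A B. disjoint_ivls n A B \<and> (\<Sum>i<n. B i - A i) < d \<longrightarrow> (\<Sum>i<n. V (B i) - V (A i)) < e / 2"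
      by (elim exE conjE) rule
    have "(\<Sum>i<n. \<bar>F (B i) - F (A i)\<bar>) < e" if AB: "disjoint_ivls n A B" "(\<Sum>i<n. B i - A i) < d" for n A B
    proof -
      have "(\<Sum>i<n. \<bar>F (B i) - F (A i)\<bar>) \<le> (\<Sum>i<n. 2 * (V (B i) - V (A i)))"
        using AB(1) by (intro sum_mono F) (auto simp: disjoint_ivls_def)
      also have "\<dots> = 2 * (\<Sum>i<n. V (B i) - V (A i))" by (rule sum_distrib_left[symmetric])
      also have "\<dots> < e" using ac[rule_format, OF conjI, OF AB] by linarith
      finally show ?thesis .
    qed
    then show "\<exists>d>0. \<forall>n A B. disjoint_ivls n A B \<and> (\<forall>i<n. {A i..B i} \<subseteq> UNIV) \<and> (\<Sum>i<n. B i - A i) < d \<longrightarrow>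
        (\<Sum>i<n. \<bar>F (B i) - F (A i)\<bar>) < e"
      using d by blast
  qed
  have AC1: "abs_continuous_on UNIV V" using V_mono by (intro dom) auto
  have AC2: "abs_continuous_on UNIV (\<lambda>x. V x - v x)"
  proof (rule dom)
    fix x y :: real assume xy: "x \<le> y"
    have "V y - v y - (V x - v x) = (V y - V x) - (v y - v x)" by simp
    then show "\<bar>V y - v y - (V x - v x)\<bar> \<le> 2 * (V y - V x)"
      using abs_triangle_ineq4[of "V y - V x" "v y - v x"] ge[OF xy] V_mono[OF xy] Vd[OF xy] by simp
  qed
  obtain D1 where D1: "integrable lborel D1" "\<And>x y. x \<le> y \<Longrightarrow> (LINT z:{x..y}|lborel. D1 z) = V y - V x"
    using mono_AC_density[OF V_mono abs_continuous_on_imp_continuous_on[OF AC1] V_le AC1] by metis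
  have v_le: "\<bar>V x - v x\<bar> \<le> K + (K + \<bar>v 0\<bar>)" for x
  proof -
    have "\<bar>v x - v 0\<bar> \<le> K" using ge[of 0 x] ge[of x 0] varK[of 0 x] varK[of x 0] by (cases "0 \<le> x") auto
    then show ?thesis using V_le[of x] by linarith
  qed
  obtain D2 where D2: "integrable lborel D2" "\<And>x y. x \<le> y \<Longrightarrow> (LINT z:{x..y}|lborel. D2 z) = (V y - v y) - (V x - v x)"
    using mono_AC_density[OF d_mono abs_continuous_on_imp_continuous_on[OF AC2] v_le AC2] by metis
  show thesis
  proof
    show "integrable lborel (\<lambda>z. D1 z - D2 z)" using D1 D2 by simp
    fix x y assume xy: "a \<le> x" "x \<le> y" "y \<le> b"
    have "set_integrable lborel {x..y} D1" "set_integrable lborel {x..y} D2"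
      unfolding set_integrable_def
      by (rule integrable_mult_indicator[OF _ D1(1)], simp, rule integrable_mult_indicator[OF _ D2(1)], simp)
    then have "(LINT z:{x..y}|lborel. D1 z - D2 z) = (LINT z:{x..y}|lborel. D1 z) - (LINT z:{x..y}|lborel. D2 z)"
      by (rule set_integral_diff(2))
    also have "\<dots> = v y - v x" using D1(2)[OF xy(2)] D2(2)[OF xy(2)] by simp
    also have "\<dots> = w y - w x" using xy by (auto simp: v_def c_def)
    finally show "(LINT z:{x..y}|lborel. D1 z - D2 z) = w y - w x" .
  qed
qed

lemma integral_has_derivative_AE_on:
  fixes f W :: "real \<Rightarrow> real"
  assumes f: "f integrable_on {a..b}"
    and W: "\<And>x y. a \<le> x \<Longrightarrow> x \<le> y \<Longrightarrow> y \<le> b \<Longrightarrow> W y - W x = integral {x..y} f"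
  shows "negligible {x \<in> {a<..<b}. \<not> (W has_real_derivative f x) (at x)}"
proof (cases "a < b")
  case True
  define c where "c x = max a (min b x)" for x
  define f' where "f' x = (if x \<in> {a..b} then f x else 0)" for x
  define W' where "W' x = W (c x)" for x
  have f'_int: "f' integrable_on {x..y}" for x y
  proof -
    have "f' = (\<lambda>x. if x \<in> {a..b} then f x else 0)" by (simp add: f'_def fun_eq_iff)
    then have "f' integrable_on UNIV"
      using f Henstock_Kurzweil_Integration.integrable_restrict_UNIV[of "{a..b}" f] by (simp only:)
    then show ?thesis by (rule integrable_on_subinterval) simp
  qed
  have "W' y - W' x = integral {x..y} f'" if "x \<le> y" for x y
  proof -
    have "f' = (\<lambda>x. if x \<in> {a..b} then f x else 0)" by (simp add: f'_def fun_eq_iff)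
    then have "integral {x..y} f' = integral ({a..b} \<inter> {x..y}) f"
      using Henstock_Kurzweil_Integration.integral_restrict_Int[of "{x..y}" "{a..b}" f] by (simp only:)
    also have "{a..b} \<inter> {x..y} = {max x a..min y b}" by auto
    also have "integral {max x a..min y b} f = W' y - W' x"
    proof (cases "max x a \<le> min y b")
      case True
      then have "c x = max x a" "c y = min y b" using that by (auto simp: c_def)
      then show ?thesis using W[of "max x a" "min y b"] True by (simp add: W'_def)
    next
      case False
      then have "c x = c y" using that \<open>a < b\<close> by (auto simp: c_def min_def max_def split: if_splits)
      then show ?thesis using False by (simp add: W'_def)
    qed
    finally show ?thesis by simp
  qed
  then obtain N where N: "negligible N" "\<And>x. x \<notin> N \<Longrightarrow> (W' has_real_derivative f' x) (at x)"
    using indefinite_integral_has_derivative_AE[OF f'_int] by metis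
  have "(W has_real_derivative f x) (at x)" if x: "x \<in> {a<..<b}" "x \<notin> N" for x
  proof -
    have "(W' has_real_derivative f x) (at x)" using N(2)[OF x(2)] x(1) by (simp add: f'_def)
    moreover have "\<forall>\<^sub>F y in nhds x. W' y = W y"
      using eventually_nhds_in_open[of "{a<..<b}" x] x(1)
      by (auto elim!: eventually_mono simp: W'_def c_def)
    ultimately show ?thesis
      using DERIV_cong_ev[of x x W' W "f x" "f x"] by simp
  qed
  then have "{x \<in> {a<..<b}. \<not> (W has_real_derivative f x) (at x)} \<subseteq> N" by blast
  then show ?thesis using N(1) negligible_subset by blast
qed simp

text \<open>The density from the Jordan decomposition is the derivative off a null set. Hence
  \<open>deriv w\<close>, although arbitrary where no derivative exists, is integrable with the
  right integral.\<close>

lemma AC_fundamental_theorem: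
  assumes AC: "abs_continuous_on E w" and ab: "a \<le> b" "{a..b} \<subseteq> E"
  shows "deriv w absolutely_integrable_on {a..b}" "integral {a..b} (deriv w) = w b - w a"
proof -
  obtain D where D: "integrable lborel D"
    "\<And>x y. a \<le> x \<Longrightarrow> x \<le> y \<Longrightarrow> y \<le> b \<Longrightarrow> (LINT z:{x..y}|lborel. D z) = w y - w x"
    using AC_on_Icc_density[OF AC ab] by metis
  have sD: "set_integrable lborel {x..y} D" for x y
    unfolding set_integrable_def by (rule integrable_mult_indicator[OF _ D(1)]) simp
  have aD: "D absolutely_integrable_on {x..y}" for x y
    using sD[of x y] unfolding set_integrable_def by (intro integrable_completion[THEN iffD2]) auto
  have iD: "integral {x..y} D = w y - w x" if "a \<le> x" "x \<le> y" "y \<le> b" for x y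
    using D(2)[OF that] set_borel_integral_eq_integral(2)[OF sD] by simp
  have neg: "negligible {x \<in> {a<..<b}. \<not> (w has_real_derivative D x) (at x)}"
    by (rule integral_has_derivative_AE_on) (use set_borel_integral_eq_integral(1)[OF sD] iD in auto)
  define N where "N = {x \<in> {a<..<b}. \<not> (w has_real_derivative D x) (at x)} \<union> {a, b}"
  have N: "negligible N" unfolding N_def using neg by (simp add: negligible_Un)
  have eq: "deriv w x = D x" if "x \<in> {a..b} - N" for x
    using that by (auto simp: N_def intro: DERIV_imp_deriv)
  show "deriv w absolutely_integrable_on {a..b}"
    by (rule absolutely_integrable_spike[OF aD N]) (use eq in auto)
  show "integral {a..b} (deriv w) = w b - w a"
    using integral_spike[OF N, of "{a..b}" D "deriv w"] eq iD[of a b] ab by simp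
qed

lemma absolutely_integrable_imp_integrable:
  fixes f :: "real \<Rightarrow> real"
  shows "f absolutely_integrable_on S \<Longrightarrow> f integrable_on S"
  by (rule set_lebesgue_integral_eq_integral(1))

lemma absolutely_integrable_on_iff_integrable:
  fixes f :: "real \<Rightarrow> real"
  assumes "S \<in> sets lebesgue"
  shows "f absolutely_integrable_on S \<longleftrightarrow> integrable (lebesgue_on S) f"
  using integrable_restrict_space[of S lebesgue f] assms by (simp add: set_integrable_def)

text \<open>Cut \<open>k\<close> at a height \<open>n\<close> so large that the part above has small
  integral; the part below contributes at most \<open>n\<close> times the total length of the
  intervals.\<close>

lemma abs_continuous_on_if_dominated:
  fixes F k :: "real \<Rightarrow> real"
  assumes S: "S \<in> sets lebesgue" and k: "k absolutely_integrable_on S" "\<And>x. x \<in> S \<Longrightarrow> 0 \<le> k x"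
    and dom: "\<And>a b. a \<le> b \<Longrightarrow> {a..b} \<subseteq> S \<Longrightarrow> \<bar>F b - F a\<bar> \<le> integral {a..b} k"
  shows "abs_continuous_on S F"
  unfolding abs_continuous_on_iff
proof (intro allI impI)
  fix e :: real assume e: "0 < e"
  define K where "K x = indicator S x * k x" for x
  have K: "integrable lebesgue K" "\<And>x. 0 \<le> K x"
  proof -
    have "K = (\<lambda>x. indicator S x *\<^sub>R k x)" by (simp add: K_def fun_eq_iff)
    then show "integrable lebesgue K" using k(1) by (simp only: set_integrable_def)
    show "0 \<le> K x" for x using k(2)[of x] by (simp add: K_def indicator_def)
  qed
  define q where "q n x = K x - min (K x) (real n)" for n x
  have q: "integrable lebesgue (q n)" "\<And>x. 0 \<le> q n x" "\<And>x. q n x \<le> K x" for n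
  proof -
    have m: "integrable lebesgue (\<lambda>x. min (K x) (real n))"
      by (rule Bochner_Integration.integrable_bound[OF K(1)]) (use K in auto)
    show "integrable lebesgue (q n)" unfolding q_def by (intro Bochner_Integration.integrable_diff K m)
    show "\<And>x. 0 \<le> q n x" "\<And>x. q n x \<le> K x" using K(2) by (auto simp: q_def)
  qed
  have "(\<lambda>n. LINT x|lebesgue. q n x) \<longlonglongrightarrow> (LINT x|(lebesgue :: real measure). (0::real))"
  proof (rule integral_dominated_convergence[OF _ _ K(1)])
    show "AE x in lebesgue. (\<lambda>n. q n x) \<longlonglongrightarrow> 0"
    proof (rule AE_I2)
      fix x
      obtain N where N: "K x \<le> real N" using real_arch_simple by blast
      have "\<forall>\<^sub>F n in sequentially. q n x = 0"
        using eventually_ge_at_top[of N] by eventually_elim (use N in \<open>auto simp: q_def\<close>)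
      then show "(\<lambda>n. q n x) \<longlonglongrightarrow> 0" by (rule tendsto_eventually)
    qed
    show "\<And>n. AE x in lebesgue. norm (q n x) \<le> K x" using q by auto
  qed (use q in auto)
  then have "\<forall>\<^sub>F n in sequentially. (LINT x|lebesgue. q n x) < e / 2"
    using e by (intro order_tendstoD) auto
  then obtain n where n: "(LINT x|lebesgue. q n x) < e / 2" by (auto simp: eventually_sequentially)
  \<comment> \<open>The other half of \<open>e\<close> is left for the bounded part;
    \<open>Suc n\<close> keeps the denominator positive.\<close>
  define d where "d = e / (2 * real (Suc n))"
  have d: "0 < d" using e by (simp add: d_def)
  have "(\<Sum>i<m. \<bar>F (b i) - F (a i)\<bar>) < e"
    if ab: "disjoint_ivls m a b" "\<forall>i<m. {a i..b i} \<subseteq> S" "(\<Sum>i<m. b i - a i) < d" for m a b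
  proof -
    have le: "a i \<le> b i" if "i < m" for i using ab that by (simp add: disjoint_ivls_def)
    let ?I = "\<lambda>i. {a i<..<b i}"
    have ind: "integrable lebesgue (\<lambda>x. indicator (?I i) x * f x)" if "integrable lebesgue f" for i and f :: "real \<Rightarrow> real"
      using integrable_mult_indicator[OF _ that, of "?I i"] by simp
    have "\<bar>F (b i) - F (a i)\<bar> \<le> (LINT x|lebesgue. indicator (?I i) x * q n x) + real n * (b i - a i)" if i: "i < m" for i
    proof -
      have indI: "integrable lebesgue (indicator (?I i) :: real \<Rightarrow> real)"
        using lmeasurable_box[of "a i" "b i"] by (simp add: lmeasurable_iff_integrable)
      have sub: "{a i..b i} \<subseteq> S" using ab(2) i by blast
      have ki: "k absolutely_integrable_on {a i..b i}"
        using set_integrable_subset[OF k(1) _ sub] by simp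
      have ki': "k absolutely_integrable_on ?I i"
        by (rule set_integrable_subset[OF ki]) auto
      have "\<bar>F (b i) - F (a i)\<bar> \<le> integral {a i..b i} k" using dom le i sub by blast
      also have "\<dots> = integral (?I i) k" by (rule integral_open_interval_real)
      also have "\<dots> = (LINT x:?I i|lebesgue. k x)" using set_lebesgue_integral_eq_integral(2)[OF ki'] by simp
      also have "\<dots> = (LINT x|lebesgue. indicator (?I i) x * K x)"
        unfolding set_lebesgue_integral_def
      proof (intro Bochner_Integration.integral_cong refl)
        fix x
        show "indicator (?I i) x *\<^sub>R k x = indicator (?I i) x * K x"
          using subsetD[OF sub, of x] by (cases "x \<in> ?I i") (auto simp: K_def)
      qed
      also have "\<dots> \<le> (LINT x|lebesgue. indicator (?I i) x * q n x + real n * indicator (?I i) x)"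
      proof (rule integral_mono)
        show "integrable lebesgue (\<lambda>x. indicator (?I i) x * q n x + real n * indicator (?I i) x)"
          using ind[OF q(1)] indI by auto
      qed (use ind[OF K(1)] in \<open>auto simp: q_def split: split_indicator\<close>)
      also have "\<dots> = (LINT x|lebesgue. indicator (?I i) x * q n x) + (LINT x|lebesgue. real n * indicator (?I i) x)"
        by (rule Bochner_Integration.integral_add) (use ind[OF q(1)] indI in auto)
      also have "(LINT x|lebesgue. real n * indicator (?I i) x) = real n * (b i - a i)"
        using le[OF i] by simp
      finally show ?thesis .
    qed
    then have "(\<Sum>i<m. \<bar>F (b i) - F (a i)\<bar>)
        \<le> (\<Sum>i<m. (LINT x|lebesgue. indicator (?I i) x * q n x) + real n * (b i - a i))"
      by (intro sum_mono) auto
    also have "\<dots> = (LINT x|lebesgue. (\<Sum>i<m. indicator (?I i) x * q n x)) + real n * (\<Sum>i<m. b i - a i)"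
    proof -
      have "(LINT x|lebesgue. (\<Sum>i<m. indicator (?I i) x * q n x)) = (\<Sum>i<m. LINT x|lebesgue. indicator (?I i) x * q n x)"
        by (rule Bochner_Integration.integral_sum) (rule ind[OF q(1)])
      then show ?thesis by (simp only: sum.distrib sum_distrib_left)
    qed
    also have "(LINT x|lebesgue. (\<Sum>i<m. indicator (?I i) x * q n x)) \<le> (LINT x|lebesgue. q n x)"
    proof (rule integral_mono)
      show "integrable lebesgue (\<lambda>x. \<Sum>i<m. indicator (?I i) x * q n x)"
        by (rule Bochner_Integration.integrable_sum) (rule ind[OF q(1)])
      fix x
      \<comment> \<open>At most one of the disjoint open intervals contains \<open>x\<close>, so the
        pieces of the tail integral add up to no more than the whole.\<close>
      have "(\<Sum>i<m. indicator (?I i) x) \<le> (1::real)"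
      proof (cases "\<exists>i<m. x \<in> ?I i")
        case True
        then obtain i where i: "i < m" "x \<in> ?I i" by blast
        have "(\<Sum>j<m. indicator (?I j) x) = (\<Sum>j<m. if j = i then 1 else (0::real))"
        proof (rule sum.cong)
          fix j assume j: "j \<in> {..<m}"
          show "indicator (?I j) x = (if j = i then 1 else (0::real))"
          proof (cases "j = i")
            case False
            then have "?I j \<inter> ?I i = {}" using ab(1) i(1) j unfolding disjoint_ivls_def by blast
            then have "x \<notin> ?I j" using i(2) by blast
            then show ?thesis using False by simp
          qed (use i in simp)
        qed simp
        then show ?thesis using i by simp
      next
        case False
        then have "(\<Sum>j<m. indicator (?I j) x) = (0::real)" by (intro sum.neutral) auto
        then show ?thesis by simp
      qed
      then have "(\<Sum>i<m. indicator (?I i) x) * q n x \<le> 1 * q n x" by (intro mult_right_mono q)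
      then show "(\<Sum>i<m. indicator (?I i) x * q n x) \<le> q n x" by (simp add: sum_distrib_right)
    qed (use q in auto)
    also have "real n * (\<Sum>i<m. b i - a i) \<le> real n * d" using ab(3) by (intro mult_left_mono) auto
    also have "real n * d \<le> e / 2" using e by (simp add: d_def field_simps)
    finally show ?thesis using n by simp
  qed
  then show "\<exists>d>0. \<forall>m a b. disjoint_ivls m a b \<and> (\<forall>i<m. {a i..b i} \<subseteq> S) \<and> (\<Sum>i<m. b i - a i) < d \<longrightarrow>
      (\<Sum>i<m. \<bar>F (b i) - F (a i)\<bar>) < e" using d by blast
qed

section \<open>The transport equation on an interval\<close>

text \<open>With \<open>w = g u\<close>, the equation \<open>lam u - A u = v\<close> becomes
  \<open>w' + \<psi> w = v\<close> for \<open>\<psi> = (lam + \<phi>) / g\<close>, and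
  \<open>\<Psi>\<close> is a primitive of \<open>\<psi>\<close>. Both lam = 0 and lam = 1 are
  needed, for \<open>R0\<close> and for R(1, A).\<close>

locale interval_flow =
  fixes d0 d1 :: ereal and E :: "real set" and \<psi> \<Psi> :: "real \<Rightarrow> real"
  assumes E_def: "E = einterval d0 d1" and d01: "d0 < d1"
    and \<psi>_nonneg: "\<And>x. x \<in> E \<Longrightarrow> 0 \<le> \<psi> x" and \<psi>_meas: "\<psi> \<in> borel_measurable (lebesgue_on E)"
    and \<psi>_int: "\<And>a b. a \<in> E \<Longrightarrow> b \<in> E \<Longrightarrow> \<psi> absolutely_integrable_on {a..b}"
    and \<Psi>: "\<And>x y. x \<in> E \<Longrightarrow> y \<in> E \<Longrightarrow> x \<le> y \<Longrightarrow> \<Psi> y - \<Psi> x = integral {x..y} \<psi>"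
begin

lemma open_E: "open E" and E_lebesgue [measurable]: "E \<in> sets lebesgue"
  by (simp_all add: E_def)

lemma Icc_sub_E: "a \<in> E \<Longrightarrow> b \<in> E \<Longrightarrow> {a..b} \<subseteq> E"
proof
  fix x assume ab: "a \<in> E" "b \<in> E" and x: "x \<in> {a..b}"
  have "d0 < ereal x" using ab(1) x order.strict_trans2[of d0 "ereal a" "ereal x"] by (simp add: E_def einterval_iff)
  moreover have "ereal x < d1" using ab(2) x order.strict_trans1[of "ereal x" "ereal b" d1] by (simp add: E_def einterval_iff)
  ultimately show "x \<in> E" by (simp add: E_def einterval_iff)
qed

lemma E_mem_between: "a \<in> E \<Longrightarrow> b \<in> E \<Longrightarrow> a \<le> x \<Longrightarrow> x \<le> b \<Longrightarrow> x \<in> E"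
  using Icc_sub_E[of a b] by auto

lemma E_nbhd: assumes "x \<in> E" obtains a b where "a \<in> E" "b \<in> E" "a < x" "x < b"
proof -
  obtain e where e: "0 < e" "ball x e \<subseteq> E" using open_E assms by (auto simp: open_contains_ball)
  then have "x - e / 2 \<in> E" "x + e / 2 \<in> E" by (auto simp: subset_iff dist_real_def)
  then show thesis using that e by force
qed

lemma E_exhaustion:
  "\<exists>l u :: nat \<Rightarrow> real. (\<forall>n. l n \<in> E) \<and> (\<forall>n. u n \<in> E) \<and> (\<forall>n. l n < u n) \<and> decseq l \<and> incseq u \<and> E = (\<Union>n. {l n..u n})"
proof (rule einterval_Icc_approximation[OF d01])
  fix u l :: "nat \<Rightarrow> real"
  assume ul: "einterval d0 d1 = (\<Union>i. {l i..u i})" "incseq u" "decseq l" "\<And>i. l i < u i"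
  have "l n \<in> {l n..u n}" "u n \<in> {l n..u n}" for n using ul(4)[of n] by auto
  then have "l n \<in> E" "u n \<in> E" for n unfolding E_def ul(1) by blast+
  then show ?thesis using ul by (intro exI[of _ l] exI[of _ u]) (auto simp: E_def)
qed

lemma \<Psi>_mono: "x \<in> E \<Longrightarrow> y \<in> E \<Longrightarrow> x \<le> y \<Longrightarrow> \<Psi> x \<le> \<Psi> y"
proof -
  assume xy: "x \<in> E" "y \<in> E" "x \<le> y"
  have "0 \<le> integral {x..y} \<psi>"
    by (rule Henstock_Kurzweil_Integration.integral_nonneg[OF absolutely_integrable_imp_integrable[OF \<psi>_int[OF xy(1,2)]]])
      (use Icc_sub_E[OF xy(1,2)] \<psi>_nonneg in blast)
  then show ?thesis using \<Psi>[OF xy] by simp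
qed

lemma continuous_if_increments_integral:
  assumes f: "\<And>a b. a \<in> E \<Longrightarrow> b \<in> E \<Longrightarrow> f integrable_on {a..b}"
    and W: "\<And>x y. x \<in> E \<Longrightarrow> y \<in> E \<Longrightarrow> x \<le> y \<Longrightarrow> W y - W x = integral {x..y} f"
  shows "continuous_on E (W :: real \<Rightarrow> real)"
  unfolding continuous_on_eq_continuous_at[OF open_E]
proof
  fix x assume "x \<in> E"
  then obtain a b where ab: "a \<in> E" "b \<in> E" "a < x" "x < b" by (rule E_nbhd)
  have "continuous_on {a..b} (\<lambda>y. W a + integral {a..y} f)"
    by (intro continuous_intros indefinite_integral_continuous_1 f ab)
  moreover have "W a + integral {a..y} f = W y" if "y \<in> {a..b}" for y
    using W[of a y] E_mem_between[OF ab(1,2), of y] that ab by auto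
  ultimately have "continuous_on {a..b} W" by (rule continuous_on_eq)
  then show "isCont W x" using ab by (auto intro: continuous_on_interior)
qed

lemma continuous_\<Psi>: "continuous_on E \<Psi>"
  by (rule continuous_if_increments_integral[OF absolutely_integrable_imp_integrable[OF \<psi>_int] \<Psi>])

definition Lo :: "real \<Rightarrow> real set" where "Lo x = {y \<in> E. y \<le> x}"

lemma Lo_sub: "Lo x \<subseteq> E" and Lo_lebesgue [measurable]: "Lo x \<in> sets lebesgue"
proof -
  show "Lo x \<subseteq> E" by (auto simp: Lo_def)
  have "Lo x = E \<inter> {..x}" by (auto simp: Lo_def)
  moreover have "E \<inter> {..x} \<in> sets lebesgue" using E_lebesgue by (intro sets.Int) auto
  ultimately show "Lo x \<in> sets lebesgue" by simp
qed

lemma Lo_split: "x \<in> E \<Longrightarrow> y \<in> E \<Longrightarrow> x \<le> y \<Longrightarrow> Lo y = Lo x \<union> {x..y}"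
  using Icc_sub_E[of x y] by (auto simp: Lo_def)

lemma integral_Lo_split:
  fixes f :: "real \<Rightarrow> real"
  assumes "f absolutely_integrable_on Lo y" "x \<in> E" "y \<in> E" "x \<le> y"
  shows "integral (Lo y) f = integral (Lo x) f + integral {x..y} f"
proof -
  have s: "Lo y = Lo x \<union> {x..y}" by (rule Lo_split[OF assms(2-)])
  have "f absolutely_integrable_on Lo x" "f absolutely_integrable_on {x..y}"
    by (rule set_integrable_subset[OF assms(1)]; use s in auto)+
  moreover have "negligible (Lo x \<inter> {x..y})"
    by (rule negligible_subset[of "{x}"]) (auto simp: Lo_def)
  ultimately show ?thesis unfolding s
    by (intro integral_Un absolutely_integrable_imp_integrable)
qed

text \<open>Along the exhaustion the sets \<open>Lo (l n)\<close> shrink to the empty set, so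
  dominated convergence applies.\<close>

lemma integral_Lo_small:
  fixes v :: "real \<Rightarrow> real"
  assumes v: "v absolutely_integrable_on E" and e: "0 < e"
  shows "\<exists>c\<in>E. \<forall>x\<in>E. x < c \<longrightarrow> integral (Lo x) (\<lambda>y. \<bar>v y\<bar>) < e"
proof -
  from E_exhaustion obtain l u :: "nat \<Rightarrow> real" where lu: "\<forall>n. l n \<in> E" "\<forall>n. u n \<in> E" "\<forall>n. l n < u n"
      "decseq l" "incseq u" "E = (\<Union>n. {l n..u n})"
    by (elim exE conjE) rule
  note lu = lu(1-3)[rule_format] lu(4-)
  define V where "V x = indicator E x * \<bar>v x\<bar>" for x
  have V: "integrable lebesgue V"
    using set_integrable_abs[OF v] by (simp add: set_integrable_def V_def[abs_def])
  have av: "(\<lambda>y. \<bar>v y\<bar>) absolutely_integrable_on Lo x" for x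
    using set_integrable_subset[OF set_integrable_abs[OF v] _ Lo_sub] by simp
  have eq: "integral (Lo x) (\<lambda>y. \<bar>v y\<bar>) = (LINT y|lebesgue. indicator (Lo x) y * V y)" for x
  proof -
    have "integral (Lo x) (\<lambda>y. \<bar>v y\<bar>) = (LINT y:Lo x|lebesgue. \<bar>v y\<bar>)"
      using set_lebesgue_integral_eq_integral(2)[OF av] by simp
    also have "\<dots> = (LINT y|lebesgue. indicator (Lo x) y * V y)"
      unfolding set_lebesgue_integral_def
      by (intro Bochner_Integration.integral_cong) (auto simp: V_def Lo_def split: split_indicator)
    finally show ?thesis .
  qed
  have "(\<lambda>n. LINT y|lebesgue. indicator (Lo (l n)) y * V y) \<longlonglongrightarrow> (LINT y|(lebesgue::real measure). (0::real))"
  proof (rule integral_dominated_convergence[OF _ _ V])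
    show "AE y in lebesgue. (\<lambda>n. indicator (Lo (l n)) y * V y) \<longlonglongrightarrow> 0"
    proof (rule AE_I2)
      fix y
      show "(\<lambda>n. indicator (Lo (l n)) y * V y) \<longlonglongrightarrow> 0"
      proof (cases "y \<in> E")
        case True
        then obtain a b where a: "a \<in> E" "b \<in> E" "a < y" "y < b" by (rule E_nbhd)
        then obtain N where "l N \<le> a" using lu(6) by auto
        then have "indicator (Lo (l n)) y * V y = 0" if "n \<ge> N" for n
          using decseqD[OF lu(4) that] a by (auto simp: Lo_def)
        then show ?thesis by (intro tendsto_eventually) (auto simp: eventually_sequentially)
      qed (simp add: V_def)
    qed
    show "AE y in lebesgue. norm (indicator (Lo (l n)) y * V y) \<le> V y" for n
      by (auto simp: V_def split: split_indicator)
    show "(\<lambda>y. indicator (Lo (l n)) y * V y) \<in> borel_measurable lebesgue" for n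
      using V by measurable
  qed auto
  then have "\<forall>\<^sub>F n in sequentially. (LINT y|lebesgue. indicator (Lo (l n)) y * V y) < e"
    using e by (intro order_tendstoD) auto
  then obtain n where n: "integral (Lo (l n)) (\<lambda>y. \<bar>v y\<bar>) < e" by (auto simp: eventually_sequentially eq)
  have "integral (Lo x) (\<lambda>y. \<bar>v y\<bar>) < e" if "x < l n" for x
  proof -
    have "integral (Lo x) (\<lambda>y. \<bar>v y\<bar>) \<le> integral (Lo (l n)) (\<lambda>y. \<bar>v y\<bar>)"
      using that by (intro integral_subset_le absolutely_integrable_imp_integrable av) (auto simp: Lo_def)
    then show ?thesis using n by simp
  qed
  then show ?thesis using lu(1)[of n] by blast
qed

text \<open>Variation of constants for \<open>w' + \<psi> w = v\<close> with \<open>w\<close>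
  tending to 0 at the lower end. Keeping both exponents together bounds the kernel by 1, however
  \<open>\<Psi>\<close> behaves near that end.\<close>

definition sol :: "(real \<Rightarrow> real) \<Rightarrow> real \<Rightarrow> real" where
  "sol v x = integral (Lo x) (\<lambda>y. exp (\<Psi> y - \<Psi> x) * v y)"

context
  fixes v :: "real \<Rightarrow> real"
  assumes v: "v absolutely_integrable_on E"
begin

lemma v_Lo: "v absolutely_integrable_on Lo x"
  using set_integrable_subset[OF v _ Lo_sub] by simp

lemma v_Icc: "a \<in> E \<Longrightarrow> b \<in> E \<Longrightarrow> v absolutely_integrable_on {a..b}"
  using set_integrable_subset[OF v _ Icc_sub_E] by simp

lemma exp_v_int: assumes "x \<in> E" shows "(\<lambda>y. exp (\<Psi> y - c) * v y) absolutely_integrable_on Lo x"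
proof (rule absolutely_integrable_bounded_measurable_product_real[OF _ Lo_lebesgue _ v_Lo])
  have "continuous_on (Lo x) (\<lambda>y. exp (\<Psi> y - c))"
    by (intro continuous_intros continuous_on_subset[OF continuous_\<Psi> Lo_sub])
  then show "(\<lambda>y. exp (\<Psi> y - c)) \<in> borel_measurable (lebesgue_on (Lo x))"
    by (rule continuous_imp_measurable_on_sets_lebesgue[OF _ Lo_lebesgue])
  show "bounded ((\<lambda>y. exp (\<Psi> y - c)) ` Lo x)"
    using assms \<Psi>_mono by (intro boundedI[of _ "exp (\<Psi> x - c)"]) (auto simp: Lo_def)
qed

lemma sol_eq: "sol v x = exp (- \<Psi> x) * integral (Lo x) (\<lambda>y. exp (\<Psi> y) * v y)"
  unfolding sol_def by (subst integral_mult_right[symmetric]) (simp add: exp_diff exp_minus field_simps)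

lemma abs_sol_le: assumes "x \<in> E" shows "\<bar>sol v x\<bar> \<le> integral (Lo x) (\<lambda>y. \<bar>v y\<bar>)"
proof -
  have "norm (integral (Lo x) (\<lambda>y. exp (\<Psi> y - \<Psi> x) * v y)) \<le> integral (Lo x) (\<lambda>y. \<bar>v y\<bar>)"
  proof (rule Henstock_Kurzweil_Integration.integral_norm_bound_integral)
    show "(\<lambda>y. exp (\<Psi> y - \<Psi> x) * v y) integrable_on Lo x"
      by (rule absolutely_integrable_imp_integrable[OF exp_v_int[OF assms]])
    show "(\<lambda>y. \<bar>v y\<bar>) integrable_on Lo x"
      by (rule absolutely_integrable_imp_integrable[OF set_integrable_abs[OF v_Lo]])
    fix y assume "y \<in> Lo x"
    then have "exp (\<Psi> y - \<Psi> x) \<le> 1" using \<Psi>_mono[of y x] assms by (auto simp: Lo_def)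
    then show "norm (exp (\<Psi> y - \<Psi> x) * v y) \<le> \<bar>v y\<bar>"
      using mult_right_mono[of "exp (\<Psi> y - \<Psi> x)" 1 "\<bar>v y\<bar>"] by (simp add: abs_mult)
  qed
  then show ?thesis by (simp add: sol_def)
qed

lemma sol_tendsto_0: "0 < e \<Longrightarrow> \<exists>c\<in>E. \<forall>x\<in>E. x < c \<longrightarrow> \<bar>sol v x\<bar> < e"
proof -
  assume "0 < e"
  from integral_Lo_small[OF v this] obtain c where c: "c \<in> E" "\<And>x. x \<in> E \<Longrightarrow> x < c \<Longrightarrow> integral (Lo x) (\<lambda>y. \<bar>v y\<bar>) < e"
    by blast
  have "\<bar>sol v x\<bar> < e" if "x \<in> E" "x < c" for x using c(2)[OF that] abs_sol_le[OF that(1)] by simp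
  then show ?thesis using c(1) by blast
qed

text \<open>\<open>sol v\<close> is \<open>exp (- \<Psi>)\<close> times an indefinite integral. The
  product rule holds only almost everywhere, so absolute continuity has to be shown first, through
  an integrable bound on increments, before the derivative may be integrated back.\<close>

lemma sol_increment:
  assumes ab: "a \<in> E" "b \<in> E" "a \<le> b"
  shows "(\<lambda>y. v y - \<psi> y * sol v y) absolutely_integrable_on {a..b}"
    "sol v b - sol v a = integral {a..b} (\<lambda>y. v y - \<psi> y * sol v y)"
proof -
  let ?h = "\<lambda>y. exp (\<Psi> y) * v y"
  define U where "U x = integral (Lo x) ?h" for x
  have E: "x \<in> E" if "x \<in> {a..b}" for x using that Icc_sub_E[OF ab(1,2)] by blast
  have h_Lo: "?h absolutely_integrable_on Lo x" if "x \<in> E" for x using exp_v_int[OF that, of 0] by simp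
  have h_int: "?h absolutely_integrable_on {x..y}" if "x \<in> E" "y \<in> E" "x \<le> y" for x y
    by (rule set_integrable_subset[OF h_Lo[OF that(2)]]) (use Lo_split[OF that] in auto)
  have U_inc: "U y - U x = integral {x..y} ?h" if "x \<in> E" "y \<in> E" "x \<le> y" for x y
    unfolding U_def using integral_Lo_split[OF h_Lo[OF that(2)] that] by simp
  have U_le: "\<bar>U x\<bar> \<le> exp (\<Psi> b) * integral (Lo b) (\<lambda>y. \<bar>v y\<bar>)" if x: "x \<in> {a..b}" for x
  proof -
    have "U x = exp (\<Psi> x) * sol v x" by (simp add: sol_eq U_def flip: mult.assoc exp_add)
    then have "\<bar>U x\<bar> = exp (\<Psi> x) * \<bar>sol v x\<bar>" by (simp add: abs_mult)
    also have "\<dots> \<le> exp (\<Psi> b) * integral (Lo b) (\<lambda>y. \<bar>v y\<bar>)"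
    proof (rule mult_mono)
      show "exp (\<Psi> x) \<le> exp (\<Psi> b)" using \<Psi>_mono E x ab by auto
      have "integral (Lo x) (\<lambda>y. \<bar>v y\<bar>) \<le> integral (Lo b) (\<lambda>y. \<bar>v y\<bar>)"
        using x by (intro integral_subset_le absolutely_integrable_imp_integrable set_integrable_abs v_Lo) (auto simp: Lo_def)
      then show "\<bar>sol v x\<bar> \<le> integral (Lo b) (\<lambda>y. \<bar>v y\<bar>)" using abs_sol_le[OF E[OF x]] by simp
    qed auto
    finally show ?thesis .
  qed
  define M where "M = exp (\<Psi> b) * integral (Lo b) (\<lambda>y. \<bar>v y\<bar>)"
  have M: "0 \<le> M" using U_le[of a] ab by (auto simp: M_def)
  \<comment> \<open>One term for the increment of each factor, the other factor being bounded on
    \<open>{a..b}\<close>: \<open>exp (- \<Psi>)\<close> by its value at \<open>a\<close>, and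
    \<open>U\<close> by \<open>M\<close>.\<close>
  define k where "k y = exp (- \<Psi> a) * \<bar>?h y\<bar> + (M * exp (- \<Psi> a)) * \<psi> y" for y
  have k_int: "k absolutely_integrable_on {x..y}" if "x \<in> E" "y \<in> E" "x \<le> y" for x y
    unfolding k_def using h_int[OF that] \<psi>_int[OF that(1,2)]
    by (intro set_integral_add set_integrable_mult_right set_integrable_abs) auto
  have exp_lip: "\<bar>exp (- \<Psi> y) - exp (- \<Psi> x)\<bar> \<le> exp (- \<Psi> a) * (\<Psi> y - \<Psi> x)" if xy: "x \<in> {a..b}" "y \<in> {a..b}" "x \<le> y" for x y
  proof -
    have 1: "\<Psi> x \<le> \<Psi> y" "\<Psi> a \<le> \<Psi> x" using \<Psi>_mono E xy ab by auto
    have "exp (- \<Psi> x) - exp (- \<Psi> y) = exp (- \<Psi> x) * (1 - exp (- (\<Psi> y - \<Psi> x)))"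
      by (simp add: right_diff_distrib flip: exp_add)
    also have "\<dots> \<le> exp (- \<Psi> a) * (\<Psi> y - \<Psi> x)"
    proof (rule mult_mono)
      show "1 - exp (- (\<Psi> y - \<Psi> x)) \<le> \<Psi> y - \<Psi> x"
        using exp_ge_add_one_self[of "- (\<Psi> y - \<Psi> x)"] by linarith
    qed (use 1 in auto)
    finally show ?thesis using 1 by simp
  qed
  have AC: "abs_continuous_on {a..b} (sol v)"
  proof (rule abs_continuous_on_if_dominated[of _ k])
    show "k absolutely_integrable_on {a..b}" by (rule k_int[OF ab])
    show "0 \<le> k x" if "x \<in> {a..b}" for x using M \<psi>_nonneg[OF E[OF that]] by (simp add: k_def)
    fix x y assume xy: "x \<le> y" "{x..y} \<subseteq> {a..b}"
    then have x: "x \<in> {a..b}" and y: "y \<in> {a..b}" by auto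
    have "sol v y - sol v x = exp (- \<Psi> y) * (U y - U x) + (exp (- \<Psi> y) - exp (- \<Psi> x)) * U x"
      by (simp add: sol_eq U_def algebra_simps)
    then have "\<bar>sol v y - sol v x\<bar> \<le> exp (- \<Psi> y) * \<bar>U y - U x\<bar> + \<bar>exp (- \<Psi> y) - exp (- \<Psi> x)\<bar> * \<bar>U x\<bar>"
      using abs_triangle_ineq[of "exp (- \<Psi> y) * (U y - U x)" "(exp (- \<Psi> y) - exp (- \<Psi> x)) * U x"]
      by (simp add: abs_mult)
    also have "exp (- \<Psi> y) * \<bar>U y - U x\<bar> \<le> exp (- \<Psi> a) * integral {x..y} (\<lambda>y. \<bar>?h y\<bar>)"
    proof (rule mult_mono)
      show "exp (- \<Psi> y) \<le> exp (- \<Psi> a)" using \<Psi>_mono E y ab by auto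
      have hi: "?h absolutely_integrable_on {x..y}" by (rule h_int[OF E[OF x] E[OF y] xy(1)])
      show "\<bar>U y - U x\<bar> \<le> integral {x..y} (\<lambda>y. \<bar>?h y\<bar>)"
        unfolding U_inc[OF E[OF x] E[OF y] xy(1)] real_norm_def[symmetric]
        by (rule Henstock_Kurzweil_Integration.integral_norm_bound_integral)
          (use hi set_integrable_abs[OF hi] in \<open>auto intro: absolutely_integrable_imp_integrable\<close>)
    qed auto
    also have "\<bar>exp (- \<Psi> y) - exp (- \<Psi> x)\<bar> * \<bar>U x\<bar> \<le> (exp (- \<Psi> a) * (\<Psi> y - \<Psi> x)) * M"
      using exp_lip[OF x y xy(1)] U_le[OF x] \<Psi>_mono[OF E[OF x] E[OF y] xy(1)] by (intro mult_mono) (auto simp: M_def)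
    also have "\<Psi> y - \<Psi> x = integral {x..y} \<psi>" by (rule \<Psi>[OF E[OF x] E[OF y] xy(1)])
    also have "exp (- \<Psi> a) * integral {x..y} (\<lambda>y. \<bar>?h y\<bar>) + exp (- \<Psi> a) * integral {x..y} \<psi> * M = integral {x..y} k"
    proof -
      have hi: "(\<lambda>y. \<bar>?h y\<bar>) integrable_on {x..y}" "\<psi> integrable_on {x..y}"
        using set_integrable_abs[OF h_int[OF E[OF x] E[OF y] xy(1)]] \<psi>_int[OF E[OF x] E[OF y]]
        by (auto intro: absolutely_integrable_imp_integrable)
      have "integral {x..y} k = integral {x..y} (\<lambda>y. exp (- \<Psi> a) * \<bar>?h y\<bar>) + integral {x..y} (\<lambda>y. (M * exp (- \<Psi> a)) * \<psi> y)"
        unfolding k_def by (rule Henstock_Kurzweil_Integration.integral_add) (use hi in \<open>auto intro!: integrable_on_mult_right\<close>)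
      then show ?thesis by simp
    qed
    finally show "\<bar>sol v y - sol v x\<bar> \<le> integral {x..y} k" by simp
  qed simp
  have negU: "negligible {x \<in> {a<..<b}. \<not> (U has_real_derivative ?h x) (at x)}"
  proof (rule integral_has_derivative_AE_on)
    show "?h integrable_on {a..b}" by (rule absolutely_integrable_imp_integrable[OF h_int[OF ab]])
    show "U y - U x = integral {x..y} ?h" if "a \<le> x" "x \<le> y" "y \<le> b" for x y
      using U_inc[of x y] E that by auto
  qed
  have neg\<Psi>: "negligible {x \<in> {a<..<b}. \<not> (\<Psi> has_real_derivative \<psi> x) (at x)}"
  proof (rule integral_has_derivative_AE_on)
    show "\<psi> integrable_on {a..b}" by (rule absolutely_integrable_imp_integrable[OF \<psi>_int[OF ab(1,2)]])
    show "\<Psi> y - \<Psi> x = integral {x..y} \<psi>" if "a \<le> x" "x \<le> y" "y \<le> b" for x y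
      using \<Psi>[of x y] E that by auto
  qed
  define N where "N = {x \<in> {a<..<b}. \<not> (U has_real_derivative ?h x) (at x)} \<union>
      {x \<in> {a<..<b}. \<not> (\<Psi> has_real_derivative \<psi> x) (at x)} \<union> {a, b}"
  have N: "negligible N" unfolding N_def using negU neg\<Psi> by (simp add: negligible_Un)
  have der: "v x - \<psi> x * sol v x = deriv (sol v) x" if "x \<in> {a..b} - N" for x
  proof -
    have d: "(U has_real_derivative ?h x) (at x)" "(\<Psi> has_real_derivative \<psi> x) (at x)"
      using that by (auto simp: N_def)
    have "((\<lambda>x. exp (- \<Psi> x) * U x) has_real_derivative
        exp (- \<Psi> x) * (- \<psi> x) * U x + exp (- \<Psi> x) * (exp (\<Psi> x) * v x)) (at x)"
      using d by (auto intro!: derivative_eq_intros)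
    moreover have "exp (- \<Psi> x) * (- \<psi> x) * U x + exp (- \<Psi> x) * (exp (\<Psi> x) * v x) = v x - \<psi> x * sol v x"
      by (simp add: sol_eq U_def exp_minus field_simps)
    ultimately have "((\<lambda>x. exp (- \<Psi> x) * U x) has_real_derivative v x - \<psi> x * sol v x) (at x)" by simp
    moreover have "(\<lambda>x. exp (- \<Psi> x) * U x) = sol v" by (simp add: sol_eq U_def fun_eq_iff)
    ultimately show ?thesis by (simp add: DERIV_imp_deriv)
  qed
  show "(\<lambda>y. v y - \<psi> y * sol v y) absolutely_integrable_on {a..b}"
    by (rule absolutely_integrable_spike[OF AC_fundamental_theorem(1)[OF AC ab(3) order_refl] N]) (use der in auto)
  show "sol v b - sol v a = integral {a..b} (\<lambda>y. v y - \<psi> y * sol v y)"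
    unfolding AC_fundamental_theorem(2)[OF AC ab(3) order_refl, symmetric]
    by (rule integral_spike[OF N]) (use der in auto)
qed

lemma \<psi>_sol_Icc: assumes "a \<in> E" "b \<in> E" shows "(\<lambda>y. \<psi> y * sol v y) absolutely_integrable_on {a..b}"
proof (cases "a \<le> b")
  case True
  have "(\<lambda>y. v y - (v y - \<psi> y * sol v y)) absolutely_integrable_on {a..b}"
    by (rule set_integral_diff(1)[OF v_Icc[OF assms] sol_increment(1)[OF assms True]])
  then show ?thesis by simp
qed simp

lemma sol_has_derivative_AE: "negligible {x \<in> E. \<not> (sol v has_real_derivative v x - \<psi> x * sol v x) (at x)}"
proof -
  from E_exhaustion obtain l u :: "nat \<Rightarrow> real" where lu: "\<forall>n. l n \<in> E" "\<forall>n. u n \<in> E" "\<forall>n. l n < u n"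
      "decseq l" "incseq u" "E = (\<Union>n. {l n..u n})"
    by (elim exE conjE) rule
  note lu = lu(1-3)[rule_format] lu(4-)
  let ?bad = "\<lambda>x. \<not> (sol v has_real_derivative v x - \<psi> x * sol v x) (at x)"
  have "negligible {x \<in> {l n<..<u n}. ?bad x}" for n
  proof (rule integral_has_derivative_AE_on)
    have E: "x \<in> E" if "l n \<le> x" "x \<le> u n" for x using that Icc_sub_E[OF lu(1)[of n] lu(2)[of n]] by auto
    show "(\<lambda>y. v y - \<psi> y * sol v y) integrable_on {l n..u n}"
      by (rule absolutely_integrable_imp_integrable[OF sol_increment(1)]) (use lu in \<open>auto intro: less_imp_le\<close>)
    show "sol v y - sol v x = integral {x..y} (\<lambda>y. v y - \<psi> y * sol v y)" if "l n \<le> x" "x \<le> y" "y \<le> u n" for x y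
      by (rule sol_increment(2)) (use E that in auto)
  qed
  then have "negligible (\<Union>n. {x \<in> {l n<..<u n}. ?bad x} \<union> {l n, u n})"
    by (intro negligible_countable_Union) (auto intro!: negligible_Un)
  moreover have "{x \<in> E. ?bad x} \<subseteq> (\<Union>n. {x \<in> {l n<..<u n}. ?bad x} \<union> {l n, u n})"
  proof
    fix x assume x: "x \<in> {x \<in> E. ?bad x}"
    then obtain n where "x \<in> {l n..u n}" using lu(6) by blast
    then have "x \<in> {x \<in> {l n<..<u n}. ?bad x} \<union> {l n, u n}" using x by (auto simp: order.order_iff_strict)
    then show "x \<in> (\<Union>n. {x \<in> {l n<..<u n}. ?bad x} \<union> {l n, u n})" by (rule UN_I[OF UNIV_I])
  qed
  ultimately show ?thesis by (rule negligible_subset)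
qed

lemma continuous_sol: "continuous_on E (sol v)"
proof (rule continuous_if_increments_integral[OF _ sol_increment(2)])
  show "(\<lambda>y. v y - \<psi> y * sol v y) integrable_on {a..b}" if "a \<in> E" "b \<in> E" for a b
    using absolutely_integrable_imp_integrable[OF sol_increment(1)[OF that]] by (cases "a \<le> b") auto
qed

end


lemma sol_cong:
  assumes "negligible {x \<in> E. v x \<noteq> v' x}" shows "sol v x = sol v' x"
  unfolding sol_def by (rule integral_spike[OF assms]) (use Lo_sub in auto)

lemma integral_exhaustion:
  fixes f :: "real \<Rightarrow> real" and l u :: "nat \<Rightarrow> real"
  assumes f: "f absolutely_integrable_on E" and lu: "decseq l" "incseq u" "E = (\<Union>n. {l n..u n})"
  shows "(\<lambda>n. integral {l n..u n} f) \<longlonglongrightarrow> integral E f"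
proof -
  let ?f = "\<lambda>n x. if x \<in> {l n..u n} then f x else 0"
  have fn: "f absolutely_integrable_on {l n..u n}" for n
    by (rule set_integrable_subset[OF f]) (use lu(3) in auto)
  have sub: "{l n..u n} \<subseteq> E" for n using lu(3) by blast
  have "(\<lambda>n. integral E (?f n)) \<longlonglongrightarrow> integral E f"
  proof (rule dominated_convergence(2))
    show "?f n integrable_on E" for n
      using absolutely_integrable_imp_integrable[OF fn, of n] sub[of n]
      by (subst Henstock_Kurzweil_Integration.integrable_restrict_Int) (auto simp: Int_absorb2)
    show "(\<lambda>x. \<bar>f x\<bar>) integrable_on E" by (rule absolutely_integrable_imp_integrable[OF set_integrable_abs[OF f]])
    show "norm (?f n x) \<le> \<bar>f x\<bar>" for n x by simp
    show "(\<lambda>n. ?f n x) \<longlonglongrightarrow> f x" if x: "x \<in> E" for x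
    proof -
      obtain N where N: "x \<in> {l N..u N}" using x lu(3) by blast
      have "?f n x = f x" if "n \<ge> N" for n
        using N decseqD[OF lu(1) that] incseqD[OF lu(2) that] by auto
      then show ?thesis by (intro tendsto_eventually eventually_sequentiallyI[of N])
    qed
  qed
  moreover have "integral E (?f n) = integral {l n..u n} f" for n
    using Henstock_Kurzweil_Integration.integral_restrict_Int[of E "{l n..u n}" f] sub[of n] by (simp add: Int_absorb2)
  ultimately show ?thesis by simp
qed

lemma sol_nonneg:
  assumes v: "v absolutely_integrable_on E" "\<And>y. y \<in> E \<Longrightarrow> 0 \<le> v y" and x: "x \<in> E"
  shows "0 \<le> sol v x"
  unfolding sol_def
  by (rule Henstock_Kurzweil_Integration.integral_nonneg[OF absolutely_integrable_imp_integrable[OF exp_v_int[OF v(1) x]]])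
    (auto intro!: mult_nonneg_nonneg v(2) dest: subsetD[OF Lo_sub])

text \<open>Integrating \<open>w' = v - \<psi> w\<close> over a compact interval gives
  \<open>\<psi> w\<close> at most the mass of \<open>v\<close> there plus the value of
  \<open>w\<close> at the left end, and that value is at most the mass of \<open>v\<close> further
  left. Monotone convergence exhausts \<open>E\<close>.\<close>

lemma \<psi>_sol_nonneg_int:
  assumes v: "v absolutely_integrable_on E" "\<And>y. y \<in> E \<Longrightarrow> 0 \<le> v y"
  shows "(\<lambda>y. \<psi> y * sol v y) absolutely_integrable_on E" "integral E (\<lambda>y. \<psi> y * sol v y) \<le> integral E v"
proof -
  from E_exhaustion obtain l u :: "nat \<Rightarrow> real" where lu: "\<forall>n. l n \<in> E" "\<forall>n. u n \<in> E" "\<forall>n. l n < u n"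
      "decseq l" "incseq u" "E = (\<Union>n. {l n..u n})"
    by (elim exE conjE) rule
  note lu = lu(1-3)[rule_format] lu(4-)
  let ?h = "\<lambda>y. \<psi> y * sol v y"
  let ?f = "\<lambda>n x. if x \<in> {l n..u n} then ?h x else 0"
  have h0: "0 \<le> ?h x" if "x \<in> E" for x using \<psi>_nonneg sol_nonneg[OF v] that by simp
  have hn: "?h absolutely_integrable_on {l n..u n}" for n by (rule \<psi>_sol_Icc[OF v(1) lu(1,2)])
  have sub: "{l n..u n} \<subseteq> E" for n by (rule Icc_sub_E[OF lu(1,2)])
  have eq: "integral E (?f n) = integral {l n..u n} ?h" for n
    using Henstock_Kurzweil_Integration.integral_restrict_Int[of E "{l n..u n}" ?h] sub[of n] by (simp add: Int_absorb2)
  have bound: "integral {l n..u n} ?h \<le> integral E v" for n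
  proof -
    have vi: "v absolutely_integrable_on {l n..u n}" by (rule v_Icc[OF v(1) lu(1,2)])
    have "sol v (u n) - sol v (l n) = integral {l n..u n} v - integral {l n..u n} ?h"
      unfolding sol_increment(2)[OF v(1) lu(1,2) less_imp_le[OF lu(3)]]
      by (rule Henstock_Kurzweil_Integration.integral_diff) (use vi hn in \<open>auto intro: absolutely_integrable_imp_integrable\<close>)
    moreover have "0 \<le> sol v (u n)" by (rule sol_nonneg[OF v lu(2)])
    moreover have "sol v (l n) \<le> integral (Lo (l n)) v"
    proof -
      have "integral (Lo (l n)) (\<lambda>y. \<bar>v y\<bar>) = integral (Lo (l n)) v"
        by (intro Henstock_Kurzweil_Integration.integral_cong abs_of_nonneg v(2) subsetD[OF Lo_sub])
      then show ?thesis using abs_sol_le[OF v(1) lu(1), of n] by simp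
    qed
    moreover have "integral (Lo (l n)) v + integral {l n..u n} v = integral (Lo (u n)) v"
      by (rule integral_Lo_split[symmetric, OF v_Lo[OF v(1)] lu(1,2) less_imp_le[OF lu(3)]])
    moreover have "integral (Lo (u n)) v \<le> integral E v"
      by (intro integral_subset_le absolutely_integrable_imp_integrable v_Lo[OF v(1)] v(1) Lo_sub) (use v(2) in auto)
    ultimately show ?thesis by linarith
  qed
  have "?h integrable_on E \<and> (\<lambda>n. integral E (?f n)) \<longlonglongrightarrow> integral E ?h"
  proof (rule monotone_convergence_increasing)
    show "?f n integrable_on E" for n
      using absolutely_integrable_imp_integrable[OF hn, of n] sub[of n]
      by (subst Henstock_Kurzweil_Integration.integrable_restrict_Int) (auto simp: Int_absorb2)
    show "?f n x \<le> ?f (Suc n) x" if x: "x \<in> E" for n x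
      using h0[OF x] decseq_SucD[OF lu(4), of n] incseq_SucD[OF lu(5), of n] by auto
    show "(\<lambda>n. ?f n x) \<longlonglongrightarrow> ?h x" if x: "x \<in> E" for x
    proof -
      obtain N where N: "x \<in> {l N..u N}" using x lu(6) by blast
      have "?f n x = ?h x" if "n \<ge> N" for n
        using N decseqD[OF lu(4) that] incseqD[OF lu(5) that] by auto
      then show ?thesis by (intro tendsto_eventually eventually_sequentiallyI[of N])
    qed
    have "\<bar>integral E (?f n)\<bar> \<le> integral E v" for n
    proof -
      have "0 \<le> integral {l n..u n} ?h"
        by (rule Henstock_Kurzweil_Integration.integral_nonneg[OF absolutely_integrable_imp_integrable[OF hn]])
          (use h0 sub in blast)
      then show ?thesis using bound[of n] unfolding eq by simp
    qed
    then show "bounded (range (\<lambda>n. integral E (?f n)))" by (intro boundedI[of _ "integral E v"]) auto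
  qed
  then have h: "?h integrable_on E" "(\<lambda>n. integral E (?f n)) \<longlonglongrightarrow> integral E ?h" by auto
  show "?h absolutely_integrable_on E" by (rule nonnegative_absolutely_integrable_1[OF h(1) h0])
  show "integral E ?h \<le> integral E v"
    by (rule LIMSEQ_le_const2[OF h(2)]) (use bound eq in auto)
qed

lemma abs_sol_le_sol_abs:
  assumes v: "v absolutely_integrable_on E" and x: "x \<in> E"
  shows "\<bar>sol v x\<bar> \<le> sol (\<lambda>y. \<bar>v y\<bar>) x"
  unfolding sol_def real_norm_def[symmetric]
  by (rule Henstock_Kurzweil_Integration.integral_norm_bound_integral)
    (use exp_v_int[OF v x] exp_v_int[OF set_integrable_abs[OF v] x] in
      \<open>auto intro: absolutely_integrable_imp_integrable simp: abs_mult\<close>)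

lemma \<psi>_sol_int:
  assumes v: "v absolutely_integrable_on E"
  shows "(\<lambda>y. \<psi> y * sol v y) absolutely_integrable_on E"
proof (rule measurable_bounded_by_integrable_imp_absolutely_integrable)
  have "sol v \<in> borel_measurable (lebesgue_on E)"
    by (rule continuous_imp_measurable_on_sets_lebesgue[OF continuous_sol[OF v] E_lebesgue])
  then show "(\<lambda>y. \<psi> y * sol v y) \<in> borel_measurable (lebesgue_on E)" using \<psi>_meas by measurable
  show "E \<in> sets lebesgue" by (rule E_lebesgue)
  show "(\<lambda>y. \<psi> y * sol (\<lambda>y. \<bar>v y\<bar>) y) integrable_on E"
    by (rule absolutely_integrable_imp_integrable[OF \<psi>_sol_nonneg_int(1)[OF set_integrable_abs[OF v]]]) auto
  show "norm (\<psi> x * sol v x) \<le> \<psi> x * sol (\<lambda>y. \<bar>v y\<bar>) x" if "x \<in> E" for x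
    using abs_sol_le_sol_abs[OF v that] \<psi>_nonneg[OF that] by (simp add: abs_mult mult_left_mono)
qed

text \<open>The derivative is integrable over all of \<open>E\<close> because
  \<open>\<psi> * sol v\<close> is; this turns absolute continuity on compact intervals into the
  form on \<open>E\<close> that \<open>A_graph\<close> demands.\<close>

lemma abs_continuous_on_sol:
  assumes v: "v absolutely_integrable_on E"
  shows "abs_continuous_on E (sol v)"
proof (rule abs_continuous_on_if_dominated[OF E_lebesgue])
  have "(\<lambda>y. v y - \<psi> y * sol v y) absolutely_integrable_on E"
    by (rule set_integral_diff(1)[OF v \<psi>_sol_int[OF v]])
  then show "(\<lambda>y. \<bar>v y - \<psi> y * sol v y\<bar>) absolutely_integrable_on E" by (rule set_integrable_abs)
  fix a b :: real assume ab: "a \<le> b" "{a..b} \<subseteq> E"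
  then have E: "a \<in> E" "b \<in> E" by auto
  have ai: "(\<lambda>y. v y - \<psi> y * sol v y) absolutely_integrable_on {a..b}"
    by (rule sol_increment(1)[OF v E ab(1)])
  show "\<bar>sol v b - sol v a\<bar> \<le> integral {a..b} (\<lambda>y. \<bar>v y - \<psi> y * sol v y\<bar>)"
    unfolding sol_increment(2)[OF v E ab(1)] real_norm_def[symmetric]
    by (rule Henstock_Kurzweil_Integration.integral_norm_bound_integral)
      (use ai set_integrable_abs[OF ai] in \<open>auto intro: absolutely_integrable_imp_integrable\<close>)
qed simp

text \<open>A solution of \<open>H' = - \<psi> H\<close> cannot rise while it is positive. So to the
  right of the last point with \<open>H \<le> m\<close> it is at least \<open>H x1\<close>, which
  contradicts continuity at that point.\<close>

lemma homogeneous_le_0: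
  assumes H: "\<And>a b. a \<in> E \<Longrightarrow> b \<in> E \<Longrightarrow> (\<lambda>y. \<psi> y * H y) integrable_on {a..b}"
      "\<And>x y. x \<in> E \<Longrightarrow> y \<in> E \<Longrightarrow> x \<le> y \<Longrightarrow> H y - H x = - integral {x..y} (\<lambda>y. \<psi> y * H y)"
    and lim: "\<And>e. 0 < e \<Longrightarrow> \<exists>c\<in>E. \<forall>x\<in>E. x < c \<longrightarrow> \<bar>H x\<bar> < e" and x1: "x1 \<in> E"
  shows "H x1 \<le> 0"
proof (rule ccontr)
  assume "\<not> H x1 \<le> 0"
  then have pos: "0 < H x1" by simp
  have cont: "continuous_on E H"
    by (rule continuous_if_increments_integral[of "\<lambda>y. - (\<psi> y * H y)"]) (use H in \<open>auto intro: integrable_neg\<close>)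
  obtain c where c: "c \<in> E" "\<forall>x\<in>E. x < c \<longrightarrow> \<bar>H x\<bar> < H x1" using lim[OF pos] by blast
  have "min c x1 \<in> E" using c x1 by (simp add: min_def)
  then obtain z z' where z: "z \<in> E" "z' \<in> E" "z < min c x1" "min c x1 < z'" by (rule E_nbhd)
  \<comment> \<open>A positive level strictly below \<open>H x1\<close> and not exceeded at
    \<open>z\<close>, a point near enough to the lower end that \<open>H z < H x1\<close>.\<close>
  define m where "m = max (H z) (H x1 / 2)"
  have m: "0 < m" "m < H x1" "H z \<le> m" using c z pos by (auto simp: m_def)
  have sub: "{z..x1} \<subseteq> E" by (rule Icc_sub_E[OF z(1) x1])
  define A where "A = {z..x1} \<inter> H -` {..m}"
  have "closed A" unfolding A_def
    by (rule continuous_closed_preimage[OF continuous_on_subset[OF cont sub]]) auto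
  then have "compact ({z..x1} \<inter> A)" by (intro compact_Int_closed compact_Icc)
  moreover have "{z..x1} \<inter> A = A" by (auto simp: A_def)
  ultimately have cA: "compact A" by simp
  have "z \<in> A" using z m by (auto simp: A_def)
  then obtain s where s: "s \<in> A" "\<And>x. x \<in> A \<Longrightarrow> x \<le> s"
    using compact_attains_sup[OF cA] by blast
  have s': "z \<le> s" "s \<le> x1" "H s \<le> m" using s(1) by (auto simp: A_def)
  have sE: "s \<in> E" using sub s' by auto
  have sx: "s < x1" using s' m by (cases "s = x1") auto
  have big: "m < H x" if "s < x" "x \<le> x1" for x
  proof (rule ccontr)
    assume "\<not> m < H x"
    then have "x \<in> A" using that s' by (auto simp: A_def)
    then show False using s(2)[of x] that by simp
  qed
  have ge: "H x1 \<le> H t" if t: "s < t" "t \<le> x1" for t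
  proof -
    have tE: "t \<in> E" using sub s' t by auto
    have "0 \<le> integral {t..x1} (\<lambda>y. \<psi> y * H y)"
    proof (rule Henstock_Kurzweil_Integration.integral_nonneg[OF H(1)[OF tE x1]])
      fix y assume y: "y \<in> {t..x1}"
      have "y \<in> E" using Icc_sub_E[OF tE x1] y by blast
      moreover have "m < H y" using big[of y] t y by auto
      ultimately show "0 \<le> \<psi> y * H y" using \<psi>_nonneg m by simp
    qed
    then show ?thesis using H(2)[OF tE x1 t(2)] by simp
  qed
  have "(H \<longlongrightarrow> H s) (at s)" using cont open_E sE by (simp add: continuous_on_eq_continuous_at isCont_def)
  then have "(H \<longlongrightarrow> H s) (at_right s)" by (rule tendsto_within_subset) simp
  moreover have "\<forall>\<^sub>F t in at_right s. H x1 \<le> H t"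
    using ge sx by (auto simp: eventually_at_right_field intro!: exI[of _ x1])
  ultimately have "H x1 \<le> H s"
    by (rule tendsto_lowerbound) simp
  then show False using s' m by simp
qed

text \<open>The difference of two solutions solves the homogeneous equation and tends to 0 at the
  lower end; neither it nor its negative can be positive anywhere.\<close>

lemma sol_unique:
  assumes v: "v absolutely_integrable_on E"
    and W: "\<And>a b. a \<in> E \<Longrightarrow> b \<in> E \<Longrightarrow> (\<lambda>y. \<psi> y * W y) integrable_on {a..b}"
      "\<And>x y. x \<in> E \<Longrightarrow> y \<in> E \<Longrightarrow> x \<le> y \<Longrightarrow> W y - W x = integral {x..y} (\<lambda>y. v y - \<psi> y * W y)"
    and lim: "\<And>e. 0 < e \<Longrightarrow> \<exists>c\<in>E. \<forall>x\<in>E. x < c \<longrightarrow> \<bar>W x\<bar> < e" and x: "x \<in> E"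
  shows "W x = sol v x"
proof -
  define H where "H s y = s * (W y - sol v y)" for s y
  have si: "(\<lambda>y. \<psi> y * sol v y) integrable_on {a..b}" if "a \<in> E" "b \<in> E" for a b
    by (rule absolutely_integrable_imp_integrable[OF \<psi>_sol_Icc[OF v that]])
  have vi: "v integrable_on {a..b}" if "a \<in> E" "b \<in> E" for a b
    by (rule absolutely_integrable_imp_integrable[OF v_Icc[OF v that]])
  have "H s x \<le> 0" if s: "\<bar>s\<bar> = 1" for s
  proof (rule homogeneous_le_0[OF _ _ _ x])
    have Hi: "(\<lambda>y. \<psi> y * H s y) = (\<lambda>y. s * (\<psi> y * W y - \<psi> y * sol v y))" by (auto simp: H_def algebra_simps)
    show "(\<lambda>y. \<psi> y * H s y) integrable_on {a..b}" if "a \<in> E" "b \<in> E" for a b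
      unfolding Hi using W(1)[OF that] si[OF that] by (intro integrable_on_mult_right Henstock_Kurzweil_Integration.integrable_diff)
    show "H s y - H s x = - integral {x..y} (\<lambda>y. \<psi> y * H s y)" if xy: "x \<in> E" "y \<in> E" "x \<le> y" for x y
    proof -
      have 1: "W y - W x = integral {x..y} v - integral {x..y} (\<lambda>y. \<psi> y * W y)"
        unfolding W(2)[OF xy] by (rule Henstock_Kurzweil_Integration.integral_diff) (use vi W(1) xy in auto)
      have 2: "sol v y - sol v x = integral {x..y} v - integral {x..y} (\<lambda>y. \<psi> y * sol v y)"
        unfolding sol_increment(2)[OF v xy] by (rule Henstock_Kurzweil_Integration.integral_diff) (use vi si xy in auto)
      have 3: "integral {x..y} (\<lambda>y. \<psi> y * H s y)
          = s * (integral {x..y} (\<lambda>y. \<psi> y * W y) - integral {x..y} (\<lambda>y. \<psi> y * sol v y))"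
        unfolding Hi using W(1)[OF xy(1,2)] si[OF xy(1,2)]
        by (simp add: Henstock_Kurzweil_Integration.integral_diff)
      have "H s y - H s x = s * ((W y - W x) - (sol v y - sol v x))" by (simp add: H_def algebra_simps)
      also have "\<dots> = s * (integral {x..y} (\<lambda>y. \<psi> y * sol v y) - integral {x..y} (\<lambda>y. \<psi> y * W y))"
        unfolding 1 2 by simp
      also have "\<dots> = - integral {x..y} (\<lambda>y. \<psi> y * H s y)" unfolding 3 by (simp add: right_diff_distrib)
      finally show ?thesis .
    qed
    fix e :: real assume "0 < e"
    then have e: "0 < e / 2" by simp
    obtain c1 where c1: "c1 \<in> E" "\<forall>x\<in>E. x < c1 \<longrightarrow> \<bar>W x\<bar> < e / 2" using lim[OF e] by blast
    obtain c2 where c2: "c2 \<in> E" "\<forall>x\<in>E. x < c2 \<longrightarrow> \<bar>sol v x\<bar> < e / 2" using sol_tendsto_0[OF v e] by blast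
    have "\<bar>H s x\<bar> < e" if x: "x \<in> E" "x < min c1 c2" for x
    proof -
      have "\<bar>H s x\<bar> = \<bar>W x - sol v x\<bar>" using s by (simp add: H_def abs_mult)
      moreover have "\<bar>W x\<bar> < e / 2" "\<bar>sol v x\<bar> < e / 2" using c1 c2 x by auto
      ultimately show ?thesis by linarith
    qed
    moreover have "min c1 c2 \<in> E" using c1 c2 by (simp add: min_def)
    ultimately show "\<exists>c\<in>E. \<forall>x\<in>E. x < c \<longrightarrow> \<bar>H s x\<bar> < e" by blast
  qed
  from this[of 1] this[of "- 1"] show ?thesis by (simp add: H_def)
qed

text \<open>\<open>sol v\<close> is the flux through a point. If part of the mass of
  \<open>v\<close> were never absorbed, the flux would stay above a positive constant near the upper
  end, and the absorbed mass would exceed a fixed multiple of the increments of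
  \<open>\<Psi>\<close>, which are unbounded.\<close>

lemma mass_balance:
  assumes v: "v absolutely_integrable_on E" "\<And>y. y \<in> E \<Longrightarrow> 0 \<le> v y"
    and unbounded: "\<And>M. \<exists>c\<in>E. \<forall>x\<in>E. c < x \<longrightarrow> M < \<Psi> x"
  shows "integral E (\<lambda>y. \<psi> y * sol v y) = integral E v"
proof (rule ccontr)
  let ?h = "\<lambda>y. \<psi> y * sol v y" and ?l = "integral E v - integral E (\<lambda>y. \<psi> y * sol v y)"
  assume "integral E ?h \<noteq> integral E v"
  then have l: "0 < ?l" using \<psi>_sol_nonneg_int(2)[OF v] by simp
  have h: "?h absolutely_integrable_on E" by (rule \<psi>_sol_int[OF v(1)])
  have h0: "0 \<le> ?h x" if "x \<in> E" for x using \<psi>_nonneg sol_nonneg[OF v] that by simp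
  have h_le: "integral {a..b} ?h \<le> integral E ?h" if "a \<in> E" "b \<in> E" for a b
    by (intro integral_subset_le Icc_sub_E that absolutely_integrable_imp_integrable \<psi>_sol_Icc v(1) h) (use h0 in auto)
  from E_exhaustion obtain l u :: "nat \<Rightarrow> real" where lu: "\<forall>n. l n \<in> E" "\<forall>n. u n \<in> E" "\<forall>n. l n < u n"
      "decseq l" "incseq u" "E = (\<Union>n. {l n..u n})"
    by (elim exE conjE) rule
  note lu = lu(1-3)[rule_format] lu(4-)
  have "\<forall>\<^sub>F n in sequentially. integral E v - ?l / 2 < integral {l n..u n} v"
    by (rule order_tendstoD(1)[OF integral_exhaustion[OF v(1) lu(4-6)]]) (use l in auto)
  then obtain n where n: "integral E v - ?l / 2 < integral {l n..u n} v" by (auto simp: eventually_sequentially)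
  have big: "?l / 2 \<le> sol v y" if y: "y \<in> E" "u n \<le> y" for y
  proof -
    have le: "l n \<le> y" using lu(3)[of n] y by simp
    have "sol v y - sol v (l n) = integral {l n..y} v - integral {l n..y} ?h"
      unfolding sol_increment(2)[OF v(1) lu(1) y(1) le]
      by (rule Henstock_Kurzweil_Integration.integral_diff)
        (use v_Icc[OF v(1) lu(1) y(1)] \<psi>_sol_Icc[OF v(1) lu(1) y(1)] in \<open>auto intro: absolutely_integrable_imp_integrable\<close>)
    moreover have "integral {l n..u n} v \<le> integral {l n..y} v"
      by (intro integral_subset_le absolutely_integrable_imp_integrable v_Icc[OF v(1)] lu y)
        (use y v(2) Icc_sub_E[OF lu(1) y(1)] in auto)
    moreover have "integral {l n..y} ?h \<le> integral E ?h" by (rule h_le[OF lu(1) y(1)])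
    moreover have "0 \<le> sol v (l n)" by (rule sol_nonneg[OF v lu(1)])
    ultimately show ?thesis using n by argo
  qed
  have bnd: "\<Psi> y - \<Psi> (u n) \<le> integral E ?h / (?l / 2)" if y: "y \<in> E" "u n \<le> y" for y
  proof -
    have "(?l / 2) * (\<Psi> y - \<Psi> (u n)) = integral {u n..y} (\<lambda>y. (?l / 2) * \<psi> y)"
      unfolding \<Psi>[OF lu(2) y] by simp
    also have "\<dots> \<le> integral {u n..y} ?h"
    proof (rule integral_le)
      show "(\<lambda>y. (?l / 2) * \<psi> y) integrable_on {u n..y}"
        by (intro integrable_on_mult_right absolutely_integrable_imp_integrable \<psi>_int lu y)
      show "?h integrable_on {u n..y}" by (rule absolutely_integrable_imp_integrable[OF \<psi>_sol_Icc[OF v(1) lu(2) y(1)]])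
      fix z assume z: "z \<in> {u n..y}"
      then have "z \<in> E" using Icc_sub_E[OF lu(2) y(1)] by blast
      then show "(?l / 2) * \<psi> z \<le> ?h z"
        using mult_right_mono[OF big[of z] \<psi>_nonneg[of z]] z by (simp add: mult.commute)
    qed
    also have "\<dots> \<le> integral E ?h" by (rule h_le[OF lu(2) y(1)])
    finally show ?thesis using l by (simp add: field_simps)
  qed
  obtain c where c: "c \<in> E" "\<forall>x\<in>E. c < x \<longrightarrow> \<Psi> (u n) + integral E ?h / (?l / 2) < \<Psi> x"
    using unbounded by blast
  have "max c (u n) \<in> E" using c lu(2)[of n] by (simp add: max_def)
  then obtain z z' where z: "z \<in> E" "z' \<in> E" "z < max c (u n)" "max c (u n) < z'" by (rule E_nbhd)
  have "\<Psi> (u n) + integral E ?h / (?l / 2) < \<Psi> z'" using c(2) z by auto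
  moreover have "\<Psi> z' - \<Psi> (u n) \<le> integral E ?h / (?l / 2)" using z by (intro bnd) auto
  ultimately show False by linarith
qed

lemma sol_pos:
  assumes v: "v absolutely_integrable_on E" "\<And>y. y \<in> E \<Longrightarrow> 0 \<le> v y" and x: "x \<in> E"
    and pos: "0 < integral (Lo x) v"
  shows "0 < sol v x"
proof (rule ccontr)
  assume "\<not> 0 < sol v x"
  then have 0: "integral (Lo x) (\<lambda>y. exp (\<Psi> y - \<Psi> x) * v y) = 0"
    using sol_nonneg[OF v x] by (simp add: sol_def)
  have i: "integrable (lebesgue_on (Lo x)) (\<lambda>y. exp (\<Psi> y - \<Psi> x) * v y)"
    using exp_v_int[OF v(1) x] by (simp add: absolutely_integrable_on_iff_integrable)
  have "(LINT y|lebesgue_on (Lo x). exp (\<Psi> y - \<Psi> x) * v y) = 0"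
    using lebesgue_integral_eq_integral[OF i Lo_lebesgue] 0 by simp
  then have "AE y in lebesgue_on (Lo x). exp (\<Psi> y - \<Psi> x) * v y = 0"
    using i by (subst (asm) integral_nonneg_eq_0_iff_AE)
      (auto intro!: AE_I2 mult_nonneg_nonneg v(2) dest: subsetD[OF Lo_sub])
  then have "AE y in lebesgue_on (Lo x). v y = 0" by simp
  then have "(LINT y|lebesgue_on (Lo x). v y) = 0" by (rule integral_eq_zero_AE)
  moreover have "integrable (lebesgue_on (Lo x)) v"
    using v_Lo[OF v(1)] by (simp add: absolutely_integrable_on_iff_integrable)
  ultimately show False using pos lebesgue_integral_eq_integral[of "Lo x" v] by simp
qed

end

section \<open>The resolvent of the transport operator and \<open>R0\<close>\<close>

lemma set_integrable_lborel_imp_absolutely_integrable: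
  fixes f :: "real \<Rightarrow> real"
  assumes "set_integrable lborel S f" shows "f absolutely_integrable_on S"
  using assms unfolding set_integrable_def by (intro integrable_completion[THEN iffD2]) auto

text \<open>The base point cancels in increments, so both branches of \<open>prim\<close> obey one
  formula; \<open>R0\<close> involves Q only through increments.\<close>

lemma prim_increment:
  assumes h: "\<And>a b. a \<in> Eint d0 d1 \<Longrightarrow> b \<in> Eint d0 d1 \<Longrightarrow> set_integrable lborel {a..b} h"
    and d01: "d0 < d1" and xy: "x \<in> Eint d0 d1" "y \<in> Eint d0 d1" "x \<le> y"
  shows "prim d0 d1 h y - prim d0 d1 h x = integral {x..y} h"
proof -
  have Ih: "(LBINT z=ereal x..ereal y. h z) = integral {x..y} h"
    using interval_integral_Icc[OF xy(3), of h] set_borel_integral_eq_integral(2)[OF h[OF xy(1,2)]] by simp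
  show ?thesis
  proof (cases "\<forall>y\<in>Eint d0 d1. set_integrable lborel (einterval d0 (ereal y)) h")
    case True
    have d: "d0 < ereal x" using xy(1) by (simp add: Eint_def einterval_iff)
    have mm: "min d0 (min (ereal x) (ereal y)) = d0" "max d0 (max (ereal x) (ereal y)) = ereal y"
      using d xy(3) order.strict_trans2[OF d, of "ereal y"] by (auto simp: min_def max_def)
    have "interval_lebesgue_integrable lborel (min d0 (min (ereal x) (ereal y))) (max d0 (max (ereal x) (ereal y))) h"
      unfolding mm using True xy(2) order.strict_trans2[OF d, of "ereal y"] xy(3)
      by (simp add: interval_lebesgue_integrable_def less_imp_le)
    from interval_integral_sum[OF this] show ?thesis unfolding prim_def if_P[OF True] Ih by linarith
  next
    case False
    define c where "c = (SOME c. c \<in> Eint d0 d1)"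
    have c: "c \<in> Eint d0 d1" unfolding c_def Eint_def by (rule someI_ex[OF einterval_nonempty[OF d01]])
    define m M where "m = min c (min x y)" and "M = max c (max x y)"
    have mM: "m \<in> Eint d0 d1" "M \<in> Eint d0 d1" "m \<le> M" using c xy by (auto simp: m_def M_def min_def max_def)
    have mm: "min (ereal c) (min (ereal x) (ereal y)) = ereal m" "max (ereal c) (max (ereal x) (ereal y)) = ereal M"
      by (auto simp: m_def M_def min_def max_def)
    have "set_integrable lborel {m<..<M} h" by (rule set_integrable_subset[OF h[OF mM(1,2)]]) auto
    then have "interval_lebesgue_integrable lborel (min (ereal c) (min (ereal x) (ereal y))) (max (ereal c) (max (ereal x) (ereal y))) h"
      unfolding mm using mM(3) by (simp add: interval_lebesgue_integrable_def)
    from interval_integral_sum[OF this] show ?thesis unfolding prim_def if_not_P[OF False] c_def[symmetric] Ih by linarith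
  qed
qed

locale transport =
  fixes d0 d1 :: ereal and g \<phi> :: "real \<Rightarrow> real" and E :: "real set"
  assumes E_Eint: "E = Eint d0 d1" and d01: "d0 < d1"
    and g_cont: "continuous_on E g" and g_pos: "\<forall>x\<in>E. 0 < g x"
    and phi_meas: "\<phi> \<in> borel_measurable borel" and phi_nonneg: "\<forall>x\<in>E. 0 \<le> \<phi> x"
    and phi_loc_int: "\<forall>a b. {a..b} \<subseteq> E \<longrightarrow> set_integrable lborel {a..b} \<phi>"
    and G_infty: "tends_to_infty_at_d1 d0 d1 (Gfun d0 d1 g)"
begin

lemma Icc_E: "a \<in> E \<Longrightarrow> b \<in> E \<Longrightarrow> {a..b} \<subseteq> E"
proof
  fix x assume ab: "a \<in> E" "b \<in> E" and x: "x \<in> {a..b}"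
  have "d0 < ereal x" using ab(1) x order.strict_trans2[of d0 "ereal a" "ereal x"] by (simp add: E_Eint Eint_def einterval_iff)
  moreover have "ereal x < d1" using ab(2) x order.strict_trans1[of "ereal x" "ereal b" d1] by (simp add: E_Eint Eint_def einterval_iff)
  ultimately show "x \<in> E" by (simp add: E_Eint Eint_def einterval_iff)
qed

lemma E_sets [measurable]: "E \<in> sets lebesgue"
  by (simp add: E_Eint Eint_def)

lemma inv_g_int: "a \<in> E \<Longrightarrow> b \<in> E \<Longrightarrow> set_integrable lborel {a..b} (\<lambda>x. 1 / g x)"
  using Icc_E[of a b] g_pos
  by (intro borel_integrable_atLeastAtMost' continuous_intros continuous_on_subset[OF g_cont]) fastforce+

lemma phi_g_int: assumes ab: "a \<in> E" "b \<in> E" shows "set_integrable lborel {a..b} (\<lambda>x. \<phi> x / g x)"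
proof -
  have "continuous_on {a..b} (\<lambda>x. 1 / g x)"
    using Icc_E[OF ab] g_pos by (intro continuous_intros continuous_on_subset[OF g_cont]) fastforce+
  then obtain C where C: "\<And>x. x \<in> {a..b} \<Longrightarrow> \<bar>1 / g x\<bar> \<le> C"
    using compact_imp_bounded[OF compact_continuous_image[OF _ compact_Icc]] by (force simp: bounded_iff)
  have p: "integrable lborel (\<lambda>x. indicator {a..b} x * \<phi> x)"
    using phi_loc_int Icc_E[OF ab] by (simp add: set_integrable_def)
  have i: "integrable lborel (\<lambda>x. indicator {a..b} x * (1 / g x))"
    using inv_g_int[OF ab] by (simp add: set_integrable_def)
  have "integrable lborel (\<lambda>x. \<phi> x * (indicator {a..b} x * (1 / g x)))"
  proof (rule Bochner_Integration.integrable_bound)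
    show "integrable lborel (\<lambda>x. C * (indicator {a..b} x * \<phi> x))" using p by simp
    show "(\<lambda>x. \<phi> x * (indicator {a..b} x * (1 / g x))) \<in> borel_measurable lborel"
      using phi_meas borel_measurable_integrable[OF i] by measurable
    show "AE x in lborel. norm (\<phi> x * (indicator {a..b} x * (1 / g x))) \<le> norm (C * (indicator {a..b} x * \<phi> x))"
    proof (rule AE_I2)
      fix x
      show "norm (\<phi> x * (indicator {a..b} x * (1 / g x))) \<le> norm (C * (indicator {a..b} x * \<phi> x))"
      proof (cases "x \<in> {a..b}")
        case True
        have "\<bar>1 / g x\<bar> * \<bar>\<phi> x\<bar> \<le> \<bar>C\<bar> * \<bar>\<phi> x\<bar>" using C[OF True] by (intro mult_right_mono) auto
        then show ?thesis using True by (simp add: abs_mult mult.commute)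
      qed simp
    qed
  qed
  then show ?thesis by (simp add: set_integrable_def mult_ac)
qed

lemma g_meas: "g \<in> borel_measurable (lebesgue_on E)"
  by (rule continuous_imp_measurable_on_sets_lebesgue[OF g_cont E_sets])

lemma phi_meas_E: "\<phi> \<in> borel_measurable (lebesgue_on E)"
  using phi_meas by (simp add: measurable_restrict_space1 measurable_completion)

abbreviation "Q \<equiv> Qfun d0 d1 g \<phi>"
abbreviation "\<Psi>1 \<equiv> \<lambda>x. Gfun d0 d1 g x + Qfun d0 d1 g \<phi> x"

text \<open>\<open>0 + \<phi> x\<close> keeps the shape \<open>lam + \<phi> x\<close> at lam = 0, so
  that the statements on \<open>A_graph\<close> below serve both flows.\<close>

sublocale f0: interval_flow d0 d1 E "\<lambda>x. (0 + \<phi> x) / g x" Q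
proof
  show "E = einterval d0 d1" by (simp add: E_Eint Eint_def)
  show "d0 < d1" by (rule d01)
  show "0 \<le> (0 + \<phi> x) / g x" if "x \<in> E" for x using g_pos phi_nonneg that by (simp add: less_imp_le)
  show "(\<lambda>x. (0 + \<phi> x) / g x) \<in> borel_measurable (lebesgue_on E)" using g_meas phi_meas_E by measurable
  show "(\<lambda>x. (0 + \<phi> x) / g x) absolutely_integrable_on {a..b}" if "a \<in> E" "b \<in> E" for a b
    using set_integrable_lborel_imp_absolutely_integrable[OF phi_g_int[OF that]] by simp
  show "Q y - Q x = integral {x..y} (\<lambda>x. (0 + \<phi> x) / g x)" if "x \<in> E" "y \<in> E" "x \<le> y" for x y
    using prim_increment[of d0 d1 "\<lambda>x. \<phi> x / g x" x y] phi_g_int that d01 by (simp add: E_Eint Qfun_def)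
qed

lemma G_increment: "x \<in> E \<Longrightarrow> y \<in> E \<Longrightarrow> x \<le> y \<Longrightarrow> Gfun d0 d1 g y - Gfun d0 d1 g x = integral {x..y} (\<lambda>x. 1 / g x)"
  using prim_increment[of d0 d1 "\<lambda>x. 1 / g x" x y] inv_g_int d01 by (simp add: E_Eint Gfun_def)

lemma G_mono: assumes "x \<in> E" "y \<in> E" "x \<le> y" shows "Gfun d0 d1 g x \<le> Gfun d0 d1 g y"
proof -
  have "0 \<le> integral {x..y} (\<lambda>x. 1 / g x)"
    by (rule Henstock_Kurzweil_Integration.integral_nonneg[OF set_borel_integral_eq_integral(1)[OF inv_g_int[OF assms(1,2)]]])
      (use Icc_E[OF assms(1,2)] g_pos in \<open>auto simp: subset_iff less_imp_le\<close>)
  then show ?thesis using G_increment[OF assms] by simp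
qed

sublocale f1: interval_flow d0 d1 E "\<lambda>x. (1 + \<phi> x) / g x" \<Psi>1
proof
  show "0 \<le> (1 + \<phi> x) / g x" if "x \<in> E" for x using g_pos phi_nonneg that by (simp add: less_imp_le add_nonneg_nonneg)
  show "(\<lambda>x. (1 + \<phi> x) / g x) \<in> borel_measurable (lebesgue_on E)" using g_meas phi_meas_E by measurable
  show "(\<lambda>x. (1 + \<phi> x) / g x) absolutely_integrable_on {a..b}" if "a \<in> E" "b \<in> E" for a b
    using set_integrable_lborel_imp_absolutely_integrable[OF set_integral_add(1)[OF inv_g_int[OF that] phi_g_int[OF that]]]
    by (simp add: add_divide_distrib)
  show "\<Psi>1 y - \<Psi>1 x = integral {x..y} (\<lambda>x. (1 + \<phi> x) / g x)" if xy: "x \<in> E" "y \<in> E" "x \<le> y" for x y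
  proof -
    have "integral {x..y} (\<lambda>x. 1 / g x + \<phi> x / g x) = integral {x..y} (\<lambda>x. 1 / g x) + integral {x..y} (\<lambda>x. \<phi> x / g x)"
      by (rule Henstock_Kurzweil_Integration.integral_add[OF
          set_borel_integral_eq_integral(1)[OF inv_g_int[OF xy(1,2)]] set_borel_integral_eq_integral(1)[OF phi_g_int[OF xy(1,2)]]])
    then show ?thesis using G_increment[OF xy] f0.\<Psi>[OF xy] by (simp add: add_divide_distrib)
  qed
qed (simp_all add: E_Eint Eint_def d01)

lemma L1_iff: "L1 E u \<longleftrightarrow> u absolutely_integrable_on E"
  by (simp add: L1_def absolutely_integrable_on_iff_integrable)

lemma eqL_iff: "eqL E u v \<longleftrightarrow> negligible {x \<in> E. u x \<noteq> v x}"
proof -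
  have "eqL E u v \<longleftrightarrow> (AE x in lebesgue. x \<in> E \<longrightarrow> u x = v x)"
    unfolding eqL_def by (subst AE_restrict_space_iff) auto
  also have "\<dots> \<longleftrightarrow> negligible {x \<in> E. u x \<noteq> v x}"
  proof
    assume "AE x in lebesgue. x \<in> E \<longrightarrow> u x = v x"
    then obtain N where N: "N \<in> null_sets lebesgue" "{x \<in> space lebesgue. \<not> (x \<in> E \<longrightarrow> u x = v x)} \<subseteq> N"
      unfolding eventually_ae_filter by blast
    have "negligible N" using N(1) by (simp add: negligible_iff_null_sets)
    moreover have "{x \<in> E. u x \<noteq> v x} \<subseteq> N" using N(2) by auto
    ultimately show "negligible {x \<in> E. u x \<noteq> v x}" by (rule negligible_subset)
  next
    assume "negligible {x \<in> E. u x \<noteq> v x}"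
    then show "AE x in lebesgue. x \<in> E \<longrightarrow> u x = v x"
      unfolding negligible_iff_null_sets by (rule AE_I') auto
  qed
  finally show ?thesis .
qed

text \<open>The absolutely continuous \<open>w\<close> in the graph has the prescribed derivative
  almost everywhere. By the fundamental theorem it solves the equation in integrated form, where
  solutions vanishing at \<open>d0\<close> are unique.\<close>

lemma A_graph_imp_sol:
  assumes flow: "interval_flow d0 d1 E (\<lambda>x. (lam + \<phi> x) / g x) \<Psi>"
    and A: "A_graph d0 d1 g \<phi> u f" and v: "L1 E v" "eqL E (\<lambda>x. lam * u x - f x) v"
  shows "eqL E u (\<lambda>x. interval_flow.sol E \<Psi> v x / g x)"
proof -
  interpret f: interval_flow d0 d1 E "\<lambda>x. (lam + \<phi> x) / g x" \<Psi> by (rule flow)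
  let ?\<psi> = "\<lambda>x. (lam + \<phi> x) / g x"
  from A[unfolded A_graph_def Let_def, folded E_Eint, THEN conjunct2]
  obtain w where w: "abs_continuous_on E w" "eqL E (\<lambda>x. g x * u x) w" "L1 E (deriv w)"
      "\<forall>e>0. \<exists>c\<in>E. \<forall>x\<in>E. x < c \<longrightarrow> \<bar>w x\<bar> < e" "eqL E f (\<lambda>x. - deriv w x - \<phi> x * u x)"
    by (elim exE conjE) rule
  note w = w(1-3) w(4)[rule_format] w(5)
  define N where "N = {x \<in> E. g x * u x \<noteq> w x} \<union> {x \<in> E. f x \<noteq> - deriv w x - \<phi> x * u x} \<union> {x \<in> E. lam * u x - f x \<noteq> v x}"
  have N: "negligible N" unfolding N_def using w(2,5) v(2) by (simp add: eqL_iff negligible_Un)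
  have der: "v x - ?\<psi> x * w x = deriv w x" if "x \<in> E - N" for x
  proof -
    have x: "w x = g x * u x" "f x = - deriv w x - \<phi> x * u x" "lam * u x - f x = v x" "0 < g x"
      using that g_pos by (auto simp: N_def)
    have "?\<psi> x * w x = (lam + \<phi> x) * u x" unfolding x(1) using x(4) by simp
    then show ?thesis using x(2,3) by (simp add: algebra_simps)
  qed
  have va: "v absolutely_integrable_on E" using v(1) by (simp add: L1_iff)
  have dw: "deriv w absolutely_integrable_on {a..b}" if "a \<in> E" "b \<in> E" for a b
    by (rule set_integrable_subset[OF _ _ Icc_E[OF that]]) (use w(3) in \<open>auto simp: L1_iff\<close>)
  have inc_int: "(\<lambda>y. v y - ?\<psi> y * w y) absolutely_integrable_on {a..b}" if "a \<in> E" "b \<in> E" for a b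
    by (rule absolutely_integrable_spike[OF dw[OF that] N]) (use der Icc_E[OF that] in auto)
  have "w x = f.sol v x" if "x \<in> E" for x
  proof (rule f.sol_unique[OF va _ _ w(4) that])
    show "(\<lambda>y. ?\<psi> y * w y) integrable_on {a..b}" if "a \<in> E" "b \<in> E" for a b
    proof -
      have "(\<lambda>y. v y - (v y - ?\<psi> y * w y)) absolutely_integrable_on {a..b}"
        by (rule set_integral_diff(1)[OF f.v_Icc[OF va that] inc_int[OF that]])
      then show ?thesis by (simp add: absolutely_integrable_imp_integrable)
    qed
    show "w y - w x = integral {x..y} (\<lambda>y. v y - ?\<psi> y * w y)" if xy: "x \<in> E" "y \<in> E" "x \<le> y" for x y
      unfolding AC_fundamental_theorem(2)[OF w(1) xy(3) Icc_E[OF xy(1,2)], symmetric]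
      by (rule integral_spike[OF N]) (use der Icc_E[OF xy(1,2)] in auto)
  qed
  then have "u x = f.sol v x / g x" if "x \<in> E - N" for x
  proof -
    have "g x * u x = w x" "0 < g x" using that g_pos by (auto simp: N_def)
    then show ?thesis using \<open>\<And>x. x \<in> E \<Longrightarrow> w x = f.sol v x\<close>[of x] that by (auto simp: field_simps)
  qed
  then have "{x \<in> E. u x \<noteq> f.sol v x / g x} \<subseteq> N" by blast
  then show ?thesis unfolding eqL_iff using N negligible_subset by blast
qed

text \<open>Integrability of the solution is a hypothesis: it is automatic at lam = 1, but a genuine
  restriction on \<open>v\<close> at lam = 0.\<close>

lemma A_graph_sol:
  assumes flow: "interval_flow d0 d1 E (\<lambda>x. (lam + \<phi> x) / g x) \<Psi>" and lam: "0 \<le> lam"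
    and v: "L1 E v" and L: "L1 E (\<lambda>x. interval_flow.sol E \<Psi> v x / g x)"
  shows "A_graph d0 d1 g \<phi> (\<lambda>x. interval_flow.sol E \<Psi> v x / g x) (\<lambda>x. lam * (interval_flow.sol E \<Psi> v x / g x) - v x)"
proof -
  interpret f: interval_flow d0 d1 E "\<lambda>x. (lam + \<phi> x) / g x" \<Psi> by (rule flow)
  let ?\<psi> = "\<lambda>x. (lam + \<phi> x) / g x" and ?w = "f.sol v" and ?u = "\<lambda>x. f.sol v x / g x"
  have va: "v absolutely_integrable_on E" using v by (simp add: L1_iff)
  have gx: "g x \<noteq> 0" if "x \<in> E" for x using g_pos that by auto
  define N where "N = {x \<in> E. \<not> (?w has_real_derivative v x - ?\<psi> x * ?w x) (at x)}"
  have N: "negligible N" unfolding N_def by (rule f.sol_has_derivative_AE[OF va])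
  have der: "deriv ?w x = v x - ?\<psi> x * ?w x" if "x \<in> E - N" for x
    using that by (auto simp: N_def intro: DERIV_imp_deriv)
  have dint: "deriv ?w absolutely_integrable_on E"
    by (rule absolutely_integrable_spike[OF set_integral_diff(1)[OF va f.\<psi>_sol_int[OF va]] N]) (use der in auto)
  have pint: "(\<lambda>x. \<phi> x * ?u x) absolutely_integrable_on E"
  proof -
    have "(\<lambda>x. ?\<psi> x * ?w x - lam * ?u x) absolutely_integrable_on E"
      using L by (intro set_integral_diff(1) f.\<psi>_sol_int[OF va] set_integrable_mult_right) (simp add: L1_iff)
    moreover have "(\<lambda>x. ?\<psi> x * ?w x - lam * ?u x) = (\<lambda>x. \<phi> x * ?u x)"
      by (auto simp: add_divide_distrib algebra_simps)
    ultimately show ?thesis by simp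
  qed
  have e1: "eqL E (\<lambda>x. g x * ?u x) ?w" unfolding eqL_iff using gx by (intro negligible_subset[OF negligible_empty]) auto
  have "{x \<in> E. lam * ?u x - v x \<noteq> - deriv ?w x - \<phi> x * ?u x} \<subseteq> N"
  proof
    fix x assume x: "x \<in> {x \<in> E. lam * ?u x - v x \<noteq> - deriv ?w x - \<phi> x * ?u x}"
    show "x \<in> N"
    proof (rule ccontr)
      assume "x \<notin> N"
      then have "deriv ?w x = v x - ?\<psi> x * ?w x" using der x by auto
      moreover have "?\<psi> x * ?w x = lam * ?u x + \<phi> x * ?u x" by (simp add: add_divide_distrib algebra_simps)
      ultimately show False using x by simp
    qed
  qed
  then have e2: "eqL E (\<lambda>x. lam * ?u x - v x) (\<lambda>x. - deriv ?w x - \<phi> x * ?u x)"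
    unfolding eqL_iff using N negligible_subset by blast
  show ?thesis
    unfolding A_graph_def Let_def E_Eint[symmetric]
    using L e1 e2 f.abs_continuous_on_sol[OF va] dint pint f.sol_tendsto_0[OF va]
    by (auto simp: L1_iff intro!: exI[of _ ?w])
qed

abbreviation R1 :: "(real \<Rightarrow> real) \<Rightarrow> real \<Rightarrow> real" where "R1 v x \<equiv> f1.sol v x / g x"

text \<open>\<open>(1 + \<phi>) R1 v\<close> is the product of the coefficient of the flow with
  \<open>sol v\<close>, which is integrable, and it dominates both functions.\<close>

lemma R1_L1: assumes v: "L1 E v" shows "L1 E (R1 v)" "L1 E (\<lambda>x. \<phi> x * R1 v x)"
proof -
  have va: "v absolutely_integrable_on E" using v by (simp add: L1_iff)
  have p: "(\<lambda>x. (1 + \<phi> x) / g x * f1.sol v x) absolutely_integrable_on E" by (rule f1.\<psi>_sol_int[OF va])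
  have m: "R1 v \<in> borel_measurable (lebesgue_on E)"
    using continuous_imp_measurable_on_sets_lebesgue[OF f1.continuous_sol[OF va] E_sets] g_meas by measurable
  have pi: "(\<lambda>x. \<bar>(1 + \<phi> x) / g x * f1.sol v x\<bar>) integrable_on E"
    by (rule absolutely_integrable_imp_integrable[OF set_integrable_abs[OF p]])
  show "L1 E (R1 v)" unfolding L1_iff
  proof (rule measurable_bounded_by_integrable_imp_absolutely_integrable[OF m E_sets pi])
    fix x assume x: "x \<in> E"
    have "norm (R1 v x) * 1 \<le> norm (R1 v x) * (1 + \<phi> x)" using phi_nonneg x by (intro mult_left_mono) auto
    then show "norm (R1 v x) \<le> \<bar>(1 + \<phi> x) / g x * f1.sol v x\<bar>" using phi_nonneg x by (simp add: abs_mult mult.commute)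
  qed
  show "L1 E (\<lambda>x. \<phi> x * R1 v x)" unfolding L1_iff
  proof (rule measurable_bounded_by_integrable_imp_absolutely_integrable[OF _ E_sets pi])
    show "(\<lambda>x. \<phi> x * R1 v x) \<in> borel_measurable (lebesgue_on E)" using m phi_meas_E by measurable
    fix x assume x: "x \<in> E"
    have "norm (R1 v x) * \<phi> x \<le> norm (R1 v x) * (1 + \<phi> x)" using phi_nonneg x by (intro mult_left_mono) auto
    then show "norm (\<phi> x * R1 v x) \<le> \<bar>(1 + \<phi> x) / g x * f1.sol v x\<bar>" using phi_nonneg x by (simp add: abs_mult mult.commute)
  qed
qed

text \<open>\<open>RA\<close> is a choice. Existence of one candidate makes the chosen function
  satisfy the resolvent equation, and uniqueness identifies it up to a null set.\<close>

lemma RA_eq: assumes v: "L1 E v" shows "eqL E (RA d0 d1 g \<phi> 1 v) (R1 v)"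
proof -
  have "A_graph d0 d1 g \<phi> (R1 v) (\<lambda>x. 1 * R1 v x - v x)"
    by (rule A_graph_sol[OF f1.interval_flow_axioms _ v R1_L1(1)[OF v]]) simp
  moreover have "eqL (Eint d0 d1) (\<lambda>x. 1 * R1 v x - (1 * R1 v x - v x)) v" by (simp add: eqL_def)
  ultimately have "\<exists>u f. A_graph d0 d1 g \<phi> u f \<and> eqL (Eint d0 d1) (\<lambda>x. 1 * u x - f x) v" by blast
  then have "\<exists>f. A_graph d0 d1 g \<phi> (RA d0 d1 g \<phi> 1 v) f \<and> eqL (Eint d0 d1) (\<lambda>x. 1 * RA d0 d1 g \<phi> 1 v x - f x) v"
    unfolding RA_def by (rule someI_ex)
  then obtain f where "A_graph d0 d1 g \<phi> (RA d0 d1 g \<phi> 1 v) f" "eqL E (\<lambda>x. 1 * RA d0 d1 g \<phi> 1 v x - f x) v"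
    unfolding E_Eint by blast
  then show ?thesis using A_graph_imp_sol[OF f1.interval_flow_axioms _ v] by blast
qed

lemma R0_eq: assumes v: "L1 E v" and x: "x \<in> E" shows "R0 d0 d1 g \<phi> v x = f0.sol v x / g x"
proof -
  have va: "v absolutely_integrable_on E" using v by (simp add: L1_iff)
  let ?D = "einterval d0 (ereal x)" and ?k = "\<lambda>y. exp (Q y - Q x) * v y"
  have D: "?D \<subseteq> f0.Lo x" "f0.Lo x - ?D \<subseteq> {x}"
  proof -
    have yE: "y \<in> E" if "y \<in> ?D" for y
      using that x order.strict_trans[of "ereal y" "ereal x" d1] by (auto simp: E_Eint Eint_def einterval_iff)
    have dE: "d0 < ereal y" if "y \<in> E" for y using that by (simp add: E_Eint Eint_def einterval_iff)
    show "?D \<subseteq> f0.Lo x" using yE by (auto simp: f0.Lo_def einterval_iff)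
    show "f0.Lo x - ?D \<subseteq> {x}" using dE by (auto simp: f0.Lo_def einterval_iff)
  qed
  have k: "?k absolutely_integrable_on ?D"
    by (rule set_integrable_subset[OF f0.exp_v_int[OF va x] _ D(1)]) simp
  then have ki: "integrable (lebesgue_on ?D) ?k" by (simp add: absolutely_integrable_on_iff_integrable)
  have "R0 d0 d1 g \<phi> v x = (LINT y|lebesgue_on ?D. (1 / g x) * ?k y)"
    unfolding R0_def by (intro Bochner_Integration.integral_cong) auto
  also have "\<dots> = (1 / g x) * integral ?D ?k"
    using lebesgue_integral_eq_integral[OF ki] by simp
  also have "integral ?D ?k = f0.sol v x"
    unfolding f0.sol_def
  proof (rule integral_spike_set)
    show "negligible {y \<in> ?D - f0.Lo x. ?k y \<noteq> 0}"
      by (rule negligible_subset[OF negligible_empty]) (use D(1) in blast)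
    show "negligible {y \<in> f0.Lo x - ?D. ?k y \<noteq> 0}"
      by (rule negligible_subset[of "{x}"]) (use D in auto)
  qed
  finally show ?thesis by simp
qed

lemma phi_R0:
  assumes v: "L1 E v" "\<And>x. x \<in> E \<Longrightarrow> 0 \<le> v x"
  shows "L1 E (\<lambda>x. \<phi> x * R0 d0 d1 g \<phi> v x)"
proof -
  have va: "v absolutely_integrable_on E" using v by (simp add: L1_iff)
  have "(\<lambda>x. (0 + \<phi> x) / g x * f0.sol v x) absolutely_integrable_on E" by (rule f0.\<psi>_sol_int[OF va])
  then show ?thesis unfolding L1_iff
    by (rule absolutely_integrable_spike[OF _ negligible_empty]) (use R0_eq[OF v(1)] in auto)
qed

text \<open>The two kernels differ by the factor \<open>exp (G y - G x)\<close>, with G for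
  \<open>Gfun d0 d1 g\<close>, and it is at most 1 for \<open>y \<le> x\<close>.\<close>

lemma R1_le_R0:
  assumes v: "L1 E v" "\<And>x. x \<in> E \<Longrightarrow> 0 \<le> v x" and x: "x \<in> E"
  shows "R1 v x \<le> R0 d0 d1 g \<phi> v x"
proof -
  have va: "v absolutely_integrable_on E" using v by (simp add: L1_iff)
  have "f1.sol v x \<le> f0.sol v x"
    unfolding f1.sol_def f0.sol_def
  proof (rule integral_le)
    show "(\<lambda>y. exp (\<Psi>1 y - \<Psi>1 x) * v y) integrable_on f0.Lo x"
      by (rule absolutely_integrable_imp_integrable[OF f1.exp_v_int[OF va x]])
    show "(\<lambda>y. exp (Q y - Q x) * v y) integrable_on f0.Lo x"
      by (rule absolutely_integrable_imp_integrable[OF f0.exp_v_int[OF va x]])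
    fix y assume "y \<in> f0.Lo x"
    then have y: "y \<in> E" "y \<le> x" by (auto simp: f0.Lo_def)
    show "exp (\<Psi>1 y - \<Psi>1 x) * v y \<le> exp (Q y - Q x) * v y"
      using G_mono[OF y(1) x y(2)] v(2)[OF y(1)] by (intro mult_right_mono) auto
  qed
  then show ?thesis unfolding R0_eq[OF v(1) x] using g_pos x by (simp add: divide_right_mono less_imp_le)
qed

text \<open>\<open>\<Psi>1\<close> tends to infinity at \<open>d1\<close>, since G does and Q is
  nondecreasing; so no mass escapes there. The summands of \<open>1 + \<phi>\<close> split the
  absorbed mass into the two terms.\<close>

lemma R1_balance:
  assumes v: "L1 E v" "\<And>x. x \<in> E \<Longrightarrow> 0 \<le> v x"
  shows "integral E (\<lambda>x. R1 v x) + integral E (\<lambda>x. \<phi> x * R1 v x) = integral E v"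
proof -
  have va: "v absolutely_integrable_on E" using v by (simp add: L1_iff)
  have unb: "\<exists>c\<in>E. \<forall>x\<in>E. c < x \<longrightarrow> M < \<Psi>1 x" for M
  proof -
    obtain c0 where c0: "c0 \<in> E" using einterval_nonempty[OF d01] by (auto simp: E_Eint Eint_def)
    obtain c where c: "c \<in> E" "\<forall>x\<in>E. c < x \<longrightarrow> M - Q c0 < Gfun d0 d1 g x"
      using G_infty unfolding tends_to_infty_at_d1_def E_Eint by blast
    have "M < \<Psi>1 x" if "x \<in> E" "max c c0 < x" for x
    proof -
      have "M - Q c0 < Gfun d0 d1 g x" using c(2) that by simp
      moreover have "Q c0 \<le> Q x" using that c0 by (intro f0.\<Psi>_mono) auto
      ultimately show ?thesis by linarith
    qed
    moreover have "max c c0 \<in> E" using c c0 by (simp add: max_def)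
    ultimately show ?thesis by blast
  qed
  have "integral E (\<lambda>y. (1 + \<phi> y) / g y * f1.sol v y) = integral E v"
    by (rule f1.mass_balance[OF va v(2) unb])
  moreover have "integral E (\<lambda>y. (1 + \<phi> y) / g y * f1.sol v y) = integral E (\<lambda>x. R1 v x + \<phi> x * R1 v x)"
    by (rule Henstock_Kurzweil_Integration.integral_cong) (simp add: add_divide_distrib algebra_simps)
  moreover have "\<dots> = integral E (\<lambda>x. R1 v x) + integral E (\<lambda>x. \<phi> x * R1 v x)"
    by (rule Henstock_Kurzweil_Integration.integral_add)
      (use R1_L1[OF v(1)] in \<open>auto simp: L1_iff intro: absolutely_integrable_imp_integrable\<close>)
  ultimately show ?thesis by simp
qed

lemma sol_linear:
  assumes u: "L1 E u" and v: "L1 E v" and x: "x \<in> E"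
  shows "f1.sol (\<lambda>y. a * u y + b * v y) x = a * f1.sol u x + b * f1.sol v x"
    "f0.sol (\<lambda>y. a * u y + b * v y) x = a * f0.sol u x + b * f0.sol v x"
proof -
  have ua: "u absolutely_integrable_on E" "v absolutely_integrable_on E" using u v by (simp_all add: L1_iff)
  have eq: "integral S (\<lambda>y. e y * (a * u y + b * v y)) = a * integral S (\<lambda>y. e y * u y) + b * integral S (\<lambda>y. e y * v y)"
    if "(\<lambda>y. e y * u y) absolutely_integrable_on S" "(\<lambda>y. e y * v y) absolutely_integrable_on S" for S and e :: "real \<Rightarrow> real"
  proof -
    have "integral S (\<lambda>y. e y * (a * u y + b * v y)) = integral S (\<lambda>y. a * (e y * u y) + b * (e y * v y))"
      by (rule Henstock_Kurzweil_Integration.integral_cong) (simp add: algebra_simps)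
    also have "\<dots> = integral S (\<lambda>y. a * (e y * u y)) + integral S (\<lambda>y. b * (e y * v y))"
      by (intro Henstock_Kurzweil_Integration.integral_add integrable_on_mult_right absolutely_integrable_imp_integrable that)
    finally show ?thesis by simp
  qed
  show "f1.sol (\<lambda>y. a * u y + b * v y) x = a * f1.sol u x + b * f1.sol v x"
    unfolding f1.sol_def by (rule eq[OF f1.exp_v_int[OF ua(1) x] f1.exp_v_int[OF ua(2) x]])
  show "f0.sol (\<lambda>y. a * u y + b * v y) x = a * f0.sol u x + b * f0.sol v x"
    unfolding f0.sol_def by (rule eq[OF f0.exp_v_int[OF ua(1) x] f0.exp_v_int[OF ua(2) x]])
qed

lemma A_graph_L1:
  assumes A: "A_graph d0 d1 g \<phi> u f" shows "L1 E u" "L1 E f" "L1 E (\<lambda>x. \<phi> x * u x)"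
proof -
  from A[unfolded A_graph_def Let_def, folded E_Eint] show u: "L1 E u" by (rule conjunct1)
  from A[unfolded A_graph_def Let_def, folded E_Eint, THEN conjunct2]
  obtain w where w: "L1 E (deriv w)" "L1 E (\<lambda>x. \<phi> x * u x)" "eqL E f (\<lambda>x. - deriv w x - \<phi> x * u x)"
    by (elim exE conjE) rule
  show "L1 E (\<lambda>x. \<phi> x * u x)" by (rule w(2))
  have "(\<lambda>x. - 1 * deriv w x - \<phi> x * u x) absolutely_integrable_on E"
    using w(1,2) unfolding L1_iff by (intro set_integral_diff(1) set_integrable_mult_right) auto
  then show "L1 E f" unfolding L1_iff
    by (rule absolutely_integrable_spike[OF _ w(3)[unfolded eqL_iff]]) auto
qed

end

section \<open>The jump semigroup\<close>

locale l1_embedding =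
  fixes E :: "real set"
  assumes E_leb: "E \<in> sets lebesgue"
begin

definition J :: "(real \<Rightarrow> real) \<Rightarrow> l1" where "J u = abs_l1 (\<lambda>x. indicator E x * u x)"

text \<open>Classes vanishing off \<open>E\<close>, encoded as fixed points of the projection that
  restricts to \<open>E\<close>. As this projection is bounded and linear, the set is a closed
  subspace.\<close>

definition XE :: "l1 set" where "XE = {f. J (rep_l1 f) = f}"

text \<open>The chosen representative does not matter, because an \<open>L1_operator\<close>
  respects equality almost everywhere on \<open>E\<close>; values off \<open>E\<close> are
  ignored.\<close>

definition lift :: "op \<Rightarrow> l1 \<Rightarrow> l1" where "lift T f = J (T (rep_l1 f))"

lemma L1_iff_integrable: "L1 E u \<longleftrightarrow> integrable lebesgue (\<lambda>x. indicator E x * u x)"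
  unfolding L1_def using integrable_restrict_space[of E lebesgue u] E_leb by simp

lemma AE_on_iff: "(AE x in lebesgue_on E. P x) \<longleftrightarrow> (AE x in lebesgue. x \<in> E \<longrightarrow> P x)"
  by (rule AE_restrict_space_iff) (use E_leb in simp)

lemma L1norm_eq: "L1norm E u = (LINT x|lebesgue. \<bar>indicator E x * u x\<bar>)"
  unfolding L1norm_def using E_leb by (subst integral_restrict_space) (auto simp: abs_mult)

lemma L1_rep [simp]: "L1 E (rep_l1 f)"
  unfolding L1_iff_integrable using integrable_mult_indicator[OF E_leb integrable_rep_l1[of f]] by simp

lemma J_eq_iff: "L1 E u \<Longrightarrow> L1 E v \<Longrightarrow> J u = J v \<longleftrightarrow> eqL E u v"
  unfolding J_def L1_iff_integrable eqL_def AE_on_iff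
  by (subst abs_l1_eq_iff) (auto elim!: eventually_rev_mp intro!: always_eventually split: split_indicator)

lemma norm_J: "L1 E u \<Longrightarrow> norm (J u) = L1norm E u"
  unfolding J_def L1_iff_integrable L1norm_eq by (rule norm_abs_l1)

lemma J_le_iff: "L1 E u \<Longrightarrow> L1 E v \<Longrightarrow> J u \<le> J v \<longleftrightarrow> (AE x in lebesgue_on E. u x \<le> v x)"
  unfolding J_def L1_iff_integrable AE_on_iff
  by (subst le_abs_l1_iff) (auto elim!: eventually_rev_mp intro!: always_eventually split: split_indicator)

lemma L1_lin: "L1 E u \<Longrightarrow> L1 E v \<Longrightarrow> L1 E (\<lambda>x. a * u x + b * v x)"
  unfolding L1_def by auto

lemma J_lin: "L1 E u \<Longrightarrow> L1 E v \<Longrightarrow> J (\<lambda>x. a * u x + b * v x) = a *\<^sub>R J u + b *\<^sub>R J v"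
proof -
  assume uv: "L1 E u" "L1 E v"
  let ?u = "\<lambda>x. indicator E x * u x" and ?v = "\<lambda>x. indicator E x * v x"
  have i: "integrable lebesgue ?u" "integrable lebesgue ?v" using uv by (simp_all add: L1_iff_integrable)
  have "a *\<^sub>R J u = abs_l1 (\<lambda>x. a * ?u x)" "b *\<^sub>R J v = abs_l1 (\<lambda>x. b * ?v x)"
    unfolding J_def using i by (auto intro!: scaleR_l1.abs_eq simp: ae_eq_def)
  moreover have "abs_l1 (\<lambda>x. a * ?u x) + abs_l1 (\<lambda>x. b * ?v x) = abs_l1 (\<lambda>x. a * ?u x + b * ?v x)"
    using i by (intro plus_l1.abs_eq) (auto simp: ae_eq_def)
  moreover have "(\<lambda>x. a * ?u x + b * ?v x) = (\<lambda>x. indicator E x * (a * u x + b * v x))"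
    by (auto simp: algebra_simps)
  ultimately show ?thesis unfolding J_def by simp
qed

lemma J_diff: "L1 E u \<Longrightarrow> L1 E v \<Longrightarrow> J (\<lambda>x. u x - v x) = J u - J v"
  using J_lin[of u v 1 "- 1"] by simp

lemma J_scale: "L1 E u \<Longrightarrow> J (\<lambda>x. a * u x) = a *\<^sub>R J u"
  using J_lin[of u u a 0] by simp

lemma J_zero: "J (\<lambda>x. 0) = 0"
  using J_scale[of "\<lambda>x. 0" 0] by (simp add: L1_def)

lemma J_nonneg_iff: "L1 E u \<Longrightarrow> 0 \<le> J u \<longleftrightarrow> nonnegL E u"
  using J_le_iff[of "\<lambda>x. 0" u] by (simp add: J_zero nonnegL_def L1_def)

lemma J_rep_add: "J (rep_l1 (f + h)) = J (rep_l1 f) + J (rep_l1 h)"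
  and J_rep_scale: "J (rep_l1 (c *\<^sub>R f)) = c *\<^sub>R J (rep_l1 f)"
proof -
  have a: "AE x in lebesgue. rep_l1 (f + h) x = rep_l1 f x + rep_l1 h x"
  proof -
    have "f + h = abs_l1 (\<lambda>x. rep_l1 f x + rep_l1 h x)"
      using plus_l1.abs_eq[of "rep_l1 f" "rep_l1 h"] by (simp add: ae_eq_def)
    then show ?thesis using rep_abs_l1[of "\<lambda>x. rep_l1 f x + rep_l1 h x"] by simp
  qed
  have "eqL E (rep_l1 (f + h)) (\<lambda>x. 1 * rep_l1 f x + 1 * rep_l1 h x)"
    unfolding eqL_def AE_on_iff using a by eventually_elim simp
  then have "J (rep_l1 (f + h)) = J (\<lambda>x. 1 * rep_l1 f x + 1 * rep_l1 h x)"
    by (rule J_eq_iff[THEN iffD2, OF L1_rep L1_lin[OF L1_rep L1_rep]])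
  also have "\<dots> = 1 *\<^sub>R J (rep_l1 f) + 1 *\<^sub>R J (rep_l1 h)" by (rule J_lin) auto
  finally show "J (rep_l1 (f + h)) = J (rep_l1 f) + J (rep_l1 h)" by simp
  have b: "AE x in lebesgue. rep_l1 (c *\<^sub>R f) x = c * rep_l1 f x"
  proof -
    have "c *\<^sub>R f = abs_l1 (\<lambda>x. c * rep_l1 f x)"
      using scaleR_l1.abs_eq[of "rep_l1 f" c] by (simp add: ae_eq_def)
    then show ?thesis using rep_abs_l1[of "\<lambda>x. c * rep_l1 f x"] by simp
  qed
  have "L1 E (\<lambda>x. c * rep_l1 f x)" using L1_lin[of "rep_l1 f" "rep_l1 f" c 0] by simp
  moreover have "eqL E (rep_l1 (c *\<^sub>R f)) (\<lambda>x. c * rep_l1 f x)"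
    unfolding eqL_def AE_on_iff using b by eventually_elim simp
  ultimately have "J (rep_l1 (c *\<^sub>R f)) = J (\<lambda>x. c * rep_l1 f x)"
    by (subst J_eq_iff) auto
  then show "J (rep_l1 (c *\<^sub>R f)) = c *\<^sub>R J (rep_l1 f)" by (simp add: J_scale)
qed

lemma rep_J_eqL: "L1 E u \<Longrightarrow> eqL E (rep_l1 (J u)) u"
proof -
  assume "L1 E u"
  then have "AE x in lebesgue. rep_l1 (J u) x = indicator E x * u x"
    unfolding J_def L1_iff_integrable by (rule rep_abs_l1)
  then show ?thesis unfolding eqL_def AE_on_iff by eventually_elim simp
qed

lemma J_in_XE [simp]: "L1 E u \<Longrightarrow> J u \<in> XE"
  unfolding XE_def using rep_J_eqL[of u] J_eq_iff[of "rep_l1 (J u)" u] by simp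

lemma norm_J_rep_le: "norm (J (rep_l1 f)) \<le> norm f"
proof -
  have "L1norm E (rep_l1 f) \<le> (LINT x|lebesgue. \<bar>rep_l1 f x\<bar>)"
    unfolding L1norm_eq
  proof (rule integral_mono)
    show "integrable lebesgue (\<lambda>x. \<bar>indicator E x * rep_l1 f x\<bar>)"
      using L1_rep[of f] unfolding L1_iff_integrable by (rule integrable_abs)
    show "\<bar>indicator E x * rep_l1 f x\<bar> \<le> \<bar>rep_l1 f x\<bar>" for x by (simp split: split_indicator)
  qed (simp add: integrable_abs)
  moreover have "norm f = (LINT x|lebesgue. \<bar>rep_l1 f x\<bar>)" using norm_abs_l1[of "rep_l1 f"] by simp
  ultimately show ?thesis by (simp add: norm_J)
qed

lemma bounded_linear_J_rep: "bounded_linear (\<lambda>f. J (rep_l1 f))"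
  by (rule bounded_linear_intro[of _ 1]) (simp_all add: J_rep_add J_rep_scale norm_J_rep_le)

lemma subspace_XE: "subspace XE"
proof -
  interpret b: bounded_linear "\<lambda>f. J (rep_l1 f)" by (rule bounded_linear_J_rep)
  show ?thesis unfolding subspace_def XE_def by (simp add: b.zero b.add b.scaleR)
qed

lemma closed_XE: "closed XE"
  unfolding XE_def
  by (intro closed_Collect_eq continuous_intros linear_continuous_on bounded_linear_J_rep)

lemma XE_iff: "f \<in> XE \<longleftrightarrow> (AE x in lebesgue. x \<notin> E \<longrightarrow> rep_l1 f x = 0)"
proof -
  have "f \<in> XE \<longleftrightarrow> abs_l1 (\<lambda>x. indicator E x * rep_l1 f x) = abs_l1 (rep_l1 f)" by (simp add: XE_def J_def)
  also have "\<dots> \<longleftrightarrow> (AE x in lebesgue. indicator E x * rep_l1 f x = rep_l1 f x)"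
    using L1_rep[of f] by (subst abs_l1_eq_iff) (auto simp: L1_iff_integrable)
  also have "\<dots> \<longleftrightarrow> (AE x in lebesgue. x \<notin> E \<longrightarrow> rep_l1 f x = 0)"
    by (intro AE_cong) (auto split: split_indicator)
  finally show ?thesis .
qed

lemma sup_XE: assumes "f \<in> XE" "h \<in> XE" shows "sup f h \<in> XE"
proof -
  have "sup f h = abs_l1 (\<lambda>x. max (rep_l1 f x) (rep_l1 h x))"
    using sup_l1.abs_eq[of "rep_l1 f" "rep_l1 h"] by (simp add: ae_eq_def)
  then have "AE x in lebesgue. rep_l1 (sup f h) x = max (rep_l1 f x) (rep_l1 h x)"
    using rep_abs_l1[of "\<lambda>x. max (rep_l1 f x) (rep_l1 h x)"] by simp
  then show ?thesis using assms unfolding XE_iff by eventually_elim auto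
qed

lemma nonneg_representative:
  assumes "0 \<le> f" obtains v where "L1 E v" "\<And>x. 0 \<le> v x" "J v = J (rep_l1 f)"
proof
  show "L1 E (\<lambda>x. \<bar>rep_l1 f x\<bar>)" using L1_rep[of f] unfolding L1_def by auto
  have "AE x in lebesgue. 0 \<le> rep_l1 f x"
  proof -
    have "abs_l1 (\<lambda>x. 0) \<le> abs_l1 (rep_l1 f)" using assms by (simp add: zero_l1_def)
    then show ?thesis by (subst (asm) le_abs_l1_iff) auto
  qed
  then have "eqL E (\<lambda>x. \<bar>rep_l1 f x\<bar>) (rep_l1 f)"
    unfolding eqL_def AE_on_iff by eventually_elim simp
  then show "J (\<lambda>x. \<bar>rep_l1 f x\<bar>) = J (rep_l1 f)"
    using \<open>L1 E (\<lambda>x. \<bar>rep_l1 f x\<bar>)\<close> by (subst J_eq_iff) auto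
qed auto

lemma XE_nonneg_representative:
  assumes "0 \<le> f" "f \<in> XE" obtains v where "L1 E v" "\<And>x. 0 \<le> v x" "f = J v"
proof (rule nonneg_representative[OF assms(1)])
  fix v assume v: "L1 E v" "\<And>x. 0 \<le> v x" "J v = J (rep_l1 f)"
  moreover have "J (rep_l1 f) = f" using assms(2) by (simp add: XE_def)
  ultimately show thesis by (intro that[of v]) auto
qed

lemma norm_J_nonneg:
  assumes v: "L1 E v" "\<And>x. x \<in> E \<Longrightarrow> 0 \<le> v x" shows "norm (J v) = integral E v"
proof -
  have "L1norm E v = (LINT x|lebesgue_on E. v x)"
    unfolding L1norm_def using v(2) by (intro Bochner_Integration.integral_cong) auto
  also have "\<dots> = integral E v" using v(1) E_leb unfolding L1_def by (intro lebesgue_integral_eq_integral)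
  finally show ?thesis using v(1) by (simp add: norm_J)
qed

context
  fixes T :: op assumes T: "L1_operator E T"
begin

lemma T_L1: "L1 E u \<Longrightarrow> L1 E (T u)" using T by (simp add: L1_operator_def)

lemma lift_J: "L1 E u \<Longrightarrow> lift T (J u) = J (T u)"
  using T rep_J_eqL[of u] T_L1 unfolding lift_def L1_operator_def by (subst J_eq_iff) auto

lemma lift_lin: "L1 E u \<Longrightarrow> L1 E v \<Longrightarrow> J (T (\<lambda>x. a * u x + b * v x)) = a *\<^sub>R J (T u) + b *\<^sub>R J (T v)"
proof -
  assume uv: "L1 E u" "L1 E v"
  then have "eqL E (T (\<lambda>x. a * u x + b * v x)) (\<lambda>x. a * T u x + b * T v x)" using T by (simp add: L1_operator_def)
  then have "J (T (\<lambda>x. a * u x + b * v x)) = J (\<lambda>x. a * T u x + b * T v x)"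
    using uv by (subst J_eq_iff) (auto intro: T_L1 L1_lin)
  then show ?thesis using uv by (simp add: J_lin T_L1)
qed

lemma lift_rep: "lift T f = lift T (J (rep_l1 f))"
  by (subst lift_J) (auto simp: lift_def)

lemma linear_lift: "linear (lift T)"
proof (rule linearI)
  fix f h :: l1 and c :: real
  have "lift T (f + h) = lift T (J (\<lambda>x. 1 * rep_l1 f x + 1 * rep_l1 h x))"
    by (subst lift_rep) (simp only: J_rep_add J_lin[OF L1_rep L1_rep] scaleR_one)
  also have "\<dots> = J (T (\<lambda>x. 1 * rep_l1 f x + 1 * rep_l1 h x))" by (rule lift_J) (rule L1_lin[OF L1_rep L1_rep])
  also have "\<dots> = 1 *\<^sub>R J (T (rep_l1 f)) + 1 *\<^sub>R J (T (rep_l1 h))" by (rule lift_lin) auto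
  finally show "lift T (f + h) = lift T f + lift T h" by (simp add: lift_def)
  have "lift T (c *\<^sub>R f) = lift T (J (\<lambda>x. c * rep_l1 f x + 0 * rep_l1 f x))"
    by (subst lift_rep) (simp only: J_rep_scale J_lin[OF L1_rep L1_rep] scaleR_zero_left add_0_right)
  also have "\<dots> = J (T (\<lambda>x. c * rep_l1 f x + 0 * rep_l1 f x))" by (rule lift_J) (rule L1_lin[OF L1_rep L1_rep])
  also have "\<dots> = c *\<^sub>R J (T (rep_l1 f)) + 0 *\<^sub>R J (T (rep_l1 f))" by (rule lift_lin) auto
  finally show "lift T (c *\<^sub>R f) = c *\<^sub>R lift T f" by (simp add: lift_def)
qed

lemma lift_in_XE: "lift T f \<in> XE" unfolding lift_def by (simp add: T_L1)

end

lemma contraction_if_positive: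
  fixes T :: "l1 \<Rightarrow> l1"
  assumes T: "linear T" "\<And>f. 0 \<le> f \<Longrightarrow> norm (T f) \<le> norm f"
  shows "norm (T f) \<le> norm f"
proof -
  have "T f = T (sup f 0) - T (sup (- f) 0)"
    using linear_diff[OF T(1), of "sup f 0" "sup (- f) 0"] sup_0_diff[of f] by simp
  then have "norm (T f) \<le> norm (T (sup f 0)) + norm (T (sup (- f) 0))" by (simp only: norm_triangle_ineq4)
  also have "\<dots> \<le> norm (sup f 0) + norm (sup (- f) 0)" by (intro add_mono T(2)) auto
  also have "\<dots> = norm f" by (rule norm_eq_pprt_nprt[symmetric])
  finally show ?thesis .
qed

text \<open>Where \<open>w\<close> is positive, large multiples of it exceed the given value, so
  almost everywhere the truncations are eventually constant; dominated convergence gives the limit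
  in norm.\<close>

lemma inf_multiple_tendsto:
  assumes w: "L1 E w" "AE x in lebesgue_on E. 0 < w x" and u: "0 \<le> u" "u \<in> XE"
  shows "(\<lambda>n. inf u (real n *\<^sub>R J w)) \<longlonglongrightarrow> u"
proof -
  from XE_nonneg_representative[OF u] obtain v where v: "L1 E v" "\<And>x. 0 \<le> v x" "u = J v" by blast
  let ?v = "\<lambda>x. indicator E x * v x" and ?w = "\<lambda>x. indicator E x * w x"
  have vi: "integrable lebesgue ?v" "integrable lebesgue ?w" using v w by (simp_all add: L1_iff_integrable)
  let ?f = "\<lambda>n x. min (?v x) (real n * ?w x)"
  have fi: "integrable lebesgue (?f n)" for n
    using vi by (intro integrable_min) auto
  have wpos: "AE x in lebesgue. x \<in> E \<longrightarrow> 0 < w x" using w(2) by (simp only: AE_on_iff)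
  have eq: "inf u (real n *\<^sub>R J w) = abs_l1 (?f n)" for n
  proof -
    have "real n *\<^sub>R J w = abs_l1 (\<lambda>x. real n * ?w x)"
      unfolding J_def using vi by (intro scaleR_l1.abs_eq) (auto simp: ae_eq_def)
    then show ?thesis unfolding v(3) J_def using vi by (simp only:) (rule inf_l1.abs_eq; auto simp: ae_eq_def)
  qed
  have "(\<lambda>n. abs_l1 (?f n)) \<longlonglongrightarrow> abs_l1 ?v"
  proof (rule abs_l1_tendsto_dominated(2)[OF fi _ vi(1)])
    show "?v \<in> borel_measurable lebesgue" using vi(1) by auto
    show "AE x in lebesgue. (\<lambda>n. ?f n x) \<longlonglongrightarrow> ?v x"
      using wpos
    proof eventually_elim
      case (elim x)
      show ?case
      proof (cases "x \<in> E")
        case True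
        then have wx: "0 < w x" using elim by simp
        obtain N :: nat where N: "v x / w x \<le> real N" using real_arch_simple by blast
        have "?f n x = ?v x" if "n \<ge> N" for n
        proof -
          have "v x / w x \<le> real n" using N that by (simp add: order_trans[of _ "real N"])
          then have "v x \<le> real n * w x" using wx by (simp add: pos_divide_le_eq)
          then show ?thesis using True by simp
        qed
        then show ?thesis by (intro tendsto_eventually eventually_sequentiallyI[of N])
      qed simp
    qed
    show "AE x in lebesgue. \<bar>?f n x\<bar> \<le> ?v x" for n
      using wpos by eventually_elim (use v(2) in \<open>auto simp: abs_le_iff min_le_iff_disj less_imp_le split: split_indicator\<close>)
  qed
  then have "(\<lambda>n. inf u (real n *\<^sub>R J w)) \<longlonglongrightarrow> abs_l1 ?v" by (simp only: eq)
  moreover have "abs_l1 ?v = u" by (simp only: v(3) J_def)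
  ultimately show ?thesis by simp
qed

lemma bounded_linear_integral_on:
  assumes B: "B \<in> sets lebesgue"
  shows "bounded_linear (\<lambda>f. LINT x|lebesgue. indicator B x * rep_l1 f x)"
    "0 \<le> f \<Longrightarrow> 0 \<le> (LINT x|lebesgue. indicator B x * rep_l1 f x)"
proof -
  have ib: "integrable lebesgue (\<lambda>x. indicator B x * rep_l1 f x)" for f
    using integrable_mult_indicator[OF B integrable_rep_l1[of f]] by simp
  have rep_add: "AE x in lebesgue. rep_l1 (f + h) x = rep_l1 f x + rep_l1 h x" for f h
  proof -
    have "f + h = abs_l1 (\<lambda>x. rep_l1 f x + rep_l1 h x)"
      using plus_l1.abs_eq[of "rep_l1 f" "rep_l1 h"] by (simp add: ae_eq_def)
    then show ?thesis using rep_abs_l1[of "\<lambda>x. rep_l1 f x + rep_l1 h x"] by simp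
  qed
  have rep_scale: "AE x in lebesgue. rep_l1 (c *\<^sub>R f) x = c * rep_l1 f x" for c f
  proof -
    have "c *\<^sub>R f = abs_l1 (\<lambda>x. c * rep_l1 f x)"
      using scaleR_l1.abs_eq[of "rep_l1 f" c] by (simp add: ae_eq_def)
    then show ?thesis using rep_abs_l1[of "\<lambda>x. c * rep_l1 f x"] by simp
  qed
  show "bounded_linear (\<lambda>f. LINT x|lebesgue. indicator B x * rep_l1 f x)"
  proof (rule bounded_linear_intro[of _ 1])
    fix f h :: l1 and c :: real
    have "(LINT x|lebesgue. indicator B x * rep_l1 (f + h) x) = (LINT x|lebesgue. indicator B x * rep_l1 f x + indicator B x * rep_l1 h x)"
    proof (rule integral_cong_AE)
      show "AE x in lebesgue. indicator B x * rep_l1 (f + h) x = indicator B x * rep_l1 f x + indicator B x * rep_l1 h x"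
        using rep_add[of f h] by eventually_elim (simp add: algebra_simps)
    qed (use ib[of "f + h"] ib[of f] ib[of h] in auto)
    then show "(LINT x|lebesgue. indicator B x * rep_l1 (f + h) x)
        = (LINT x|lebesgue. indicator B x * rep_l1 f x) + (LINT x|lebesgue. indicator B x * rep_l1 h x)"
      by (simp add: ib)
    have "(LINT x|lebesgue. indicator B x * rep_l1 (c *\<^sub>R f) x) = (LINT x|lebesgue. c * (indicator B x * rep_l1 f x))"
    proof (rule integral_cong_AE)
      show "AE x in lebesgue. indicator B x * rep_l1 (c *\<^sub>R f) x = c * (indicator B x * rep_l1 f x)"
        using rep_scale[of c f] by eventually_elim simp
    qed (use ib[of "c *\<^sub>R f"] ib[of f] in auto)
    then show "(LINT x|lebesgue. indicator B x * rep_l1 (c *\<^sub>R f) x) = c *\<^sub>R (LINT x|lebesgue. indicator B x * rep_l1 f x)"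
      by simp
    have "\<bar>LINT x|lebesgue. indicator B x * rep_l1 f x\<bar> \<le> (LINT x|lebesgue. \<bar>rep_l1 f x\<bar>)"
      using ib[of f] integrable_rep_l1[of f]
      by (intro integral_abs_bound_integral) (auto split: split_indicator)
    also have "\<dots> = norm f" using norm_abs_l1[of "rep_l1 f"] by simp
    finally show "norm (LINT x|lebesgue. indicator B x * rep_l1 f x) \<le> norm f * 1" by simp
  qed
  assume "0 \<le> f"
  then have "abs_l1 (\<lambda>x. 0) \<le> abs_l1 (rep_l1 f)" by (simp add: zero_l1_def)
  then have "AE x in lebesgue. 0 \<le> rep_l1 f x" by (subst (asm) le_abs_l1_iff) auto
  then show "0 \<le> (LINT x|lebesgue. indicator B x * rep_l1 f x)"
    by (intro integral_nonneg_AE) (auto elim!: eventually_mono)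
qed

end

section \<open>Lifting the jump operators and the semigroup\<close>

locale jump = transport d0 d1 g \<phi> E
  for d0 d1 g \<phi> E +
  fixes P :: op and S :: "real \<Rightarrow> op"
  assumes P_stoch: "stochastic_op E P" and S_def: "is_Pt_semigroup d0 d1 g \<phi> P S"
begin

sublocale l1_embedding E by standard (rule E_sets)

lemma P_op: "L1_operator E P"
  using P_stoch by (simp add: stochastic_op_def)

text \<open>Scaling a nonnegative vector to norm one turns preservation of densities into
  preservation of norms; norm zero is treated apart. Only the part of \<open>f\<close> on
  \<open>E\<close> counts, hence \<open>norm (J (rep_l1 f))\<close> and not
  \<open>norm f\<close>.\<close>

lemma stochastic_lift:
  assumes T: "stochastic_op E T" and f: "0 \<le> f"
  shows "0 \<le> lift T f" "norm (lift T f) = norm (J (rep_l1 f))"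
proof -
  have Top: "L1_operator E T" using T by (simp add: stochastic_op_def)
  from nonneg_representative[OF f] obtain v where v: "L1 E v" "\<And>x. 0 \<le> v x" "J v = J (rep_l1 f)" by blast
  have eq: "lift T f = J (T v)" using lift_rep[OF Top, of f] lift_J[OF Top v(1)] v(3) by simp
  have "0 \<le> J (T v) \<and> norm (J (T v)) = norm (J v)"
  proof (cases "norm (J v) = 0")
    case True
    then have "J v = J (\<lambda>x. 0)" by (simp add: J_zero)
    then have "J (T v) = lift T 0" using lift_J[OF Top v(1)] by (simp add: J_zero)
    then have "J (T v) = 0" using linear_0[OF linear_lift[OF Top]] by simp
    then show ?thesis using True by simp
  next
    case False
    define c where "c = norm (J v)"
    have c: "0 < c" using False by (simp add: c_def)
    let ?u = "\<lambda>x. (1 / c) * v x"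
    have Lu: "L1 E ?u" using L1_lin[OF v(1) v(1), of "1 / c" 0] by simp
    have Ju: "J ?u = (1 / c) *\<^sub>R J v" by (rule J_scale[OF v(1)])
    have "is_density E ?u"
      unfolding is_density_def using Lu v(2) c norm_J[OF Lu] Ju by (auto simp: nonnegL_def c_def)
    then have d: "is_density E (T ?u)" using T by (simp add: stochastic_op_def)
    then have dd: "L1 E (T ?u)" "0 \<le> J (T ?u)" "norm (J (T ?u)) = 1"
      using J_nonneg_iff norm_J by (auto simp: is_density_def)
    have "J (T ?u) = (1 / c) *\<^sub>R J (T v)"
      using lift_J[OF Top Lu] lift_J[OF Top v(1)] linear_scale[OF linear_lift[OF Top], of "1 / c" "J v"] Ju by simp
    then have "J (T v) = c *\<^sub>R J (T ?u)" using c by simp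
    then show ?thesis using dd c by (simp add: scaleR_nonneg_nonneg c_def)
  qed
  then show "0 \<le> lift T f" "norm (lift T f) = norm (J (rep_l1 f))" using eq v(3) by simp_all
qed

lemma R1_op: "L1_operator E R1" "L1_operator E (\<lambda>v x. \<phi> x * R1 v x)"
proof -
  have cong: "R1 u x = R1 v x" if "eqL E u v" for u v x
    using f1.sol_cong[of u v x] that by (simp add: eqL_iff)
  have lin: "R1 (\<lambda>y. a * u y + b * v y) x = a * R1 u x + b * R1 v x" if "L1 E u" "L1 E v" "x \<in> E" for a b u v x
    using sol_linear(1)[OF that, of a b] by (simp add: add_divide_distrib)
  show "L1_operator E R1"
    unfolding L1_operator_def
  proof (intro conjI allI impI)
    show "L1 E (R1 u)" if "L1 E u" for u by (rule R1_L1(1)[OF that])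
    show "eqL E (R1 u) (R1 v)" if "eqL E u v" for u v using cong[OF that] by (simp add: eqL_def)
    show "eqL E (R1 (\<lambda>x. a * u x + b * v x)) (\<lambda>x. a * R1 u x + b * R1 v x)" if "L1 E u" "L1 E v" for u v a b
      unfolding eqL_iff by (rule negligible_subset[OF negligible_empty]) (use lin[OF that] in auto)
  qed
  show "L1_operator E (\<lambda>v x. \<phi> x * R1 v x)"
    unfolding L1_operator_def
  proof (intro conjI allI impI)
    show "L1 E (\<lambda>x. \<phi> x * R1 u x)" if "L1 E u" for u by (rule R1_L1(2)[OF that])
    show "eqL E (\<lambda>x. \<phi> x * R1 u x) (\<lambda>x. \<phi> x * R1 v x)" if "eqL E u v" for u v
      unfolding cong[OF that] by (simp only: eqL_def AE_on_iff simp_thms eventually_True)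
    show "eqL E (\<lambda>x. \<phi> x * R1 (\<lambda>x. a * u x + b * v x) x) (\<lambda>x. a * (\<phi> x * R1 u x) + b * (\<phi> x * R1 v x))"
      if "L1 E u" "L1 E v" for u v a b
      unfolding eqL_iff
    proof (rule negligible_subset[OF negligible_empty], clarify)
      fix x assume x: "x \<in> E"
        and ne: "\<phi> x * R1 (\<lambda>x. a * u x + b * v x) x \<noteq> a * (\<phi> x * R1 u x) + b * (\<phi> x * R1 v x)"
      have "\<phi> x * R1 (\<lambda>x. a * u x + b * v x) x = \<phi> x * (a * R1 u x + b * R1 v x)" by (simp only: lin[OF that x])
      then show "x \<in> {}" using ne by (simp add: algebra_simps)
    qed
  qed
qed

definition "RR = lift R1"
definition "PhiR = lift (\<lambda>v x. \<phi> x * R1 v x)"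
definition "BB f = lift P (PhiR f)"

lemma RR_J: "L1 E u \<Longrightarrow> RR (J u) = J (R1 u)"
  unfolding RR_def by (rule lift_J[OF R1_op(1)])

lemma BB_J: "L1 E u \<Longrightarrow> BB (J u) = J (P (\<lambda>x. \<phi> x * R1 u x))"
  unfolding BB_def PhiR_def by (simp only: lift_J[OF R1_op(2)] lift_J[OF P_op] R1_L1)

lemma RR_rep: "RR f = RR (J (rep_l1 f))" and BB_rep: "BB f = BB (J (rep_l1 f))"
  unfolding RR_def BB_def PhiR_def by (rule lift_rep[OF R1_op(1)]) (subst lift_rep[OF R1_op(2)], rule refl)

lemma R1_nonneg: assumes "L1 E v" "\<And>x. 0 \<le> v x" "x \<in> E" shows "0 \<le> R1 v x"
  using f1.sol_nonneg[of v x] assms g_pos by (simp add: L1_iff less_imp_le)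

text \<open>\<open>P\<close> preserves norms of nonnegative vectors, so the mass balance between
  \<open>R1\<close> and \<open>\<phi> R1\<close> becomes one between \<open>RR\<close> and
  \<open>BB\<close>.\<close>

lemma RR_BB_nonneg:
  assumes f: "0 \<le> f"
  shows "0 \<le> RR f" "0 \<le> BB f" "norm (RR f) + norm (BB f) = norm (J (rep_l1 f))"
proof -
  from nonneg_representative[OF f] obtain v where v: "L1 E v" "\<And>x. 0 \<le> v x" "J v = J (rep_l1 f)" by blast
  have phiR: "0 \<le> \<phi> x * R1 v x" if "x \<in> E" for x using mult_nonneg_nonneg[OF bspec[OF phi_nonneg that] R1_nonneg[OF v(1,2) that]] .
  have R: "RR f = J (R1 v)" using RR_rep[of f] RR_J[OF v(1)] v(3) by simp
  have Phi: "PhiR f = J (\<lambda>x. \<phi> x * R1 v x)"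
    unfolding PhiR_def using lift_rep[OF R1_op(2), of f] lift_J[OF R1_op(2) v(1)] v(3) by simp
  have nn: "nonnegL E (R1 v)" "nonnegL E (\<lambda>x. \<phi> x * R1 v x)"
    unfolding nonnegL_def AE_on_iff using R1_nonneg[OF v(1,2)] phiR by auto
  then show "0 \<le> RR f" unfolding R by (subst J_nonneg_iff) (auto intro: R1_L1 v)
  have P0: "0 \<le> PhiR f" unfolding Phi by (rule J_nonneg_iff[THEN iffD2, OF R1_L1(2)[OF v(1)] nn(2)])
  show "0 \<le> BB f" unfolding BB_def by (rule stochastic_lift(1)[OF P_stoch P0])
  have "norm (BB f) = norm (J (rep_l1 (PhiR f)))" unfolding BB_def by (rule stochastic_lift(2)[OF P_stoch P0])
  also have "J (rep_l1 (PhiR f)) = PhiR f"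
    using J_in_XE[OF R1_L1(2)[OF v(1)]] unfolding Phi XE_def by simp
  finally have "norm (BB f) = integral E (\<lambda>x. \<phi> x * R1 v x)"
    unfolding Phi using norm_J_nonneg[OF R1_L1(2)[OF v(1)] phiR] by simp
  moreover have "norm (RR f) = integral E (R1 v)"
    unfolding R using norm_J_nonneg[OF R1_L1(1)[OF v(1)] R1_nonneg[OF v(1,2)]] by simp
  moreover have "norm (J (rep_l1 f)) = integral E v" unfolding v(3)[symmetric] by (rule norm_J_nonneg[OF v(1,2)])
  ultimately show "norm (RR f) + norm (BB f) = norm (J (rep_l1 f))" using R1_balance[OF v(1,2)] by simp
qed

lemma linear_RR: "linear RR" unfolding RR_def by (rule linear_lift[OF R1_op(1)])

lemma linear_BB: "linear BB"
proof -
  have "BB = lift P \<circ> PhiR" by (simp add: BB_def fun_eq_iff)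
  then show ?thesis unfolding PhiR_def using linear_compose[OF linear_lift[OF R1_op(2)] linear_lift[OF P_op]] by simp
qed

lemma RR_BB_contraction: "norm (RR f) \<le> norm f" "norm (BB f) \<le> norm f"
proof -
  have le: "norm (RR f) \<le> norm f" "norm (BB f) \<le> norm f" if "0 \<le> f" for f
    using RR_BB_nonneg(3)[OF that] norm_J_rep_le[of f] norm_ge_zero[of "RR f"] norm_ge_zero[of "BB f"] by linarith+
  show "norm (RR f) \<le> norm f" by (rule contraction_if_positive[OF linear_RR le(1)])
  show "norm (BB f) \<le> norm f" by (rule contraction_if_positive[OF linear_BB le(2)])
qed

sublocale sp: substochastic_pair RR BB XE
proof (rule substochastic_pair.intro)
  show "bounded_linear RR"
    using linear_RR RR_BB_contraction(1)
    by (intro bounded_linear_intro[of _ 1]) (auto simp: linear_add linear_scale)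
  show "linear BB" by (rule linear_BB)
  show "closed XE" by (rule closed_XE)
  show "0 \<le> RR u" "0 \<le> BB u" if "0 \<le> u" for u using RR_BB_nonneg[OF that] by simp_all
  show "norm (BB u) \<le> norm u" for u by (rule RR_BB_contraction)
  show "BB u \<in> XE" for u unfolding BB_def by (rule lift_in_XE[OF P_op])
  show "norm u = norm (RR u) + norm (BB u)" if "0 \<le> u" "u \<in> XE" for u
    using RR_BB_nonneg(3)[OF that(1)] that(2) by (simp add: XE_def)
  \<comment> \<open>\<open>\<phi> R1 u\<close> vanishes wherever \<open>R1 u\<close> does, so the
    kernel of \<open>RR\<close> is contained in that of \<open>BB\<close>.\<close>
  show "BB u = 0" if "RR u = 0" for u
  proof -
    have L: "L1 E (rep_l1 u)" by simp
    have "J (R1 (rep_l1 u)) = J (\<lambda>x. 0)" using that RR_rep[of u] RR_J[OF L] by (simp add: J_zero)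
    then have "eqL E (R1 (rep_l1 u)) (\<lambda>x. 0)" using J_eq_iff[OF R1_L1(1)[OF L], of "\<lambda>x. 0"] by (simp add: L1_def)
    then have "eqL E (\<lambda>x. \<phi> x * R1 (rep_l1 u) x) (\<lambda>x. 0)"
      unfolding eqL_def by (auto elim!: eventually_mono)
    then have "J (\<lambda>x. \<phi> x * R1 (rep_l1 u) x) = J (\<lambda>x. 0)"
      using J_eq_iff[OF R1_L1(2)[OF L], of "\<lambda>x. 0"] by (simp add: L1_def)
    then have "PhiR (J (rep_l1 u)) = 0" unfolding PhiR_def using lift_J[OF R1_op(2) L] by (simp add: J_zero)
    then show ?thesis using BB_rep[of u] linear_0[OF linear_lift[OF P_op]] by (simp add: BB_def)
  qed
qed

lemma S_facts:
  "positive_contraction_C0_semigroup E S" "C0_semigroup E S" "\<And>t. 0 \<le> t \<Longrightarrow> L1_operator E (S t)"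
proof -
  show 1: "positive_contraction_C0_semigroup E S"
    using S_def unfolding is_Pt_semigroup_def Let_def E_Eint by (rule conjunct1)
  show 2: "C0_semigroup E S" using 1 unfolding positive_contraction_C0_semigroup_def by (rule conjunct1)
  show "L1_operator E (S t)" if "0 \<le> t" for t using 2 that unfolding C0_semigroup_def by blast
qed

definition "SS t = lift (S t)"

lemma SS_J: "0 \<le> t \<Longrightarrow> L1 E u \<Longrightarrow> SS t (J u) = J (S t u)"
  unfolding SS_def by (rule lift_J[OF S_facts(3)])

sublocale ps: pos_semigroup SS XE
proof (rule pos_semigroup.intro)
  note C0 = S_facts(2)[unfolded C0_semigroup_def]
  fix t s :: real and u :: l1
  show "linear (SS t)" if "0 \<le> t" unfolding SS_def by (rule linear_lift[OF S_facts(3)[OF that]])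
  show "0 \<le> SS t u" if t: "0 \<le> t" and u: "0 \<le> u"
  proof -
    from nonneg_representative[OF u] obtain v where v: "L1 E v" "\<And>x. 0 \<le> v x" "J v = J (rep_l1 u)" by blast
    have "SS t u = J (S t v)"
      unfolding SS_def using lift_rep[OF S_facts(3)[OF t], of u] lift_J[OF S_facts(3)[OF t] v(1)] v(3) by simp
    moreover have "nonnegL E (S t v)"
      using S_facts(1) t v unfolding positive_contraction_C0_semigroup_def by (auto simp: nonnegL_def)
    ultimately show ?thesis using T_L1[OF S_facts(3)[OF t] v(1)] by (simp add: J_nonneg_iff)
  qed
  show "norm (SS t u) \<le> norm u" if t: "0 \<le> t"
  proof -
    have "norm (SS t u) = L1norm E (S t (rep_l1 u))"
      unfolding SS_def lift_def by (rule norm_J[OF T_L1[OF S_facts(3)[OF t] L1_rep]])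
    also have "\<dots> \<le> L1norm E (rep_l1 u)"
      using S_facts(1) t unfolding positive_contraction_C0_semigroup_def by simp
    also have "\<dots> \<le> norm u" using norm_J_rep_le[of u] by (simp add: norm_J)
    finally show ?thesis .
  qed
  show "SS (t + s) u = SS t (SS s u)" if ts: "0 \<le> t" "0 \<le> s"
  proof -
    have L: "L1 E (S s (rep_l1 u))" by (rule T_L1[OF S_facts(3)[OF ts(2)] L1_rep])
    have "SS t (SS s u) = J (S t (S s (rep_l1 u)))"
      using SS_J[OF ts(1) L] by (simp add: SS_def lift_def)
    moreover have "eqL E (S (t + s) (rep_l1 u)) (S t (S s (rep_l1 u)))" using C0 ts by simp
    then have "SS (t + s) u = J (S t (S s (rep_l1 u)))"
      unfolding SS_def lift_def
      by (subst J_eq_iff) (auto intro!: T_L1[OF S_facts(3)] L simp: ts)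
    ultimately show ?thesis by simp
  qed
  show "continuous_on {0..} (\<lambda>t. SS t u)"
    unfolding continuous_on_def
  proof
    fix t :: real assume t: "t \<in> {0..}"
    have "((\<lambda>s. L1norm E (\<lambda>x. S s (rep_l1 u) x - S t (rep_l1 u) x)) \<longlongrightarrow> 0) (at t within {0..})"
      using C0 t by simp
    moreover have "\<forall>\<^sub>F s in at t within {0..}. L1norm E (\<lambda>x. S s (rep_l1 u) x - S t (rep_l1 u) x) = norm (SS s u - SS t u)"
    proof (rule eventually_at_filter[THEN iffD2], rule always_eventually, intro allI impI)
      fix s :: real assume s: "s \<in> {0..}"
      have L: "L1 E (S s (rep_l1 u))" "L1 E (S t (rep_l1 u))" using s t by (auto intro: T_L1[OF S_facts(3)])
      have "L1 E (\<lambda>x. S s (rep_l1 u) x - S t (rep_l1 u) x)" using L1_lin[OF L, of 1 "- 1"] by simp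
      then show "L1norm E (\<lambda>x. S s (rep_l1 u) x - S t (rep_l1 u) x) = norm (SS s u - SS t u)"
        using J_diff[OF L] norm_J[OF \<open>L1 E (\<lambda>x. S s (rep_l1 u) x - S t (rep_l1 u) x)\<close>] by (simp add: SS_def lift_def)
    qed
    ultimately have "((\<lambda>s. norm (SS s u - SS t u)) \<longlongrightarrow> 0) (at t within {0..})"
      by (rule tendsto_cong[THEN iffD1, rotated])
    then show "((\<lambda>t. SS t u) \<longlongrightarrow> SS t u) (at t within {0..})"
      by (rule LIM_zero_cancel[OF tendsto_norm_zero_cancel])
  qed
  show "SS 0 u = u" if "u \<in> XE"
  proof -
    have "eqL E (S 0 (rep_l1 u)) (rep_l1 u)" using C0 by simp
    then have "SS 0 u = J (rep_l1 u)"
      unfolding SS_def lift_def by (subst J_eq_iff) (auto intro: T_L1[OF S_facts(3)])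
    then show ?thesis using that by (simp add: XE_def)
  qed
  show "SS t u \<in> XE" if "0 \<le> t" unfolding SS_def by (rule lift_in_XE[OF S_facts(3)[OF that]])
qed (fact subspace_XE closed_XE sup_XE)+

lemma generator_graph_imp_gen:
  assumes "generator_graph E S u f" shows "ps.gen (J u) (J f)"
proof -
  have L: "L1 E u" "L1 E f" and lim: "((\<lambda>h. L1norm E (\<lambda>x. (S h u x - u x) / h - f x)) \<longlongrightarrow> 0) (at_right 0)"
    using assms by (auto simp: generator_graph_def)
  have "\<forall>\<^sub>F h in at_right 0. L1norm E (\<lambda>x. (S h u x - u x) / h - f x) = norm ((SS h (J u) - J u) /\<^sub>R h - J f)"
    using eventually_at_right_less[of "0::real"]
  proof eventually_elim
    case (elim h)
    have Lh: "L1 E (S h u)" by (rule T_L1[OF S_facts(3)]) (use elim L in auto)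
    have L1: "L1 E (\<lambda>x. (1 / h) * S h u x + (- 1 / h) * u x)" by (rule L1_lin[OF Lh L(1)])
    have L2: "L1 E (\<lambda>x. 1 * ((1 / h) * S h u x + (- 1 / h) * u x) + (- 1) * f x)" by (rule L1_lin[OF L1 L(2)])
    have "J (\<lambda>x. 1 * ((1 / h) * S h u x + (- 1 / h) * u x) + (- 1) * f x) = (SS h (J u) - J u) /\<^sub>R h - J f"
      unfolding J_lin[OF L1 L(2)] J_lin[OF Lh L(1)] using SS_J[of h u] elim L
      by (simp add: scaleR_diff_right divide_inverse)
    moreover have "(\<lambda>x. 1 * ((1 / h) * S h u x + (- 1 / h) * u x) + (- 1) * f x) = (\<lambda>x. (S h u x - u x) / h - f x)"
      by (auto simp: diff_divide_distrib)
    ultimately show ?case using norm_J[OF L2] by simp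
  qed
  with lim have "((\<lambda>h. norm ((SS h (J u) - J u) /\<^sub>R h - J f)) \<longlongrightarrow> 0) (at_right 0)"
    by (rule tendsto_cong[THEN iffD1, rotated])
  then have "((\<lambda>h. (SS h (J u) - J u) /\<^sub>R h) \<longlongrightarrow> J f) (at_right 0)"
    by (rule LIM_zero_cancel[OF tendsto_norm_zero_cancel])
  then show ?thesis unfolding ps.gen_def using L by simp
qed

abbreviation "Bop \<equiv> (\<lambda>v. P (\<lambda>y. \<phi> y * RA d0 d1 g \<phi> 1 v y))"

lemma RA_L1: assumes v: "L1 E v" shows "L1 E (RA d0 d1 g \<phi> 1 v)" "L1 E (\<lambda>y. \<phi> y * RA d0 d1 g \<phi> 1 v y)"
    "J (RA d0 d1 g \<phi> 1 v) = RR (J v)" "J (\<lambda>y. \<phi> y * RA d0 d1 g \<phi> 1 v y) = PhiR (J v)"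
proof -
  have N: "negligible {x \<in> E. RA d0 d1 g \<phi> 1 v x \<noteq> R1 v x}" using RA_eq[OF v] by (simp only: eqL_iff)
  show 1: "L1 E (RA d0 d1 g \<phi> 1 v)" unfolding L1_iff
    by (rule absolutely_integrable_spike[OF R1_L1(1)[OF v, unfolded L1_iff] N]) auto
  show 2: "L1 E (\<lambda>y. \<phi> y * RA d0 d1 g \<phi> 1 v y)" unfolding L1_iff
    by (rule absolutely_integrable_spike[OF R1_L1(2)[OF v, unfolded L1_iff] N]) auto
  have "J (RA d0 d1 g \<phi> 1 v) = J (R1 v)" using RA_eq[OF v] 1 R1_L1(1)[OF v] by (subst J_eq_iff) auto
  then show "J (RA d0 d1 g \<phi> 1 v) = RR (J v)" by (simp add: RR_J[OF v])
  have "eqL E (\<lambda>y. \<phi> y * RA d0 d1 g \<phi> 1 v y) (\<lambda>y. \<phi> y * R1 v y)"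
    using RA_eq[OF v] unfolding eqL_def by (auto elim!: eventually_mono)
  then have "J (\<lambda>y. \<phi> y * RA d0 d1 g \<phi> 1 v y) = J (\<lambda>y. \<phi> y * R1 v y)"
    using 2 R1_L1(2)[OF v] by (subst J_eq_iff) auto
  then show "J (\<lambda>y. \<phi> y * RA d0 d1 g \<phi> 1 v y) = PhiR (J v)" unfolding PhiR_def lift_J[OF R1_op(2) v] .
qed

lemma Bop_power: assumes u: "L1 E u" shows "L1 E ((Bop ^^ n) u) \<and> J ((Bop ^^ n) u) = (BB ^^ n) (J u)"
proof (induction n)
  case 0 then show ?case using u by simp
next
  case (Suc n)
  then have L: "L1 E ((Bop ^^ n) u)" and eq: "J ((Bop ^^ n) u) = (BB ^^ n) (J u)" by auto
  have "L1 E (Bop ((Bop ^^ n) u))" by (rule T_L1[OF P_op RA_L1(2)[OF L]])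
  moreover have "J (Bop ((Bop ^^ n) u)) = BB (J ((Bop ^^ n) u))"
    using lift_J[OF P_op RA_L1(2)[OF L]] RA_L1(4)[OF L] by (simp add: BB_def)
  ultimately show ?case using eq by simp
qed

text \<open>This is the defining property of the semigroup at lam = 1, transported to classes:
  \<open>RA\<close> and its composition with \<open>P\<close> become \<open>RR\<close> and
  \<open>BB\<close>, and the limit is the resolvent of the generator.\<close>

lemma resolvent_exists:
  assumes f: "f \<in> XE"
  obtains w where "(\<lambda>N. RR (\<Sum>n\<le>N. (BB ^^ n) f)) \<longlonglongrightarrow> w" "ps.gen w (w - f)"
proof -
  define u where "u = rep_l1 f"
  have u: "L1 E u" "J u = f" using f by (simp_all add: u_def XE_def)
  have "\<exists>w. L1_limseq E (\<lambda>N. RA d0 d1 g \<phi> 1 (\<lambda>x. \<Sum>n\<le>N. (Bop ^^ n) u x)) w \<and> generator_graph E S w (\<lambda>x. 1 * w x - u x)"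
    by (rule S_def[unfolded is_Pt_semigroup_def Let_def E_Eint[symmetric], THEN conjunct2, rule_format, OF zero_less_one u(1)])
  then obtain w where w: "L1_limseq E (\<lambda>N. RA d0 d1 g \<phi> 1 (\<lambda>x. \<Sum>n\<le>N. (Bop ^^ n) u x)) w"
      "generator_graph E S w (\<lambda>x. 1 * w x - u x)" by (elim exE conjE) rule
  have Ls: "L1 E (\<lambda>x. \<Sum>n\<le>N. (Bop ^^ n) u x) \<and> J (\<lambda>x. \<Sum>n\<le>N. (Bop ^^ n) u x) = (\<Sum>n\<le>N. (BB ^^ n) f)" for N
  proof (induction N)
    case 0 then show ?case using u by simp
  next
    case (Suc N)
    then have L: "L1 E (\<lambda>x. \<Sum>n\<le>N. (Bop ^^ n) u x)" and eq: "J (\<lambda>x. \<Sum>n\<le>N. (Bop ^^ n) u x) = (\<Sum>n\<le>N. (BB ^^ n) f)" by auto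
    have B: "L1 E ((Bop ^^ Suc N) u)" "J ((Bop ^^ Suc N) u) = (BB ^^ Suc N) f"
      using Bop_power[OF u(1), of "Suc N"] unfolding u(2) by blast+
    have e: "(\<lambda>x. \<Sum>n\<le>Suc N. (Bop ^^ n) u x) = (\<lambda>x. 1 * (\<Sum>n\<le>N. (Bop ^^ n) u x) + 1 * (Bop ^^ Suc N) u x)"
      by (simp only: sum.atMost_Suc mult_1)
    show ?case unfolding e
      using L1_lin[OF L B(1), of 1 1] J_lin[OF L B(1), of 1 1]
      by (simp only: eq B(2) scaleR_one sum.atMost_Suc simp_thms)
  qed
  have Lw: "L1 E w" using w(1) by (simp add: L1_limseq_def)
  show thesis
  proof
    have "L1norm E (\<lambda>x. RA d0 d1 g \<phi> 1 (\<lambda>x. \<Sum>n\<le>N. (Bop ^^ n) u x) x - w x) = norm (RR (\<Sum>n\<le>N. (BB ^^ n) f) - J w)" for N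
    proof -
      have L: "L1 E (\<lambda>x. \<Sum>n\<le>N. (Bop ^^ n) u x)" and eq: "J (\<lambda>x. \<Sum>n\<le>N. (Bop ^^ n) u x) = (\<Sum>n\<le>N. (BB ^^ n) f)"
        using Ls[of N] by blast+
      have "L1 E (\<lambda>x. RA d0 d1 g \<phi> 1 (\<lambda>x. \<Sum>n\<le>N. (Bop ^^ n) u x) x - w x)"
        using L1_lin[OF RA_L1(1)[OF L] Lw, of 1 "- 1"] by simp
      from norm_J[OF this] show ?thesis
        unfolding J_diff[OF RA_L1(1)[OF L] Lw] RA_L1(3)[OF L] eq by simp
    qed
    then have "(\<lambda>N. norm (RR (\<Sum>n\<le>N. (BB ^^ n) f) - J w)) \<longlonglongrightarrow> 0"
      using w(1) by (simp add: L1_limseq_def)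
    then show "(\<lambda>N. RR (\<Sum>n\<le>N. (BB ^^ n) f)) \<longlonglongrightarrow> J w"
      by (rule LIM_zero_cancel[OF tendsto_norm_zero_cancel])
    have "J (\<lambda>x. 1 * w x - u x) = J w - f" using J_diff[OF Lw u(1)] u(2) by simp
    then show "ps.gen (J w) (J w - f)" using generator_graph_imp_gen[OF w(2)] by simp
  qed
qed

text \<open>For \<open>z = u - f\<close> one has \<open>RR z = u\<close> and
  \<open>BB z = P (\<phi> u)\<close>. By telescoping, the resolvent of the semigroup maps
  \<open>z - BB z\<close> to \<open>RR z\<close>, so the generator is defined at \<open>u\<close>
  with value \<open>u - z + BB z\<close>.\<close>

lemma generator_extends:
  assumes A: "A_graph d0 d1 g \<phi> u f"
  shows "ps.gen (J u) (J f + J (P (\<lambda>x. \<phi> x * u x)))"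
proof -
  note L = A_graph_L1[OF A]
  have Lz: "L1 E (\<lambda>x. u x - f x)" using L1_lin[OF L(1,2), of 1 "- 1"] by simp
  have e: "eqL E u (R1 (\<lambda>x. u x - f x))"
    by (rule A_graph_imp_sol[OF f1.interval_flow_axioms A Lz]) (simp add: eqL_def)
  define z where "z = J (\<lambda>x. u x - f x)"
  have zX: "z \<in> XE" unfolding z_def by (rule J_in_XE[OF Lz])
  have z: "z = J u - J f" unfolding z_def by (rule J_diff[OF L(1,2)])
  have Rz: "RR z = J u" unfolding z_def RR_J[OF Lz] using e L(1) R1_L1(1)[OF Lz] by (subst J_eq_iff) (auto simp: eqL_def)
  have "J (\<lambda>x. \<phi> x * R1 (\<lambda>x. u x - f x) x) = J (\<lambda>x. \<phi> x * u x)"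
    using e L(3) R1_L1(2)[OF Lz] by (subst J_eq_iff) (auto simp: eqL_def elim!: eventually_mono)
  then have Bz: "BB z = J (P (\<lambda>x. \<phi> x * u x))"
    unfolding z_def BB_def PhiR_def lift_J[OF R1_op(2) Lz] by (simp add: lift_J[OF P_op L(3)])
  have BzX: "z - BB z \<in> XE" using subspace_diff[OF subspace_XE zX] lift_in_XE[OF P_op] by (simp add: BB_def)
  obtain y where y: "(\<lambda>N. RR (\<Sum>n\<le>N. (BB ^^ n) z)) \<longlonglongrightarrow> y" by (rule resolvent_exists[OF zX])
  obtain w where w: "(\<lambda>N. RR (\<Sum>n\<le>N. (BB ^^ n) (z - BB z))) \<longlonglongrightarrow> w" "ps.gen w (w - (z - BB z))"
    by (rule resolvent_exists[OF BzX])
  have "w = J u" using LIMSEQ_unique[OF w(1) sp.resolvent_series_diff[OF y]] Rz by simp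
  moreover have "J u - (z - BB z) = J f + J (P (\<lambda>x. \<phi> x * u x))"
    unfolding Bz by (simp add: z)
  ultimately show ?thesis using w(2) by simp
qed

end

section \<open>Invariant vectors and preservation of mass\<close>

context jump begin

lemma J_cong: "(\<And>x. x \<in> E \<Longrightarrow> u x = v x) \<Longrightarrow> J u = J v"
  unfolding J_def by (rule arg_cong[where f = abs_l1]) (auto simp: indicator_def fun_eq_iff)

lemma L1_eqL: assumes "L1 E u" "eqL E u v" shows "L1 E v"
proof -
  have N: "negligible {x \<in> E. u x \<noteq> v x}" using assms(2) by (simp only: eqL_iff)
  show ?thesis unfolding L1_iff
    by (rule absolutely_integrable_spike[OF assms(1)[unfolded L1_iff] N]) auto
qed

lemma eqL_on: "(\<And>x. x \<in> E \<Longrightarrow> u x = v x) \<Longrightarrow> eqL E u v"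
  unfolding eqL_def AE_on_iff by simp

lemma lift_P_mono: assumes "f \<le> h" shows "lift P f \<le> lift P h"
proof -
  have "0 \<le> lift P (h - f)" by (rule stochastic_lift(1)[OF P_stoch]) (use assms in simp)
  then show ?thesis by (simp add: linear_diff[OF linear_lift[OF P_op]])
qed

lemma not_AE_avoids_interval:
  assumes ab: "a \<in> E" "b \<in> E" "a < b" and AE: "AE x in lebesgue_on E. \<not> (a \<le> x \<and> x \<le> b)"
  shows False
proof -
  have "AE x in lebesgue. x \<notin> {a..b}"
    using AE[unfolded AE_on_iff] by eventually_elim (use Icc_E[OF ab(1,2)] in auto)
  then have "{a..b} \<in> null_sets lebesgue" by (subst AE_iff_null_sets) auto
  then have "negligible {a..b}" by (simp add: negligible_iff_null_sets)
  then show False using ab(3) negligible_interval(1)[of a b] by simp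
qed

lemma integral_Icc_pos:
  assumes v: "L1 E v" "\<And>x. 0 \<le> v x" "AE x in lebesgue_on E. 0 < v x" and ab: "a \<in> E" "b \<in> E" "a < b"
  shows "0 < integral {a..b} v"
proof (rule ccontr)
  assume neg: "\<not> 0 < integral {a..b} v"
  have i: "integrable (lebesgue_on {a..b}) v"
    using f0.v_Icc[OF v(1)[unfolded L1_iff] ab(1,2)] by (simp add: absolutely_integrable_on_iff_integrable)
  have eq: "(LINT y|lebesgue_on {a..b}. v y) = integral {a..b} v" by (rule lebesgue_integral_eq_integral[OF i]) simp
  have "0 \<le> (LINT y|lebesgue_on {a..b}. v y)" by (rule Bochner_Integration.integral_nonneg) (rule v(2))
  then have "(LINT y|lebesgue_on {a..b}. v y) = 0" using eq neg by simp
  then have "AE y in lebesgue_on {a..b}. v y = 0"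
    using integral_nonneg_eq_0_iff_AE[OF i] v(2) by simp
  then have "AE y in lebesgue. y \<in> {a..b} \<longrightarrow> v y = 0" by (subst (asm) AE_restrict_space_iff) auto
  with v(3)[unfolded AE_on_iff] have "AE x in lebesgue_on E. \<not> (a \<le> x \<and> x \<le> b)"
    unfolding AE_on_iff by eventually_elim auto
  then show False by (rule not_AE_avoids_interval[OF ab])
qed

lemma integral_Lo_ge:
  assumes v: "L1 E v" "\<And>x. 0 \<le> v x" and ab: "a \<in> E" "b \<in> E" and x: "x \<in> E" "b \<le> x"
  shows "integral {a..b} v \<le> integral (f0.Lo x) v"
proof (rule Henstock_Kurzweil_Integration.integral_subset_le)
  show "{a..b} \<subseteq> f0.Lo x" using Icc_E[OF ab] x unfolding f0.Lo_def by auto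
  show "v integrable_on {a..b}" by (rule absolutely_integrable_imp_integrable[OF f0.v_Icc[OF v(1)[unfolded L1_iff] ab]])
  show "v integrable_on f0.Lo x" by (rule absolutely_integrable_imp_integrable[OF f0.v_Lo[OF v(1)[unfolded L1_iff]]])
qed (use v(2) in simp)

lemma RR_le_resolvent:
  assumes f: "0 \<le> f" and w: "(\<lambda>N. RR (\<Sum>n\<le>N. (BB ^^ n) f)) \<longlonglongrightarrow> w"
  shows "RR f \<le> w"
proof (rule le_if_limit[OF tendsto_const w])
  fix N
  have "0 \<le> (\<Sum>n<N. (BB ^^ Suc n) f)" by (intro sum_nonneg sp.B_power(2) f)
  then have "0 \<le> RR (\<Sum>n<N. (BB ^^ Suc n) f)" by (rule sp.R(2))
  moreover have "(\<Sum>n\<le>N. (BB ^^ n) f) = f + (\<Sum>n<N. (BB ^^ Suc n) f)" by (subst sum.atMost_shift) simp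
  ultimately show "RR f \<le> RR (\<Sum>n\<le>N. (BB ^^ n) f)" by (simp only: linear_add[OF linear_RR] le_add_same_cancel1)
qed

lemma resolvent_nonneg:
  assumes f: "0 \<le> f" and w: "(\<lambda>N. RR (\<Sum>n\<le>N. (BB ^^ n) f)) \<longlonglongrightarrow> w"
  shows "0 \<le> w"
  using sp.R(2)[OF f] RR_le_resolvent[OF f w] by (rule order_trans)

text \<open>Past the bottom of its support, an invariant vector dominates a strictly positive solution of the transport equation.\<close>

lemma invariant_pos_beyond:
  assumes e: "e \<in> XE" "0 \<le> e" "e \<noteq> 0" and inv: "\<forall>t\<ge>0. SS t e = e"
  shows "\<exists>x0\<in>E. \<exists>v. L1 E v \<and> (\<forall>x. 0 \<le> v x) \<and> e = J v \<and> (AE x in lebesgue_on E. x0 \<le> x \<longrightarrow> 0 < v x)"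
proof -
  from XE_nonneg_representative[OF e(2,1)] obtain v where v: "L1 E v" "\<And>x. 0 \<le> v x" "e = J v" by blast
  have "0 < norm e" using e(3) by simp
  then have pos: "0 < integral E v" using norm_J_nonneg[OF v(1,2)] v(3) by simp
  from f0.E_exhaustion obtain l u :: "nat \<Rightarrow> real" where lu: "\<forall>n. l n \<in> E" "\<forall>n. u n \<in> E" "\<forall>n. l n < u n"
      "decseq l" "incseq u" "E = (\<Union>n. {l n..u n})" by (elim exE conjE) rule
  have "\<forall>\<^sub>F n in sequentially. 0 < integral {l n..u n} v"
    by (rule order_tendstoD(1)[OF f0.integral_exhaustion[OF v(1)[unfolded L1_iff] lu(4-6)] pos])
  then obtain n where n: "0 < integral {l n..u n} v" using eventually_happens by fastforce
  have R1: "0 < R1 v x" if x: "x \<in> E" "u n \<le> x" for x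
  proof -
    have "0 < integral (f1.Lo x) v"
      using n integral_Lo_ge[OF v(1,2) lu(1)[rule_format, of n] lu(2)[rule_format, of n] x] by linarith
    then have "0 < f1.sol v x" by (rule f1.sol_pos[OF v(1)[unfolded L1_iff] v(2) x(1)])
    then show ?thesis using g_pos x(1) by simp
  qed
  obtain w where w: "(\<lambda>N. RR (\<Sum>n\<le>N. (BB ^^ n) e)) \<longlonglongrightarrow> w" "ps.gen w (w - e)" by (rule resolvent_exists[OF e(1)])
  \<comment> \<open>Invariance makes the resolvent series of \<open>e\<close> sum to
    \<open>e\<close> itself, so its first term \<open>RR e\<close> lies below
    \<open>e\<close>.\<close>
  have "w = e" by (rule ps.resolvent_of_invariant[OF w(2) inv[rule_format]])
  then have "RR e \<le> e" using RR_le_resolvent[OF e(2) w(1)] by simp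
  then have "AE x in lebesgue_on E. R1 v x \<le> v x"
    unfolding v(3) RR_J[OF v(1)] J_le_iff[OF R1_L1(1)[OF v(1)] v(1)] .
  then have "AE x in lebesgue_on E. u n \<le> x \<longrightarrow> 0 < v x"
    unfolding AE_on_iff by eventually_elim (use R1 in \<open>auto intro: less_le_trans\<close>)
  then show ?thesis using v lu(2) by blast
qed

text \<open>Each nonzero one is positive almost everywhere from some point on, so two of them would
  both be positive on a common nondegenerate interval, where their infimum could not vanish.\<close>

lemma invariants_not_disjoint:
  assumes e: "e \<in> XE" "e' \<in> XE" "0 \<le> e" "0 \<le> e'" and inv: "\<And>t. 0 \<le> t \<Longrightarrow> SS t e = e" "\<And>t. 0 \<le> t \<Longrightarrow> SS t e' = e'"
    and inf: "inf e e' = 0"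
  shows "e = 0 \<or> e' = 0"
proof (rule ccontr)
  assume "\<not> (e = 0 \<or> e' = 0)"
  then have ne: "e \<noteq> 0" "e' \<noteq> 0" by simp_all
  have inv: "\<forall>t\<ge>0. SS t e = e" "\<forall>t\<ge>0. SS t e' = e'" using inv by simp_all
  from invariant_pos_beyond[OF e(1,3) ne(1) inv(1)] obtain x0 v where v: "x0 \<in> E" "L1 E v" "\<forall>x. 0 \<le> v x" "e = J v"
    "AE x in lebesgue_on E. x0 \<le> x \<longrightarrow> 0 < v x" by (elim bexE exE conjE) rule
  from invariant_pos_beyond[OF e(2,4) ne(2) inv(2)] obtain x1 v' where v': "x1 \<in> E" "L1 E v'" "\<forall>x. 0 \<le> v' x" "e' = J v'"
    "AE x in lebesgue_on E. x1 \<le> x \<longrightarrow> 0 < v' x" by (elim bexE exE conjE) rule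
  let ?z = "\<lambda>x. min (v x) (v' x)"
  have L: "L1 E ?z" using v(2) v'(2) unfolding L1_def by (rule integrable_min)
  have "J ?z \<le> J v" "J ?z \<le> J v'" using J_le_iff[OF L v(2)] J_le_iff[OF L v'(2)] by simp_all
  then have "J ?z \<le> inf (J v) (J v')" by (rule le_infI)
  then have "J ?z \<le> 0" using inf unfolding v(4) v'(4) by simp
  moreover have L0: "L1 E (\<lambda>x. 0)" by (simp add: L1_def)
  ultimately have "AE x in lebesgue_on E. ?z x \<le> 0" using J_le_iff[OF L L0] by (simp only: J_zero)
  then have AE: "AE x in lebesgue_on E. \<not> (x0 \<le> x \<and> x1 \<le> x)"
    using v(5) v'(5) unfolding AE_on_iff by eventually_elim auto
  have m: "max x0 x1 \<in> E" using v(1) v'(1) by (simp add: max_def)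
  then obtain a b where ab: "a \<in> E" "b \<in> E" "a < max x0 x1" "max x0 x1 < b" by (rule f0.E_nbhd)
  have "AE x in lebesgue_on E. \<not> (max x0 x1 \<le> x \<and> x \<le> b)" using AE unfolding AE_on_iff by eventually_elim auto
  then show False by (rule not_AE_avoids_interval[OF m ab(2,4)])
qed

lemma stochastic_semigroup_if_norm_preserving:
  assumes "\<And>t u. 0 \<le> t \<Longrightarrow> 0 \<le> u \<Longrightarrow> u \<in> XE \<Longrightarrow> norm (SS t u) = norm u"
  shows "stochastic_semigroup E S"
  unfolding stochastic_semigroup_def stochastic_op_def
proof (intro conjI allI impI)
  show "C0_semigroup E S" by (rule S_facts)
  fix t :: real assume t: "0 \<le> t"
  show "L1_operator E (S t)" by (rule S_facts(3)[OF t])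
  fix u assume "is_density E u"
  then have u: "L1 E u" "nonnegL E u" "L1norm E u = 1" by (auto simp: is_density_def)
  have Ju: "0 \<le> J u" "J u \<in> XE" using u J_nonneg_iff[OF u(1)] by simp_all
  have L: "L1 E (S t u)" by (rule T_L1[OF S_facts(3)[OF t] u(1)])
  have "nonnegL E (S t u)" using ps.pos[OF t Ju(1)] unfolding SS_J[OF t u(1)] J_nonneg_iff[OF L] .
  moreover have "L1norm E (S t u) = 1"
    using assms[OF t Ju] u(3) unfolding SS_J[OF t u(1)] norm_J[OF L] norm_J[OF u(1)] by simp
  ultimately show "is_density E (S t u)" using L by (simp add: is_density_def)
qed

end

locale jump_invariant = jump +
  fixes vstar
  assumes inv_vstar: "invariant_density_op E (Kop d0 d1 g \<phi> P) vstar"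
    and vstar_pos: "AE x in lebesgue_on E. 0 < vstar x"
begin

lemma vstar: "L1 E vstar" "eqL E (Kop d0 d1 g \<phi> P vstar) vstar"
  using inv_vstar by (auto simp: invariant_density_op_def is_density_def)

text \<open>A representative of \<open>vstar\<close> that is nonnegative everywhere, as the
  estimates for \<open>R0\<close> and \<open>R1\<close> ask for pointwise signs.\<close>

definition "av x = \<bar>vstar x\<bar>"

lemma av: "L1 E av" "0 \<le> av x" "AE x in lebesgue_on E. 0 < av x" "eqL E vstar av" "J vstar = J av"
proof -
  show 1: "L1 E av" using vstar(1) unfolding L1_def av_def by auto
  show "0 \<le> av x" by (simp add: av_def)
  show "AE x in lebesgue_on E. 0 < av x" using vstar_pos by eventually_elim (simp add: av_def)
  show 2: "eqL E vstar av" using vstar_pos unfolding eqL_def by eventually_elim (simp add: av_def)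
  show "J vstar = J av" using J_eq_iff[OF vstar(1) 1] 2 by simp
qed

lemma f0_sol_av: "f0.sol vstar x = f0.sol av x"
  by (rule f0.sol_cong) (use av(4) in \<open>simp only: eqL_iff\<close>)

lemma R0_av: "x \<in> E \<Longrightarrow> R0 d0 d1 g \<phi> vstar x = R0 d0 d1 g \<phi> av x"
  by (simp only: R0_eq[OF vstar(1)] R0_eq[OF av(1)] f0_sol_av)

lemma lift_P_R0: "lift P (J (\<lambda>x. \<phi> x * R0 d0 d1 g \<phi> av x)) = J av"
proof -
  have L: "L1 E (\<lambda>x. \<phi> x * R0 d0 d1 g \<phi> av x)" by (rule phi_R0[OF av(1,2)])
  have L': "L1 E (\<lambda>x. \<phi> x * R0 d0 d1 g \<phi> vstar x)" by (rule L1_eqL[OF L]) (rule eqL_on, simp only: R0_av)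
  have "J (\<lambda>x. \<phi> x * R0 d0 d1 g \<phi> av x) = J (\<lambda>x. \<phi> x * R0 d0 d1 g \<phi> vstar x)"
    by (rule J_cong) (simp only: R0_av)
  then have "lift P (J (\<lambda>x. \<phi> x * R0 d0 d1 g \<phi> av x)) = J (Kop d0 d1 g \<phi> P vstar)"
    using lift_J[OF P_op L'] by (simp add: Kop_def)
  also have "\<dots> = J vstar"
    using vstar(2) T_L1[OF P_op L'] J_eq_iff[OF _ vstar(1), of "Kop d0 d1 g \<phi> P vstar"] by (simp add: Kop_def)
  finally show ?thesis by (simp only: av(5))
qed

text \<open>The inequality \<open>R1 av \<le> R0 av\<close> passes through multiplication by
  \<open>\<phi>\<close> and through the positive operator \<open>P\<close>, and
  \<open>P (\<phi> R0 av) = av\<close> by invariance under K.\<close>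

lemma BB_av: "BB (J av) \<le> J av"
proof -
  have "\<phi> x * R1 av x \<le> \<phi> x * R0 d0 d1 g \<phi> av x" if x: "x \<in> E" for x
    using R1_le_R0[OF av(1,2) x] phi_nonneg x by (intro mult_left_mono) auto
  then have "AE x in lebesgue_on E. \<phi> x * R1 av x \<le> \<phi> x * R0 d0 d1 g \<phi> av x"
    unfolding AE_on_iff by (intro always_eventually allI impI)
  then have "J (\<lambda>x. \<phi> x * R1 av x) \<le> J (\<lambda>x. \<phi> x * R0 d0 d1 g \<phi> av x)"
    by (rule J_le_iff[THEN iffD2, OF R1_L1(2)[OF av(1)] phi_R0[OF av(1,2)]])
  from lift_P_mono[OF this] show ?thesis
    unfolding BB_J[OF av(1)] lift_J[OF P_op R1_L1(2)[OF av(1)]] lift_P_R0 .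
qed

lemma J_av: "J av \<in> XE" "0 \<le> J av"
proof -
  show "J av \<in> XE" by (rule J_in_XE[OF av(1)])
  show "0 \<le> J av" using J_nonneg_iff[OF av(1)] av(2) by (simp add: nonnegL_def)
qed

lemma norm_resolvent:
  assumes u: "0 \<le> u" "u \<in> XE" and w: "(\<lambda>N. RR (\<Sum>n\<le>N. (BB ^^ n) u)) \<longlonglongrightarrow> w"
  shows "norm w = norm u"
  by (rule sp.norm_resolvent_eq[OF sp.B_power_tendsto_0[OF J_av BB_av inf_multiple_tendsto[OF av(1,3)] u] u w])

lemma norm_SS: assumes "0 \<le> t" "0 \<le> u" "u \<in> XE" shows "norm (SS t u) = norm u"
proof -
  obtain w where w: "(\<lambda>N. RR (\<Sum>n\<le>N. (BB ^^ n) u)) \<longlonglongrightarrow> w" "ps.gen w (w - u)"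
    by (rule resolvent_exists[OF assms(3)])
  show ?thesis
    by (rule ps.norm_S_eq_if_resolvent_norm_eq[OF w(2) assms(2) resolvent_nonneg[OF assms(2) w(1)]
      norm_resolvent[OF assms(2,3) w(1)] assms(1)])
qed

lemma R0_vstar_pos: assumes x: "x \<in> E" shows "0 < R0 d0 d1 g \<phi> vstar x"
proof -
  from f0.E_nbhd[OF x] obtain a where a: "a \<in> E" "a < x" by blast
  have "0 < integral (f0.Lo x) av"
    using integral_Icc_pos[OF av(1-3) a(1) x a(2)] integral_Lo_ge[OF av(1,2) a(1) x x order_refl] by linarith
  then have "0 < f0.sol av x" by (rule f0.sol_pos[OF av(1)[unfolded L1_iff] av(2) x])
  then show ?thesis using g_pos x by (simp add: R0_eq[OF vstar(1) x] f0_sol_av)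
qed

text \<open>The generator vanishes at \<open>R0 vstar\<close>: the part from A is
  \<open>- vstar\<close>, because \<open>R0 vstar\<close> solves the equation with lam = 0, and the
  part from P \<phi> is \<open>vstar\<close>, because K fixes \<open>vstar\<close>.\<close>

lemma R0_vstar_invariant:
  assumes L: "L1 E (R0 d0 d1 g \<phi> vstar)" and t: "0 \<le> t"
  shows "SS t (J (R0 d0 d1 g \<phi> vstar)) = J (R0 d0 d1 g \<phi> vstar)"
proof -
  let ?u = "\<lambda>x. f0.sol vstar x / g x"
  have eq: "J (R0 d0 d1 g \<phi> vstar) = J ?u" by (rule J_cong) (rule R0_eq[OF vstar(1)])
  have Lu: "L1 E ?u" by (rule L1_eqL[OF L]) (rule eqL_on, rule R0_eq[OF vstar(1)])
  have A: "A_graph d0 d1 g \<phi> ?u (\<lambda>x. 0 * ?u x - vstar x)"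
    by (rule A_graph_sol[OF f0.interval_flow_axioms order_refl vstar(1) Lu])
  have "J (P (\<lambda>x. \<phi> x * ?u x)) = lift P (J (\<lambda>x. \<phi> x * ?u x))"
    by (rule lift_J[OF P_op A_graph_L1(3)[OF A], symmetric])
  also have "J (\<lambda>x. \<phi> x * ?u x) = J (\<lambda>x. \<phi> x * R0 d0 d1 g \<phi> av x)"
    by (rule J_cong) (simp only: R0_eq[OF av(1)] f0_sol_av)
  finally have P: "J (P (\<lambda>x. \<phi> x * ?u x)) = J av" by (simp only: lift_P_R0)
  have "J (\<lambda>x. 0 * ?u x - vstar x) = - J av"
    using J_lin[OF Lu vstar(1), of 0 "- 1"] av(5) by simp
  then have "ps.gen (J ?u) 0" using generator_extends[OF A] unfolding P by simp
  then show ?thesis unfolding eq by (rule ps.invariant_if_gen_0[OF _ t])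
qed

end

context jump begin

text \<open>Invariance makes the generator vanish at \<open>ustar\<close>, so \<open>ustar\<close>
  solves the equation with lam = 0 and right-hand side \<open>v = P (\<phi> ustar)\<close>.
  Uniqueness gives \<open>ustar = R0 v\<close>, and applying P \<phi> to both sides shows that K
  fixes \<open>v\<close>.\<close>

lemma invariant_density_embedded:
  assumes "invariant_density_sg E S ustar" "A_domain d0 d1 g \<phi> ustar"
  shows "invariant_density_op E (Kop d0 d1 g \<phi> P)
          (\<lambda>x. P (\<lambda>y. \<phi> y * ustar y) x / L1norm E (\<lambda>y. \<phi> y * ustar y))"
proof -
  have u: "L1 E ustar" "nonnegL E ustar" "L1norm E ustar = 1" "\<And>t. 0 \<le> t \<Longrightarrow> eqL E (S t ustar) ustar"
    using assms(1) by (auto simp: invariant_density_sg_def is_density_def)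
  obtain f where A: "A_graph d0 d1 g \<phi> ustar f" using assms(2) by (auto simp: A_domain_def)
  note L = A_graph_L1[OF A]
  let ?p = "\<lambda>y. \<phi> y * ustar y"
  define v where "v = P ?p"
  have Lv: "L1 E v" unfolding v_def by (rule T_L1[OF P_op L(3)])
  have Jv: "J v = lift P (J ?p)" unfolding v_def by (rule lift_J[OF P_op L(3), symmetric])
  have inv: "SS t (J ustar) = J ustar" if t: "0 \<le> t" for t
    unfolding SS_J[OF t u(1)] by (rule J_eq_iff[THEN iffD2, OF T_L1[OF S_facts(3)[OF t] u(1)] u(1) u(4)[OF t]])
  have "\<forall>\<^sub>F h in at_right 0. (SS h (J ustar) - J ustar) /\<^sub>R h = 0"
    using eventually_at_right_less[of "0::real"] by eventually_elim (simp add: inv)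
  then have "((\<lambda>h. (SS h (J ustar) - J ustar) /\<^sub>R h) \<longlongrightarrow> 0) (at_right 0)" by (rule tendsto_eventually)
  moreover have "((\<lambda>h. (SS h (J ustar) - J ustar) /\<^sub>R h) \<longlongrightarrow> J f + J v) (at_right 0)"
    using generator_extends[OF A] by (simp add: ps.gen_def v_def)
  ultimately have "J f + J v = 0" by (intro tendsto_unique[of "at_right (0::real)"]) auto
  then have "J (\<lambda>x. 0 * ustar x + (- 1) * f x) = J v"
    unfolding J_lin[OF L(1,2)] using minus_unique[of "J f" "J v"] by simp
  then have "eqL E (\<lambda>x. 0 * ustar x + (- 1) * f x) v" using J_eq_iff[OF L1_lin[OF L(1,2)] Lv] by blast
  then have "eqL E (\<lambda>x. 0 * ustar x - f x) v" by simp
  from A_graph_imp_sol[OF f0.interval_flow_axioms A Lv this] have e: "eqL E ustar (\<lambda>x. f0.sol v x / g x)" .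
  define c where "c = L1norm E ?p"
  have c: "norm (J ?p) = c" unfolding c_def by (rule norm_J[OF L(3)])
  have p0: "0 \<le> J ?p"
    unfolding J_nonneg_iff[OF L(3)] nonnegL_def AE_on_iff using u(2)[unfolded nonnegL_def AE_on_iff]
    by eventually_elim (use phi_nonneg in auto)
  \<comment> \<open>If \<open>\<phi> ustar\<close> vanished, so would \<open>v\<close> and with it
    \<open>ustar = R0 v\<close>, which has norm one.\<close>
  have cpos: "0 < c"
  proof (rule ccontr)
    assume "\<not> 0 < c"
    then have "J ?p = 0" using c norm_ge_zero[of "J ?p"] by simp
    then have "J v = J (\<lambda>x. 0)" using Jv linear_0[OF linear_lift[OF P_op]] by (simp add: J_zero)
    moreover have L0: "L1 E (\<lambda>x. 0)" by (simp add: L1_def)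
    ultimately have "eqL E v (\<lambda>x. 0)" using J_eq_iff[OF Lv L0] by simp
    then have "f0.sol v x = f0.sol (\<lambda>x. 0) x" for x by (intro f0.sol_cong) (simp only: eqL_iff)
    then have "eqL E ustar (\<lambda>x. 0)" using e by (simp add: f0.sol_def)
    then have "J ustar = 0" using J_eq_iff[OF u(1) L0] by (simp add: J_zero)
    then show False using norm_J[OF u(1)] u(3) by simp
  qed
  let ?w = "\<lambda>x. (1 / c) * v x"
  have Lw: "L1 E ?w" using L1_lin[OF Lv Lv, of "1 / c" 0] by simp
  have Jw: "J ?w = (1 / c) *\<^sub>R J v" by (rule J_scale[OF Lv])
  have "J (rep_l1 (J ?p)) = J ?p" using J_in_XE[OF L(3)] by (simp add: XE_def)
  then have nv: "norm (J v) = c" "0 \<le> J v" unfolding Jv using stochastic_lift[OF P_stoch p0] c by simp_all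
  have "0 \<le> J ?w" unfolding Jw using cpos nv(2) by (simp add: scaleR_nonneg_nonneg)
  then have "nonnegL E ?w" by (simp only: J_nonneg_iff[OF Lw])
  moreover have "L1norm E ?w = 1" using norm_J[OF Lw] unfolding Jw using cpos nv(1) by simp
  ultimately have dens: "is_density E ?w" using Lw by (simp add: is_density_def)
  have R0w: "R0 d0 d1 g \<phi> ?w x = (1 / c) * (f0.sol v x / g x)" if x: "x \<in> E" for x
    unfolding R0_eq[OF Lw x] using sol_linear(2)[OF Lv Lv x, of "1 / c" 0] by simp
  have q: "eqL E (\<lambda>x. (1 / c) * ?p x + 0 * ?p x) (\<lambda>x. \<phi> x * R0 d0 d1 g \<phi> ?w x)"
    using e unfolding eqL_def AE_on_iff
  proof eventually_elim
    case (elim x)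
    show ?case
    proof
      assume x: "x \<in> E"
      then have ux: "ustar x = f0.sol v x / g x" using elim by simp
      show "(1 / c) * ?p x + 0 * ?p x = \<phi> x * R0 d0 d1 g \<phi> ?w x" unfolding R0w[OF x] ux by simp
    qed
  qed
  have Lq: "L1 E (\<lambda>x. \<phi> x * R0 d0 d1 g \<phi> ?w x)" by (rule L1_eqL[OF L1_lin[OF L(3,3)] q])
  have "J (\<lambda>x. \<phi> x * R0 d0 d1 g \<phi> ?w x) = (1 / c) *\<^sub>R J ?p"
    using J_eq_iff[OF L1_lin[OF L(3,3)] Lq, of "1 / c" 0] q J_lin[OF L(3,3), of "1 / c" 0] by simp
  then have "J (Kop d0 d1 g \<phi> P ?w) = J ?w"
    unfolding Kop_def lift_J[OF P_op Lq, symmetric] Jw Jv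
    by (simp only: linear_scale[OF linear_lift[OF P_op]])
  then have "eqL E (Kop d0 d1 g \<phi> P ?w) ?w"
    using J_eq_iff[OF T_L1[OF P_op Lq] Lw] by (simp only: Kop_def)
  with dens have "invariant_density_op E (Kop d0 d1 g \<phi> P) ?w" by (simp add: invariant_density_op_def)
  then show ?thesis by (simp add: v_def c_def)
qed

end

section \<open>Minorization by a bounded kernel\<close>

text \<open>Outer regularity replaces a set by an open one, and an open set of finite measure is
  approximated by finite unions from a countable base.\<close>

lemma countable_measure_dense_borel_family:
  "\<exists>\<D> :: real set set. countable \<D> \<and> \<D> \<subseteq> sets borel \<and>
     (\<forall>X\<in>sets borel. emeasure lborel X < \<infinity> \<longrightarrow>
       (\<forall>e>0. \<exists>D\<in>\<D>. emeasure lborel (sym_diff X D) < ennreal e))"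
proof -
  obtain B :: "real set set" where B: "countable B" "topological_basis B" using ex_countable_basis by blast
  define \<D> where "\<D> = Union ` {F. finite F \<and> F \<subseteq> B}"
  have "countable \<D>" unfolding \<D>_def by (intro countable_image countable_Collect_finite_subset B)
  moreover have "\<D> \<subseteq> sets borel"
    unfolding \<D>_def using topological_basis_open[OF B(2)] by (auto intro!: borel_open open_Union)
  moreover have "\<exists>D\<in>\<D>. emeasure lborel (sym_diff X D) < ennreal e"
    if X: "X \<in> sets borel" "emeasure lborel X < \<infinity>" and e: "0 < e" for X e
  proof -
    have e2: "0 < e / 2" using e by simp
    obtain U where U: "open U" "X \<subseteq> U" "emeasure lborel (U - X) < ennreal (e / 2)"
      by (rule outer_regular_lborel[OF X(1) e2])
    have "emeasure lborel U \<le> emeasure lborel X + emeasure lborel (U - X)"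
      using U X by (intro order_trans[OF emeasure_mono emeasure_subadditive]) auto
    also have "\<dots> < \<infinity>"
      using X(2) order.strict_trans[OF U(3), of \<infinity>] by (simp add: less_top[symmetric])
    finally have Ufin: "emeasure lborel U < \<infinity>" .
    from B(2) U(1) obtain C where C: "C \<subseteq> B" "\<Union>C = U" unfolding topological_basis_def by meson
    show ?thesis
    proof (cases "C = {}")
      case True
      then have "X = {}" using C U(2) by auto
      moreover have "{} \<in> \<D>" unfolding \<D>_def by (rule image_eqI[of _ _ "{}"]) auto
      ultimately show ?thesis using e by (intro bexI[of _ "{}"]) auto
    next
      case False
      have cC: "countable C" by (rule countable_subset[OF C(1) B(1)])
      define D where "D n = \<Union>(from_nat_into C ` {..<n})" for n
      have sub: "from_nat_into C ` {..<n} \<subseteq> B" for n using from_nat_into[OF False] C(1) by blast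
      have DD: "D n \<in> \<D>" for n unfolding D_def \<D>_def using sub[of n] by blast
      have Dm: "D n \<in> sets borel" for n using DD \<open>\<D> \<subseteq> sets borel\<close> by blast
      have DU: "D n \<subseteq> U" for n unfolding D_def using from_nat_into[OF False] C(2) by blast
      have cover: "(\<Inter>n. U - D n) = {}"
      proof -
        have "\<exists>n. x \<in> D n" if x: "x \<in> U" for x
        proof -
          obtain c where c: "c \<in> C" "x \<in> c" using x C(2) by blast
          obtain k where "from_nat_into C k = c" using from_nat_into_surj[OF cC c(1)] by blast
          then show ?thesis using c(2) unfolding D_def by (intro exI[of _ "Suc k"]) auto
        qed
        then show ?thesis by auto
      qed
      have "(\<lambda>n. emeasure lborel (U - D n)) \<longlonglongrightarrow> emeasure lborel (\<Inter>n. U - D n)"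
      proof (rule Lim_emeasure_decseq)
        show "range (\<lambda>n. U - D n) \<subseteq> sets lborel" using Dm U(1) by auto
        show "decseq (\<lambda>n. U - D n)" by (rule decseq_SucI) (auto simp: D_def lessThan_Suc)
        show "emeasure lborel (U - D n) \<noteq> \<infinity>" for n
          using emeasure_mono[of "U - D n" U lborel] Ufin U(1) by (auto simp: top_unique)
      qed
      then have "(\<lambda>n. emeasure lborel (U - D n)) \<longlonglongrightarrow> 0" unfolding cover by simp
      then have "\<forall>\<^sub>F n in sequentially. emeasure lborel (U - D n) < ennreal (e / 2)"
        by (rule order_tendstoD(2)) (use e in simp)
      then obtain n where n: "emeasure lborel (U - D n) < ennreal (e / 2)" using eventually_happens by fastforce
      have "emeasure lborel (sym_diff X (D n)) \<le> emeasure lborel ((U - D n) \<union> (U - X))"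
        using U DU[of n] Dm[of n] X by (intro emeasure_mono) auto
      also have "\<dots> \<le> emeasure lborel (U - D n) + emeasure lborel (U - X)"
        using U Dm[of n] X by (intro emeasure_subadditive) auto
      also have "\<dots> < ennreal (e / 2 + e / 2)" by (rule add_mono_ennreal[OF n U(3)])
      also have "\<dots> = ennreal e" by simp
      finally show ?thesis using DD by blast
    qed
  qed
  ultimately show ?thesis by blast
qed

locale bounded_kernel =
  fixes A :: "(real \<times> real) set" and n :: real
  assumes A_meas [measurable]: "A \<in> sets (lborel \<Otimes>\<^sub>M lborel)"
    and A_bounded: "A \<subseteq> {- n..n} \<times> {- n..n}"
begin

text \<open>A point of \<open>A\<close> is a pair \<open>(y, x)\<close> with source \<open>y\<close> and target \<open>x\<close>.\<close>

definition col :: "real \<Rightarrow> real set" where "col y = Pair y -` A"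

definition TA :: "(real \<Rightarrow> real) \<Rightarrow> real \<Rightarrow> real" where "TA v x = (LINT y|lborel. indicator A (y, x) * v y)"

lemma col_sets [measurable]: "col y \<in> sets borel"
  unfolding col_def using sets_Pair1[OF A_meas, of y] by simp

lemma col_bounded: "col y \<subseteq> {- n..n}"
  unfolding col_def using A_bounded by auto

lemma emeasure_col_finite: "emeasure lborel (col y) < \<infinity>"
  using emeasure_mono[OF col_bounded[of y], of lborel] emeasure_lborel_Icc_eq[of "- n" n]
  by (auto simp: less_top[symmetric] top_unique split: if_splits)

lemma emeasure_sym_diff_measurable:
  assumes "D \<in> sets borel" shows "(\<lambda>y. emeasure lborel (sym_diff (col y) D)) \<in> borel_measurable borel"
proof -
  have "sym_diff A (UNIV \<times> D) \<in> sets (lborel \<Otimes>\<^sub>M lborel)" using assms by (intro sets.Un sets.Diff A_meas) auto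
  moreover have "Pair y -` sym_diff A (UNIV \<times> D) = sym_diff (col y) D" for y by (auto simp: col_def)
  ultimately show ?thesis using lborel.measurable_emeasure_Pair[of "sym_diff A (UNIV \<times> D)" lborel] by simp
qed

lemma emeasure_col_measurable: "(\<lambda>y. emeasure lborel (col y)) \<in> borel_measurable borel"
  using emeasure_sym_diff_measurable[of "{}"] by simp

text \<open>Separability of the measure algebra makes almost every column a point of the support of the distribution of columns.\<close>

lemma AE_col_support:
  assumes W: "W \<in> sets borel"
  shows "AE y0 in lborel. y0 \<in> W \<longrightarrow>
    (\<forall>e>0. 0 < emeasure lborel {y \<in> W. emeasure lborel (sym_diff (col y) (col y0)) < ennreal e})"
proof -
  from countable_measure_dense_borel_family obtain \<D> :: "real set set" where
    D: "countable \<D>" "\<D> \<subseteq> sets borel"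
       "\<forall>X\<in>sets borel. emeasure lborel X < \<infinity> \<longrightarrow> (\<forall>e>0. \<exists>D\<in>\<D>. emeasure lborel (sym_diff X D) < ennreal e)"
    by (elim exE conjE) rule
  \<comment> \<open>The points of \<open>W\<close> whose column is within \<open>1 / Suc k\<close>
    of \<open>D\<close>. There are countably many such sets, and the null ones among them cover all
    exceptional points.\<close>
  define V where "V D k = {y \<in> W. emeasure lborel (sym_diff (col y) D) < ennreal (1 / real (Suc k))}" for D k
  have Vm: "V D k \<in> sets borel" if "D \<in> sets borel" for D k
    unfolding V_def using emeasure_sym_diff_measurable[OF that] W by measurable
  define I where "I = {(D, k). D \<in> \<D> \<and> emeasure lborel (V D k) = 0}"
  have "I \<subseteq> \<D> \<times> UNIV" by (auto simp: I_def)
  then have cI: "countable I" by (rule countable_subset) (intro countable_SIGMA D countableI_type)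
  have null: "(\<Union>i\<in>I. V (fst i) (snd i)) \<in> null_sets lborel"
    by (rule null_sets_UN'[OF cI]) (use D(2) Vm in \<open>auto simp: I_def null_sets_def\<close>)
  show ?thesis
  proof (rule AE_I'[OF null], rule subsetI, clarsimp simp del: ennreal_eq_0_iff)
    fix y0 e assume y0: "y0 \<in> W" and e: "0 < (e::real)"
      and neg: "emeasure lborel {y \<in> W. emeasure lborel (sym_diff (col y) (col y0)) < ennreal e} = 0"
    \<comment> \<open>Twice \<open>1 / Suc k\<close> is below \<open>e\<close>, so two columns this
      close to the same \<open>D0\<close> are within \<open>e\<close> of each other.\<close>
    obtain k :: nat where k: "1 / real (Suc k) < e / 2" using e nat_approx_posE[of "e / 2"] by auto
    obtain D0 where D0: "D0 \<in> \<D>" "emeasure lborel (sym_diff (col y0) D0) < ennreal (1 / real (Suc k))"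
      using D(3)[rule_format, OF col_sets emeasure_col_finite, of "1 / real (Suc k)" y0] by auto
    have D0m: "D0 \<in> sets borel" using D0(1) D(2) by blast
    have "V D0 k \<subseteq> {y \<in> W. emeasure lborel (sym_diff (col y) (col y0)) < ennreal e}"
    proof (clarsimp simp: V_def)
      fix y assume y: "emeasure lborel (sym_diff (col y) D0) < ennreal (1 / (1 + real k))"
      have "emeasure lborel (sym_diff (col y) (col y0)) \<le> emeasure lborel (sym_diff (col y) D0 \<union> sym_diff (col y0) D0)"
        using D0m by (intro emeasure_mono) auto
      also have "\<dots> \<le> emeasure lborel (sym_diff (col y) D0) + emeasure lborel (sym_diff (col y0) D0)"
        using D0m by (intro emeasure_subadditive) auto
      also have "\<dots> < ennreal (1 / real (Suc k) + 1 / real (Suc k))" using y D0(2) by (intro add_mono_ennreal) simp_all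
      also have "\<dots> \<le> ennreal e" by (rule ennreal_leI) (use k in linarith)
      finally show "emeasure lborel (sym_diff (col y) (col y0)) < ennreal e" .
    qed
    moreover have "{y \<in> W. emeasure lborel (sym_diff (col y) (col y0)) < ennreal e} \<in> sets lborel"
      using emeasure_sym_diff_measurable[OF col_sets, of y0] W by measurable
    ultimately have "emeasure lborel (V D0 k) \<le> 0" unfolding neg[symmetric] by (rule emeasure_mono)
    then have "(D0, k) \<in> I" using D0(1) by (simp add: I_def)
    moreover have "y0 \<in> V D0 k" using y0 D0(2) by (simp add: V_def)
    ultimately show "\<exists>i\<in>I. y0 \<in> V (fst i) (snd i)" by force
  qed
qed

context
  fixes v :: "real \<Rightarrow> real"
  assumes v_meas [measurable]: "v \<in> borel_measurable borel" and v_int: "integrable lborel v"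
begin

lemma section_integrable: "integrable lborel (\<lambda>y. indicator A (y, x) * v y)"
  by (rule Bochner_Integration.integrable_bound[OF v_int]) (measurable, auto split: split_indicator)

lemma TA_measurable [measurable]: "TA v \<in> borel_measurable borel"
  unfolding TA_def by measurable

lemma TA_bound: "\<bar>TA v x\<bar> \<le> indicator {- n..n} x * (LINT y|lborel. \<bar>v y\<bar>)"
proof (cases "x \<in> {- n..n}")
  case True
  have "norm (TA v x) \<le> (LINT y|lborel. norm (indicator A (y, x) * v y))"
    unfolding TA_def by (rule integral_norm_bound)
  also have "\<dots> \<le> (LINT y|lborel. \<bar>v y\<bar>)"
    by (rule integral_mono) (use section_integrable[of x] v_int in \<open>auto split: split_indicator\<close>)
  finally show ?thesis using True by simp
next
  case False
  then have "(\<lambda>y. indicator A (y, x) * v y) = (\<lambda>y. 0)" using A_bounded by (intro ext) (auto split: split_indicator)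
  then have "TA v x = 0" by (simp only: TA_def Bochner_Integration.integral_zero)
  then show ?thesis using False by simp
qed

lemma TA_integrable: "integrable lborel (TA v)"
proof (rule Bochner_Integration.integrable_bound)
  show "integrable lborel (\<lambda>x. indicator {- n..n} x * (LINT y|lborel. \<bar>v y\<bar>))"
    by (intro integrable_mult_left integrable_real_indicator) (auto simp: emeasure_lborel_Icc_eq)
  show "AE x in lborel. norm (TA v x) \<le> norm (indicator {- n..n} x * (LINT y|lborel. \<bar>v y\<bar>))"
    unfolding real_norm_def by (intro always_eventually allI order_trans[OF TA_bound abs_ge_self])
qed simp

end

lemma TA_nonneg: "(\<And>y. 0 \<le> v y) \<Longrightarrow> 0 \<le> TA v x"
  unfolding TA_def by (rule Bochner_Integration.integral_nonneg) simp

text \<open>The kernel is bounded by one, so distance in norm becomes distance at every point. This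
  is what permits a pointwise lower bound after an approximation in norm.\<close>

lemma TA_lipschitz:
  assumes v: "v \<in> borel_measurable borel" "integrable lborel v" and w: "w \<in> borel_measurable borel" "integrable lborel w"
  shows "\<bar>TA v x - TA w x\<bar> \<le> (LINT y|lborel. \<bar>v y - w y\<bar>)"
proof -
  note i = section_integrable[OF v, of x] section_integrable[OF w, of x]
  have "TA v x - TA w x = (LINT y|lborel. indicator A (y, x) * v y - indicator A (y, x) * w y)"
    unfolding TA_def by (rule Bochner_Integration.integral_diff[OF i, symmetric])
  also have "norm \<dots> \<le> (LINT y|lborel. norm (indicator A (y, x) * v y - indicator A (y, x) * w y))"
    by (rule integral_norm_bound)
  also have "\<dots> \<le> (LINT y|lborel. \<bar>v y - w y\<bar>)"
    by (rule integral_mono) (use i v w in \<open>auto split: split_indicator\<close>)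
  finally show ?thesis by simp
qed

lemma TA_mono:
  assumes v: "v \<in> borel_measurable borel" "integrable lborel v" and w: "w \<in> borel_measurable borel" "integrable lborel w"
    and le: "\<And>y. v y \<le> w y"
  shows "TA v x \<le> TA w x"
  unfolding TA_def
  by (rule integral_mono[OF section_integrable[OF v] section_integrable[OF w]]) (use le in \<open>auto split: split_indicator\<close>)

text \<open>By Fubini the error is at most the integral, over sources in \<open>B\<close> weighted
  by \<open>v\<close>, of the measure of the symmetric difference between their column and the fixed
  one.\<close>

lemma TA_near_column:
  assumes v: "v \<in> borel_measurable borel" "integrable lborel v" "\<And>y. 0 \<le> v y" and B [measurable]: "B \<in> sets borel"
    and near: "\<And>y. y \<in> B \<Longrightarrow> emeasure lborel (sym_diff (col y) (col y0)) \<le> ennreal h" and h: "0 \<le> h"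
  shows "(LINT x|lborel. \<bar>TA (\<lambda>y. indicator B y * v y) x - (LINT y|lborel. indicator B y * v y) * indicator (col y0) x\<bar>)
    \<le> h * (LINT y|lborel. indicator B y * v y)"
proof -
  note [measurable] = v(1)
  let ?w = "\<lambda>y. indicator B y * v y" and ?D = "\<lambda>y. sym_diff (col y) (col y0)"
  let ?k = "LINT y|lborel. ?w y"
  have wm: "?w \<in> borel_measurable borel" by measurable
  have wi: "integrable lborel ?w" using integrable_mult_indicator[of B lborel v] v(2) B by simp
  have w0: "0 \<le> ?w y" for y using v(3) by simp
  have Dm: "(\<lambda>(x, y). indicator (?D y) x :: real) \<in> borel_measurable (lborel \<Otimes>\<^sub>M lborel)"
  proof -
    have "(\<lambda>(x, y). indicator (?D y) x :: real) = (\<lambda>(x, y). \<bar>indicator A (y, x) - indicator (col y0) x\<bar>)"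
      by (auto simp: fun_eq_iff col_def split: split_indicator)
    then show ?thesis by simp
  qed
  have pt: "ennreal \<bar>TA ?w x - ?k * indicator (col y0) x\<bar> \<le> (\<integral>\<^sup>+y. ennreal (indicator (?D y) x * ?w y) \<partial>lborel)" for x
  proof -
    have i2: "integrable lborel (\<lambda>y. ?w y * indicator (col y0) x)" using wi by simp
    have "TA ?w x - ?k * indicator (col y0) x = (LINT y|lborel. indicator A (y, x) * ?w y - ?w y * indicator (col y0) x)"
      unfolding TA_def using section_integrable[OF wm wi, of x] i2 by simp
    then have "ennreal (norm (TA ?w x - ?k * indicator (col y0) x)) \<le> (\<integral>\<^sup>+y. ennreal (norm (indicator A (y, x) * ?w y - ?w y * indicator (col y0) x)) \<partial>lborel)"
      using integral_norm_bound_ennreal[OF Bochner_Integration.integrable_diff[OF section_integrable[OF wm wi, of x] i2]] by simp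
    also have "\<dots> = (\<integral>\<^sup>+y. ennreal (indicator (?D y) x * ?w y) \<partial>lborel)"
      by (rule nn_integral_cong) (use w0 in \<open>auto simp: col_def split: split_indicator\<close>)
    finally show ?thesis by simp
  qed
  have m2: "(\<lambda>(x, y). ennreal (indicator (?D y) x * ?w y)) \<in> borel_measurable (lborel \<Otimes>\<^sub>M lborel)"
    using Dm wm by (simp add: split_beta')
  have "(\<integral>\<^sup>+x. ennreal \<bar>TA ?w x - ?k * indicator (col y0) x\<bar> \<partial>lborel)
      \<le> (\<integral>\<^sup>+x. (\<integral>\<^sup>+y. ennreal (indicator (?D y) x * ?w y) \<partial>lborel) \<partial>lborel)"
    by (intro nn_integral_mono pt)
  also have "\<dots> = (\<integral>\<^sup>+y. (\<integral>\<^sup>+x. ennreal (indicator (?D y) x * ?w y) \<partial>lborel) \<partial>lborel)"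
    using lborel_pair.Fubini'[OF m2] by simp
  also have "\<dots> \<le> (\<integral>\<^sup>+y. ennreal (h * ?w y) \<partial>lborel)"
  proof (intro nn_integral_mono)
    fix y
    have "(\<integral>\<^sup>+x. ennreal (indicator (?D y) x * ?w y) \<partial>lborel) = (\<integral>\<^sup>+x. ennreal (?w y) * indicator (?D y) x \<partial>lborel)"
      by (intro nn_integral_cong) (auto split: split_indicator)
    also have "\<dots> = ennreal (?w y) * emeasure lborel (?D y)" by (rule nn_integral_cmult_indicator) simp
    also have "\<dots> \<le> ennreal (?w y) * ennreal h" using near[of y] by (cases "y \<in> B") (auto intro: mult_left_mono)
    also have "\<dots> = ennreal (h * ?w y)" using w0[of y] h by (simp add: ennreal_mult mult.commute)
    finally show "(\<integral>\<^sup>+x. ennreal (indicator (?D y) x * ?w y) \<partial>lborel) \<le> ennreal (h * ?w y)" .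
  qed
  also have "\<dots> = ennreal (h * ?k)"
    using nn_integral_eq_integral[of lborel "\<lambda>y. h * ?w y"] wi w0 h by simp
  finally have le: "(\<integral>\<^sup>+x. ennreal \<bar>TA ?w x - ?k * indicator (col y0) x\<bar> \<partial>lborel) \<le> ennreal (h * ?k)" .
  have "0 \<le> h * ?k" by (rule mult_nonneg_nonneg[OF h Bochner_Integration.integral_nonneg[OF w0]])
  moreover have "(LINT x|lborel. \<bar>TA ?w x - ?k * indicator (col y0) x\<bar>) = enn2real (\<integral>\<^sup>+x. ennreal \<bar>TA ?w x - ?k * indicator (col y0) x\<bar> \<partial>lborel)"
    using TA_measurable[OF wm wi] by (intro integral_eq_nn_integral) auto
  ultimately show ?thesis using enn2real_leI[OF _ le] by simp
qed

text \<open>If \<open>TA b\<close> vanished almost everywhere, Fubini would make \<open>b\<close>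
  vanish almost everywhere on the sources whose columns have positive measure. The factor 2 leaves
  room for an error of size \<open>h\<close>.\<close>

lemma TA_superlevel:
  assumes b: "b \<in> borel_measurable borel" "integrable lborel b" "\<And>y. 0 \<le> b y"
    and pos: "(LINT y|lborel. indicator {y. 0 < emeasure lborel (col y)} y * b y) \<noteq> 0"
  shows "\<exists>h>0. 0 < emeasure lborel {x. 2 * h < TA b x}"
proof (rule ccontr)
  assume neg: "\<not> ?thesis"
  note [measurable] = b(1) TA_measurable[OF b(1,2)]
  have "AE x in lborel. \<not> 1 / real (Suc k) < TA b x" for k
  proof -
    have eq: "2 * (1 / (2 * real (Suc k))) = 1 / real (Suc k)" by (simp del: of_nat_Suc)
    have "0 < 1 / (2 * real (Suc k))" by simp
    then have "\<not> 0 < emeasure lborel {x. 2 * (1 / (2 * real (Suc k))) < TA b x}" using neg by blast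
    then have "emeasure lborel {x. 1 / real (Suc k) < TA b x} = 0" unfolding eq by (simp only: not_gr_zero)
    then show ?thesis by (intro AE_iff_measurable[THEN iffD2, OF _ refl]) auto
  qed
  then have "AE x in lborel. \<forall>k. \<not> 1 / real (Suc k) < TA b x" by (simp add: AE_all_countable)
  then have TA0: "AE x in lborel. TA b x = 0"
  proof eventually_elim
    case (elim x)
    show ?case
    proof (rule ccontr)
      assume "TA b x \<noteq> 0"
      then have "0 < TA b x" using TA_nonneg[of b x] b(3) by simp
      then obtain k where "1 / real (Suc k) < TA b x" by (rule nat_approx_posE)
      then show False using elim by blast
    qed
  qed
  have m: "(\<lambda>(x, y). ennreal (indicator A (y, x) * b y)) \<in> borel_measurable (lborel \<Otimes>\<^sub>M lborel)" by measurable
  have "(\<integral>\<^sup>+y. ennreal (indicator A (y, x) * b y) \<partial>lborel) = ennreal (TA b x)" for x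
    unfolding TA_def by (rule nn_integral_eq_integral[OF section_integrable[OF b(1,2)]]) (use b(3) in simp)
  then have "(\<integral>\<^sup>+x. (\<integral>\<^sup>+y. ennreal (indicator A (y, x) * b y) \<partial>lborel) \<partial>lborel) = (\<integral>\<^sup>+x. ennreal (TA b x) \<partial>lborel)" by simp
  also have "\<dots> = 0" using TA0 by (subst nn_integral_0_iff_AE) (auto elim: eventually_mono)
  finally have "(\<integral>\<^sup>+y. (\<integral>\<^sup>+x. ennreal (indicator A (y, x) * b y) \<partial>lborel) \<partial>lborel) = 0"
    using lborel_pair.Fubini'[OF m] by simp
  moreover have "(\<integral>\<^sup>+x. ennreal (indicator A (y, x) * b y) \<partial>lborel) = ennreal (b y) * emeasure lborel (col y)" for y
  proof -
    have "(\<integral>\<^sup>+x. ennreal (indicator A (y, x) * b y) \<partial>lborel) = (\<integral>\<^sup>+x. ennreal (b y) * indicator (col y) x \<partial>lborel)"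
      by (intro nn_integral_cong) (auto simp: col_def split: split_indicator)
    also have "\<dots> = ennreal (b y) * emeasure lborel (col y)" by (rule nn_integral_cmult_indicator) simp
    finally show ?thesis .
  qed
  ultimately have "(\<integral>\<^sup>+y. ennreal (b y) * emeasure lborel (col y) \<partial>lborel) = 0" by simp
  then have "AE y in lborel. ennreal (b y) * emeasure lborel (col y) = 0"
    using emeasure_col_measurable by (subst (asm) nn_integral_0_iff_AE) auto
  then have "AE y in lborel. indicator {y. 0 < emeasure lborel (col y)} y * b y = 0"
  proof eventually_elim
    case (elim y)
    show ?case
    proof (cases "0 < emeasure lborel (col y)")
      case True
      then have "b y \<le> 0" using elim by (auto simp: ennreal_eq_0_iff)
      then have "b y = 0" using b(3)[of y] by (rule antisym)
      then show ?thesis by simp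
    qed simp
  qed
  then have "(LINT y|lborel. indicator {y. 0 < emeasure lborel (col y)} y * b y) = 0" by (rule integral_eq_zero_AE)
  with pos show False by contradiction
qed

end

section \<open>The rank-one bound for the jump semigroup\<close>

context jump begin

lemma E_borel [measurable]: "E \<in> sets borel"
  using f0.open_E by (rule borel_open)

lemma L1_borel: assumes "v \<in> borel_measurable borel" "integrable lborel v" shows "L1 E v"
proof -
  have "integrable lebesgue v" using assms by (subst integrable_completion) auto
  from integrable_mult_indicator[OF E_leb this] show ?thesis by (simp add: L1_iff_integrable)
qed

lemma norm_J_borel:
  assumes "v \<in> borel_measurable borel" "integrable lborel v" "\<forall>x. x \<notin> E \<longrightarrow> v x = 0"
  shows "norm (J v) = (LINT x|lborel. \<bar>v x\<bar>)"
proof -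
  have "(\<lambda>x. \<bar>indicator E x * v x\<bar>) = (\<lambda>x. \<bar>v x\<bar>)" using assms(3) by (auto simp: fun_eq_iff split: split_indicator)
  then have "norm (J v) = (LINT x|lebesgue. \<bar>v x\<bar>)" unfolding norm_J[OF L1_borel[OF assms(1,2)]] L1norm_eq by (simp only:)
  also have "\<dots> = (LINT x|lborel. \<bar>v x\<bar>)" by (rule integral_completion) (use assms(1) in simp)
  finally show ?thesis .
qed

lemma integral_on_J:
  assumes v: "v \<in> borel_measurable borel" "integrable lborel v" and B: "B \<in> sets borel" "B \<subseteq> E"
  shows "(LINT x|lebesgue. indicator B x * rep_l1 (J v) x) = (LINT x|lborel. indicator B x * v x)"
proof -
  have Bl: "B \<in> sets lebesgue" using B(1) by simp
  have vl: "integrable lebesgue v" using v by (subst integrable_completion) auto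
  have "(LINT x|lebesgue. indicator B x * rep_l1 (J v) x) = (LINT x|lebesgue. indicator B x * v x)"
  proof (rule integral_cong_AE)
    show "(\<lambda>x. indicator B x * rep_l1 (J v) x) \<in> borel_measurable lebesgue"
      using integrable_mult_indicator[OF Bl integrable_rep_l1[of "J v"]] by (simp add: borel_measurable_integrable)
    show "(\<lambda>x. indicator B x * v x) \<in> borel_measurable lebesgue"
      using integrable_mult_indicator[OF Bl vl] by (simp add: borel_measurable_integrable)
    have "AE x in lebesgue. x \<in> E \<longrightarrow> rep_l1 (J v) x = v x"
      using rep_J_eqL[OF L1_borel[OF v]] by (simp only: eqL_def AE_on_iff)
    then show "AE x in lebesgue. indicator B x * rep_l1 (J v) x = indicator B x * v x"
      by eventually_elim (use B(2) in \<open>auto split: split_indicator\<close>)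
  qed
  also have "\<dots> = (LINT x|lborel. indicator B x * v x)" by (rule integral_completion) (use v B in simp)
  finally show ?thesis .
qed

text \<open>The kernel set, its columns and Fubini refer to \<open>lborel\<close>, whereas classes
  are formed with Lebesgue measurable functions; hence the change to Borel representatives that
  vanish off \<open>E\<close>.\<close>

lemma borel_representative:
  assumes "0 \<le> f" "f \<in> XE"
  shows "\<exists>v. v \<in> borel_measurable borel \<and> integrable lborel v \<and> (\<forall>x. 0 \<le> v x) \<and> (\<forall>x. x \<notin> E \<longrightarrow> v x = 0) \<and> f = J v"
proof -
  from XE_nonneg_representative[OF assms] obtain w where w: "L1 E w" "\<And>x. 0 \<le> w x" "f = J w" by blast
  let ?w = "\<lambda>x. indicator E x * w x"
  have wi: "integrable lebesgue ?w" using w(1) by (simp only: L1_iff_integrable)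
  from completion_ex_borel_measurable_real[OF borel_measurable_integrable[OF wi]]
  obtain q where q: "q \<in> borel_measurable lborel" "AE x in lborel. ?w x = q x" by blast
  have qb: "q \<in> borel_measurable borel" using q(1) by simp
  define v where "v x = indicator E x * \<bar>q x\<bar>" for x
  have vm: "v \<in> borel_measurable borel" unfolding v_def using qb by measurable
  have AE: "AE x in lebesgue. ?w x = v x"
    using AE_completion[OF q(2)]
  proof eventually_elim
    case (elim x)
    then show ?case using w(2)[of x] by (auto simp: v_def split: split_indicator)
  qed
  have vml: "v \<in> borel_measurable lebesgue" using vm by (simp add: measurable_completion)
  have "integrable lebesgue v"
    by (rule integrable_cong_AE_imp[OF wi vml]) (use AE in \<open>auto elim: eventually_mono\<close>)
  then have vi: "integrable lborel v" using vm by (subst (asm) integrable_completion) auto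
  have "eqL E w v" unfolding eqL_def AE_on_iff using AE by eventually_elim (auto split: split_indicator)
  then have "J w = J v" using J_eq_iff[OF w(1) L1_borel[OF vm vi]] by simp
  then show ?thesis using vm vi w(3) by (intro exI[of _ v]) (auto simp: v_def)
qed

end

text \<open>Of the kernel minorant only this is kept: at time \<open>t0\<close> the semigroup
  dominates \<open>c\<close> times the kernel operator of the indicator of a bounded non-null set
  \<open>A\<close>.\<close>

locale jump_kernel = jump_invariant d0 d1 g \<phi> E P S vstar + bounded_kernel A n
  for d0 d1 g \<phi> E P S vstar A n +
  fixes c t0 :: real
  assumes R0_L1: "L1 E (R0 d0 d1 g \<phi> vstar)"
    and A_E: "A \<subseteq> E \<times> E" and A_pos: "emeasure (lborel \<Otimes>\<^sub>M lborel) A \<noteq> 0" and c: "0 < c" and t0: "0 \<le> t0"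
    and below: "\<And>v. v \<in> borel_measurable borel \<Longrightarrow> integrable lborel v \<Longrightarrow> \<forall>x. 0 \<le> v x \<Longrightarrow> \<forall>x. x \<notin> E \<longrightarrow> v x = 0 \<Longrightarrow>
      AE x in lebesgue_on E. c * TA v x \<le> S t0 v x"
begin

definition "us = J (R0 d0 d1 g \<phi> vstar)"

lemma R0_pos_AE: "AE x in lebesgue_on E. 0 < R0 d0 d1 g \<phi> vstar x"
  unfolding AE_on_iff by (intro always_eventually allI impI R0_vstar_pos)

lemma us: "us \<in> XE" "0 \<le> us" "0 \<le> t \<Longrightarrow> SS t us = us"
proof -
  show "us \<in> XE" unfolding us_def by (rule J_in_XE[OF R0_L1])
  have "nonnegL E (R0 d0 d1 g \<phi> vstar)" unfolding nonnegL_def using R0_pos_AE by eventually_elim simp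
  then show "0 \<le> us" unfolding us_def J_nonneg_iff[OF R0_L1] .
  show "SS t us = us" if "0 \<le> t" unfolding us_def by (rule R0_vstar_invariant[OF R0_L1 that])
qed

lemma us_dense: "0 \<le> u \<Longrightarrow> u \<in> XE \<Longrightarrow> (\<lambda>n. inf u (real n *\<^sub>R us)) \<longlonglongrightarrow> u"
  unfolding us_def by (rule inf_multiple_tendsto[OF R0_L1 R0_pos_AE])

text \<open>Integration over \<open>B\<close> is nonzero on the strictly positive \<open>us\<close>,
  so irreducibility makes the resolvent of \<open>f\<close> zero. The resolvent at 1 preserves norms
  of nonnegative vectors, so \<open>f\<close> is zero too.\<close>

lemma eq_0_if_never_visits:
  assumes B: "B \<in> sets borel" "B \<subseteq> E" "emeasure lborel B \<noteq> 0" and f: "0 \<le> f" "f \<in> XE"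
    and vanish: "\<And>r. 0 \<le> r \<Longrightarrow> (LINT x|lebesgue. indicator B x * rep_l1 (SS r f) x) = 0"
  shows "f = 0"
proof -
  have Bl: "B \<in> sets lebesgue" using B(1) by simp
  obtain w where w: "(\<lambda>N. RR (\<Sum>n\<le>N. (BB ^^ n) f)) \<longlonglongrightarrow> w" "ps.gen w (w - f)" by (rule resolvent_exists[OF f(2)])
  have ne: "(LINT x|lebesgue. indicator B x * rep_l1 us x) \<noteq> 0"
  proof
    assume z: "(LINT x|lebesgue. indicator B x * rep_l1 us x) = 0"
    have "AE x in lebesgue. x \<in> E \<longrightarrow> rep_l1 us x = R0 d0 d1 g \<phi> vstar x"
      using rep_J_eqL[OF R0_L1] unfolding us_def by (simp only: eqL_def AE_on_iff)
    then have pos: "AE x in lebesgue. x \<in> E \<longrightarrow> 0 < rep_l1 us x" by eventually_elim (simp add: R0_vstar_pos)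
    have nn: "AE x in lebesgue. 0 \<le> indicator B x * rep_l1 us x"
      using pos by eventually_elim (use B(2) in \<open>auto intro: less_imp_le split: split_indicator\<close>)
    have i: "integrable lebesgue (\<lambda>x. indicator B x * rep_l1 us x)"
      using integrable_mult_indicator[OF Bl integrable_rep_l1[of us]] by simp
    have "AE x in lebesgue. indicator B x * rep_l1 us x = 0"
      using integral_nonneg_eq_0_iff_AE[OF i nn] z by (rule iffD1)
    with pos have "AE x in lebesgue. x \<notin> B" by eventually_elim (use B(2) in auto)
    then have "B \<in> null_sets lebesgue" by (subst AE_iff_null_sets[OF Bl])
    then show False using B by (simp add: null_sets_completion_iff null_sets_def)
  qed
  have "w = 0"
    by (rule ps.resolvent_eq_0_if_functional_vanishes[OF norm_SS us us_dense invariants_not_disjoint w(2) f(1)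
      resolvent_nonneg[OF f(1) w(1)] bounded_linear_integral_on[OF Bl] ne vanish])
  then show ?thesis using norm_resolvent[OF f w(1)] by simp
qed

lemma TA_E: assumes "x \<notin> E" shows "TA v x = 0"
proof -
  have "(\<lambda>y. indicator A (y, x) * v y) = (\<lambda>y. 0)" using assms A_E by (intro ext) (auto split: split_indicator)
  then show ?thesis by (simp only: TA_def Bochner_Integration.integral_zero)
qed

lemma SS_ge_TA:
  assumes "v \<in> borel_measurable borel" "integrable lborel v" "\<forall>x. 0 \<le> v x" "\<forall>x. x \<notin> E \<longrightarrow> v x = 0"
  shows "c *\<^sub>R J (TA v) \<le> SS t0 (J v)"
proof -
  have L: "L1 E (TA v)" by (rule L1_borel[OF TA_measurable[OF assms(1,2)] TA_integrable[OF assms(1,2)]])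
  have L': "L1 E (\<lambda>x. c * TA v x)" using L1_lin[OF L L, of c 0] by simp
  have Lv: "L1 E v" by (rule L1_borel[OF assms(1,2)])
  have "J (\<lambda>x. c * TA v x) \<le> J (S t0 v)"
    by (rule J_le_iff[THEN iffD2, OF L' T_L1[OF S_facts(3)[OF t0] Lv] below[OF assms]])
  then show ?thesis unfolding J_scale[OF L] SS_J[OF t0 Lv] .
qed

lemma indicator_facts:
  assumes H: "H \<in> sets borel" "H \<subseteq> E" "H \<subseteq> {- n..n}"
  shows "integrable lborel (indicator H :: real \<Rightarrow> real)" "L1 E (indicator H)" "0 \<le> J (indicator H)"
    "emeasure lborel H \<noteq> 0 \<Longrightarrow> J (indicator H) \<noteq> 0"
proof -
  have "emeasure lborel H \<le> emeasure lborel {- n..n}" using H(3) by (rule emeasure_mono) simp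
  also have "\<dots> < \<infinity>" by (simp add: emeasure_lborel_Icc_eq)
  finally show i: "integrable lborel (indicator H :: real \<Rightarrow> real)" using H(1) by (intro integrable_real_indicator) auto
  have m: "(indicator H :: real \<Rightarrow> real) \<in> borel_measurable borel" using H(1) by simp
  show L: "L1 E (indicator H)" by (rule L1_borel[OF m i])
  show "0 \<le> J (indicator H)" using J_nonneg_iff[OF L] by (simp add: nonnegL_def)
  show "J (indicator H) \<noteq> 0" if ne: "emeasure lborel H \<noteq> 0"
  proof
    assume "J (indicator H) = 0"
    moreover have L0: "L1 E (\<lambda>x. 0)" by (simp add: L1_def)
    ultimately have "eqL E (indicator H) (\<lambda>x. 0)" using J_eq_iff[OF L L0] by (simp add: J_zero)
    then have "AE x in lebesgue. x \<in> E \<longrightarrow> indicator H x = (0::real)" by (simp only: eqL_def AE_on_iff)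
    then have "AE x in lebesgue. x \<notin> H" by eventually_elim (use H(2) in \<open>auto split: split_indicator_asm\<close>)
    then have "AE x in lborel. x \<notin> H" by (simp only: AE_completion_iff)
    then have "H \<in> null_sets lborel" using H(1) by (subst AE_iff_null_sets) auto
    then show False using ne by (simp add: null_sets_def)
  qed
qed

text \<open>The kernel is used twice: the first time to reach approximately one fixed column, the second time to turn what the
  semigroup makes of that column into a pointwise lower bound.\<close>

theorem semigroup_tendsto:
  assumes u: "0 \<le> u" "u \<in> XE"
  shows "((\<lambda>t. SS t u) \<longlongrightarrow> (norm u / norm us) *\<^sub>R us) at_top"
proof -
  \<comment> \<open>The sources through which the kernel transmits mass; they are not null because
    \<open>A\<close> is not.\<close>
  define B1 where "B1 = {y. 0 < emeasure lborel (col y)}"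
  have B1m: "B1 \<in> sets borel" unfolding B1_def using emeasure_col_measurable by measurable
  have B1E: "B1 \<subseteq> E"
  proof
    fix y assume "y \<in> B1"
    then have "col y \<noteq> {}" by (auto simp: B1_def)
    then show "y \<in> E" using A_E by (auto simp: col_def)
  qed
  have B1pos: "emeasure lborel B1 \<noteq> 0"
  proof
    assume "emeasure lborel B1 = 0"
    then have "B1 \<in> null_sets lborel" using B1m by (simp add: null_sets_def)
    then have "AE y in lborel. y \<notin> B1" by (rule AE_not_in)
    then have "AE y in lborel. emeasure lborel (Pair y -` A) = 0" by eventually_elim (simp add: B1_def col_def)
    then have "(\<integral>\<^sup>+y. emeasure lborel (Pair y -` A) \<partial>lborel) = (\<integral>\<^sup>+(y::real). 0 \<partial>lborel)" by (rule nn_integral_cong_AE)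
    then show False using A_pos lborel.emeasure_pair_measure_alt[OF A_meas] by simp
  qed
  \<comment> \<open>A source whose column is approximated by the columns of a non-null set of other
    sources; this replaces the rectangle that \<open>A\<close> need not contain.\<close>
  have "\<exists>y0\<in>B1. \<forall>e>0. 0 < emeasure lborel {y \<in> B1. emeasure lborel (sym_diff (col y) (col y0)) < ennreal e}"
  proof (rule ccontr)
    assume neg: "\<not> ?thesis"
    have "AE y in lborel. y \<notin> B1" using AE_col_support[OF B1m] by eventually_elim (use neg in blast)
    then have "B1 \<in> null_sets lborel" using B1m by (subst AE_iff_null_sets) auto
    then show False using B1pos by (simp add: null_sets_def)
  qed
  then obtain y0 where y0: "y0 \<in> B1"
    "\<forall>e>0. 0 < emeasure lborel {y \<in> B1. emeasure lborel (sym_diff (col y) (col y0)) < ennreal e}" by (elim bexE) rule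
  define a :: "real \<Rightarrow> real" where "a = indicator (col y0)"
  have colE: "col y0 \<subseteq> E" using A_E by (auto simp: col_def)
  have am: "a \<in> borel_measurable borel" unfolding a_def by simp
  note af = indicator_facts[OF col_sets colE col_bounded, folded a_def]
  have "J a \<noteq> 0" by (rule af(4)) (use y0(1) in \<open>simp add: B1_def\<close>)
  \<comment> \<open>At some time \<open>s\<close> mass spread over the fixed column has reached
    transmitting sources; otherwise the column would never visit a non-null set.\<close>
  then obtain s where s: "0 \<le> s" "(LINT x|lebesgue. indicator B1 x * rep_l1 (SS s (J a)) x) \<noteq> 0"
    using eq_0_if_never_visits[OF B1m B1E B1pos af(3) J_in_XE[OF af(2)]] by blast
  from borel_representative[OF ps.pos[OF s(1) af(3)] ps.SX[OF s(1)]] obtain b where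
    b: "b \<in> borel_measurable borel" "integrable lborel b" "\<forall>x. 0 \<le> b x" "\<forall>x. x \<notin> E \<longrightarrow> b x = 0" "SS s (J a) = J b"
    by (elim exE conjE) rule
  have "(LINT y|lborel. indicator B1 y * b y) \<noteq> 0"
    using s(2) unfolding b(5) integral_on_J[OF b(1,2) B1m B1E] .
  from TA_superlevel[OF b(1,2) b(3)[rule_format] this[unfolded B1_def]]
  obtain h where h: "0 < h" "0 < emeasure lborel {x. 2 * h < TA b x}" by (elim exE conjE) rule
  \<comment> \<open>Here the second passage of the exact column exceeds \<open>2 * h\<close>; one
    \<open>h\<close> of it will be given up to the error of the first passage.\<close>
  define H where "H = {x. 2 * h < TA b x}"
  have Hm: "H \<in> sets borel" unfolding H_def using TA_measurable[OF b(1,2)] by measurable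
  have HE: "H \<subseteq> E" unfolding H_def using TA_E[of _ b] h(1) by force
  have Hn: "H \<subseteq> {- n..n}"
  proof
    fix x assume "x \<in> H"
    then have "0 < TA b x" using h(1) by (simp add: H_def)
    then show "x \<in> {- n..n}" using TA_bound[OF b(1,2), of x] by (cases "x \<in> {- n..n}") auto
  qed
  note Hf = indicator_facts[OF Hm HE Hn]
  have Hne: "J (indicator H) \<noteq> 0" by (rule Hf(4)) (use h(2) in \<open>auto simp: H_def\<close>)
  \<comment> \<open>The tolerance is the level \<open>h\<close> from \<open>H\<close>, so that each
    unit of mass starting in \<open>B\<close> reproduces the fixed column with error at most
    \<open>h\<close>.\<close>
  define B where "B = {y \<in> B1. emeasure lborel (sym_diff (col y) (col y0)) < ennreal h}"
  have Bm: "B \<in> sets borel" unfolding B_def using emeasure_sym_diff_measurable[OF col_sets, of y0] B1m by measurable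
  have BE: "B \<subseteq> E" using B1E by (auto simp: B_def)
  have Bpos: "emeasure lborel B \<noteq> 0" using y0(2)[rule_format, OF h(1)] by (simp add: B_def)
  have Bl: "B \<in> sets lebesgue" using Bm by simp
  define \<beta> where "\<beta> f = (LINT x|lebesgue. indicator B x * rep_l1 f x)" for f
  note \<beta>f = bounded_linear_integral_on[OF Bl, folded \<beta>_def]
  \<comment> \<open>One factor \<open>c\<close> for each passage through the kernel, and
    \<open>h\<close> for what is left of the level \<open>2 * h\<close>.\<close>
  define \<alpha> where "\<alpha> = (c * c * h) *\<^sub>R J (indicator H)"
  have minor: "\<beta> f *\<^sub>R \<alpha> \<le> SS (t0 + (s + t0)) f" if f: "0 \<le> f" "f \<in> XE" for f
  proof -
    from borel_representative[OF f] obtain v where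
      v: "v \<in> borel_measurable borel" "integrable lborel v" "\<forall>x. 0 \<le> v x" "\<forall>x. x \<notin> E \<longrightarrow> v x = 0" "f = J v"
      by (elim exE conjE) rule
    define k where "k = (LINT y|lborel. indicator B y * v y)"
    have bk: "\<beta> f = k" unfolding \<beta>_def k_def v(5) by (rule integral_on_J[OF v(1,2) Bm BE])
    have k0: "0 \<le> k" unfolding k_def by (rule Bochner_Integration.integral_nonneg) (use v(3) in simp)
    let ?w = "\<lambda>y. indicator B y * v y"
    have w: "?w \<in> borel_measurable borel" "integrable lborel ?w"
      using v(1) Bm integrable_mult_indicator[of B lborel v] v(2) by auto
    note Tw = TA_measurable[OF w] TA_integrable[OF w]
    have LTw: "L1 E (TA ?w)" by (rule L1_borel[OF Tw])
    have LTv: "L1 E (TA v)" by (rule L1_borel[OF TA_measurable[OF v(1,2)] TA_integrable[OF v(1,2)]])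
    have Tw0: "0 \<le> J (TA ?w)" using J_nonneg_iff[OF LTw] TA_nonneg[of ?w] v(3) by (simp add: nonnegL_def)
    have "J (TA ?w) \<le> J (TA v)"
      unfolding J_le_iff[OF LTw LTv]
      by (intro always_eventually allI TA_mono[OF w v(1,2)]) (use v(3) in \<open>auto split: split_indicator\<close>)
    then have "c *\<^sub>R J (TA ?w) \<le> c *\<^sub>R J (TA v)" using c by (intro scaleR_left_mono) auto
    also have "\<dots> \<le> SS t0 f" unfolding v(5) by (rule SS_ge_TA[OF v(1-4)])
    finally have step1: "c *\<^sub>R J (TA ?w) \<le> SS t0 f" .
    define f2 where "f2 = SS s (J (TA ?w))"
    from borel_representative[OF ps.pos[OF s(1) Tw0] ps.SX[OF s(1)], folded f2_def] obtain b2 where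
      b2: "b2 \<in> borel_measurable borel" "integrable lborel b2" "\<forall>x. 0 \<le> b2 x" "\<forall>x. x \<notin> E \<longrightarrow> b2 x = 0" "f2 = J b2"
      by (elim exE conjE) rule
    let ?kb = "\<lambda>x. k * b x"
    have kb: "?kb \<in> borel_measurable borel" "integrable lborel ?kb" using b(1,2) by auto
    \<comment> \<open>\<open>SS s\<close> is a contraction, so the error of the first passage does
      not grow before the second.\<close>
    have "(LINT x|lborel. \<bar>b2 x - ?kb x\<bar>) = norm (J (\<lambda>x. b2 x - ?kb x))"
      by (rule norm_J_borel[symmetric]) (use b b2 kb in auto)
    also have "J (\<lambda>x. b2 x - ?kb x) = SS s (J (TA ?w) - k *\<^sub>R J a)"
      unfolding J_diff[OF L1_borel[OF b2(1,2)] L1_borel[OF kb]] J_scale[OF L1_borel[OF b(1,2)]]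
      by (simp only: ps.S_diff[OF s(1)] ps.S_scale[OF s(1)] b(5) b2(5)[symmetric] f2_def)
    also have "norm \<dots> \<le> norm (J (TA ?w) - k *\<^sub>R J a)" by (rule ps.contr[OF s(1)])
    also have "J (TA ?w) - k *\<^sub>R J a = J (\<lambda>x. TA ?w x - k * a x)"
    proof -
      have ka: "L1 E (\<lambda>x. k * a x)" using L1_lin[OF af(2) af(2), of k 0] by simp
      show ?thesis unfolding J_diff[OF LTw ka] J_scale[OF af(2)] ..
    qed
    also have "norm \<dots> = (LINT x|lborel. \<bar>TA ?w x - k * a x\<bar>)"
    proof (rule norm_J_borel)
      show "(\<lambda>x. TA ?w x - k * a x) \<in> borel_measurable borel" using Tw(1) am by simp
      show "integrable lborel (\<lambda>x. TA ?w x - k * a x)" using Tw(2) af(1) by simp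
      show "\<forall>x. x \<notin> E \<longrightarrow> TA ?w x - k * a x = 0" using TA_E[of _ ?w] colE by (auto simp: a_def indicator_def)
    qed
    also have "\<dots> \<le> h * k"
      unfolding k_def a_def
      by (rule TA_near_column[OF v(1,2) v(3)[rule_format] Bm]) (use h in \<open>auto simp: B_def less_imp_le\<close>)
    finally have close: "(LINT x|lborel. \<bar>b2 x - ?kb x\<bar>) \<le> h * k" .
    \<comment> \<open>At least \<open>2 * h * k\<close> comes from the exact column, and at most
      \<open>h * k\<close> is lost to the error.\<close>
    have lower: "(h * k) * indicator H x \<le> TA b2 x" for x
    proof (cases "x \<in> H")
      case True
      have "\<bar>TA b2 x - TA ?kb x\<bar> \<le> h * k" using TA_lipschitz[OF b2(1,2) kb, of x] close by linarith
      moreover have "TA ?kb x = k * TA b x"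
        unfolding TA_def using Bochner_Integration.integral_mult_right_zero[of lborel k "\<lambda>y. indicator A (y, x) * b y"]
        by (simp add: mult.left_commute)
      moreover have "k * (2 * h) \<le> k * TA b x" using True k0 by (intro mult_left_mono) (auto simp: H_def)
      ultimately have "h * k \<le> TA b2 x" by (simp add: abs_le_iff algebra_simps)
      then show ?thesis using True by simp
    next
      case False
      then show ?thesis using TA_nonneg[of b2 x] b2(3) by simp
    qed
    have LTb2: "L1 E (TA b2)" by (rule L1_borel[OF TA_measurable[OF b2(1,2)] TA_integrable[OF b2(1,2)]])
    have LH: "L1 E (\<lambda>x. (h * k) * indicator H x)" using L1_lin[OF Hf(2) Hf(2), of "h * k" 0] by simp
    have "J (\<lambda>x. (h * k) * indicator H x) \<le> J (TA b2)"
      unfolding J_le_iff[OF LH LTb2] by (intro always_eventually allI lower)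
    then have "c *\<^sub>R ((h * k) *\<^sub>R J (indicator H)) \<le> c *\<^sub>R J (TA b2)"
      unfolding J_scale[OF Hf(2)] using c by (intro scaleR_left_mono) auto
    also have "\<dots> \<le> SS t0 f2" unfolding b2(5) by (rule SS_ge_TA[OF b2(1-4)])
    finally have "c *\<^sub>R (c *\<^sub>R ((h * k) *\<^sub>R J (indicator H))) \<le> c *\<^sub>R SS t0 f2" using c by (intro scaleR_left_mono) auto
    also have "c *\<^sub>R SS t0 f2 = SS t0 (SS s (c *\<^sub>R J (TA ?w)))"
      unfolding f2_def by (simp only: ps.S_scale[OF s(1)] ps.S_scale[OF t0])
    also have "\<dots> \<le> SS t0 (SS s (SS t0 f))" by (intro ps.mono t0 s(1) step1)
    also have "\<dots> = SS (t0 + (s + t0)) f" using ps.semig[of t0 "s + t0" f] ps.semig[of s t0 f] t0 s(1) by simp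
    finally show ?thesis unfolding bk \<alpha>_def by (simp add: mult.assoc mult.commute mult.left_commute)
  qed
  interpret m: minorized_semigroup SS XE us \<alpha> \<beta> "t0 + (s + t0)"
  proof (rule minorized_semigroup.intro[OF ps.pos_semigroup_axioms], rule minorized_semigroup_axioms.intro)
    show "norm (SS t u) = norm u" if "0 \<le> t" "0 \<le> u" "u \<in> XE" for t u by (rule norm_SS[OF that])
    show "us \<in> XE" "0 \<le> us" by (rule us)+
    show "SS t us = us" if "0 \<le> t" for t by (rule us(3)[OF that])
    show "us \<noteq> 0"
    proof
      assume "us = 0"
      then have "(\<lambda>n. inf (J (indicator H)) (real n *\<^sub>R 0)) \<longlonglongrightarrow> J (indicator H)"
        using us_dense[OF Hf(3) J_in_XE[OF Hf(2)]] by simp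
      then have "J (indicator H) = 0" using Hf(3) by (simp add: inf_absorb2 LIMSEQ_const_iff)
      with Hne show False by contradiction
    qed
    show "(\<lambda>n. inf u (real n *\<^sub>R us)) \<longlonglongrightarrow> u" if "0 \<le> u" "u \<in> XE" for u by (rule us_dense[OF that])
    show "bounded_linear \<beta>" by (rule \<beta>f(1))
    show "0 \<le> \<beta> u" if "0 \<le> u" for u by (rule \<beta>f(2)[OF that])
    show "v = 0" if "0 \<le> v" "v \<in> XE" "\<And>r. 0 \<le> r \<Longrightarrow> \<beta> (SS r v) = 0" for v
      by (rule eq_0_if_never_visits[OF Bm BE Bpos that(1,2) that(3)[unfolded \<beta>_def]])
    show "\<alpha> \<in> XE" unfolding \<alpha>_def by (rule subspace_scale[OF subspace_XE J_in_XE[OF Hf(2)]])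
    show "0 \<le> \<alpha>" unfolding \<alpha>_def using Hf(3) c h(1) by (intro scaleR_nonneg_nonneg) auto
    show "\<alpha> \<noteq> 0" unfolding \<alpha>_def using Hne h(1) c by simp
    show "0 \<le> t0 + (s + t0)" using t0 s(1) by simp
    show "\<beta> u *\<^sub>R \<alpha> \<le> SS (t0 + (s + t0)) u" if "0 \<le> u" "u \<in> XE" for u by (rule minor[OF that])
  qed
  show ?thesis by (rule m.asymptotic_stability[OF u])
qed

end

section \<open>From partially integral semigroups to a bounded kernel\<close>

context jump begin

lemma nn_integral_on_E: "(\<integral>\<^sup>+y. f y \<partial>lebesgue_on E) = (\<integral>\<^sup>+y. f y * indicator E y \<partial>lborel)"
  by (subst nn_integral_restrict_space) (auto simp: nn_integral_completion)

text \<open>If all the bounded sets on which \<open>p\<close> exceeds \<open>1 / Suc k\<close> were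
  null, \<open>p\<close> would vanish almost everywhere on \<open>E \<times> E\<close>. Points of
  \<open>A\<close> list the source first, whereas \<open>p\<close> takes the target first.\<close>

lemma kernel_restriction:
  assumes p: "p \<in> borel_measurable borel" "\<forall>z. 0 \<le> p z"
    and pos: "(\<integral>\<^sup>+x. (\<integral>\<^sup>+y. ennreal (p (x, y)) \<partial>lebesgue_on E) \<partial>lebesgue_on E) > 0"
  shows "\<exists>A (k::nat). bounded_kernel A (real k) \<and> A \<subseteq> E \<times> E \<and> emeasure (lborel \<Otimes>\<^sub>M lborel) A \<noteq> 0 \<and>
    (\<forall>y x. (y, x) \<in> A \<longrightarrow> 1 / real (Suc k) < p (x, y))"
proof (rule ccontr)
  assume neg: "\<not> ?thesis"
  define A where "A k = {z. fst z \<in> E \<and> snd z \<in> E \<and> 1 / real (Suc k) < p (snd z, fst z) \<and> \<bar>fst z\<bar> \<le> real k \<and> \<bar>snd z\<bar> \<le> real k}" for k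
  have p' [measurable]: "p \<in> borel_measurable (lborel \<Otimes>\<^sub>M lborel)" using p(1) by (simp add: lborel_prod)
  have Am [measurable]: "A k \<in> sets (lborel \<Otimes>\<^sub>M lborel)" for k
  proof -
    have "{z \<in> space (lborel \<Otimes>\<^sub>M lborel). fst z \<in> E \<and> snd z \<in> E \<and> 1 / real (Suc k) < p (snd z, fst z) \<and> \<bar>fst z\<bar> \<le> real k \<and> \<bar>snd z\<bar> \<le> real k}
      \<in> sets (lborel \<Otimes>\<^sub>M lborel)" by measurable
    then show ?thesis by (simp add: A_def space_pair_measure)
  qed
  have "bounded_kernel (A k) (real k)" for k
    by (rule bounded_kernel.intro[OF Am]) (auto simp: A_def)
  moreover have "A k \<subseteq> E \<times> E" for k by (auto simp: A_def)
  moreover have "\<forall>y x. (y, x) \<in> A k \<longrightarrow> 1 / real (Suc k) < p (x, y)" for k by (auto simp: A_def)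
  ultimately have "emeasure (lborel \<Otimes>\<^sub>M lborel) (A k) = 0" for k using neg by blast
  then have "A k \<in> null_sets (lborel \<Otimes>\<^sub>M lborel)" for k using Am by (simp add: null_sets_def)
  then have "AE z in lborel \<Otimes>\<^sub>M lborel. z \<notin> A k" for k by (rule AE_not_in)
  then have "AE z in lborel \<Otimes>\<^sub>M lborel. \<forall>k. z \<notin> A k" by (simp add: AE_all_countable)
  then have AE: "AE z in lborel \<Otimes>\<^sub>M lborel. fst z \<in> E \<longrightarrow> snd z \<in> E \<longrightarrow> p (snd z, fst z) = 0"
  proof eventually_elim
    case (elim z)
    show ?case
    proof (intro impI, rule ccontr)
      assume z: "fst z \<in> E" "snd z \<in> E" "p (snd z, fst z) \<noteq> 0"
      then have "0 < p (snd z, fst z)" using p(2) by (simp add: order_less_le)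
      then obtain k1 where k1: "1 / real (Suc k1) < p (snd z, fst z)" by (rule nat_approx_posE)
      obtain k2 :: nat where k2: "max \<bar>fst z\<bar> \<bar>snd z\<bar> \<le> real k2" using real_arch_simple by blast
      let ?k = "max k1 k2"
      have "1 / real (Suc ?k) \<le> 1 / real (Suc k1)" by (simp add: frac_le)
      then have "z \<in> A ?k" using z k1 k2 by (auto simp: A_def)
      then show False using elim by blast
    qed
  qed
  from lborel_pair.AE_pair[OF AE] have "AE y in lborel. AE x in lborel. y \<in> E \<longrightarrow> x \<in> E \<longrightarrow> p (x, y) = 0" by simp
  then have "AE x in lborel. AE y in lborel. y \<in> E \<longrightarrow> x \<in> E \<longrightarrow> p (x, y) = 0"
  proof (rule lborel_pair.AE_commute[THEN iffD1, rotated])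
    show "{z \<in> space (lborel \<Otimes>\<^sub>M lborel). fst z \<in> E \<longrightarrow> snd z \<in> E \<longrightarrow> p (snd z, fst z) = 0} \<in> sets (lborel \<Otimes>\<^sub>M lborel)"
      by measurable
  qed
  then have "AE x in lborel. (\<integral>\<^sup>+y. ennreal (p (x, y)) * indicator E y \<partial>lborel) * indicator E x = 0"
  proof eventually_elim
    case (elim x)
    have "(\<integral>\<^sup>+y. ennreal (p (x, y)) * indicator E y \<partial>lborel) = (\<integral>\<^sup>+(y::real). 0 \<partial>lborel)" if "x \<in> E"
      by (rule nn_integral_cong_AE) (use elim that in \<open>auto elim!: eventually_mono split: split_indicator\<close>)
    then show ?case by (auto split: split_indicator)
  qed
  then have "(\<integral>\<^sup>+x. (\<integral>\<^sup>+y. ennreal (p (x, y)) * indicator E y \<partial>lborel) * indicator E x \<partial>lborel) = (\<integral>\<^sup>+(x::real). 0 \<partial>lborel)"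
    by (rule nn_integral_cong_AE)
  then show False using pos unfolding nn_integral_on_E by simp
qed

text \<open>The minorant is assumed for densities only, so \<open>v\<close> is normalized and the
  factor cancelled at the end. For \<open>v\<close> of norm zero, \<open>TA v\<close> vanishes and
  positivity of the semigroup is enough.\<close>

lemma kernel_below:
  assumes p: "\<forall>z. 0 \<le> p z" and t0: "0 \<le> t0"
    and dens: "\<forall>u. is_density E u \<longrightarrow>
        (AE x in lebesgue_on E. (\<integral>\<^sup>+ y. ennreal (p (x, y) * u y) \<partial>lebesgue_on E) \<le> ennreal (S t0 u x))"
    and A: "bounded_kernel A k" "A \<subseteq> E \<times> E" and c: "0 < c" "\<forall>y x. (y, x) \<in> A \<longrightarrow> c < p (x, y)"
    and v: "v \<in> borel_measurable borel" "integrable lborel v" "\<forall>x. 0 \<le> v x" "\<forall>x. x \<notin> E \<longrightarrow> v x = 0"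
  shows "AE x in lebesgue_on E. c * bounded_kernel.TA A v x \<le> S t0 v x"
proof -
  interpret bounded_kernel A k by (rule A(1))
  have Lv: "L1 E v" by (rule L1_borel[OF v(1,2)])
  have Jv: "0 \<le> J v" using J_nonneg_iff[OF Lv] v(3) by (simp add: nonnegL_def)
  have LS: "L1 E (S t0 v)" by (rule T_L1[OF S_facts(3)[OF t0] Lv])
  have S0: "AE x in lebesgue_on E. 0 \<le> S t0 v x"
    using ps.pos[OF t0 Jv] unfolding SS_J[OF t0 Lv] J_nonneg_iff[OF LS] nonnegL_def .
  define N where "N = norm (J v)"
  show ?thesis
  proof (cases "N = 0")
    case True
    then have "(LINT y|lborel. \<bar>v y\<bar>) = 0" using norm_J_borel[OF v(1,2,4)] by (simp add: N_def)
    then have "TA v x = 0" for x using TA_bound[OF v(1,2), of x] by simp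
    then show ?thesis using S0 by simp
  next
    case False
    then have N: "0 < N" by (simp add: N_def)
    let ?u = "\<lambda>x. 1 / N * v x + 0 * v x"
    have Lu: "L1 E ?u" by (rule L1_lin[OF Lv Lv])
    have "norm (J ?u) = 1" unfolding J_lin[OF Lv Lv] using N by (simp add: N_def)
    then have "is_density E ?u"
      unfolding is_density_def using Lu norm_J[OF Lu] v(3) N by (simp add: nonnegL_def)
    then have 1: "AE x in lebesgue_on E. (\<integral>\<^sup>+ y. ennreal (p (x, y) * ?u y) \<partial>lebesgue_on E) \<le> ennreal (S t0 ?u x)"
      using dens by blast
    have "eqL E (S t0 ?u) (\<lambda>x. 1 / N * S t0 v x + 0 * S t0 v x)"
      using S_facts(3)[OF t0] Lv unfolding L1_operator_def by blast
    then have 2: "AE x in lebesgue_on E. S t0 ?u x = 1 / N * S t0 v x + 0 * S t0 v x" by (simp only: eqL_def)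
    show ?thesis using 1 2 S0
    proof eventually_elim
      case (elim x)
      have i: "integrable lborel (\<lambda>y. (c / N) * (indicator A (y, x) * v y))"
        using section_integrable[OF v(1,2), of x] by simp
      have "ennreal (c / N * TA v x) = (\<integral>\<^sup>+y. ennreal ((c / N) * (indicator A (y, x) * v y)) \<partial>lborel)"
        unfolding TA_def using nn_integral_eq_integral[OF i] v(3) c N by simp
      also have "\<dots> \<le> (\<integral>\<^sup>+y. ennreal (p (x, y) * ?u y) * indicator E y \<partial>lborel)"
      proof (rule nn_integral_mono)
        fix y
        show "ennreal ((c / N) * (indicator A (y, x) * v y)) \<le> ennreal (p (x, y) * ?u y) * indicator E y"
        proof (cases "(y, x) \<in> A")
          case True
          then have yE: "y \<in> E" using A(2) by auto
          have "c * (v y / N) \<le> p (x, y) * (v y / N)"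
            using c(2) True v(3) N by (intro mult_right_mono) (auto intro: less_imp_le)
          then have "(c / N) * (indicator A (y, x) * v y) \<le> p (x, y) * ?u y" using True by simp
          then show ?thesis using yE by (simp add: ennreal_leI)
        qed simp
      qed
      also have "\<dots> = (\<integral>\<^sup>+ y. ennreal (p (x, y) * ?u y) \<partial>lebesgue_on E)" by (rule nn_integral_on_E[symmetric])
      also have "\<dots> \<le> ennreal (S t0 ?u x)" by (rule elim(1))
      also have "S t0 ?u x = 1 / N * S t0 v x" using elim(2) by simp
      finally have "c / N * TA v x \<le> 1 / N * S t0 v x"
        using elim(3) N by (subst (asm) ennreal_le_iff) auto
      then show ?case using N by (simp add: field_simps)
    qed
  qed
qed

end

context jump_invariant begin

lemma asymptotically_stable:
  assumes pint: "partially_integral E S" and L: "L1 E (R0 d0 d1 g \<phi> vstar)"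
  shows "asymptotically_stable_with E S (\<lambda>x. R0 d0 d1 g \<phi> vstar x / L1norm E (R0 d0 d1 g \<phi> vstar))"
proof -
  let ?r = "R0 d0 d1 g \<phi> vstar"
  from pint obtain t0 and p :: "real \<times> real \<Rightarrow> real" where t0: "0 < t0"
    and p: "p \<in> borel_measurable borel" "\<forall>z. 0 \<le> p z"
      "(\<integral>\<^sup>+ x. (\<integral>\<^sup>+ y. ennreal (p (x, y)) \<partial>lebesgue_on E) \<partial>lebesgue_on E) > 0"
      "\<forall>u. is_density E u \<longrightarrow>
        (AE x in lebesgue_on E. (\<integral>\<^sup>+ y. ennreal (p (x, y) * u y) \<partial>lebesgue_on E) \<le> ennreal (S t0 u x))"
    unfolding partially_integral_def by (elim exE conjE) rule
  from kernel_restriction[OF p(1-3)] obtain A and k :: nat where A: "bounded_kernel A (real k)" "A \<subseteq> E \<times> E"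
    "emeasure (lborel \<Otimes>\<^sub>M lborel) A \<noteq> 0" "\<forall>y x. (y, x) \<in> A \<longrightarrow> 1 / real (Suc k) < p (x, y)"
    by (elim exE conjE) rule
  have t0': "0 \<le> t0" using t0 by simp
  have c: "0 < 1 / real (Suc k)" by simp
  interpret K: jump_kernel d0 d1 g \<phi> E P S vstar A "real k" "1 / real (Suc k)" t0
    by (rule jump_kernel.intro[OF jump_invariant_axioms A(1)], rule jump_kernel_axioms.intro)
      (rule L A c t0' kernel_below[OF p(2) t0' p(4) A(1,2) c A(4)]; assumption)+
  define N where "N = L1norm E ?r"
  have N: "norm K.us = N" unfolding K.us_def N_def by (rule norm_J[OF L])
  \<comment> \<open>\<open>R0 vstar\<close> is positive on \<open>E\<close>, and \<open>E\<close>
    contains a nondegenerate interval.\<close>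
  have "N \<noteq> 0"
  proof
    assume "N = 0"
    then have "K.us = 0" using N by simp
    moreover have L0: "L1 E (\<lambda>x. 0)" by (simp add: L1_def)
    ultimately have "eqL E ?r (\<lambda>x. 0)" using J_eq_iff[OF L L0] by (simp add: K.us_def J_zero)
    then have "AE x in lebesgue_on E. ?r x = 0" by (simp only: eqL_def)
    with K.R0_pos_AE have AE: "AE x in lebesgue_on E. False" by eventually_elim simp
    from f0.E_exhaustion obtain l u :: "nat \<Rightarrow> real" where lu: "\<forall>n. l n \<in> E" "\<forall>n. u n \<in> E" "\<forall>n. l n < u n"
      by (elim exE conjE) rule
    have "AE x in lebesgue_on E. \<not> (l 0 \<le> x \<and> x \<le> u 0)" using AE by eventually_elim simp
    then show False by (rule not_AE_avoids_interval[OF lu(1)[rule_format] lu(2)[rule_format] lu(3)[rule_format]])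
  qed
  then have Npos: "0 < N" using N norm_ge_zero[of K.us] by simp
  let ?u = "\<lambda>x. 1 / N * ?r x"
  have Lu: "L1 E ?u" using L1_lin[OF L L, of "1 / N" 0] by simp
  have Ju: "J ?u = (1 / N) *\<^sub>R K.us" unfolding K.us_def by (rule J_scale[OF L])
  have Ju0: "0 \<le> J ?u" unfolding Ju using Npos K.us(2) by (intro scaleR_nonneg_nonneg) auto
  have "norm (J ?u) = 1" unfolding Ju using N Npos by simp
  then have "is_density E ?u" unfolding is_density_def using Lu Ju0 J_nonneg_iff[OF Lu] norm_J[OF Lu] by simp
  moreover have "eqL E (S t ?u) ?u" if t: "0 \<le> t" for t
  proof -
    have "J (S t ?u) = J ?u" unfolding SS_J[OF t Lu, symmetric] Ju by (simp only: ps.S_scale[OF t] K.us(3)[OF t])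
    then show ?thesis using J_eq_iff[OF T_L1[OF S_facts(3)[OF t] Lu] Lu] by blast
  qed
  moreover have "((\<lambda>t. L1norm E (\<lambda>x. S t w x - ?u x)) \<longlongrightarrow> 0) at_top" if "is_density E w" for w
  proof -
    have w: "L1 E w" "nonnegL E w" "L1norm E w = 1" using that by (auto simp: is_density_def)
    have w0: "0 \<le> J w" using w(2) by (simp only: J_nonneg_iff[OF w(1)])
    have "((\<lambda>t. SS t (J w)) \<longlongrightarrow> J ?u) at_top"
      using K.semigroup_tendsto[OF w0 J_in_XE[OF w(1)]] unfolding norm_J[OF w(1)] w(3) N Ju .
    then have lim: "((\<lambda>t. norm (SS t (J w) - J ?u)) \<longlongrightarrow> 0) at_top" by (intro tendsto_norm_zero LIM_zero)
    have "\<forall>\<^sub>F t in at_top. norm (SS t (J w) - J ?u) = L1norm E (\<lambda>x. S t w x - ?u x)"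
      using eventually_ge_at_top[of 0]
    proof eventually_elim
      case (elim t)
      have LS: "L1 E (S t w)" by (rule T_L1[OF S_facts(3)[OF elim] w(1)])
      have Ld: "L1 E (\<lambda>x. S t w x - ?u x)" using L1_lin[OF LS Lu, of 1 "- 1"] by simp
      show ?case unfolding SS_J[OF elim w(1)] J_diff[OF LS Lu, symmetric] by (rule norm_J[OF Ld])
    qed
    from tendsto_cong[OF this] lim show ?thesis by (rule iffD1)
  qed
  ultimately have "asymptotically_stable_with E S ?u"
    unfolding asymptotically_stable_with_def invariant_density_sg_def by blast
  then show ?thesis by (simp add: N_def)
qed

end

theorem theorem5p1:
  fixes d0 d1 :: ereal and g \<phi> :: "real \<Rightarrow> real" and P :: op and S :: "real \<Rightarrow> op"
  defines "E \<equiv> Eint d0 d1"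
  assumes d01: "d0 < d1"
    and g_cont: "continuous_on E g" and g_pos: "\<forall>x\<in>E. 0 < g x"
    and phi_meas: "\<phi> \<in> borel_measurable borel" and phi_nonneg: "\<forall>x\<in>E. 0 \<le> \<phi> x"
    and phi_loc_int: "\<forall>a b. {a..b} \<subseteq> E \<longrightarrow> set_integrable lborel {a..b} \<phi>"
    and G_infty: "tends_to_infty_at_d1 d0 d1 (Gfun d0 d1 g)"
    and Q_infty: "tends_to_infty_at_d1 d0 d1 (Qfun d0 d1 g \<phi>)"
    and P_stoch: "stochastic_op E P"
    and S_def: "is_Pt_semigroup d0 d1 g \<phi> P S"
  shows
    "(\<forall>vstar. invariant_density_op E (Kop d0 d1 g \<phi> P) vstar \<and>
              (AE x in lebesgue_on E. 0 < vstar x) \<longrightarrow>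
        stochastic_semigroup E S \<and>
        (partially_integral E S \<and> L1 E (R0 d0 d1 g \<phi> vstar) \<longrightarrow>
           asymptotically_stable_with E S
             (\<lambda>x. R0 d0 d1 g \<phi> vstar x / L1norm E (R0 d0 d1 g \<phi> vstar))))
     \<and>
     (\<forall>ustar. invariant_density_sg E S ustar \<and> A_domain d0 d1 g \<phi> ustar \<longrightarrow>
        invariant_density_op E (Kop d0 d1 g \<phi> P)
          (\<lambda>x. P (\<lambda>y. \<phi> y * ustar y) x / L1norm E (\<lambda>y. \<phi> y * ustar y)))"
proof -
  interpret T: transport d0 d1 g \<phi> E
    by (rule transport.intro[OF meta_eq_to_obj_eq[OF E_def] d01 g_cont g_pos phi_meas phi_nonneg phi_loc_int G_infty])
  interpret jump d0 d1 g \<phi> E P S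
    by (rule jump.intro[OF T.transport_axioms], rule jump_axioms.intro[OF P_stoch S_def])
  show ?thesis
  proof (intro conjI allI impI; (elim conjE)?)
    fix vstar
    assume v: "invariant_density_op E (Kop d0 d1 g \<phi> P) vstar" "AE x in lebesgue_on E. 0 < vstar x"
    interpret jump_invariant d0 d1 g \<phi> E P S vstar
      by (rule jump_invariant.intro[OF jump_axioms], rule jump_invariant_axioms.intro[OF v])
    show "stochastic_semigroup E S" by (rule stochastic_semigroup_if_norm_preserving[OF norm_SS])
    assume "partially_integral E S" "L1 E (R0 d0 d1 g \<phi> vstar)"
    then show "asymptotically_stable_with E S (\<lambda>x. R0 d0 d1 g \<phi> vstar x / L1norm E (R0 d0 d1 g \<phi> vstar))"
      by (rule asymptotically_stable)
  next
    fix ustar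
    assume "invariant_density_sg E S ustar" "A_domain d0 d1 g \<phi> ustar"
    then show "invariant_density_op E (Kop d0 d1 g \<phi> P)
          (\<lambda>x. P (\<lambda>y. \<phi> y * ustar y) x / L1norm E (\<lambda>y. \<phi> y * ustar y))"
      by (rule invariant_density_embedded)
  qed
qed

end
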